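(* Let $R$ be a commutative ring and let $\mathscr{A}$ and $\mathscr{B}$ be right exact symmetric monoidal $R$-linear categories. Then the right exact tensor product $\mathscr{A}\boxtimes \mathscr{B}$ is a bicategorical coproduct of $\mathscr{A}$ and $\mathscr{B}$ in the 2-category of right exact symmetric monoidal $R$-linear categories.
   Context: A symmetric monoidal $R$-linear category is right exact symmetric monoidal if it is finitely cocomplete and its tensor product is right exact (preserves finite colimits) in each variable. The 2-category of such has as 1-cells the right exact $R$-linear strong symmetric monoidal functors and as 2-cells the monoidal natural transformations. Right exact (Kelly) tensor product: for finitely cocomplete $R$-linear categories $\mathscr{A},\mathscr{B}$, the finitely cocomplete $R$-linear category $\mathscr{A}\boxtimes\mathscr{B}$ comes with a universal functor $Z\colon\mathscr{A}\otimes\mathscr{B}\to\mathscr{A}\boxtimes\mathscr{B}$ that is $R$-linear and right exact in each variable (here $\mathscr{A}\otimes\mathscr{B}$ has objects pairs $(A,B)$ and hom-modules $\mathscr{A}(A,A')\otimes_R\mathscr{B}(B,B')$): for every finitely cocomplete $R$-linear $\mathscr{C}$, composition with $Z$ gives an equivalence between right exact $R$-linear functors $\mathscr{A}\boxtimes\mathscr{B}\to\mathscr{C}$ and functors $\mathscr{A}\otimes\mathscr{B}\to\mathscr{C}$ that are $R$-linear and right exact in each variable. It always exists and makes the 2-category $\mathbf{Rex}$ of finitely cocomplete $R$-linear categories and right exact $R$-linear functors a symmetric monoidal bicategory. If $\mathscr{A},\mathscr{B}$ are right exact symmetric monoidal, then $\mathscr{A}\boxtimes\mathscr{B}$ has an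 induced right exact symmetric monoidal structure, for which $Z$ is strong symmetric monoidal. An object $P$ with 1-cells $\mathscr{A}\to P\leftarrow\mathscr{B}$ is a bicategorical coproduct if for every object $\mathscr{C}$, precomposition induces an equivalence of categories $\operatorname{Hom}(P,\mathscr{C})\to\operatorname{Hom}(\mathscr{A},\mathscr{C})\times\operatorname{Hom}(\mathscr{B},\mathscr{C})$. Here the 1-cells are $A\mapsto Z(A,I)$ and $B\mapsto Z(I,B)$, where $I$ denotes the unit objects. *)

theory Defs
  imports "HOL-Algebra.Module" "HOL-Algebra.AbelCoset" "HOL-Library.FuncSet"
begin

section \<open>Categories and functors\<close>

record ('o, 'a) cat =
  Ob :: "'o set"
  Ar :: "'a set"
  Dom :: "'a \<Rightarrow> 'o"
  Cod :: "'a \<Rightarrow> 'o"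
  Comp :: "'a \<Rightarrow> 'a \<Rightarrow> 'a" (infixr \<open>\<cdot>\<index>\<close> 55)
  ide :: "'o \<Rightarrow> 'a"

definition Hom :: "('o, 'a, 'z) cat_scheme \<Rightarrow> 'o \<Rightarrow> 'o \<Rightarrow> 'a set" where
  "Hom C x y = {f \<in> Ar C. Dom C f = x \<and> Cod C f = y}"

locale category =
  fixes C :: "('o, 'a, 'z) cat_scheme" (structure)
  assumes dom_closed: "f \<in> Ar C \<Longrightarrow> Dom C f \<in> Ob C"
    and cod_closed: "f \<in> Ar C \<Longrightarrow> Cod C f \<in> Ob C"
    and ide_in_hom: "x \<in> Ob C \<Longrightarrow> ide C x \<in> Hom C x x"
    and comp_in_hom: "f \<in> Hom C x y \<Longrightarrow> g \<in> Hom C y z \<Longrightarrow> g \<cdot> f \<in> Hom C x z"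
    and comp_ide_left: "f \<in> Hom C x y \<Longrightarrow> ide C y \<cdot> f = f"
    and comp_ide_right: "f \<in> Hom C x y \<Longrightarrow> f \<cdot> ide C x = f"
    and comp_assoc: "f \<in> Hom C w x \<Longrightarrow> g \<in> Hom C x y \<Longrightarrow> h \<in> Hom C y z \<Longrightarrow>
      (h \<cdot> g) \<cdot> f = h \<cdot> (g \<cdot> f)"

definition is_iso :: "('o, 'a, 'z) cat_scheme \<Rightarrow> 'o \<Rightarrow> 'o \<Rightarrow> 'a \<Rightarrow> bool" where
  "is_iso C x y f \<longleftrightarrow> f \<in> Hom C x y \<and>
    (\<exists>g \<in> Hom C y x. g \<cdot>\<^bsub>C\<^esub> f = ide C x \<and> f \<cdot>\<^bsub>C\<^esub> g = ide C y)"

text \<open>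
  The values of a functor, and of the structure maps of a monoidal functor below, outside the
  objects and arrows of its source are irrelevant and not normalised.  Two such representations
  of one functor are isomorphic through identity components, so functor categories change only
  up to equivalence.  Natural transformations, on the other hand, are normalised.
\<close>

record ('o1, 'a1, 'o2, 'a2) fct =
  fo :: "'o1 \<Rightarrow> 'o2"
  fa :: "'a1 \<Rightarrow> 'a2"

definition is_functor ::
  "('o1, 'a1, 'y) cat_scheme \<Rightarrow> ('o2, 'a2, 'z) cat_scheme \<Rightarrow> ('o1, 'a1, 'o2, 'a2, 'w) fct_scheme \<Rightarrow> bool"
where
  "is_functor C D F \<longleftrightarrow>
    (\<forall>x \<in> Ob C. fo F x \<in> Ob D) \<and>
    (\<forall>x y f. f \<in> Hom C x y \<longrightarrow> fa F f \<in> Hom D (fo F x) (fo F y)) \<and>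
    (\<forall>x \<in> Ob C. fa F (ide C x) = ide D (fo F x)) \<and>
    (\<forall>x y z f g. f \<in> Hom C x y \<longrightarrow> g \<in> Hom C y z \<longrightarrow> fa F (g \<cdot>\<^bsub>C\<^esub> f) = fa F g \<cdot>\<^bsub>D\<^esub> fa F f)"

definition id_fct :: "('o, 'a, 'o, 'a) fct" where
  "id_fct = \<lparr>fo = \<lambda>x. x, fa = \<lambda>f. f\<rparr>"

definition comp_fct ::
  "('o2, 'a2, 'o3, 'a3, 'y) fct_scheme \<Rightarrow> ('o1, 'a1, 'o2, 'a2, 'z) fct_scheme \<Rightarrow> ('o1, 'a1, 'o3, 'a3) fct"
where
  "comp_fct G F = \<lparr>fo = \<lambda>x. fo G (fo F x), fa = \<lambda>f. fa G (fa F f)\<rparr>"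

definition nat_trans ::
  "('o1, 'a1, 'y) cat_scheme \<Rightarrow> ('o2, 'a2, 'z) cat_scheme \<Rightarrow>
   ('o1, 'a1, 'o2, 'a2, 'v) fct_scheme \<Rightarrow> ('o1, 'a1, 'o2, 'a2, 'w) fct_scheme \<Rightarrow> ('o1 \<Rightarrow> 'a2) \<Rightarrow> bool"
where
  "nat_trans C D F G \<eta> \<longleftrightarrow>
    (\<forall>x \<in> Ob C. \<eta> x \<in> Hom D (fo F x) (fo G x)) \<and>
    (\<forall>x y f. f \<in> Hom C x y \<longrightarrow> fa G f \<cdot>\<^bsub>D\<^esub> \<eta> x = \<eta> y \<cdot>\<^bsub>D\<^esub> fa F f)"

definition nat_iso ::
  "('o1, 'a1, 'y) cat_scheme \<Rightarrow> ('o2, 'a2, 'z) cat_scheme \<Rightarrow>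
   ('o1, 'a1, 'o2, 'a2, 'v) fct_scheme \<Rightarrow> ('o1, 'a1, 'o2, 'a2, 'w) fct_scheme \<Rightarrow> ('o1 \<Rightarrow> 'a2) \<Rightarrow> bool"
where
  "nat_iso C D F G \<eta> \<longleftrightarrow>
    nat_trans C D F G \<eta> \<and> (\<forall>x \<in> Ob C. is_iso D (fo F x) (fo G x) (\<eta> x))"

definition is_equivalence ::
  "('o1, 'a1, 'y) cat_scheme \<Rightarrow> ('o2, 'a2, 'z) cat_scheme \<Rightarrow> ('o1, 'a1, 'o2, 'a2, 'w) fct_scheme \<Rightarrow> bool"
where
  "is_equivalence C D F \<longleftrightarrow> is_functor C D F \<and>
    (\<exists>G :: ('o2, 'a2, 'o1, 'a1) fct. is_functor D C G \<and>
      (\<exists>\<eta>. nat_iso C C id_fct (comp_fct G F) \<eta>) \<and>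
      (\<exists>\<epsilon>. nat_iso D D (comp_fct F G) id_fct \<epsilon>))"

definition prod_cat ::
  "('o1, 'a1, 'y) cat_scheme \<Rightarrow> ('o2, 'a2, 'z) cat_scheme \<Rightarrow> ('o1 \<times> 'o2, 'a1 \<times> 'a2) cat"
where
  "prod_cat C D =
    \<lparr>Ob = Ob C \<times> Ob D,
     Ar = Ar C \<times> Ar D,
     Dom = map_prod (Dom C) (Dom D),
     Cod = map_prod (Cod C) (Cod D),
     Comp = \<lambda>(g, g') (f, f'). (g \<cdot>\<^bsub>C\<^esub> f, g' \<cdot>\<^bsub>D\<^esub> f'),
     ide = map_prod (ide C) (ide D)\<rparr>"

definition pair_fct ::
  "('o, 'a, 'o1, 'a1, 'y) fct_scheme \<Rightarrow> ('o, 'a, 'o2, 'a2, 'z) fct_scheme \<Rightarrow>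
   ('o, 'a, 'o1 \<times> 'o2, 'a1 \<times> 'a2) fct"
where
  "pair_fct F G = \<lparr>fo = \<lambda>x. (fo F x, fo G x), fa = \<lambda>f. (fa F f, fa G f)\<rparr>"

text \<open>
  The category whose objects are the functors in \<open>S\<close> and whose arrows \<open>F \<Rightarrow> G\<close> are the families
  \<open>\<eta>\<close> with \<open>T F G \<eta>\<close>; an arrow is stored together with its source and target.
\<close>

definition fun_cat ::
  "('o1, 'a1, 'y) cat_scheme \<Rightarrow> ('o2, 'a2, 'z) cat_scheme \<Rightarrow>
   ('o1, 'a1, 'o2, 'a2, 'w) fct_scheme set \<Rightarrow>
   (('o1, 'a1, 'o2, 'a2, 'w) fct_scheme \<Rightarrow> ('o1, 'a1, 'o2, 'a2, 'w) fct_scheme \<Rightarrow> ('o1 \<Rightarrow> 'a2) \<Rightarrow> bool) \<Rightarrow>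
   (('o1, 'a1, 'o2, 'a2, 'w) fct_scheme,
    ('o1, 'a1, 'o2, 'a2, 'w) fct_scheme \<times> ('o1, 'a1, 'o2, 'a2, 'w) fct_scheme \<times> ('o1 \<Rightarrow> 'a2)) cat"
where
  "fun_cat C D S T =
    \<lparr>Ob = S,
     Ar = {(F, G, \<eta>). F \<in> S \<and> G \<in> S \<and> \<eta> \<in> extensional (Ob C) \<and> T F G \<eta>},
     Dom = \<lambda>(F, G, \<eta>). F,
     Cod = \<lambda>(F, G, \<eta>). G,
     Comp = \<lambda>(G, H, \<theta>) (F, G', \<eta>). (F, H, restrict (\<lambda>x. \<theta> x \<cdot>\<^bsub>D\<^esub> \<eta> x) (Ob C)),
     ide = \<lambda>F. (F, F, restrict (\<lambda>x. ide D (fo F x)) (Ob C))\<rparr>"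

text \<open>
  Precomposition with \<open>K\<close>, a functor with source \<open>A\<close>, as a functor between functor categories;
  \<open>c\<close> is the composition of 1-cells.
\<close>

definition precomp_fct where
  "precomp_fct A c K =
    \<lparr>fo = \<lambda>F. c F K,
     fa = \<lambda>(F, G, \<eta>). (c F K, c G K, restrict (\<lambda>a. \<eta> (fo K a)) (Ob A))\<rparr>"


section \<open>Finite colimits\<close>

definition is_cocone ::
  "('j, 'u, 'y) cat_scheme \<Rightarrow> ('o, 'a, 'z) cat_scheme \<Rightarrow> ('j, 'u, 'o, 'a, 'w) fct_scheme \<Rightarrow> 'o \<Rightarrow> ('j \<Rightarrow> 'a) \<Rightarrow> bool"
where
  "is_cocone J C K c \<iota> \<longleftrightarrow> c \<in> Ob C \<and> (\<forall>j \<in> Ob J. \<iota> j \<in> Hom C (fo K j) c) \<and>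
    (\<forall>i j u. u \<in> Hom J i j \<longrightarrow> \<iota> j \<cdot>\<^bsub>C\<^esub> fa K u = \<iota> i)"

definition is_colimit ::
  "('j, 'u, 'y) cat_scheme \<Rightarrow> ('o, 'a, 'z) cat_scheme \<Rightarrow> ('j, 'u, 'o, 'a, 'w) fct_scheme \<Rightarrow> 'o \<Rightarrow> ('j \<Rightarrow> 'a) \<Rightarrow> bool"
where
  "is_colimit J C K c \<iota> \<longleftrightarrow> is_cocone J C K c \<iota> \<and>
    (\<forall>d \<kappa>. is_cocone J C K d \<kappa> \<longrightarrow>
      (\<exists>!h. h \<in> Hom C c d \<and> (\<forall>j \<in> Ob J. h \<cdot>\<^bsub>C\<^esub> \<iota> j = \<kappa> j)))"

text \<open>
  Every finite category is isomorphic to one whose objects and arrows are natural numbers, so it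
  suffices to consider these as shapes of finite diagrams.  In an \<open>R\<close>-linear category, the
  finite colimits in the enriched sense reduce to these conical ones.
\<close>

definition finite_category :: "('o, 'a, 'z) cat_scheme \<Rightarrow> bool" where
  "finite_category J \<longleftrightarrow> category J \<and> finite (Ob J) \<and> finite (Ar J)"

definition finitely_cocomplete :: "('o, 'a, 'z) cat_scheme \<Rightarrow> bool" where
  "finitely_cocomplete C \<longleftrightarrow>
    (\<forall>(J :: (nat, nat) cat) (K :: (nat, nat, 'o, 'a) fct).
      finite_category J \<and> is_functor J C K \<longrightarrow> (\<exists>c \<iota>. is_colimit J C K c \<iota>))"

definition right_exact ::
  "('o1, 'a1, 'y) cat_scheme \<Rightarrow> ('o2, 'a2, 'z) cat_scheme \<Rightarrow> ('o1, 'a1, 'o2, 'a2, 'w) fct_scheme \<Rightarrow> bool"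
where
  "right_exact C D F \<longleftrightarrow>
    (\<forall>(J :: (nat, nat) cat) (K :: (nat, nat, 'o1, 'a1) fct) c \<iota>.
      finite_category J \<and> is_functor J C K \<and> is_colimit J C K c \<iota> \<longrightarrow>
      is_colimit J D (comp_fct F K) (fo F c) (\<lambda>j. fa F (\<iota> j)))"


section \<open>Linear categories\<close>

definition linear_map ::
  "('r, 'k) ring_scheme \<Rightarrow> ('r, 'm, 'y) module_scheme \<Rightarrow> ('r, 'n, 'z) module_scheme \<Rightarrow> ('m \<Rightarrow> 'n) \<Rightarrow> bool"
where
  "linear_map R M N h \<longleftrightarrow> h \<in> carrier M \<rightarrow> carrier N \<and>
    (\<forall>m \<in> carrier M. \<forall>m' \<in> carrier M. h (m \<oplus>\<^bsub>M\<^esub> m') = h m \<oplus>\<^bsub>N\<^esub> h m') \<and>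
    (\<forall>r \<in> carrier R. \<forall>m \<in> carrier M. h (r \<odot>\<^bsub>M\<^esub> m) = r \<odot>\<^bsub>N\<^esub> h m)"

definition bilinear_map ::
  "('r, 'k) ring_scheme \<Rightarrow> ('r, 'm, 'x) module_scheme \<Rightarrow> ('r, 'n, 'y) module_scheme \<Rightarrow>
   ('r, 'q, 'z) module_scheme \<Rightarrow> ('m \<Rightarrow> 'n \<Rightarrow> 'q) \<Rightarrow> bool"
where
  "bilinear_map R M N Q b \<longleftrightarrow>
    (\<forall>m \<in> carrier M. linear_map R N Q (b m)) \<and>
    (\<forall>n \<in> carrier N. linear_map R M Q (\<lambda>m. b m n))"

text \<open>
  The multiplication and unit that a module record inherits from the ring record play no role.
\<close>

record ('o, 'a, 'r) lcat = "('o, 'a) cat" +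
  HomM :: "'o \<Rightarrow> 'o \<Rightarrow> ('r, 'a) module"

locale linear_category = category C for R :: "('r, 'k) ring_scheme" and C :: "('o, 'a, 'r, 'z) lcat_scheme" (structure) +
  assumes base_ring: "cring R"
    and carrier_HomM: "x \<in> Ob C \<Longrightarrow> y \<in> Ob C \<Longrightarrow> carrier (HomM C x y) = Hom C x y"
    and module_HomM: "x \<in> Ob C \<Longrightarrow> y \<in> Ob C \<Longrightarrow> module R (HomM C x y)"
    and comp_bilinear: "x \<in> Ob C \<Longrightarrow> y \<in> Ob C \<Longrightarrow> z \<in> Ob C \<Longrightarrow>
      bilinear_map R (HomM C y z) (HomM C x y) (HomM C x z) (\<lambda>g f. g \<cdot> f)"

definition linear_functor ::
  "('r, 'k) ring_scheme \<Rightarrow> ('o1, 'a1, 'r, 'y) lcat_scheme \<Rightarrow> ('o2, 'a2, 'r, 'z) lcat_scheme \<Rightarrow>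
   ('o1, 'a1, 'o2, 'a2, 'w) fct_scheme \<Rightarrow> bool"
where
  "linear_functor R C D F \<longleftrightarrow> is_functor C D F \<and>
    (\<forall>x \<in> Ob C. \<forall>y \<in> Ob C. linear_map R (HomM C x y) (HomM D (fo F x) (fo F y)) (fa F))"

definition rex_cat ::
  "('r, 'k) ring_scheme \<Rightarrow> ('o1, 'a1, 'r, 'y) lcat_scheme \<Rightarrow> ('o2, 'a2, 'r, 'z) lcat_scheme \<Rightarrow> _"
where
  "rex_cat R C D =
    fun_cat C D {F :: ('o1, 'a1, 'o2, 'a2) fct. linear_functor R C D F \<and> right_exact C D F}
      (nat_trans C D)"


section \<open>Tensor products of modules\<close>

text \<open>
  \<open>M \<otimes> N\<close> is the free module on \<open>carrier M \<times> carrier N\<close>, realised by finitely supported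
  functions, modulo the submodule generated by the usual relations.
\<close>

definition free_module :: "('r, 'k) ring_scheme \<Rightarrow> 's set \<Rightarrow> ('r, 's \<Rightarrow> 'r) module" where
  "free_module R S =
    \<lparr>carrier = {v. (\<forall>s. v s \<in> carrier R) \<and> finite {s. v s \<noteq> \<zero>\<^bsub>R\<^esub>} \<and> {s. v s \<noteq> \<zero>\<^bsub>R\<^esub>} \<subseteq> S},
     mult = undefined, one = undefined,
     zero = \<lambda>_. \<zero>\<^bsub>R\<^esub>,
     add = \<lambda>v w s. v s \<oplus>\<^bsub>R\<^esub> w s,
     smult = \<lambda>r v s. r \<otimes>\<^bsub>R\<^esub> v s\<rparr>"

definition single :: "('r, 'k) ring_scheme \<Rightarrow> 's \<Rightarrow> 's \<Rightarrow> 'r" where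
  "single R s = (\<lambda>t. if t = s then \<one>\<^bsub>R\<^esub> else \<zero>\<^bsub>R\<^esub>)"

definition submodule_generated ::
  "('r, 'k) ring_scheme \<Rightarrow> ('r, 'm, 'z) module_scheme \<Rightarrow> 'm set \<Rightarrow> 'm set"
where
  "submodule_generated R M X = \<Inter>{H. submodule H R M \<and> X \<subseteq> H}"

definition quotient_module ::
  "('r, 'm, 'z) module_scheme \<Rightarrow> 'm set \<Rightarrow> ('r, 'm set) module"
where
  "quotient_module M H =
    \<lparr>carrier = a_rcosets\<^bsub>M\<^esub> H,
     mult = undefined, one = undefined,
     zero = H,
     add = (\<lambda>X Y. X <+>\<^bsub>M\<^esub> Y),
     smult = \<lambda>r X. (\<Union>x \<in> X. H +>\<^bsub>M\<^esub> (r \<odot>\<^bsub>M\<^esub> x))\<rparr>"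

definition tensor_free ::
  "('r, 'k) ring_scheme \<Rightarrow> ('r, 'm, 'y) module_scheme \<Rightarrow> ('r, 'n, 'z) module_scheme \<Rightarrow> ('r, 'm \<times> 'n \<Rightarrow> 'r) module"
where
  "tensor_free R M N = free_module R (carrier M \<times> carrier N)"

definition tensor_relations ::
  "('r, 'k) ring_scheme \<Rightarrow> ('r, 'm, 'y) module_scheme \<Rightarrow> ('r, 'n, 'z) module_scheme \<Rightarrow> ('m \<times> 'n \<Rightarrow> 'r) set"
where
  "tensor_relations R M N = (let F = tensor_free R M N; e = (\<lambda>m n. single R (m, n)) in
    submodule_generated R F
     ({e (m \<oplus>\<^bsub>M\<^esub> m') n \<ominus>\<^bsub>F\<^esub> (e m n \<oplus>\<^bsub>F\<^esub> e m' n) | m m' n.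
         m \<in> carrier M \<and> m' \<in> carrier M \<and> n \<in> carrier N} \<union>
      {e m (n \<oplus>\<^bsub>N\<^esub> n') \<ominus>\<^bsub>F\<^esub> (e m n \<oplus>\<^bsub>F\<^esub> e m n') | m n n'.
         m \<in> carrier M \<and> n \<in> carrier N \<and> n' \<in> carrier N} \<union>
      {e (r \<odot>\<^bsub>M\<^esub> m) n \<ominus>\<^bsub>F\<^esub> (r \<odot>\<^bsub>F\<^esub> e m n) | r m n.
         r \<in> carrier R \<and> m \<in> carrier M \<and> n \<in> carrier N} \<union>
      {e m (r \<odot>\<^bsub>N\<^esub> n) \<ominus>\<^bsub>F\<^esub> (r \<odot>\<^bsub>F\<^esub> e m n) | r m n.
         r \<in> carrier R \<and> m \<in> carrier M \<and> n \<in> carrier N}))"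

definition tensor_module ::
  "('r, 'k) ring_scheme \<Rightarrow> ('r, 'm, 'y) module_scheme \<Rightarrow> ('r, 'n, 'z) module_scheme \<Rightarrow> ('r, ('m \<times> 'n \<Rightarrow> 'r) set) module"
where
  "tensor_module R M N = quotient_module (tensor_free R M N) (tensor_relations R M N)"

definition tensor_pure ::
  "('r, 'k) ring_scheme \<Rightarrow> ('r, 'm, 'y) module_scheme \<Rightarrow> ('r, 'n, 'z) module_scheme \<Rightarrow> 'm \<Rightarrow> 'n \<Rightarrow> ('m \<times> 'n \<Rightarrow> 'r) set"
where
  "tensor_pure R M N m n = tensor_relations R M N +>\<^bsub>tensor_free R M N\<^esub> single R (m, n)"

text \<open>
  The linear map \<open>M \<otimes> N \<rightarrow> Q\<close> induced by a bilinear map \<open>b\<close>; bilinearity makes the value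
  independent of the chosen representative.
\<close>

definition tensor_lift ::
  "('r, 'k) ring_scheme \<Rightarrow> ('r, 'q, 'z) module_scheme \<Rightarrow> ('m \<Rightarrow> 'n \<Rightarrow> 'q) \<Rightarrow> ('m \<times> 'n \<Rightarrow> 'r) set \<Rightarrow> 'q"
where
  "tensor_lift R Q b X = (let v = (SOME v. v \<in> X) in
    finsum Q (\<lambda>(m, n). v (m, n) \<odot>\<^bsub>Q\<^esub> b m n) {p. v p \<noteq> \<zero>\<^bsub>R\<^esub>})"


section \<open>The tensor product of linear categories\<close>

text \<open>
  The category \<open>A \<otimes> B\<close> with objects pairs and hom-modules \<open>A(a, a') \<otimes> B(b, b')\<close>.  As distinct
  hom-modules must be disjoint, an arrow is an element of such a module together with its source
  and target.
\<close>

type_synonym ('ao, 'aa, 'bo, 'ba, 'r) tensor_arrow =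
  "('ao \<times> 'bo) \<times> ('ao \<times> 'bo) \<times> ('aa \<times> 'ba \<Rightarrow> 'r) set"

definition tensor_hom ::
  "('r, 'k) ring_scheme \<Rightarrow> ('ao, 'aa, 'r, 'y) lcat_scheme \<Rightarrow> ('bo, 'ba, 'r, 'z) lcat_scheme \<Rightarrow>
   'ao \<times> 'bo \<Rightarrow> 'ao \<times> 'bo \<Rightarrow> ('r, ('aa \<times> 'ba \<Rightarrow> 'r) set) module"
where
  "tensor_hom R A B x y = tensor_module R (HomM A (fst x) (fst y)) (HomM B (snd x) (snd y))"

definition tagged_module :: "'o \<Rightarrow> 'o \<Rightarrow> ('r, 'm, 'z) module_scheme \<Rightarrow> ('r, 'o \<times> 'o \<times> 'm) module" where
  "tagged_module x y M =
    \<lparr>carrier = {x} \<times> {y} \<times> carrier M,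
     mult = undefined, one = undefined,
     zero = (x, y, \<zero>\<^bsub>M\<^esub>),
     add = \<lambda>(_, _, m) (_, _, m'). (x, y, m \<oplus>\<^bsub>M\<^esub> m'),
     smult = \<lambda>r (_, _, m). (x, y, r \<odot>\<^bsub>M\<^esub> m)\<rparr>"

definition tensor_arr ::
  "('r, 'k) ring_scheme \<Rightarrow> ('ao, 'aa, 'r, 'y) lcat_scheme \<Rightarrow> ('bo, 'ba, 'r, 'z) lcat_scheme \<Rightarrow>
   'aa \<Rightarrow> 'ba \<Rightarrow> ('ao, 'aa, 'bo, 'ba, 'r) tensor_arrow"
where
  "tensor_arr R A B f g =
    ((Dom A f, Dom B g), (Cod A f, Cod B g),
     tensor_pure R (HomM A (Dom A f) (Cod A f)) (HomM B (Dom B g) (Cod B g)) f g)"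

text \<open>
  The arrow \<open>z \<rightarrow> z'\<close> obtained by extending
  \<open>(f \<otimes> g, h \<otimes> k) \<mapsto> p f h \<otimes> q g k\<close> bilinearly.
\<close>

definition tensor_op ::
  "('r, 'k) ring_scheme \<Rightarrow> ('ao, 'aa, 'r, 'y) lcat_scheme \<Rightarrow> ('bo, 'ba, 'r, 'z) lcat_scheme \<Rightarrow>
   ('aa \<Rightarrow> 'aa \<Rightarrow> 'aa) \<Rightarrow> ('ba \<Rightarrow> 'ba \<Rightarrow> 'ba) \<Rightarrow> 'ao \<times> 'bo \<Rightarrow> 'ao \<times> 'bo \<Rightarrow>
   ('aa \<times> 'ba \<Rightarrow> 'r) set \<Rightarrow> ('aa \<times> 'ba \<Rightarrow> 'r) set \<Rightarrow> ('ao, 'aa, 'bo, 'ba, 'r) tensor_arrow"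
where
  "tensor_op R A B p q z z' s t =
    (z, z',
     tensor_lift R (tensor_hom R A B z z')
       (\<lambda>f g. tensor_lift R (tensor_hom R A B z z')
         (\<lambda>h k. tensor_pure R (HomM A (fst z) (fst z')) (HomM B (snd z) (snd z')) (p f h) (q g k)) t) s)"

definition tensor_cat ::
  "('r, 'k) ring_scheme \<Rightarrow> ('ao, 'aa, 'r, 'y) lcat_scheme \<Rightarrow> ('bo, 'ba, 'r, 'z) lcat_scheme \<Rightarrow>
   ('ao \<times> 'bo, ('ao, 'aa, 'bo, 'ba, 'r) tensor_arrow, 'r) lcat"
where
  "tensor_cat R A B =
    \<lparr>Ob = Ob A \<times> Ob B,
     Ar = {(x, y, s). x \<in> Ob A \<times> Ob B \<and> y \<in> Ob A \<times> Ob B \<and> s \<in> carrier (tensor_hom R A B x y)},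
     Dom = \<lambda>(x, y, s). x,
     Cod = \<lambda>(x, y, s). y,
     Comp = \<lambda>(y, z, s) (x, y', t). tensor_op R A B (Comp A) (Comp B) x z s t,
     ide = \<lambda>(a, b). tensor_arr R A B (ide A a) (ide B b),
     HomM = \<lambda>x y. tagged_module x y (tensor_hom R A B x y)\<rparr>"


section \<open>The right exact tensor product\<close>

text \<open>The functors \<open>B \<rightarrow> A \<otimes> B\<close>, \<open>b \<mapsto> (a, b)\<close>, and \<open>A \<rightarrow> A \<otimes> B\<close>, \<open>a \<mapsto> (a, b)\<close>.\<close>

definition fix_left where
  "fix_left R A B a = \<lparr>fo = \<lambda>b. (a, b), fa = \<lambda>g. tensor_arr R A B (ide A a) g\<rparr>"

definition fix_right where
  "fix_right R A B b = \<lparr>fo = \<lambda>a. (a, b), fa = \<lambda>f. tensor_arr R A B f (ide B b)\<rparr>"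

definition separately_rex ::
  "('r, 'k) ring_scheme \<Rightarrow> ('ao, 'aa, 'r, 'x) lcat_scheme \<Rightarrow> ('bo, 'ba, 'r, 'y) lcat_scheme \<Rightarrow>
   ('co, 'ca, 'r, 'z) lcat_scheme \<Rightarrow>
   ('ao \<times> 'bo, ('ao, 'aa, 'bo, 'ba, 'r) tensor_arrow, 'co, 'ca, 'w) fct_scheme \<Rightarrow> bool"
where
  "separately_rex R A B C F \<longleftrightarrow> linear_functor R (tensor_cat R A B) C F \<and>
    (\<forall>a \<in> Ob A. right_exact B C (comp_fct F (fix_left R A B a))) \<and>
    (\<forall>b \<in> Ob B. right_exact A C (comp_fct F (fix_right R A B b)))"

definition separately_rex_cat ::
  "('r, 'k) ring_scheme \<Rightarrow> ('ao, 'aa, 'r, 'x) lcat_scheme \<Rightarrow> ('bo, 'ba, 'r, 'y) lcat_scheme \<Rightarrow>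
   ('co, 'ca, 'r, 'z) lcat_scheme \<Rightarrow> _"
where
  "separately_rex_cat R A B C =
    fun_cat (tensor_cat R A B) C
      {F :: ('ao \<times> 'bo, ('ao, 'aa, 'bo, 'ba, 'r) tensor_arrow, 'co, 'ca) fct. separately_rex R A B C F}
      (nat_trans (tensor_cat R A B) C)"

text \<open>
  \<open>P\<close> with \<open>Z\<close> is the right exact tensor product of \<open>A\<close> and \<open>B\<close>.  In HOL, quantification over all
  test categories \<open>C\<close> must refer to fixed types of objects and arrows; the type argument
  plays the role of the universe in which \<open>C\<close> lives.
\<close>

definition is_rex_tensor ::
  "('co \<times> 'ca) itself \<Rightarrow> ('r, 'k) ring_scheme \<Rightarrow> ('ao, 'aa, 'r, 'x) lcat_scheme \<Rightarrow>
   ('bo, 'ba, 'r, 'y) lcat_scheme \<Rightarrow> ('po, 'pa, 'r, 'z) lcat_scheme \<Rightarrow>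
   ('ao \<times> 'bo, ('ao, 'aa, 'bo, 'ba, 'r) tensor_arrow, 'po, 'pa, 'w) fct_scheme \<Rightarrow> bool"
where
  "is_rex_tensor U R A B P Z \<longleftrightarrow>
    linear_category R P \<and> finitely_cocomplete P \<and> separately_rex R A B P Z \<and>
    (\<forall>C :: ('co, 'ca, 'r) lcat. linear_category R C \<and> finitely_cocomplete C \<longrightarrow>
      is_equivalence (rex_cat R P C) (separately_rex_cat R A B C)
        (precomp_fct (tensor_cat R A B) comp_fct Z))"


section \<open>Right exact symmetric monoidal categories\<close>

record ('o, 'a, 'r) smcat = "('o, 'a, 'r) lcat" +
  tob :: "'o \<Rightarrow> 'o \<Rightarrow> 'o" (infixl \<open>\<star>\<index>\<close> 75)
  tar :: "'a \<Rightarrow> 'a \<Rightarrow> 'a" (infixl \<open>\<diamondop>\<index>\<close> 75)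
  munit :: "'o"
  massoc :: "'o \<Rightarrow> 'o \<Rightarrow> 'o \<Rightarrow> 'a"
  mlunit :: "'o \<Rightarrow> 'a"
  mrunit :: "'o \<Rightarrow> 'a"
  msym :: "'o \<Rightarrow> 'o \<Rightarrow> 'a"

locale symmetric_monoidal_linear_category = linear_category R C
  for R :: "('r, 'k) ring_scheme" and C :: "('o, 'a, 'r, 'z) smcat_scheme" (structure) +
  assumes munit_ob: "munit C \<in> Ob C"
    and tob_ob: "x \<in> Ob C \<Longrightarrow> y \<in> Ob C \<Longrightarrow> x \<star> y \<in> Ob C"
    and tar_in_hom: "f \<in> Hom C x x' \<Longrightarrow> g \<in> Hom C y y' \<Longrightarrow> f \<diamondop> g \<in> Hom C (x \<star> y) (x' \<star> y')"
    and tar_ide: "x \<in> Ob C \<Longrightarrow> y \<in> Ob C \<Longrightarrow> ide C x \<diamondop> ide C y = ide C (x \<star> y)"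
    and tar_comp: "f \<in> Hom C x x' \<Longrightarrow> f' \<in> Hom C x' x'' \<Longrightarrow> g \<in> Hom C y y' \<Longrightarrow> g' \<in> Hom C y' y'' \<Longrightarrow>
      (f' \<cdot> f) \<diamondop> (g' \<cdot> g) = (f' \<diamondop> g') \<cdot> (f \<diamondop> g)"
    and tar_bilinear: "x \<in> Ob C \<Longrightarrow> x' \<in> Ob C \<Longrightarrow> y \<in> Ob C \<Longrightarrow> y' \<in> Ob C \<Longrightarrow>
      bilinear_map R (HomM C x x') (HomM C y y') (HomM C (x \<star> y) (x' \<star> y')) (\<lambda>f g. f \<diamondop> g)"
    and massoc_iso: "x \<in> Ob C \<Longrightarrow> y \<in> Ob C \<Longrightarrow> z \<in> Ob C \<Longrightarrow>
      is_iso C ((x \<star> y) \<star> z) (x \<star> (y \<star> z)) (massoc C x y z)"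
    and mlunit_iso: "x \<in> Ob C \<Longrightarrow> is_iso C (munit C \<star> x) x (mlunit C x)"
    and mrunit_iso: "x \<in> Ob C \<Longrightarrow> is_iso C (x \<star> munit C) x (mrunit C x)"
    and msym_in_hom: "x \<in> Ob C \<Longrightarrow> y \<in> Ob C \<Longrightarrow> msym C x y \<in> Hom C (x \<star> y) (y \<star> x)"
    and massoc_natural: "f \<in> Hom C x x' \<Longrightarrow> g \<in> Hom C y y' \<Longrightarrow> h \<in> Hom C z z' \<Longrightarrow>
      massoc C x' y' z' \<cdot> ((f \<diamondop> g) \<diamondop> h) = (f \<diamondop> (g \<diamondop> h)) \<cdot> massoc C x y z"
    and mlunit_natural: "f \<in> Hom C x x' \<Longrightarrow>
      mlunit C x' \<cdot> (ide C (munit C) \<diamondop> f) = f \<cdot> mlunit C x"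
    and mrunit_natural: "f \<in> Hom C x x' \<Longrightarrow>
      mrunit C x' \<cdot> (f \<diamondop> ide C (munit C)) = f \<cdot> mrunit C x"
    and msym_natural: "f \<in> Hom C x x' \<Longrightarrow> g \<in> Hom C y y' \<Longrightarrow>
      msym C x' y' \<cdot> (f \<diamondop> g) = (g \<diamondop> f) \<cdot> msym C x y"
    and pentagon: "w \<in> Ob C \<Longrightarrow> x \<in> Ob C \<Longrightarrow> y \<in> Ob C \<Longrightarrow> z \<in> Ob C \<Longrightarrow>
      massoc C w x (y \<star> z) \<cdot> massoc C (w \<star> x) y z =
      (ide C w \<diamondop> massoc C x y z) \<cdot> massoc C w (x \<star> y) z \<cdot> (massoc C w x y \<diamondop> ide C z)"
    and triangle: "x \<in> Ob C \<Longrightarrow> y \<in> Ob C \<Longrightarrow>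
      (ide C x \<diamondop> mlunit C y) \<cdot> massoc C x (munit C) y = mrunit C x \<diamondop> ide C y"
    and msym_symmetric: "x \<in> Ob C \<Longrightarrow> y \<in> Ob C \<Longrightarrow> msym C y x \<cdot> msym C x y = ide C (x \<star> y)"
    and hexagon: "x \<in> Ob C \<Longrightarrow> y \<in> Ob C \<Longrightarrow> z \<in> Ob C \<Longrightarrow>
      massoc C y z x \<cdot> msym C x (y \<star> z) \<cdot> massoc C x y z =
      (ide C y \<diamondop> msym C x z) \<cdot> massoc C y x z \<cdot> (msym C x y \<diamondop> ide C z)"

definition rex_sm_category :: "('r, 'k) ring_scheme \<Rightarrow> ('o, 'a, 'r, 'z) smcat_scheme \<Rightarrow> bool" where
  "rex_sm_category R C \<longleftrightarrow>
    symmetric_monoidal_linear_category R C \<and> finitely_cocomplete C \<and>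
    (\<forall>x \<in> Ob C. right_exact C C \<lparr>fo = \<lambda>y. x \<star>\<^bsub>C\<^esub> y, fa = \<lambda>g. ide C x \<diamondop>\<^bsub>C\<^esub> g\<rparr>) \<and>
    (\<forall>y \<in> Ob C. right_exact C C \<lparr>fo = \<lambda>x. x \<star>\<^bsub>C\<^esub> y, fa = \<lambda>f. f \<diamondop>\<^bsub>C\<^esub> ide C y\<rparr>)"

text \<open>
  Monoidal functors carry \<open>fmu F x y : F x \<star> F y \<rightarrow> F (x \<star> y)\<close> and \<open>feps F : I \<rightarrow> F I\<close>.
\<close>

record ('o1, 'a1, 'o2, 'a2) smfct = "('o1, 'a1, 'o2, 'a2) fct" +
  fmu :: "'o1 \<Rightarrow> 'o1 \<Rightarrow> 'a2"
  feps :: "'a2"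

definition strong_sm_functor ::
  "('r, 'k) ring_scheme \<Rightarrow> ('o1, 'a1, 'r, 'y) smcat_scheme \<Rightarrow> ('o2, 'a2, 'r, 'z) smcat_scheme \<Rightarrow>
   ('o1, 'a1, 'o2, 'a2) smfct \<Rightarrow> bool"
where
  "strong_sm_functor R C D F \<longleftrightarrow> linear_functor R C D F \<and>
    (\<forall>x \<in> Ob C. \<forall>y \<in> Ob C. is_iso D (fo F x \<star>\<^bsub>D\<^esub> fo F y) (fo F (x \<star>\<^bsub>C\<^esub> y)) (fmu F x y)) \<and>
    is_iso D (munit D) (fo F (munit C)) (feps F) \<and>
    (\<forall>x x' y y' f g. f \<in> Hom C x x' \<longrightarrow> g \<in> Hom C y y' \<longrightarrow>
      fa F (f \<diamondop>\<^bsub>C\<^esub> g) \<cdot>\<^bsub>D\<^esub> fmu F x y = fmu F x' y' \<cdot>\<^bsub>D\<^esub> (fa F f \<diamondop>\<^bsub>D\<^esub> fa F g)) \<and>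
    (\<forall>x \<in> Ob C. \<forall>y \<in> Ob C. \<forall>z \<in> Ob C.
      fa F (massoc C x y z) \<cdot>\<^bsub>D\<^esub> fmu F (x \<star>\<^bsub>C\<^esub> y) z \<cdot>\<^bsub>D\<^esub> (fmu F x y \<diamondop>\<^bsub>D\<^esub> ide D (fo F z)) =
      fmu F x (y \<star>\<^bsub>C\<^esub> z) \<cdot>\<^bsub>D\<^esub> (ide D (fo F x) \<diamondop>\<^bsub>D\<^esub> fmu F y z) \<cdot>\<^bsub>D\<^esub> massoc D (fo F x) (fo F y) (fo F z)) \<and>
    (\<forall>x \<in> Ob C.
      fa F (mlunit C x) \<cdot>\<^bsub>D\<^esub> fmu F (munit C) x \<cdot>\<^bsub>D\<^esub> (feps F \<diamondop>\<^bsub>D\<^esub> ide D (fo F x)) = mlunit D (fo F x)) \<and>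
    (\<forall>x \<in> Ob C.
      fa F (mrunit C x) \<cdot>\<^bsub>D\<^esub> fmu F x (munit C) \<cdot>\<^bsub>D\<^esub> (ide D (fo F x) \<diamondop>\<^bsub>D\<^esub> feps F) = mrunit D (fo F x)) \<and>
    (\<forall>x \<in> Ob C. \<forall>y \<in> Ob C.
      fa F (msym C x y) \<cdot>\<^bsub>D\<^esub> fmu F x y = fmu F y x \<cdot>\<^bsub>D\<^esub> msym D (fo F x) (fo F y))"

definition monoidal_nat_trans ::
  "('o1, 'a1, 'r, 'y) smcat_scheme \<Rightarrow> ('o2, 'a2, 'r, 'z) smcat_scheme \<Rightarrow>
   ('o1, 'a1, 'o2, 'a2) smfct \<Rightarrow> ('o1, 'a1, 'o2, 'a2) smfct \<Rightarrow> ('o1 \<Rightarrow> 'a2) \<Rightarrow> bool"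
where
  "monoidal_nat_trans C D F G \<eta> \<longleftrightarrow> nat_trans C D F G \<eta> \<and>
    (\<forall>x \<in> Ob C. \<forall>y \<in> Ob C. \<eta> (x \<star>\<^bsub>C\<^esub> y) \<cdot>\<^bsub>D\<^esub> fmu F x y = fmu G x y \<cdot>\<^bsub>D\<^esub> (\<eta> x \<diamondop>\<^bsub>D\<^esub> \<eta> y)) \<and>
    \<eta> (munit C) \<cdot>\<^bsub>D\<^esub> feps F = feps G"

definition comp_smfct ::
  "('o3, 'a3, 'r, 'z) smcat_scheme \<Rightarrow> ('o2, 'a2, 'o3, 'a3) smfct \<Rightarrow> ('o1, 'a1, 'o2, 'a2) smfct \<Rightarrow>
   ('o1, 'a1, 'o3, 'a3) smfct"
where
  "comp_smfct E G F =
    \<lparr>fo = \<lambda>x. fo G (fo F x),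
     fa = \<lambda>f. fa G (fa F f),
     fmu = \<lambda>x y. fa G (fmu F x y) \<cdot>\<^bsub>E\<^esub> fmu G (fo F x) (fo F y),
     feps = fa G (feps F) \<cdot>\<^bsub>E\<^esub> feps G\<rparr>"

definition rex_sm_cat ::
  "('r, 'k) ring_scheme \<Rightarrow> ('o1, 'a1, 'r, 'y) smcat_scheme \<Rightarrow> ('o2, 'a2, 'r, 'z) smcat_scheme \<Rightarrow> _"
where
  "rex_sm_cat R C D =
    fun_cat C D {F. strong_sm_functor R C D F \<and> right_exact C D F} (monoidal_nat_trans C D)"

text \<open>The componentwise symmetric monoidal structure on \<open>A \<otimes> B\<close>.\<close>

definition tensor_smcat ::
  "('r, 'k) ring_scheme \<Rightarrow> ('ao, 'aa, 'r, 'y) smcat_scheme \<Rightarrow> ('bo, 'ba, 'r, 'z) smcat_scheme \<Rightarrow>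
   ('ao \<times> 'bo, ('ao, 'aa, 'bo, 'ba, 'r) tensor_arrow, 'r) smcat"
where
  "tensor_smcat R A B = lcat.extend (tensor_cat R A B)
    \<lparr>tob = \<lambda>(a, b) (a', b'). (a \<star>\<^bsub>A\<^esub> a', b \<star>\<^bsub>B\<^esub> b'),
     tar = \<lambda>((a, b), (c, d), s) ((a', b'), (c', d'), t).
       tensor_op R A B (tar A) (tar B) (a \<star>\<^bsub>A\<^esub> a', b \<star>\<^bsub>B\<^esub> b') (c \<star>\<^bsub>A\<^esub> c', d \<star>\<^bsub>B\<^esub> d') s t,
     munit = (munit A, munit B),
     massoc = \<lambda>(a, b) (a', b') (a'', b''). tensor_arr R A B (massoc A a a' a'') (massoc B b b' b''),
     mlunit = \<lambda>(a, b). tensor_arr R A B (mlunit A a) (mlunit B b),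
     mrunit = \<lambda>(a, b). tensor_arr R A B (mrunit A a) (mrunit B b),
     msym = \<lambda>(a, b) (a', b'). tensor_arr R A B (msym A a a') (msym B b b')\<rparr>"

text \<open>
  The monoidal functors \<open>A \<rightarrow> A \<otimes> B\<close>, \<open>a \<mapsto> (a, I)\<close>, and \<open>B \<rightarrow> A \<otimes> B\<close>, \<open>b \<mapsto> (I, b)\<close>; their
  multiplication constraints use the unit isomorphism \<open>I \<star> I \<rightarrow> I\<close> in the other variable.
\<close>

definition incl_left ::
  "('r, 'k) ring_scheme \<Rightarrow> ('ao, 'aa, 'r, 'y) smcat_scheme \<Rightarrow> ('bo, 'ba, 'r, 'z) smcat_scheme \<Rightarrow>
   ('ao, 'aa, 'ao \<times> 'bo, ('ao, 'aa, 'bo, 'ba, 'r) tensor_arrow) smfct"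
where
  "incl_left R A B =
    \<lparr>fo = \<lambda>a. (a, munit B),
     fa = \<lambda>f. tensor_arr R A B f (ide B (munit B)),
     fmu = \<lambda>a a'. tensor_arr R A B (ide A (a \<star>\<^bsub>A\<^esub> a')) (mlunit B (munit B)),
     feps = tensor_arr R A B (ide A (munit A)) (ide B (munit B))\<rparr>"

definition incl_right ::
  "('r, 'k) ring_scheme \<Rightarrow> ('ao, 'aa, 'r, 'y) smcat_scheme \<Rightarrow> ('bo, 'ba, 'r, 'z) smcat_scheme \<Rightarrow>
   ('bo, 'ba, 'ao \<times> 'bo, ('ao, 'aa, 'bo, 'ba, 'r) tensor_arrow) smfct"
where
  "incl_right R A B =
    \<lparr>fo = \<lambda>b. (munit A, b),
     fa = \<lambda>g. tensor_arr R A B (ide A (munit A)) g,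
     fmu = \<lambda>b b'. tensor_arr R A B (mlunit A (munit A)) (ide B (b \<star>\<^bsub>B\<^esub> b')),
     feps = tensor_arr R A B (ide A (munit A)) (ide B (munit B))\<rparr>"


section \<open>Bicategorical coproducts\<close>

text \<open>As above, the type argument is the universe of the test objects \<open>C\<close>.\<close>

definition is_bicategorical_coproduct ::
  "('co \<times> 'ca) itself \<Rightarrow> ('r, 'k) ring_scheme \<Rightarrow> ('ao, 'aa, 'r, 'x) smcat_scheme \<Rightarrow>
   ('bo, 'ba, 'r, 'y) smcat_scheme \<Rightarrow> ('po, 'pa, 'r, 'z) smcat_scheme \<Rightarrow>
   ('ao, 'aa, 'po, 'pa) smfct \<Rightarrow> ('bo, 'ba, 'po, 'pa) smfct \<Rightarrow> bool"
where
  "is_bicategorical_coproduct U R A B P i j \<longleftrightarrow>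
    rex_sm_category R P \<and> i \<in> Ob (rex_sm_cat R A P) \<and> j \<in> Ob (rex_sm_cat R B P) \<and>
    (\<forall>C :: ('co, 'ca, 'r) smcat. rex_sm_category R C \<longrightarrow>
      is_equivalence (rex_sm_cat R P C) (prod_cat (rex_sm_cat R A C) (rex_sm_cat R B C))
        (pair_fct (precomp_fct A (comp_smfct C) i) (precomp_fct B (comp_smfct C) j)))"

end

theory Submission
  imports Defs
begin

text \<open>
  Right exact linear functors out of the tensor product \<open>P\<close>, and transformations between them, are determined by
  composition with \<open>Z\<close>. Extending in one variable at a time, the same holds for functors on \<open>P \<times> P\<close> that are
  right exact in each variable, so the structure maps of a monoidal functor on \<open>A \<times> B\<close> extend along \<open>Z\<close>, and the
  monoidal equations descend. It remains to compare monoidal functors \<open>E\<close> on the product \<open>A \<times> B\<close> with pairs of monoidal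
  functors: \<open>E\<close> is recovered from its restrictions through the isomorphisms \<open>E (a, I) \<star> E (I, b) \<rightarrow> E (a, b)\<close>, and a
  pair \<open>(F, G)\<close> is the restriction of \<open>(a, b) \<mapsto> F a \<star> G b\<close>, which is monoidal because the tensor product
  \<open>C \<times> C \<rightarrow> C\<close> of a symmetric monoidal category is itself a strong symmetric monoidal functor.
\<close>

section \<open>Categories\<close>

text \<open>The universal property of \<open>Z\<close> concerns the linear category
  \<open>A \<otimes> B\<close>, whose arrows are sums of pure tensors, while monoidal equations are
  convenient only for pairs of arrows. Everything is therefore moved to the cartesian product
  \<open>prod_smcat A B\<close>, which has no linear structure; bilinearity carries natural families
  back to \<open>A \<otimes> B\<close>. Hence symmetric monoidal categories and functors reappear
  below without their linear parts. The computational obstacle is that the tensor product of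
  \<open>C\<close> is a monoidal functor only through identities between composites of associators,
  unitors and symmetries. They are proved by letting \<open>C\<close> act on itself: on right-nested
  products associators and unitors act as identities, and only symmetries and naturality squares
  remain. A second obstacle is that the universal property returns functors only up to isomorphism,
  so the monoidal structure of \<open>(a, b) \<mapsto> F a \<star> G b\<close> is transported along
  that isomorphism before it is extended along \<open>Z\<close>.\<close>

definition iso_arr :: "('o, 'a, 'z) cat_scheme \<Rightarrow> 'a \<Rightarrow> bool" where
  "iso_arr C f \<longleftrightarrow> f \<in> Ar C \<and> is_iso C (Dom C f) (Cod C f) f"

text \<open>Inverses are unique (\<open>inv_eqI\<close>), so the choice made by \<open>SOME\<close>
  is harmless for isomorphisms.\<close>

definition inv_arr :: "('o, 'a, 'z) cat_scheme \<Rightarrow> 'a \<Rightarrow> 'a" where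
  "inv_arr C f = (SOME g. g \<in> Hom C (Cod C f) (Dom C f) \<and>
     g \<cdot>\<^bsub>C\<^esub> f = ide C (Dom C f) \<and> f \<cdot>\<^bsub>C\<^esub> g = ide C (Cod C f))"

text \<open>Source and target become equations, the form in which simplification decides whether
  arrows compose.\<close>

lemma is_iso_iff: "is_iso C x y f \<longleftrightarrow> iso_arr C f \<and> Dom C f = x \<and> Cod C f = y"
  unfolding iso_arr_def is_iso_def Hom_def by auto

lemma inv_arr:
  assumes "iso_arr C f"
  shows "inv_arr C f \<in> Hom C (Cod C f) (Dom C f)"
    and "inv_arr C f \<cdot>\<^bsub>C\<^esub> f = ide C (Dom C f)"
    and "f \<cdot>\<^bsub>C\<^esub> inv_arr C f = ide C (Cod C f)"
proof -
  have "\<exists>g. g \<in> Hom C (Cod C f) (Dom C f) \<and>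
     g \<cdot>\<^bsub>C\<^esub> f = ide C (Dom C f) \<and> f \<cdot>\<^bsub>C\<^esub> g = ide C (Cod C f)"
    using assms unfolding iso_arr_def is_iso_def by blast
  from someI_ex[OF this]
  show "inv_arr C f \<in> Hom C (Cod C f) (Dom C f)"
    "inv_arr C f \<cdot>\<^bsub>C\<^esub> f = ide C (Dom C f)" "f \<cdot>\<^bsub>C\<^esub> inv_arr C f = ide C (Cod C f)"
    unfolding inv_arr_def by blast+
qed

context category
begin

lemma Dom_Ob [simp]: "f \<in> Ar C \<Longrightarrow> Dom C f \<in> Ob C"
  by (rule dom_closed)

lemma Cod_Ob [simp]: "f \<in> Ar C \<Longrightarrow> Cod C f \<in> Ob C"
  by (rule cod_closed)

lemma ide_typed [simp]:
  assumes "x \<in> Ob C"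
  shows "ide C x \<in> Ar C" "Dom C (ide C x) = x" "Cod C (ide C x) = x"
  using ide_in_hom[OF assms] by (auto simp: Hom_def)

lemma comp_typed [simp]:
  assumes "f \<in> Ar C" "g \<in> Ar C" "Dom C g = Cod C f"
  shows "g \<cdot> f \<in> Ar C" "Dom C (g \<cdot> f) = Dom C f" "Cod C (g \<cdot> f) = Cod C g"
  using comp_in_hom[of f "Dom C f" "Cod C f" g "Cod C g"] assms by (auto simp: Hom_def)

text \<open>The object is a separate variable tied to \<open>f\<close> by an equation, so that
  rewriting succeeds when the two are only provably equal.\<close>

lemma comp_ide [simp]:
  "f \<in> Ar C \<Longrightarrow> Cod C f = y \<Longrightarrow> ide C y \<cdot> f = f"
  "f \<in> Ar C \<Longrightarrow> Dom C f = x \<Longrightarrow> f \<cdot> ide C x = f"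
  using comp_ide_left comp_ide_right by (auto simp: Hom_def)

lemma assoc:
  "f \<in> Ar C \<Longrightarrow> g \<in> Ar C \<Longrightarrow> h \<in> Ar C \<Longrightarrow> Dom C g = Cod C f \<Longrightarrow> Dom C h = Cod C g \<Longrightarrow>
    (h \<cdot> g) \<cdot> f = h \<cdot> (g \<cdot> f)"
  using comp_assoc by (auto simp: Hom_def)

text \<open>Composites are kept nested to the right; this applies an equation
  \<open>g \<cdot> f = k\<close> at the head of such a composite.\<close>

lemma reassoc:
  "g \<cdot> f = k \<Longrightarrow> f \<in> Ar C \<Longrightarrow> g \<in> Ar C \<Longrightarrow> h \<in> Ar C \<Longrightarrow> Dom C g = Cod C f \<Longrightarrow> Dom C f = Cod C h \<Longrightarrow>
    g \<cdot> (f \<cdot> h) = k \<cdot> h"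
  using assoc by metis

lemma iso_Ar [simp]: "iso_arr C f \<Longrightarrow> f \<in> Ar C"
  by (simp add: iso_arr_def)

lemma inv_typed [simp]:
  assumes "iso_arr C f"
  shows "inv_arr C f \<in> Ar C" "Dom C (inv_arr C f) = Cod C f" "Cod C (inv_arr C f) = Dom C f"
  using inv_arr(1)[OF assms] by (auto simp: Hom_def)

lemma inv_comp [simp]:
  assumes "iso_arr C f"
  shows "inv_arr C f \<cdot> f = ide C (Dom C f)" "f \<cdot> inv_arr C f = ide C (Cod C f)"
    and "h \<in> Ar C \<Longrightarrow> Cod C h = Dom C f \<Longrightarrow> inv_arr C f \<cdot> (f \<cdot> h) = h"
    and "h \<in> Ar C \<Longrightarrow> Cod C h = Cod C f \<Longrightarrow> f \<cdot> (inv_arr C f \<cdot> h) = h"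
  using inv_arr(2,3)[OF assms] assms by (simp_all add: assoc[symmetric])

lemma iso_arrI:
  assumes "f \<in> Ar C" "g \<in> Ar C" "Dom C g = Cod C f" "Cod C g = Dom C f"
    "g \<cdot> f = ide C (Dom C f)" "f \<cdot> g = ide C (Cod C f)"
  shows "iso_arr C f"
  using assms unfolding iso_arr_def is_iso_def Hom_def by blast

lemma iso_ide [simp]: "x \<in> Ob C \<Longrightarrow> iso_arr C (ide C x)"
  by (rule iso_arrI[where g = "ide C x"]) simp_all

lemma iso_inv [simp]: "iso_arr C f \<Longrightarrow> iso_arr C (inv_arr C f)"
  by (rule iso_arrI[where g = f]) simp_all

lemma iso_comp [simp]:
  assumes "iso_arr C f" "iso_arr C g" "Dom C g = Cod C f"
  shows "iso_arr C (g \<cdot> f)"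
  by (rule iso_arrI[where g = "inv_arr C f \<cdot> inv_arr C g"]) (use assms in \<open>simp_all add: assoc\<close>)

lemma iso_cancel_left:
  assumes "iso_arr C f" "g \<in> Ar C" "h \<in> Ar C" "Cod C g = Dom C f" "Cod C h = Dom C f" "f \<cdot> g = f \<cdot> h"
  shows "g = h"
  using assms inv_comp(3) by metis

lemma iso_cancel_right:
  assumes "iso_arr C f" "g \<in> Ar C" "h \<in> Ar C" "Dom C g = Cod C f" "Dom C h = Cod C f" "g \<cdot> f = h \<cdot> f"
  shows "g = h"
proof -
  have "g = (g \<cdot> f) \<cdot> inv_arr C f" "h = (h \<cdot> f) \<cdot> inv_arr C f"
    using assms(1-5) by (simp_all add: assoc)
  then show ?thesis using assms(6) by simp
qed

lemma inv_eqI: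
  assumes "iso_arr C f" "g \<in> Ar C" "Dom C g = Cod C f" "Cod C g = Dom C f" "g \<cdot> f = ide C (Dom C f)"
  shows "inv_arr C f = g"
  by (rule iso_cancel_right[OF assms(1)]) (use assms in simp_all)

lemma inv_ide [simp]: "x \<in> Ob C \<Longrightarrow> inv_arr C (ide C x) = ide C x"
  by (rule inv_eqI) simp_all

text \<open>Cancel one factor. It will show that the symmetry with the unit object acts trivially,
  once that action is known to be idempotent.\<close>

lemma iso_eq_of_comp_ide:
  assumes "iso_arr C f" "f \<cdot> f = f" "Dom C f = Cod C f"
  shows "f = ide C (Dom C f)"
  by (rule iso_cancel_left[OF assms(1)]) (use assms in simp_all)

text \<open>A commuting square with two invertible parallel sides can be read backwards; this gives
  naturality of inverse families.\<close>

lemma swap_inv: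
  assumes "iso_arr C f" "iso_arr C g" "h \<in> Ar C" "k \<in> Ar C" "g \<cdot> h = k \<cdot> f"
    "Dom C g = Cod C h" "Dom C k = Cod C f" "Dom C h = Dom C f" "Cod C k = Cod C g"
  shows "h \<cdot> inv_arr C f = inv_arr C g \<cdot> k"
proof -
  have "g \<cdot> (h \<cdot> inv_arr C f) = (g \<cdot> h) \<cdot> inv_arr C f" using assms(1-4,6-) by (simp add: assoc)
  also have "\<dots> = (k \<cdot> f) \<cdot> inv_arr C f" by (simp only: assms(5))
  also have "\<dots> = k" using assms(1-4,6-) by (simp add: assoc)
  also have "\<dots> = g \<cdot> (inv_arr C g \<cdot> k)" using assms by simp
  finally show ?thesis by (rule iso_cancel_left[OF assms(2), rotated -1]) (use assms in simp_all)
qed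

end

section \<open>Functors and natural transformations\<close>

lemma functor_simps:
  assumes "is_functor C D F"
  shows "x \<in> Ob C \<Longrightarrow> fo F x \<in> Ob D"
    and "f \<in> Ar C \<Longrightarrow> fa F f \<in> Ar D"
    and "f \<in> Ar C \<Longrightarrow> Dom D (fa F f) = fo F (Dom C f)"
    and "f \<in> Ar C \<Longrightarrow> Cod D (fa F f) = fo F (Cod C f)"
    and "x \<in> Ob C \<Longrightarrow> fa F (ide C x) = ide D (fo F x)"
    and "f \<in> Ar C \<Longrightarrow> g \<in> Ar C \<Longrightarrow> Dom C g = Cod C f \<Longrightarrow> fa F (g \<cdot>\<^bsub>C\<^esub> f) = fa F g \<cdot>\<^bsub>D\<^esub> fa F f"
  using assms by (auto simp: is_functor_def Hom_def)

lemma functor_iso: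
  assumes "is_functor C D F" "category C" "category D" "iso_arr C f"
  shows "iso_arr D (fa F f)" "fa F (inv_arr C f) = inv_arr D (fa F f)"
proof -
  interpret C: category C by fact
  interpret D: category D by fact
  note [simp] = functor_simps[OF assms(1)] assms(4)
  have a: "fa F (inv_arr C f) \<cdot>\<^bsub>D\<^esub> fa F f = ide D (Dom D (fa F f))"
    "fa F f \<cdot>\<^bsub>D\<^esub> fa F (inv_arr C f) = ide D (Cod D (fa F f))"
    using functor_simps(6)[OF assms(1), of f "inv_arr C f", symmetric]
      functor_simps(6)[OF assms(1), of "inv_arr C f" f, symmetric] by simp_all
  show "iso_arr D (fa F f)" by (rule D.iso_arrI[OF _ _ _ _ a]) simp_all
  then show "fa F (inv_arr C f) = inv_arr D (fa F f)"
    by (rule D.inv_eqI[OF _ _ _ _ a(1), symmetric]) simp_all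
qed

lemma functorI:
  assumes "\<And>x. x \<in> Ob C \<Longrightarrow> fo F x \<in> Ob D"
    and "\<And>f. f \<in> Ar C \<Longrightarrow> fa F f \<in> Ar D \<and> Dom D (fa F f) = fo F (Dom C f) \<and> Cod D (fa F f) = fo F (Cod C f)"
    and "\<And>x. x \<in> Ob C \<Longrightarrow> fa F (ide C x) = ide D (fo F x)"
    and "\<And>f g. f \<in> Ar C \<Longrightarrow> g \<in> Ar C \<Longrightarrow> Dom C g = Cod C f \<Longrightarrow> fa F (g \<cdot>\<^bsub>C\<^esub> f) = fa F g \<cdot>\<^bsub>D\<^esub> fa F f"
  shows "is_functor C D F"
  using assms unfolding is_functor_def Hom_def by auto

lemma comp_fct_sel [simp]:
  "fo (comp_fct G F) x = fo G (fo F x)" "fa (comp_fct G F) f = fa G (fa F f)"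
  by (simp_all add: comp_fct_def)

lemma id_fct_sel [simp]: "fo id_fct x = x" "fa id_fct f = f"
  by (simp_all add: id_fct_def)

lemma functor_comp: "is_functor C D F \<Longrightarrow> is_functor D E G \<Longrightarrow> is_functor C E (comp_fct G F)"
  by (rule functorI) (simp_all add: functor_simps[of C D F] functor_simps[of D E G])

lemma nat_trans_simps:
  assumes "nat_trans C D F G \<eta>"
  shows "x \<in> Ob C \<Longrightarrow> \<eta> x \<in> Ar D"
    and "x \<in> Ob C \<Longrightarrow> Dom D (\<eta> x) = fo F x"
    and "x \<in> Ob C \<Longrightarrow> Cod D (\<eta> x) = fo G x"
  using assms by (auto simp: nat_trans_def Hom_def)

lemma nat_trans_natural:
  assumes "nat_trans C D F G \<eta>"
  shows "f \<in> Ar C \<Longrightarrow> fa G f \<cdot>\<^bsub>D\<^esub> \<eta> (Dom C f) = \<eta> (Cod C f) \<cdot>\<^bsub>D\<^esub> fa F f"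
  using assms by (auto simp: nat_trans_def Hom_def)

lemma nat_transI:
  assumes "\<And>x. x \<in> Ob C \<Longrightarrow> \<eta> x \<in> Ar D \<and> Dom D (\<eta> x) = fo F x \<and> Cod D (\<eta> x) = fo G x"
    and "\<And>f. f \<in> Ar C \<Longrightarrow> fa G f \<cdot>\<^bsub>D\<^esub> \<eta> (Dom C f) = \<eta> (Cod C f) \<cdot>\<^bsub>D\<^esub> fa F f"
  shows "nat_trans C D F G \<eta>"
  using assms unfolding nat_trans_def Hom_def by auto

text \<open>Functors carry arbitrary values outside their source, and differently built composites
  may agree only on it; this passes between them.\<close>

lemma nat_trans_cong:
  assumes "nat_trans C D F G \<eta>" "category C"
    and "\<And>x. x \<in> Ob C \<Longrightarrow> fo F x = fo F' x" "\<And>f. f \<in> Ar C \<Longrightarrow> fa F f = fa F' f"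
    and "\<And>x. x \<in> Ob C \<Longrightarrow> fo G x = fo G' x" "\<And>f. f \<in> Ar C \<Longrightarrow> fa G f = fa G' f"
    and "\<And>x. x \<in> Ob C \<Longrightarrow> \<eta> x = \<eta>' x"
  shows "nat_trans C D F' G' \<eta>'"
proof -
  interpret C: category C by fact
  show ?thesis
    by (rule nat_transI)
      (use nat_trans_simps[OF assms(1)] nat_trans_natural[OF assms(1)] assms(3-) in auto)
qed

text \<open>Of \<open>C\<close> only the closure of sources and targets is required. In this form
  the lemma applies to \<open>tensor_cat R A B\<close> without first establishing its category
  laws.\<close>

lemma nat_trans_vcomp_dom:
  assumes \<eta>: "nat_trans C D F G \<eta>" and \<theta>: "nat_trans C D G H \<theta>" and "category D"
    and dc: "\<And>f. f \<in> Ar C \<Longrightarrow> Dom C f \<in> Ob C \<and> Cod C f \<in> Ob C"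
    and F: "is_functor C D F" "is_functor C D G" "is_functor C D H"
  shows "nat_trans C D F H (\<lambda>x. \<theta> x \<cdot>\<^bsub>D\<^esub> \<eta> x)"
proof -
  interpret D: category D by fact
  note [simp] = nat_trans_simps[OF \<eta>] nat_trans_simps[OF \<theta>] functor_simps[OF F(1)] functor_simps[OF F(2)] functor_simps[OF F(3)]
  show ?thesis
  proof (rule nat_transI)
    fix f assume f: "f \<in> Ar C"
    have "fa H f \<cdot>\<^bsub>D\<^esub> \<theta> (Dom C f) \<cdot>\<^bsub>D\<^esub> \<eta> (Dom C f) = (\<theta> (Cod C f) \<cdot>\<^bsub>D\<^esub> fa G f) \<cdot>\<^bsub>D\<^esub> \<eta> (Dom C f)"
      using f dc[OF f] nat_trans_natural[OF \<theta> f] by (simp add: D.assoc[symmetric])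
    also have "\<dots> = (\<theta> (Cod C f) \<cdot>\<^bsub>D\<^esub> \<eta> (Cod C f)) \<cdot>\<^bsub>D\<^esub> fa F f"
      using f dc[OF f] nat_trans_natural[OF \<eta> f] by (simp add: D.assoc)
    finally show "fa H f \<cdot>\<^bsub>D\<^esub> \<theta> (Dom C f) \<cdot>\<^bsub>D\<^esub> \<eta> (Dom C f) = (\<theta> (Cod C f) \<cdot>\<^bsub>D\<^esub> \<eta> (Cod C f)) \<cdot>\<^bsub>D\<^esub> fa F f" .
  qed simp
qed

lemma nat_trans_vcomp:
  assumes "nat_trans C D F G \<eta>" "nat_trans C D G H \<theta>" "category C" "category D"
    "is_functor C D F" "is_functor C D G" "is_functor C D H"
  shows "nat_trans C D F H (\<lambda>x. \<theta> x \<cdot>\<^bsub>D\<^esub> \<eta> x)"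
  using nat_trans_vcomp_dom[OF assms(1,2,4) _ assms(5-7)] category.Dom_Ob[OF assms(3)] category.Cod_Ob[OF assms(3)]
  by blast

lemma nat_trans_inv:
  assumes "nat_trans C D F G \<eta>" "category C" "category D" "is_functor C D F" "is_functor C D G"
    and "\<And>x. x \<in> Ob C \<Longrightarrow> iso_arr D (\<eta> x)"
  shows "nat_trans C D G F (\<lambda>x. inv_arr D (\<eta> x))"
proof -
  interpret C: category C by fact
  interpret D: category D by fact
  note [simp] = nat_trans_simps[OF assms(1)] functor_simps[OF assms(4)] functor_simps[OF assms(5)] assms(6)
  show ?thesis
    by (rule nat_transI) (use nat_trans_natural[OF assms(1)] in \<open>auto intro!: D.swap_inv\<close>)
qed

lemma nat_trans_whisker:
  assumes "nat_trans C D F G \<eta>" "is_functor B C K"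
  shows "nat_trans B D (comp_fct F K) (comp_fct G K) (\<lambda>x. \<eta> (fo K x))"
proof (rule nat_transI)
  fix f assume "f \<in> Ar B"
  then show "fa (comp_fct G K) f \<cdot>\<^bsub>D\<^esub> \<eta> (fo K (Dom B f)) = \<eta> (fo K (Cod B f)) \<cdot>\<^bsub>D\<^esub> fa (comp_fct F K) f"
    using nat_trans_natural[OF assms(1), of "fa K f"] by (simp add: functor_simps[OF assms(2)])
qed (simp add: nat_trans_simps[OF assms(1)] functor_simps[OF assms(2)])

section \<open>Equivalences of categories\<close>

text \<open>The unit determines an arrow from its image under \<open>G\<close> after
  \<open>F\<close>, which gives faithfulness. The counit supplies the isomorphisms for essential
  surjectivity and, by making \<open>G\<close> faithful, fullness.\<close>

lemma
  fixes C :: "('o1, 'a1, 'y) cat_scheme" and D :: "('o2, 'a2, 'z) cat_scheme"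
  assumes "is_equivalence C D F" "category C" "category D"
  shows equivalence_faithful: "f \<in> Hom C x y \<Longrightarrow> f' \<in> Hom C x y \<Longrightarrow> fa F f = fa F f' \<Longrightarrow> f = f'"
    and equivalence_full: "x \<in> Ob C \<Longrightarrow> y \<in> Ob C \<Longrightarrow> k \<in> Hom D (fo F x) (fo F y) \<Longrightarrow> \<exists>f\<in>Hom C x y. fa F f = k"
    and equivalence_es: "z \<in> Ob D \<Longrightarrow> \<exists>x\<in>Ob C. \<exists>k. is_iso D (fo F x) z k"
proof -
  interpret C: category C by fact
  interpret D: category D by fact
  from assms(1) obtain G :: "('o2, 'a2, 'o1, 'a1) fct" and \<eta> \<epsilon> where F: "is_functor C D F" and G: "is_functor D C G"
    and \<eta>: "nat_iso C C id_fct (comp_fct G F) \<eta>" and \<epsilon>: "nat_iso D D (comp_fct F G) id_fct \<epsilon>"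
    unfolding is_equivalence_def by blast
  note [simp] = functor_simps[OF F] functor_simps[OF G]
  have \<eta>n: "nat_trans C C id_fct (comp_fct G F) \<eta>" and \<epsilon>n: "nat_trans D D (comp_fct F G) id_fct \<epsilon>"
    using \<eta> \<epsilon> by (auto simp: nat_iso_def)
  have \<eta>i [simp]: "\<And>x. x \<in> Ob C \<Longrightarrow> iso_arr C (\<eta> x)" and \<epsilon>i [simp]: "\<And>x. x \<in> Ob D \<Longrightarrow> iso_arr D (\<epsilon> x)"
    using \<eta> \<epsilon> by (auto simp: nat_iso_def is_iso_iff)
  note [simp] = nat_trans_simps[OF \<eta>n] nat_trans_simps[OF \<epsilon>n]
  have faith: "f = f'" if "f \<in> Hom C x y" "f' \<in> Hom C x y" "fa F f = fa F f'" for f f' x y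
  proof -
    have [simp]: "f \<in> Ar C" "f' \<in> Ar C" "Dom C f = x" "Cod C f = y" "Dom C f' = x" "Cod C f' = y"
      using that by (auto simp: Hom_def)
    have xy [simp]: "x \<in> Ob C" "y \<in> Ob C" using C.Dom_Ob[of f] C.Cod_Ob[of f] by simp_all
    have "\<eta> y \<cdot>\<^bsub>C\<^esub> f = \<eta> y \<cdot>\<^bsub>C\<^esub> f'"
      using nat_trans_natural[OF \<eta>n, of f] nat_trans_natural[OF \<eta>n, of f'] that(3) by simp
    then show ?thesis by (rule C.iso_cancel_left[OF \<eta>i[OF xy(2)], rotated -1]) simp_all
  qed
  then show "f \<in> Hom C x y \<Longrightarrow> f' \<in> Hom C x y \<Longrightarrow> fa F f = fa F f' \<Longrightarrow> f = f'" for f f' x y .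
  \<comment> \<open>Faithfulness of \<open>G\<close> lets the equation \<open>fa F f = k\<close>
    below be tested after applying \<open>G\<close>.\<close>
  have Gfaith: "f = f'" if "f \<in> Hom D x y" "f' \<in> Hom D x y" "fa G f = fa G f'" for f f' x y
  proof -
    have [simp]: "f \<in> Ar D" "f' \<in> Ar D" "Dom D f = x" "Cod D f = y" "Dom D f' = x" "Cod D f' = y"
      using that by (auto simp: Hom_def)
    have xy [simp]: "x \<in> Ob D" "y \<in> Ob D" using D.Dom_Ob[of f] D.Cod_Ob[of f] by simp_all
    have "f \<cdot>\<^bsub>D\<^esub> \<epsilon> x = f' \<cdot>\<^bsub>D\<^esub> \<epsilon> x"
      using nat_trans_natural[OF \<epsilon>n, of f] nat_trans_natural[OF \<epsilon>n, of f'] that(3) by simp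
    then show ?thesis by (rule D.iso_cancel_right[OF \<epsilon>i[OF xy(1)], rotated -1]) simp_all
  qed
  show "\<exists>f\<in>Hom C x y. fa F f = k" if "x \<in> Ob C" "y \<in> Ob C" "k \<in> Hom D (fo F x) (fo F y)" for x y k
  proof -
    note [simp] = that(1,2)
    have [simp]: "k \<in> Ar D" "Dom D k = fo F x" "Cod D k = fo F y" using that by (auto simp: Hom_def)
    \<comment> \<open>Naturality of the unit leaves no other candidate for a preimage of
      \<open>k\<close>.\<close>
    define f where "f = inv_arr C (\<eta> y) \<cdot>\<^bsub>C\<^esub> fa G k \<cdot>\<^bsub>C\<^esub> \<eta> x"
    have f [simp]: "f \<in> Ar C" "Dom C f = x" "Cod C f = y" by (simp_all add: f_def)
    have "fa G (fa F f) \<cdot>\<^bsub>C\<^esub> \<eta> x = \<eta> y \<cdot>\<^bsub>C\<^esub> f" using nat_trans_natural[OF \<eta>n, of f] by simp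
    also have "\<dots> = fa G k \<cdot>\<^bsub>C\<^esub> \<eta> x" by (simp add: f_def)
    finally have "fa G (fa F f) = fa G k"
      by (rule C.iso_cancel_right[OF \<eta>i[OF that(1)], rotated -1]) simp_all
    then have "fa F f = k" by (intro Gfaith[of _ "fo F x" "fo F y"]) (simp_all add: Hom_def)
    then show ?thesis by (intro bexI[of _ f]) (simp_all add: Hom_def)
  qed
  show "\<exists>x\<in>Ob C. \<exists>k. is_iso D (fo F x) z k" if "z \<in> Ob D" for z
    using that by (intro bexI[of _ "fo G z"] exI[of _ "\<epsilon> z"]) (simp_all add: is_iso_iff)
qed

text \<open>The axiom of choice selects an object over every \<open>z\<close>, an isomorphism
  \<open>\<epsilon> z\<close>, and a lift \<open>l x y k\<close> of every arrow. Since
  \<open>F\<close> is faithful, all equations for the inverse functor may be checked after applying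
  \<open>F\<close>.\<close>

lemma equivalenceI:
  fixes F :: "('o1, 'a1, 'o2, 'a2, 'w) fct_scheme"
  assumes "category C" "category D" "is_functor C D F"
    and faithful: "\<And>x y f f'. f \<in> Hom C x y \<Longrightarrow> f' \<in> Hom C x y \<Longrightarrow> fa F f = fa F f' \<Longrightarrow> f = f'"
    and full: "\<And>x y k. x \<in> Ob C \<Longrightarrow> y \<in> Ob C \<Longrightarrow> k \<in> Hom D (fo F x) (fo F y) \<Longrightarrow> \<exists>f\<in>Hom C x y. fa F f = k"
    and es: "\<And>z. z \<in> Ob D \<Longrightarrow> \<exists>x\<in>Ob C. \<exists>k. is_iso D (fo F x) z k"
  shows "is_equivalence C D F"
proof -
  interpret C: category C by fact
  interpret D: category D by fact
  note F = assms(3)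
  note [simp] = functor_simps[OF F]
  obtain g \<epsilon> where g: "\<And>z. z \<in> Ob D \<Longrightarrow> g z \<in> Ob C \<and> is_iso D (fo F (g z)) z (\<epsilon> z)"
    using es by metis
  have [simp]: "g z \<in> Ob C" "iso_arr D (\<epsilon> z)" "Dom D (\<epsilon> z) = fo F (g z)" "Cod D (\<epsilon> z) = z"
    if "z \<in> Ob D" for z using g[OF that] by (auto simp: is_iso_iff)
  obtain l where l: "\<And>x y k. x \<in> Ob C \<Longrightarrow> y \<in> Ob C \<Longrightarrow> k \<in> Hom D (fo F x) (fo F y) \<Longrightarrow>
      l x y k \<in> Hom C x y \<and> fa F (l x y k) = k"
    using full by metis
  have [simp]: "l x y k \<in> Ar C" "Dom C (l x y k) = x" "Cod C (l x y k) = y" "fa F (l x y k) = k"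
    if "x \<in> Ob C" "y \<in> Ob C" "k \<in> Ar D" "Dom D k = fo F x" "Cod D k = fo F y" for x y k
    using l[of x y k] that by (auto simp: Hom_def)
  have eqI: "f = f'" if "f \<in> Ar C" "f' \<in> Ar C" "Dom C f = Dom C f'" "Cod C f = Cod C f'" "fa F f = fa F f'"
    for f f' using faithful[of f "Dom C f" "Cod C f" f'] that by (simp add: Hom_def)
  \<comment> \<open>An arrow \<open>k\<close> is moved between the chosen objects by conjugation
    with \<open>\<epsilon>\<close> and then lifted along \<open>F\<close>.\<close>
  define G where "G = \<lparr>fo = g, fa = \<lambda>k. l (g (Dom D k)) (g (Cod D k))
    (inv_arr D (\<epsilon> (Cod D k)) \<cdot>\<^bsub>D\<^esub> k \<cdot>\<^bsub>D\<^esub> \<epsilon> (Dom D k))\<rparr>"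
  have fG [simp]: "fo G z = g z" for z by (simp add: G_def)
  have aG [simp]: "fa G k \<in> Ar C" "Dom C (fa G k) = g (Dom D k)" "Cod C (fa G k) = g (Cod D k)"
    and FaG [simp]: "fa F (fa G k) = inv_arr D (\<epsilon> (Cod D k)) \<cdot>\<^bsub>D\<^esub> k \<cdot>\<^bsub>D\<^esub> \<epsilon> (Dom D k)"
    if "k \<in> Ar D" for k using that by (simp_all add: G_def)
  have G: "is_functor D C G"
    by (rule functorI) (auto intro!: eqI simp: D.assoc)
  define \<eta> where "\<eta> x = l x (g (fo F x)) (inv_arr D (\<epsilon> (fo F x)))" for x
  have [simp]: "\<eta> x \<in> Ar C" "Dom C (\<eta> x) = x" "Cod C (\<eta> x) = g (fo F x)"
    "fa F (\<eta> x) = inv_arr D (\<epsilon> (fo F x))" if "x \<in> Ob C" for x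
    using that by (simp_all add: \<eta>_def)
  have \<eta>iso: "iso_arr C (\<eta> x)" if "x \<in> Ob C" for x
    by (rule C.iso_arrI[where g = "l (g (fo F x)) x (\<epsilon> (fo F x))"]) (use that in \<open>auto intro!: eqI\<close>)
  have "nat_iso C C id_fct (comp_fct G F) \<eta>"
    unfolding nat_iso_def by (auto simp: is_iso_iff \<eta>iso intro!: nat_transI eqI simp: D.assoc)
  moreover have "nat_iso D D (comp_fct F G) id_fct \<epsilon>"
    unfolding nat_iso_def by (auto simp: is_iso_iff intro!: nat_transI)
  ultimately show ?thesis unfolding is_equivalence_def using F G by blast
qed

lemma category_prod_cat:
  assumes "category C" "category D"
  shows "category (prod_cat C D)"
proof -
  interpret C: category C by fact
  interpret D: category D by fact
  show ?thesis
    by unfold_locales (auto simp: prod_cat_def Hom_def C.assoc D.assoc)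
qed

text \<open>The parameter \<open>T\<close> covers plain and monoidal transformations alike. The laws
  hold pointwise in \<open>D\<close>, and extensionality of the families turns pointwise equality
  into equality of arrows.\<close>

lemma category_fun_cat:
  assumes "category D" and dc: "\<And>f. f \<in> Ar C \<Longrightarrow> Dom C f \<in> Ob C \<and> Cod C f \<in> Ob C"
    and S: "\<And>F. F \<in> S \<Longrightarrow> is_functor C D F"
    and T: "\<And>F G \<eta>. T F G \<eta> \<Longrightarrow> nat_trans C D F G \<eta>"
    and T_ide: "\<And>F. F \<in> S \<Longrightarrow> T F F (restrict (\<lambda>x. ide D (fo F x)) (Ob C))"
    and T_comp: "\<And>F G H \<eta> \<theta>. F \<in> S \<Longrightarrow> G \<in> S \<Longrightarrow> H \<in> S \<Longrightarrow> T F G \<eta> \<Longrightarrow> T G H \<theta> \<Longrightarrow>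
       T F H (restrict (\<lambda>x. \<theta> x \<cdot>\<^bsub>D\<^esub> \<eta> x) (Ob C))"
  shows "category (fun_cat C D S T)"
proof -
  interpret D: category D by fact
  have ext: "restrict f (Ob C) = \<eta>" if "\<eta> \<in> extensional (Ob C)" "\<And>x. x \<in> Ob C \<Longrightarrow> f x = \<eta> x" for f \<eta>
    using that by (auto simp: extensional_def fun_eq_iff)
  show ?thesis
  proof (unfold_locales, goal_cases)
    case 4 then show ?case by (auto simp: fun_cat_def Hom_def T_comp)
  next
    case (5 f x y)
    then show ?case
      by (auto simp: fun_cat_def Hom_def nat_trans_simps[OF T] functor_simps[OF S] intro!: ext)
  next
    case (6 f x y)
    then show ?case
      by (auto simp: fun_cat_def Hom_def nat_trans_simps[OF T] functor_simps[OF S] intro!: ext)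
  next
    case (7 f w x g y h z)
    then show ?case
      by (auto simp: fun_cat_def Hom_def nat_trans_simps[OF T] D.assoc intro!: restrict_ext)
  qed (auto simp: fun_cat_def Hom_def T_ide)
qed

section \<open>Symmetric monoidal categories\<close>

text \<open>The axioms of \<open>symmetric_monoidal_linear_category\<close> without the linear ones,
  so that the cartesian product \<open>prod_smcat\<close> is an instance as well.\<close>

locale sm_category = category C
  for C :: "('o, 'a, 'r, 'z) smcat_scheme" (structure) +
  assumes munit_ob: "munit C \<in> Ob C"
    and tob_ob: "x \<in> Ob C \<Longrightarrow> y \<in> Ob C \<Longrightarrow> x \<star> y \<in> Ob C"
    and tar_in_hom: "f \<in> Hom C x x' \<Longrightarrow> g \<in> Hom C y y' \<Longrightarrow> f \<diamondop> g \<in> Hom C (x \<star> y) (x' \<star> y')"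
    and tar_ide: "x \<in> Ob C \<Longrightarrow> y \<in> Ob C \<Longrightarrow> ide C x \<diamondop> ide C y = ide C (x \<star> y)"
    and tar_comp: "f \<in> Hom C x x' \<Longrightarrow> f' \<in> Hom C x' x'' \<Longrightarrow> g \<in> Hom C y y' \<Longrightarrow> g' \<in> Hom C y' y'' \<Longrightarrow>
      (f' \<cdot> f) \<diamondop> (g' \<cdot> g) = (f' \<diamondop> g') \<cdot> (f \<diamondop> g)"
    and massoc_iso: "x \<in> Ob C \<Longrightarrow> y \<in> Ob C \<Longrightarrow> z \<in> Ob C \<Longrightarrow>
      is_iso C ((x \<star> y) \<star> z) (x \<star> (y \<star> z)) (massoc C x y z)"
    and mlunit_iso: "x \<in> Ob C \<Longrightarrow> is_iso C (munit C \<star> x) x (mlunit C x)"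
    and mrunit_iso: "x \<in> Ob C \<Longrightarrow> is_iso C (x \<star> munit C) x (mrunit C x)"
    and msym_in_hom: "x \<in> Ob C \<Longrightarrow> y \<in> Ob C \<Longrightarrow> msym C x y \<in> Hom C (x \<star> y) (y \<star> x)"
    and massoc_natural: "f \<in> Hom C x x' \<Longrightarrow> g \<in> Hom C y y' \<Longrightarrow> h \<in> Hom C z z' \<Longrightarrow>
      massoc C x' y' z' \<cdot> ((f \<diamondop> g) \<diamondop> h) = (f \<diamondop> (g \<diamondop> h)) \<cdot> massoc C x y z"
    and mlunit_natural: "f \<in> Hom C x x' \<Longrightarrow>
      mlunit C x' \<cdot> (ide C (munit C) \<diamondop> f) = f \<cdot> mlunit C x"
    and mrunit_natural: "f \<in> Hom C x x' \<Longrightarrow>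
      mrunit C x' \<cdot> (f \<diamondop> ide C (munit C)) = f \<cdot> mrunit C x"
    and msym_natural: "f \<in> Hom C x x' \<Longrightarrow> g \<in> Hom C y y' \<Longrightarrow>
      msym C x' y' \<cdot> (f \<diamondop> g) = (g \<diamondop> f) \<cdot> msym C x y"
    and pentagon: "w \<in> Ob C \<Longrightarrow> x \<in> Ob C \<Longrightarrow> y \<in> Ob C \<Longrightarrow> z \<in> Ob C \<Longrightarrow>
      massoc C w x (y \<star> z) \<cdot> massoc C (w \<star> x) y z =
      (ide C w \<diamondop> massoc C x y z) \<cdot> massoc C w (x \<star> y) z \<cdot> (massoc C w x y \<diamondop> ide C z)"
    and triangle: "x \<in> Ob C \<Longrightarrow> y \<in> Ob C \<Longrightarrow>
      (ide C x \<diamondop> mlunit C y) \<cdot> massoc C x (munit C) y = mrunit C x \<diamondop> ide C y"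
    and msym_symmetric: "x \<in> Ob C \<Longrightarrow> y \<in> Ob C \<Longrightarrow> msym C y x \<cdot> msym C x y = ide C (x \<star> y)"
    and hexagon: "x \<in> Ob C \<Longrightarrow> y \<in> Ob C \<Longrightarrow> z \<in> Ob C \<Longrightarrow>
      massoc C y z x \<cdot> msym C x (y \<star> z) \<cdot> massoc C x y z =
      (ide C y \<diamondop> msym C x z) \<cdot> massoc C y x z \<cdot> (msym C x y \<diamondop> ide C z)"

lemma (in symmetric_monoidal_linear_category) sm_category: "sm_category C"
  by unfold_locales
    (rule munit_ob tob_ob tar_in_hom tar_ide tar_comp massoc_iso mlunit_iso mrunit_iso msym_in_hom
      massoc_natural mlunit_natural mrunit_natural msym_natural pentagon triangle msym_symmetric
      hexagon; assumption)+

context sm_category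
begin

declare munit_ob [simp] tob_ob [simp] tar_ide [simp]

lemma tar_typed [simp]:
  assumes "f \<in> Ar C" "g \<in> Ar C"
  shows "f \<diamondop> g \<in> Ar C" "Dom C (f \<diamondop> g) = Dom C f \<star> Dom C g" "Cod C (f \<diamondop> g) = Cod C f \<star> Cod C g"
  using tar_in_hom[of f "Dom C f" "Cod C f" g "Dom C g" "Cod C g"] assms by (auto simp: Hom_def)

text \<open>Interchange is oriented towards a single tensor product of composites; the second form
  works inside a right-nested composite.\<close>

lemma tar_merge:
  assumes "f \<in> Ar C" "g \<in> Ar C" "f' \<in> Ar C" "g' \<in> Ar C" "Dom C f' = Cod C f" "Dom C g' = Cod C g"
  shows "(f' \<diamondop> g') \<cdot> (f \<diamondop> g) = (f' \<cdot> f) \<diamondop> (g' \<cdot> g)"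
    and "h \<in> Ar C \<Longrightarrow> Cod C h = Dom C f \<star> Dom C g \<Longrightarrow>
      (f' \<diamondop> g') \<cdot> (f \<diamondop> g) \<cdot> h = ((f' \<cdot> f) \<diamondop> (g' \<cdot> g)) \<cdot> h"
proof -
  show *: "(f' \<diamondop> g') \<cdot> (f \<diamondop> g) = (f' \<cdot> f) \<diamondop> (g' \<cdot> g)"
    using tar_comp[of f "Dom C f" "Cod C f" f' "Cod C f'" g "Dom C g" "Cod C g" g' "Cod C g'"] assms
    by (simp add: Hom_def)
  show "h \<in> Ar C \<Longrightarrow> Cod C h = Dom C f \<star> Dom C g \<Longrightarrow>
      (f' \<diamondop> g') \<cdot> (f \<diamondop> g) \<cdot> h = ((f' \<cdot> f) \<diamondop> (g' \<cdot> g)) \<cdot> h"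
    using assms by (intro reassoc[OF *]) auto
qed

lemma iso_tar [simp]:
  assumes "iso_arr C f" "iso_arr C g" shows "iso_arr C (f \<diamondop> g)"
  by (rule iso_arrI[where g = "inv_arr C f \<diamondop> inv_arr C g"]) (use assms in \<open>simp_all add: tar_merge\<close>)

lemma inv_tar [simp]:
  assumes "iso_arr C f" "iso_arr C g" shows "inv_arr C (f \<diamondop> g) = inv_arr C f \<diamondop> inv_arr C g"
  by (rule inv_eqI) (use assms in \<open>simp_all add: tar_merge\<close>)

lemma massoc_typed [simp]:
  assumes "x \<in> Ob C" "y \<in> Ob C" "z \<in> Ob C"
  shows "iso_arr C (massoc C x y z)" "massoc C x y z \<in> Ar C"
    "Dom C (massoc C x y z) = (x \<star> y) \<star> z" "Cod C (massoc C x y z) = x \<star> (y \<star> z)"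
  using massoc_iso[OF assms] by (auto simp: is_iso_iff)

lemma mlunit_typed [simp]:
  assumes "x \<in> Ob C"
  shows "iso_arr C (mlunit C x)" "mlunit C x \<in> Ar C" "Dom C (mlunit C x) = munit C \<star> x" "Cod C (mlunit C x) = x"
  using mlunit_iso[OF assms] by (auto simp: is_iso_iff)

lemma mrunit_typed [simp]:
  assumes "x \<in> Ob C"
  shows "iso_arr C (mrunit C x)" "mrunit C x \<in> Ar C" "Dom C (mrunit C x) = x \<star> munit C" "Cod C (mrunit C x) = x"
  using mrunit_iso[OF assms] by (auto simp: is_iso_iff)

lemma msym_typed [simp]:
  assumes "x \<in> Ob C" "y \<in> Ob C"
  shows "iso_arr C (msym C x y)" "msym C x y \<in> Ar C" "Dom C (msym C x y) = x \<star> y" "Cod C (msym C x y) = y \<star> x"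
proof -
  show *: "msym C x y \<in> Ar C" "Dom C (msym C x y) = x \<star> y" "Cod C (msym C x y) = y \<star> x"
    using msym_in_hom[OF assms] by (auto simp: Hom_def)
  show "iso_arr C (msym C x y)"
    using msym_in_hom[OF assms(2,1)] * assms msym_symmetric
    by (intro iso_arrI[where g = "msym C y x"]) (auto simp: Hom_def)
qed

lemma inv_msym [simp]: "x \<in> Ob C \<Longrightarrow> y \<in> Ob C \<Longrightarrow> inv_arr C (msym C x y) = msym C y x"
  by (rule inv_eqI) (simp_all add: msym_symmetric)

lemma massoc_nat:
  "f \<in> Ar C \<Longrightarrow> g \<in> Ar C \<Longrightarrow> h \<in> Ar C \<Longrightarrow> Cod C f = x' \<Longrightarrow> Cod C g = y' \<Longrightarrow> Cod C h = z' \<Longrightarrow>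
    massoc C x' y' z' \<cdot> ((f \<diamondop> g) \<diamondop> h) = (f \<diamondop> (g \<diamondop> h)) \<cdot> massoc C (Dom C f) (Dom C g) (Dom C h)"
  using massoc_natural[of f "Dom C f" x' g "Dom C g" y' h "Dom C h" z'] by (simp add: Hom_def)

lemma mlunit_nat: "f \<in> Ar C \<Longrightarrow> Cod C f = x \<Longrightarrow>
    mlunit C x \<cdot> (ide C (munit C) \<diamondop> f) = f \<cdot> mlunit C (Dom C f)"
  using mlunit_natural[of f "Dom C f" x] by (simp add: Hom_def)

lemma mrunit_nat: "f \<in> Ar C \<Longrightarrow> Cod C f = x \<Longrightarrow>
    mrunit C x \<cdot> (f \<diamondop> ide C (munit C)) = f \<cdot> mrunit C (Dom C f)"
  using mrunit_natural[of f "Dom C f" x] by (simp add: Hom_def)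

lemma msym_nat: "f \<in> Ar C \<Longrightarrow> g \<in> Ar C \<Longrightarrow> Cod C f = x \<Longrightarrow> Cod C g = y \<Longrightarrow>
    msym C x y \<cdot> (f \<diamondop> g) = (g \<diamondop> f) \<cdot> msym C (Dom C f) (Dom C g)"
  using msym_natural[of f "Dom C f" x g "Dom C g" y] by (simp add: Hom_def)

text \<open>Naturality of the left unitor recovers \<open>f\<close> from its tensor product with the
  identity of the unit.\<close>

lemma unit_tensor_faithful:
  assumes "f \<in> Ar C" "g \<in> Ar C" "Dom C f = Dom C g" "Cod C f = Cod C g"
    and "ide C (munit C) \<diamondop> f = ide C (munit C) \<diamondop> g"
  shows "f = g"
proof -
  have "f \<cdot> mlunit C (Dom C f) = g \<cdot> mlunit C (Dom C f)"
    using mlunit_nat[of f "Cod C f"] mlunit_nat[of g "Cod C f"] assms by simp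
  then show ?thesis by (rule iso_cancel_right[rotated -1]) (use assms in simp_all)
qed

lemma tensor_unit_faithful:
  assumes "f \<in> Ar C" "g \<in> Ar C" "Dom C f = Dom C g" "Cod C f = Cod C g"
    and "f \<diamondop> ide C (munit C) = g \<diamondop> ide C (munit C)"
  shows "f = g"
proof -
  have "f \<cdot> mrunit C (Dom C f) = g \<cdot> mrunit C (Dom C f)"
    using mrunit_nat[of f "Cod C f"] mrunit_nat[of g "Cod C f"] assms by simp
  then show ?thesis by (rule iso_cancel_right[rotated -1]) (use assms in simp_all)
qed

text \<open>Kelly's derivation of this unit law from pentagon and triangle. Tensoring with the unit
  is faithful, and after it the claim is one face of the pentagon for \<open>I, I, x, y\<close>,
  whose other faces are triangles and naturality squares.\<close>

lemma mlunit_tensor: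
  assumes [simp]: "x \<in> Ob C" "y \<in> Ob C"
  shows "mlunit C (x \<star> y) \<cdot> massoc C (munit C) x y = mlunit C x \<diamondop> ide C y"
proof (rule unit_tensor_faithful)
  let ?I = "munit C"
  \<comment> \<open>The other two factors on the three-edge side of the pentagon; being invertible,
    they are cancelled at the end.\<close>
  let ?u = "massoc C ?I (?I \<star> x) y \<cdot> (massoc C ?I ?I x \<diamondop> ide C y)"
  have "(ide C ?I \<diamondop> (mlunit C (x \<star> y) \<cdot> massoc C ?I x y)) \<cdot> ?u
      = (ide C ?I \<diamondop> mlunit C (x \<star> y)) \<cdot> (ide C ?I \<diamondop> massoc C ?I x y) \<cdot> ?u"
    by (simp add: tar_merge)
  also have "\<dots> = (ide C ?I \<diamondop> mlunit C (x \<star> y)) \<cdot> massoc C ?I ?I (x \<star> y) \<cdot> massoc C (?I \<star> ?I) x y"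
    by (simp add: pentagon)
  also have "\<dots> = (mrunit C ?I \<diamondop> ide C (x \<star> y)) \<cdot> massoc C (?I \<star> ?I) x y"
    by (intro reassoc triangle) simp_all
  also have "\<dots> = massoc C ?I x y \<cdot> ((mrunit C ?I \<diamondop> ide C x) \<diamondop> ide C y)"
    by (simp add: massoc_nat)
  also have "\<dots> = massoc C ?I x y \<cdot> ((ide C ?I \<diamondop> mlunit C x) \<diamondop> ide C y) \<cdot> (massoc C ?I ?I x \<diamondop> ide C y)"
    by (simp add: tar_merge triangle)
  also have "\<dots> = ((ide C ?I \<diamondop> (mlunit C x \<diamondop> ide C y)) \<cdot> massoc C ?I (?I \<star> x) y) \<cdot> (massoc C ?I ?I x \<diamondop> ide C y)"
    by (intro reassoc) (simp_all add: massoc_nat)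
  also have "\<dots> = (ide C ?I \<diamondop> (mlunit C x \<diamondop> ide C y)) \<cdot> ?u"
    by (simp add: assoc)
  finally show "ide C ?I \<diamondop> (mlunit C (x \<star> y) \<cdot> massoc C ?I x y) = ide C ?I \<diamondop> (mlunit C x \<diamondop> ide C y)"
    by (rule iso_cancel_right[rotated -1]) simp_all
qed simp_all

end

section \<open>Coherence through the regular representation\<close>

text \<open>Bracketed words are kept as syntax because the action below must see a formal unit:
  \<open>Unit\<close> and \<open>Leaf (munit C)\<close> evaluate to the same object, but only
  \<open>Unit\<close> disappears under \<open>nest\<close>.\<close>

datatype 'o mtree = Leaf 'o | Unit | Node "'o mtree" "'o mtree"

context sm_category
begin

primrec ev :: "'o mtree \<Rightarrow> 'o" where
  "ev (Leaf x) = x"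
| "ev Unit = munit C"
| "ev (Node X Y) = ev X \<star> ev Y"

primrec nest :: "'o mtree \<Rightarrow> 'o \<Rightarrow> 'o" where
  "nest (Leaf x) t = x \<star> t"
| "nest Unit t = t"
| "nest (Node X Y) t = nest X (nest Y t)"

primrec nest_arr :: "'o mtree \<Rightarrow> 'a \<Rightarrow> 'a" where
  "nest_arr (Leaf x) h = ide C x \<diamondop> h"
| "nest_arr Unit h = h"
| "nest_arr (Node X Y) h = nest_arr X (nest_arr Y h)"

text \<open>The canonical rebracketing \<open>ev X \<star> t \<rightarrow> nest X t\<close>,
  assembled from associators and left unitors.\<close>

primrec flat :: "'o mtree \<Rightarrow> 'o \<Rightarrow> 'a" where
  "flat (Leaf x) t = ide C (x \<star> t)"
| "flat Unit t = mlunit C t"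
| "flat (Node X Y) t = flat X (nest Y t) \<cdot> (ide C (ev X) \<diamondop> flat Y t) \<cdot> massoc C (ev X) (ev Y) t"

definition tree :: "'o mtree \<Rightarrow> bool" where
  "tree X \<longleftrightarrow> set_mtree X \<subseteq> Ob C"

lemma tree_simps [simp]:
  "tree (Leaf x) \<longleftrightarrow> x \<in> Ob C" "tree Unit" "tree (Node X Y) \<longleftrightarrow> tree X \<and> tree Y"
  by (auto simp: tree_def)

lemma ev_Ob [simp]: "tree X \<Longrightarrow> ev X \<in> Ob C"
  by (induction X) auto

lemma nest_Ob [simp]: "tree X \<Longrightarrow> t \<in> Ob C \<Longrightarrow> nest X t \<in> Ob C"
  by (induction X arbitrary: t) auto

lemma nest_arr_typed [simp]:
  "tree X \<Longrightarrow> h \<in> Ar C \<Longrightarrow>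
    nest_arr X h \<in> Ar C \<and> Dom C (nest_arr X h) = nest X (Dom C h) \<and> Cod C (nest_arr X h) = nest X (Cod C h)"
  by (induction X arbitrary: h) auto

lemma nest_arr_ide [simp]: "tree X \<Longrightarrow> t \<in> Ob C \<Longrightarrow> nest_arr X (ide C t) = ide C (nest X t)"
  by (induction X arbitrary: t) auto

lemma nest_arr_comp:
  "tree X \<Longrightarrow> f \<in> Ar C \<Longrightarrow> g \<in> Ar C \<Longrightarrow> Dom C g = Cod C f \<Longrightarrow>
    nest_arr X (g \<cdot> f) = nest_arr X g \<cdot> nest_arr X f"
  by (induction X arbitrary: f g) (auto simp: tar_merge)

lemma flat_typed [simp]:
  "tree X \<Longrightarrow> t \<in> Ob C \<Longrightarrow> iso_arr C (flat X t) \<and> flat X t \<in> Ar C \<and> Dom C (flat X t) = ev X \<star> t \<and> Cod C (flat X t) = nest X t"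
  by (induction X arbitrary: t) auto

lemma flat_natural:
  "tree X \<Longrightarrow> h \<in> Ar C \<Longrightarrow> nest_arr X h \<cdot> flat X (Dom C h) = flat X (Cod C h) \<cdot> (ide C (ev X) \<diamondop> h)"
proof (induction X arbitrary: h)
  case (Node X Y)
  then have [simp]: "tree X" "tree Y" "h \<in> Ar C" by auto
  let ?s = "Dom C h" and ?t = "Cod C h" and ?h = "nest_arr Y h"
  have "nest_arr X ?h \<cdot> flat X (nest Y ?s) \<cdot> (ide C (ev X) \<diamondop> flat Y ?s) \<cdot> massoc C (ev X) (ev Y) ?s
      = (flat X (nest Y ?t) \<cdot> (ide C (ev X) \<diamondop> ?h)) \<cdot> (ide C (ev X) \<diamondop> flat Y ?s) \<cdot> massoc C (ev X) (ev Y) ?s"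
    using Node.IH(1)[of ?h] by (intro reassoc) simp_all
  also have "\<dots> = flat X (nest Y ?t) \<cdot> (ide C (ev X) \<diamondop> (flat Y ?t \<cdot> (ide C (ev Y) \<diamondop> h))) \<cdot> massoc C (ev X) (ev Y) ?s"
    using Node.IH(2)[of h] by (simp add: assoc tar_merge)
  also have "\<dots> = flat X (nest Y ?t) \<cdot> (ide C (ev X) \<diamondop> flat Y ?t) \<cdot> (ide C (ev X) \<diamondop> (ide C (ev Y) \<diamondop> h)) \<cdot> massoc C (ev X) (ev Y) ?s"
    by (simp add: tar_merge)
  also have "(ide C (ev X) \<diamondop> (ide C (ev Y) \<diamondop> h)) \<cdot> massoc C (ev X) (ev Y) ?s
      = massoc C (ev X) (ev Y) ?t \<cdot> (ide C (ev X \<star> ev Y) \<diamondop> h)"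
    using massoc_nat[of "ide C (ev X)" "ide C (ev Y)" h "ev X" "ev Y" ?t] by simp
  finally show ?case by (simp add: assoc)
qed (auto simp: mlunit_nat)

text \<open>
  Acting on \<open>t\<close> by \<open>x \<mapsto> x \<star> t\<close> turns an arrow \<open>ev X \<rightarrow> ev Y\<close> into a natural family \<open>nest X t \<rightarrow> nest Y t\<close>
  between right-nested products, in which associators and unit constraints become identities.
  The representation is faithful, so diagrams may be checked on these families.
\<close>

definition rep :: "'o mtree \<Rightarrow> 'o mtree \<Rightarrow> 'a \<Rightarrow> ('o \<Rightarrow> 'a) \<Rightarrow> bool" where
  "rep X Y f \<phi> \<longleftrightarrow> tree X \<and> tree Y \<and> f \<in> Hom C (ev X) (ev Y) \<and>
    (\<forall>t\<in>Ob C. \<phi> t \<in> Hom C (nest X t) (nest Y t) \<and> \<phi> t \<cdot> flat X t = flat Y t \<cdot> (f \<diamondop> ide C t))"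

lemma repD:
  assumes "rep X Y f \<phi>"
  shows "tree X" "tree Y" "f \<in> Ar C" "Dom C f = ev X" "Cod C f = ev Y"
    and "t \<in> Ob C \<Longrightarrow> \<phi> t \<in> Ar C" "t \<in> Ob C \<Longrightarrow> Dom C (\<phi> t) = nest X t" "t \<in> Ob C \<Longrightarrow> Cod C (\<phi> t) = nest Y t"
    and "t \<in> Ob C \<Longrightarrow> \<phi> t \<cdot> flat X t = flat Y t \<cdot> (f \<diamondop> ide C t)"
  using assms by (auto simp: rep_def Hom_def)

lemma repI:
  assumes "tree X" "tree Y" "f \<in> Ar C" "Dom C f = ev X" "Cod C f = ev Y"
    and "\<And>t. t \<in> Ob C \<Longrightarrow> \<phi> t \<in> Ar C \<and> Dom C (\<phi> t) = nest X t \<and> Cod C (\<phi> t) = nest Y t"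
    and "\<And>t. t \<in> Ob C \<Longrightarrow> \<phi> t \<cdot> flat X t = flat Y t \<cdot> (f \<diamondop> ide C t)"
  shows "rep X Y f \<phi>"
  using assms by (auto simp: rep_def Hom_def)

text \<open>The value at the unit object suffices: \<open>flat\<close> cancels there, and tensoring
  with the unit is faithful.\<close>

lemma rep_faithful:
  assumes f: "rep X Y f \<phi>" and g: "rep X Y g \<psi>" and eq: "\<And>t. t \<in> Ob C \<Longrightarrow> \<phi> t = \<psi> t"
  shows "f = g"
proof -
  note [simp] = repD(1-8)[OF f] repD(3-8)[OF g]
  have "flat Y (munit C) \<cdot> (f \<diamondop> ide C (munit C)) = flat Y (munit C) \<cdot> (g \<diamondop> ide C (munit C))"
    using repD(9)[OF f, of "munit C"] repD(9)[OF g, of "munit C"] eq[of "munit C"] by simp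
  then have "f \<diamondop> ide C (munit C) = g \<diamondop> ide C (munit C)"
    by (rule iso_cancel_left[rotated -1]) simp_all
  then show ?thesis by (rule tensor_unit_faithful[rotated -1]) simp_all
qed

lemma rep_unique:
  assumes f: "rep X Y f \<phi>" and g: "rep X Y f \<psi>" and [simp]: "t \<in> Ob C"
  shows "\<phi> t = \<psi> t"
proof -
  note [simp] = repD(1-8)[OF f] repD(3-8)[OF g]
  have "\<phi> t \<cdot> flat X t = \<psi> t \<cdot> flat X t"
    using repD(9)[OF f, of t] repD(9)[OF g, of t] by simp
  then show ?thesis by (rule iso_cancel_right[rotated -1]) simp_all
qed

lemma rep_exists:
  assumes "tree X" "tree Y" "f \<in> Ar C" "Dom C f = ev X" "Cod C f = ev Y"
  shows "rep X Y f (\<lambda>t. flat Y t \<cdot> (f \<diamondop> ide C t) \<cdot> inv_arr C (flat X t))"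
  by (rule repI) (use assms in \<open>simp_all add: assoc\<close>)

text \<open>Naturality in the spectator \<open>t\<close>. In the coherence identities below, this is
  what lets two independent symmetries pass each other.\<close>

lemma rep_natural:
  assumes f: "rep X Y f \<phi>" and [simp]: "h \<in> Ar C"
  shows "\<phi> (Cod C h) \<cdot> nest_arr X h = nest_arr Y h \<cdot> \<phi> (Dom C h)"
proof -
  note [simp] = repD(1-8)[OF f]
  let ?s = "Dom C h" and ?t = "Cod C h"
  have "(\<phi> ?t \<cdot> nest_arr X h) \<cdot> flat X ?s = \<phi> ?t \<cdot> flat X ?t \<cdot> (ide C (ev X) \<diamondop> h)"
    using flat_natural[of X h] by (simp add: assoc)
  also have "\<dots> = (flat Y ?t \<cdot> (f \<diamondop> ide C ?t)) \<cdot> (ide C (ev X) \<diamondop> h)"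
    by (intro reassoc repD(9)[OF f]) simp_all
  also have "\<dots> = flat Y ?t \<cdot> (ide C (ev Y) \<diamondop> h) \<cdot> (f \<diamondop> ide C ?s)"
    by (simp add: assoc tar_merge)
  also have "\<dots> = (nest_arr Y h \<cdot> flat Y ?s) \<cdot> (f \<diamondop> ide C ?s)"
    using flat_natural[of Y h] by (intro reassoc) simp_all
  also have "\<dots> = (nest_arr Y h \<cdot> \<phi> ?s) \<cdot> flat X ?s"
    using repD(9)[OF f, of ?s] by (simp add: assoc)
  finally show ?thesis by (rule iso_cancel_right[rotated -1]) simp_all
qed

lemma rep_ide: "tree X \<Longrightarrow> rep X X (ide C (ev X)) (\<lambda>t. ide C (nest X t))"
  by (rule repI) simp_all

lemma rep_comp:
  assumes f: "rep X Y f \<phi>" and g: "rep Y Z g \<psi>"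
  shows "rep X Z (g \<cdot> f) (\<lambda>t. \<psi> t \<cdot> \<phi> t)"
proof -
  note [simp] = repD(1-8)[OF f] repD(2-8)[OF g]
  show ?thesis
  proof (rule repI)
    fix t assume [simp]: "t \<in> Ob C"
    have "(\<psi> t \<cdot> \<phi> t) \<cdot> flat X t = \<psi> t \<cdot> flat Y t \<cdot> (f \<diamondop> ide C t)"
      by (simp add: assoc repD(9)[OF f])
    also have "\<dots> = (flat Z t \<cdot> (g \<diamondop> ide C t)) \<cdot> (f \<diamondop> ide C t)"
      by (intro reassoc repD(9)[OF g]) simp_all
    also have "\<dots> = flat Z t \<cdot> ((g \<cdot> f) \<diamondop> ide C t)" by (simp add: assoc tar_merge)
    finally show "(\<psi> t \<cdot> \<phi> t) \<cdot> flat X t = flat Z t \<cdot> ((g \<cdot> f) \<diamondop> ide C t)" .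
  qed simp_all
qed

text \<open>\<open>Node X Y\<close> acts by \<open>Y\<close> first and then by \<open>X\<close>;
  hence \<open>f\<close> acts on \<open>nest Y t\<close>, and \<open>g\<close> acts underneath
  \<open>X'\<close>.\<close>

lemma rep_tensor:
  assumes f: "rep X X' f \<phi>" and g: "rep Y Y' g \<psi>"
  shows "rep (Node X Y) (Node X' Y') (f \<diamondop> g) (\<lambda>t. nest_arr X' (\<psi> t) \<cdot> \<phi> (nest Y t))"
proof -
  note [simp] = repD(1-8)[OF f] repD(1-8)[OF g]
  show ?thesis
  proof (rule repI)
    fix t assume [simp]: "t \<in> Ob C"
    let ?s = "nest Y t" and ?s' = "nest Y' t" and ?\<alpha> = "massoc C (ev X) (ev Y) t"
    have "(nest_arr X' (\<psi> t) \<cdot> \<phi> ?s) \<cdot> flat (Node X Y) t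
        = nest_arr X' (\<psi> t) \<cdot> \<phi> ?s \<cdot> flat X ?s \<cdot> (ide C (ev X) \<diamondop> flat Y t) \<cdot> ?\<alpha>"
      by (simp add: assoc)
    also have "\<phi> ?s \<cdot> flat X ?s \<cdot> (ide C (ev X) \<diamondop> flat Y t) \<cdot> ?\<alpha>
        = (flat X' ?s \<cdot> (f \<diamondop> ide C ?s)) \<cdot> (ide C (ev X) \<diamondop> flat Y t) \<cdot> ?\<alpha>"
      by (intro reassoc repD(9)[OF f]) simp_all
    also have "\<dots> = flat X' ?s \<cdot> (f \<diamondop> flat Y t) \<cdot> ?\<alpha>" by (simp add: assoc tar_merge)
    also have "nest_arr X' (\<psi> t) \<cdot> \<dots> = (flat X' ?s' \<cdot> (ide C (ev X') \<diamondop> \<psi> t)) \<cdot> (f \<diamondop> flat Y t) \<cdot> ?\<alpha>"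
      using flat_natural[of X' "\<psi> t"] by (intro reassoc) simp_all
    also have "\<dots> = flat X' ?s' \<cdot> (f \<diamondop> (flat Y' t \<cdot> (g \<diamondop> ide C t))) \<cdot> ?\<alpha>"
      by (simp add: assoc tar_merge repD(9)[OF g])
    also have "\<dots> = flat X' ?s' \<cdot> (ide C (ev X') \<diamondop> flat Y' t) \<cdot> (f \<diamondop> (g \<diamondop> ide C t)) \<cdot> ?\<alpha>"
      by (simp add: tar_merge)
    also have "\<dots> = flat (Node X' Y') t \<cdot> ((f \<diamondop> g) \<diamondop> ide C t)"
      using massoc_nat[of f g "ide C t"] by (simp add: assoc)
    finally show "(nest_arr X' (\<psi> t) \<cdot> \<phi> ?s) \<cdot> flat (Node X Y) t = flat (Node X' Y') t \<cdot> ((f \<diamondop> g) \<diamondop> ide C t)" .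
  qed simp_all
qed

text \<open>The pentagon in disguise: the two flattenings differ exactly by the associator, which
  therefore acts as an identity.\<close>

lemma rep_massoc:
  assumes [simp]: "tree X" "tree Y" "tree Z"
  shows "rep (Node (Node X Y) Z) (Node X (Node Y Z)) (massoc C (ev X) (ev Y) (ev Z))
    (\<lambda>t. ide C (nest X (nest Y (nest Z t))))"
proof (rule repI)
  fix t assume [simp]: "t \<in> Ob C"
  let ?x = "ev X" and ?y = "ev Y" and ?z = "ev Z" and ?s = "nest Z t"
  have "flat (Node (Node X Y) Z) t = flat X (nest Y ?s) \<cdot> (ide C ?x \<diamondop> flat Y ?s) \<cdot> massoc C ?x ?y ?s \<cdot>
      (ide C (?x \<star> ?y) \<diamondop> flat Z t) \<cdot> massoc C (?x \<star> ?y) ?z t"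
    by (simp add: assoc)
  also have "massoc C ?x ?y ?s \<cdot> (ide C (?x \<star> ?y) \<diamondop> flat Z t) \<cdot> massoc C (?x \<star> ?y) ?z t =
      ((ide C ?x \<diamondop> (ide C ?y \<diamondop> flat Z t)) \<cdot> massoc C ?x ?y (?z \<star> t)) \<cdot> massoc C (?x \<star> ?y) ?z t"
    using massoc_nat[of "ide C ?x" "ide C ?y" "flat Z t" ?x ?y ?s] by (intro reassoc) simp_all
  also have "\<dots> = (ide C ?x \<diamondop> (ide C ?y \<diamondop> flat Z t)) \<cdot> (ide C ?x \<diamondop> massoc C ?y ?z t) \<cdot>
      massoc C ?x (?y \<star> ?z) t \<cdot> (massoc C ?x ?y ?z \<diamondop> ide C t)"
    by (simp add: assoc pentagon)
  also have "flat X (nest Y ?s) \<cdot> (ide C ?x \<diamondop> flat Y ?s) \<cdot> \<dots> =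
     flat (Node X (Node Y Z)) t \<cdot> (massoc C ?x ?y ?z \<diamondop> ide C t)"
    by (simp add: assoc tar_merge)
  finally show "ide C (nest X (nest Y (nest Z t))) \<cdot> flat (Node (Node X Y) Z) t =
     flat (Node X (Node Y Z)) t \<cdot> (massoc C ?x ?y ?z \<diamondop> ide C t)" by simp
qed simp_all

text \<open>This is where the derived law \<open>mlunit_tensor\<close> enters; the right unitor
  below needs only the triangle axiom.\<close>

lemma rep_mlunit:
  assumes [simp]: "tree X"
  shows "rep (Node Unit X) X (mlunit C (ev X)) (\<lambda>t. ide C (nest X t))"
proof (rule repI)
  fix t assume [simp]: "t \<in> Ob C"
  have "flat (Node Unit X) t = mlunit C (nest X t) \<cdot> (ide C (munit C) \<diamondop> flat X t) \<cdot> massoc C (munit C) (ev X) t"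
    by simp
  also have "\<dots> = (flat X t \<cdot> mlunit C (ev X \<star> t)) \<cdot> massoc C (munit C) (ev X) t"
    using mlunit_nat[of "flat X t"] by (intro reassoc) simp_all
  also have "\<dots> = flat X t \<cdot> (mlunit C (ev X) \<diamondop> ide C t)"
    by (simp add: assoc mlunit_tensor)
  finally show "ide C (nest X t) \<cdot> flat (Node Unit X) t = flat X t \<cdot> (mlunit C (ev X) \<diamondop> ide C t)" by simp
qed simp_all

lemma rep_mrunit:
  assumes [simp]: "tree X"
  shows "rep (Node X Unit) X (mrunit C (ev X)) (\<lambda>t. ide C (nest X t))"
  by (rule repI) (simp_all add: triangle)

text \<open>By uniqueness \<open>\<phi> t\<close> is \<open>f \<diamondop> ide C t\<close>
  conjugated by \<open>flat\<close>, hence invertible together with \<open>f\<close>.\<close>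

lemma rep_inv:
  assumes f: "rep X Y f \<phi>" and [simp]: "iso_arr C f"
  shows "rep Y X (inv_arr C f) (\<lambda>t. inv_arr C (\<phi> t))" "t \<in> Ob C \<Longrightarrow> iso_arr C (\<phi> t)"
proof -
  note [simp] = repD(1-8)[OF f]
  have \<phi>: "\<phi> t = flat Y t \<cdot> (f \<diamondop> ide C t) \<cdot> inv_arr C (flat X t)" if "t \<in> Ob C" for t
    by (rule rep_unique[OF f rep_exists that]) simp_all
  show [simp]: "t \<in> Ob C \<Longrightarrow> iso_arr C (\<phi> t)" for t by (simp add: \<phi>)
  show "rep Y X (inv_arr C f) (\<lambda>t. inv_arr C (\<phi> t))"
  proof (rule repI)
    fix t assume [simp]: "t \<in> Ob C"
    have "\<phi> t \<cdot> flat X t \<cdot> (inv_arr C f \<diamondop> ide C t) = (flat Y t \<cdot> (f \<diamondop> ide C t)) \<cdot> (inv_arr C f \<diamondop> ide C t)"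
      by (intro reassoc repD(9)[OF f]) simp_all
    also have "\<dots> = \<phi> t \<cdot> inv_arr C (\<phi> t) \<cdot> flat Y t" by (simp add: assoc tar_merge)
    finally show "inv_arr C (\<phi> t) \<cdot> flat Y t = flat X t \<cdot> (inv_arr C f \<diamondop> ide C t)"
      by (rule iso_cancel_left[OF _ _ _ _ _ sym, rotated -1]) simp_all
  qed simp_all
qed

lemma rep_cong:
  assumes "rep X Y f \<phi>" "\<And>t. t \<in> Ob C \<Longrightarrow> \<psi> t = \<phi> t"
  shows "rep X Y f \<psi>"
  using assms by (auto simp: rep_def)

lemma rep_massoc_inv:
  "tree X \<Longrightarrow> tree Y \<Longrightarrow> tree Z \<Longrightarrow>
    rep (Node X (Node Y Z)) (Node (Node X Y) Z) (inv_arr C (massoc C (ev X) (ev Y) (ev Z)))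
      (\<lambda>t. ide C (nest X (nest Y (nest Z t))))"
  by (rule rep_cong[OF rep_inv(1)[OF rep_massoc]]) simp_all

abbreviation rep_swap :: "'o mtree \<Rightarrow> 'o mtree \<Rightarrow> ('o \<Rightarrow> 'a) \<Rightarrow> bool" where
  "rep_swap X Y \<phi> \<equiv> rep (Node X Y) (Node Y X) (msym C (ev X) (ev Y)) \<phi>"

text \<open>The hexagon solved for the symmetry with a product. Its associators act as identities,
  so the two elementary exchanges are left.\<close>

lemma rep_swap_Node_right:
  assumes \<phi>: "rep_swap X Y \<phi>" and \<psi>: "rep_swap X Z \<psi>"
  shows "rep_swap X (Node Y Z) (\<lambda>t. nest_arr Y (\<psi> t) \<cdot> \<phi> (nest Z t))"
proof -
  note [simp] = repD(1-8)[OF \<phi>, simplified] repD(1-8)[OF \<psi>, simplified]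
  let ?x = "ev X" and ?y = "ev Y" and ?z = "ev Z"
  let ?r = "inv_arr C (massoc C ?y ?z ?x) \<cdot> (ide C ?y \<diamondop> msym C ?x ?z) \<cdot> massoc C ?y ?x ?z \<cdot>
    (msym C ?x ?y \<diamondop> ide C ?z) \<cdot> inv_arr C (massoc C ?x ?y ?z)"
  have "(massoc C ?y ?z ?x \<cdot> msym C ?x (?y \<star> ?z) \<cdot> massoc C ?x ?y ?z) \<cdot> inv_arr C (massoc C ?x ?y ?z) =
      ((ide C ?y \<diamondop> msym C ?x ?z) \<cdot> massoc C ?y ?x ?z \<cdot> (msym C ?x ?y \<diamondop> ide C ?z)) \<cdot>
      inv_arr C (massoc C ?x ?y ?z)"
    by (simp add: hexagon)
  then have "massoc C ?y ?z ?x \<cdot> msym C ?x (?y \<star> ?z) = massoc C ?y ?z ?x \<cdot> ?r"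
    by (simp add: assoc)
  then have eq: "msym C ?x (?y \<star> ?z) = ?r"
    by (rule iso_cancel_left[rotated -1]) simp_all
  have "rep (Node X (Node Y Z)) (Node (Node Y Z) X) ?r
     (\<lambda>t. (((ide C (nest Y (nest Z (nest X t))) \<cdot> (nest_arr Y (\<psi> t) \<cdot> ide C (nest Y (nest (Node X Z) t)))) \<cdot>
       ide C (nest Y (nest X (nest Z t)))) \<cdot>
       nest_arr (Node Y X) (ide C (nest Z t)) \<cdot> \<phi> (nest Z t)) \<cdot> ide C (nest X (nest Y (nest Z t))))"
    by (intro rep_cong[OF rep_comp[OF rep_comp[OF rep_comp[OF rep_comp[OF rep_massoc_inv
        rep_tensor[OF \<phi> rep_ide]] rep_massoc] rep_tensor[OF rep_ide \<psi>]] rep_massoc_inv]])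
      (simp_all add: assoc)
  then have "rep_swap X (Node Y Z)
     (\<lambda>t. (((ide C (nest Y (nest Z (nest X t))) \<cdot> (nest_arr Y (\<psi> t) \<cdot> ide C (nest Y (nest (Node X Z) t)))) \<cdot>
       ide C (nest Y (nest X (nest Z t)))) \<cdot>
       nest_arr (Node Y X) (ide C (nest Z t)) \<cdot> \<phi> (nest Z t)) \<cdot> ide C (nest X (nest Y (nest Z t))))"
    by (simp only: eq ev.simps)
  then show ?thesis by (rule rep_cong) simp
qed

text \<open>Obtained from \<open>rep_swap_Node_right\<close> for \<open>Z\<close> against
  \<open>X\<close> and \<open>Y\<close> by taking inverses, since the inverse of a symmetry is the
  opposite symmetry.\<close>

lemma rep_swap_Node_left:
  assumes \<phi>: "rep_swap X Z \<phi>" and \<psi>: "rep_swap Y Z \<psi>"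
  shows "rep_swap (Node X Y) Z (\<lambda>t. \<phi> (nest Y t) \<cdot> nest_arr X (\<psi> t))"
proof -
  note [simp] = repD(1-8)[OF \<phi>, simplified] repD(1-8)[OF \<psi>, simplified]
  have \<phi>i [simp]: "iso_arr C (\<phi> t)" and \<psi>i [simp]: "iso_arr C (\<psi> t)" if "t \<in> Ob C" for t
    using that by (auto intro!: rep_inv(2)[OF \<phi>] rep_inv(2)[OF \<psi>])
  have \<phi>': "rep_swap Z X (\<lambda>t. inv_arr C (\<phi> t))" and \<psi>': "rep_swap Z Y (\<lambda>t. inv_arr C (\<psi> t))"
    using rep_inv(1)[OF \<phi>] rep_inv(1)[OF \<psi>] by simp_all
  note r = rep_swap_Node_right[OF \<phi>' \<psi>']
  have inv: "inv_arr C (nest_arr X (inv_arr C (\<psi> t)) \<cdot> inv_arr C (\<phi> (nest Y t))) = \<phi> (nest Y t) \<cdot> nest_arr X (\<psi> t)"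
    if [simp]: "t \<in> Ob C" for t
  proof (rule inv_eqI)
    show "iso_arr C (nest_arr X (inv_arr C (\<psi> t)) \<cdot> inv_arr C (\<phi> (nest Y t)))"
      by (rule rep_inv(2)[OF r]) simp_all
    have "nest_arr X (\<psi> t) \<cdot> nest_arr X (inv_arr C (\<psi> t)) = ide C (nest X (nest Z (nest Y t)))"
      by (simp add: nest_arr_comp[symmetric])
    from reassoc[OF this, of "inv_arr C (\<phi> (nest Y t))"]
    show "(\<phi> (nest Y t) \<cdot> nest_arr X (\<psi> t)) \<cdot> nest_arr X (inv_arr C (\<psi> t)) \<cdot> inv_arr C (\<phi> (nest Y t)) =
      ide C (Dom C (nest_arr X (inv_arr C (\<psi> t)) \<cdot> inv_arr C (\<phi> (nest Y t))))"
      by (simp add: assoc)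
  qed simp_all
  show ?thesis
    using rep_cong[OF rep_inv(1)[OF r], of "\<lambda>t. \<phi> (nest Y t) \<cdot> nest_arr X (\<psi> t)"] by (simp add: inv)
qed

lemma rep_swap_Leaf:
  "a \<in> Ob C \<Longrightarrow> b \<in> Ob C \<Longrightarrow> rep_swap (Leaf a) (Leaf b)
    (\<lambda>t. massoc C b a t \<cdot> (msym C a b \<diamondop> ide C t) \<cdot> inv_arr C (massoc C a b t))"
  by (rule repI) (simp_all add: assoc)

text \<open>The action of \<open>msym X I\<close> is idempotent by the hexagon for \<open>X, I, I\<close>, hence an identity.\<close>

lemma rep_swap_Unit_right:
  assumes [simp]: "tree X"
  shows "rep_swap X Unit (\<lambda>t. ide C (nest X t))"
proof -
  let ?x = "ev X"
  obtain \<phi> where \<phi>: "rep_swap X Unit \<phi>"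
    using rep_exists[of "Node X Unit" "Node Unit X" "msym C ?x (munit C)"] by auto
  note [simp] = repD(1-8)[OF \<phi>, simplified]
  have \<phi>i [simp]: "iso_arr C (\<phi> t)" if "t \<in> Ob C" for t
    using that by (auto intro!: rep_inv(2)[OF \<phi>])
  have l: "rep (Node Unit Unit) Unit (mlunit C (munit C)) (\<lambda>t. ide C t)"
    using rep_mlunit[of Unit] by simp
  have 1: "rep (Node X (Node Unit Unit)) (Node Unit X) ((mlunit C (munit C) \<diamondop> ide C ?x) \<cdot> msym C ?x (munit C \<star> munit C))
    (\<lambda>t. (nest_arr Unit (ide C (nest X t)) \<cdot> ide C (nest X t)) \<cdot> (nest_arr Unit (\<phi> t) \<cdot> \<phi> (nest Unit t)))"
    using rep_comp[OF rep_swap_Node_right[OF \<phi> \<phi>] rep_tensor[OF l rep_ide[of X]]] by simp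
  have 2: "rep (Node X (Node Unit Unit)) (Node Unit X) (msym C ?x (munit C) \<cdot> (ide C ?x \<diamondop> mlunit C (munit C)))
    (\<lambda>t. \<phi> t \<cdot> (nest_arr X (ide C t) \<cdot> ide C (nest X (nest (Node Unit Unit) t))))"
    using rep_comp[OF rep_tensor[OF rep_ide[of X] l] \<phi>] by simp
  \<comment> \<open>Naturality of the symmetry at the unitor of \<open>I\<close>: it identifies the
    action of two exchanges with that of one, which is the idempotence.\<close>
  have 3: "(mlunit C (munit C) \<diamondop> ide C ?x) \<cdot> msym C ?x (munit C \<star> munit C) =
      msym C ?x (munit C) \<cdot> (ide C ?x \<diamondop> mlunit C (munit C))"
    by (simp add: msym_nat)
  have "\<phi> t \<cdot> \<phi> t = \<phi> t" if "t \<in> Ob C" for t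
    using rep_unique[OF 1 2[folded 3] that] that by simp
  then have "\<phi> t = ide C (nest X t)" if "t \<in> Ob C" for t
    using iso_eq_of_comp_ide[of "\<phi> t"] that by simp
  then show ?thesis using rep_cong[OF \<phi>] by simp
qed

lemma rep_swap_Unit_left:
  assumes [simp]: "tree X"
  shows "rep_swap Unit X (\<lambda>t. ide C (nest X t))"
proof -
  have "rep (Node Unit X) (Node X Unit) (inv_arr C (msym C (ev X) (ev Unit))) (\<lambda>t. ide C (nest X t))"
    by (rule rep_cong[OF rep_inv(1)[OF rep_swap_Unit_right]]) simp_all
  then show ?thesis by simp
qed

end

section \<open>The middle interchange\<close>

text \<open>The map \<open>(a \<star> b) \<star> (c \<star> d) \<rightarrow> (a \<star> c) \<star>
  (b \<star> d)\<close> exchanging the two inner factors; it becomes the multiplication constraint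
  of the tensor product functor.\<close>

definition middle :: "('o, 'a, 'r, 'z) smcat_scheme \<Rightarrow> 'o \<Rightarrow> 'o \<Rightarrow> 'o \<Rightarrow> 'o \<Rightarrow> 'a" where
  "middle C a b c d = inv_arr C (massoc C a c (b \<star>\<^bsub>C\<^esub> d)) \<cdot>\<^bsub>C\<^esub>
     (ide C a \<diamondop>\<^bsub>C\<^esub> (massoc C c b d \<cdot>\<^bsub>C\<^esub> (msym C b c \<diamondop>\<^bsub>C\<^esub> ide C d) \<cdot>\<^bsub>C\<^esub> inv_arr C (massoc C b c d))) \<cdot>\<^bsub>C\<^esub>
     massoc C a b (c \<star>\<^bsub>C\<^esub> d)"

context sm_category
begin

lemma middle_typed [simp]:
  assumes "a \<in> Ob C" "b \<in> Ob C" "c \<in> Ob C" "d \<in> Ob C"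
  shows "iso_arr C (middle C a b c d)" "middle C a b c d \<in> Ar C"
    "Dom C (middle C a b c d) = (a \<star> b) \<star> (c \<star> d)" "Cod C (middle C a b c d) = (a \<star> c) \<star> (b \<star> d)"
  using assms by (simp_all add: middle_def)

lemma massoc_inv_nat:
  assumes "f \<in> Ar C" "g \<in> Ar C" "h \<in> Ar C"
  shows "((f \<diamondop> g) \<diamondop> h) \<cdot> inv_arr C (massoc C (Dom C f) (Dom C g) (Dom C h)) =
    inv_arr C (massoc C (Cod C f) (Cod C g) (Cod C h)) \<cdot> (f \<diamondop> (g \<diamondop> h))"
  using assms by (intro swap_inv) (simp_all add: massoc_nat)

lemma middle_nat:
  assumes [simp]: "f \<in> Ar C" "g \<in> Ar C" "h \<in> Ar C" "k \<in> Ar C"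
  shows "middle C (Cod C f) (Cod C g) (Cod C h) (Cod C k) \<cdot> ((f \<diamondop> g) \<diamondop> (h \<diamondop> k)) =
    ((f \<diamondop> h) \<diamondop> (g \<diamondop> k)) \<cdot> middle C (Dom C f) (Dom C g) (Dom C h) (Dom C k)"
proof -
  let ?a = "Dom C f" and ?b = "Dom C g" and ?c = "Dom C h" and ?d = "Dom C k"
  let ?a' = "Cod C f" and ?b' = "Cod C g" and ?c' = "Cod C h" and ?d' = "Cod C k"
  let ?s = "massoc C ?c ?b ?d \<cdot> (msym C ?b ?c \<diamondop> ide C ?d) \<cdot> inv_arr C (massoc C ?b ?c ?d)"
  let ?s' = "massoc C ?c' ?b' ?d' \<cdot> (msym C ?b' ?c' \<diamondop> ide C ?d') \<cdot> inv_arr C (massoc C ?b' ?c' ?d')"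
  have "?s' \<cdot> (g \<diamondop> (h \<diamondop> k)) = massoc C ?c' ?b' ?d' \<cdot> (msym C ?b' ?c' \<diamondop> ide C ?d') \<cdot>
      ((g \<diamondop> h) \<diamondop> k) \<cdot> inv_arr C (massoc C ?b ?c ?d)"
    by (simp add: assoc massoc_inv_nat)
  also have "\<dots> = massoc C ?c' ?b' ?d' \<cdot> ((h \<diamondop> g) \<diamondop> k) \<cdot> (msym C ?b ?c \<diamondop> ide C ?d) \<cdot> inv_arr C (massoc C ?b ?c ?d)"
    by (simp add: tar_merge msym_nat)
  also have "\<dots> = ((h \<diamondop> (g \<diamondop> k)) \<cdot> massoc C ?c ?b ?d) \<cdot> (msym C ?b ?c \<diamondop> ide C ?d) \<cdot> inv_arr C (massoc C ?b ?c ?d)"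
    by (intro reassoc) (simp_all add: massoc_nat)
  finally have s: "?s' \<cdot> (g \<diamondop> (h \<diamondop> k)) = (h \<diamondop> (g \<diamondop> k)) \<cdot> ?s" by (simp add: assoc)
  have "middle C ?a' ?b' ?c' ?d' \<cdot> ((f \<diamondop> g) \<diamondop> (h \<diamondop> k)) =
     inv_arr C (massoc C ?a' ?c' (?b' \<star> ?d')) \<cdot> (ide C ?a' \<diamondop> ?s') \<cdot> massoc C ?a' ?b' (?c' \<star> ?d') \<cdot> ((f \<diamondop> g) \<diamondop> (h \<diamondop> k))"
    by (simp add: middle_def assoc)
  also have "massoc C ?a' ?b' (?c' \<star> ?d') \<cdot> ((f \<diamondop> g) \<diamondop> (h \<diamondop> k)) = (f \<diamondop> (g \<diamondop> (h \<diamondop> k))) \<cdot> massoc C ?a ?b (?c \<star> ?d)"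
    using massoc_nat[of f g "h \<diamondop> k" ?a' ?b' "?c' \<star> ?d'"] by simp
  also have "(ide C ?a' \<diamondop> ?s') \<cdot> \<dots> = (f \<diamondop> (?s' \<cdot> (g \<diamondop> (h \<diamondop> k)))) \<cdot> massoc C ?a ?b (?c \<star> ?d)"
    by (simp add: tar_merge)
  also have "\<dots> = (f \<diamondop> (h \<diamondop> (g \<diamondop> k))) \<cdot> (ide C ?a \<diamondop> ?s) \<cdot> massoc C ?a ?b (?c \<star> ?d)"
    unfolding s by (simp add: tar_merge)
  also have "inv_arr C (massoc C ?a' ?c' (?b' \<star> ?d')) \<cdot> \<dots> =
    (((f \<diamondop> h) \<diamondop> (g \<diamondop> k)) \<cdot> inv_arr C (massoc C ?a ?c (?b \<star> ?d))) \<cdot> (ide C ?a \<diamondop> ?s) \<cdot> massoc C ?a ?b (?c \<star> ?d)"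
    using massoc_inv_nat[of f h "g \<diamondop> k"] by (intro reassoc) simp_all
  finally show ?thesis by (simp add: middle_def assoc)
qed

text \<open>All associators in \<open>middle\<close> disappear, and the exchange of \<open>X\<close>
  with \<open>Y\<close> remains, with \<open>A\<close> in front of it and \<open>D\<close> behind.
  Arbitrary trees are allowed so that units can be entered as \<open>Unit\<close>.\<close>

lemma rep_middle:
  assumes [simp]: "tree A" "tree D" and \<phi>: "rep_swap X Y \<phi>"
  shows "rep (Node (Node A X) (Node Y D)) (Node (Node A Y) (Node X D)) (middle C (ev A) (ev X) (ev Y) (ev D))
    (\<lambda>t. nest_arr A (\<phi> (nest D t)))"
proof -
  note [simp] = repD(1-8)[OF \<phi>, simplified]
  show ?thesis unfolding middle_def
    by (rule rep_cong[OF rep_comp[OF rep_comp[OF rep_massoc[of A X "Node Y D"] rep_tensor[OF rep_ide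
        rep_comp[OF rep_comp[OF rep_massoc_inv rep_tensor[OF \<phi> rep_ide]] rep_massoc]]]
        rep_massoc_inv[of A Y "Node X D"]], unfolded ev.simps])
      (simp_all add: assoc)
qed

lemma swap_swap:
  assumes [simp]: "a \<in> Ob C" "b \<in> Ob C" and \<phi>: "rep_swap (Leaf a) (Leaf b) \<phi>" and \<psi>: "rep_swap (Leaf b) (Leaf a) \<psi>"
    and [simp]: "t \<in> Ob C"
  shows "\<psi> t \<cdot> \<phi> t = ide C (nest (Node (Leaf a) (Leaf b)) t)"
  using rep_unique[OF rep_comp[OF \<phi> \<psi>, unfolded ev.simps, unfolded msym_symmetric[OF assms(1,2)]]
      rep_ide[of "Node (Leaf a) (Leaf b)", unfolded ev.simps], of t] by simp

text \<open>Both sides carry \<open>a, b, c, d, e, f\<close> to \<open>a, c, e, b, d, f\<close>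
  through the exchanges of \<open>b\<close> with \<open>c\<close>, \<open>b\<close> with
  \<open>e\<close> and \<open>d\<close> with \<open>e\<close>; they differ only in the order of two
  independent exchanges.\<close>

lemma middle_assoc:
  assumes [simp]: "a \<in> Ob C" "b \<in> Ob C" "c \<in> Ob C" "d \<in> Ob C" "e \<in> Ob C" "f \<in> Ob C"
  shows "(massoc C a c e \<diamondop> massoc C b d f) \<cdot> middle C (a \<star> c) (b \<star> d) e f \<cdot> (middle C a b c d \<diamondop> ide C (e \<star> f)) =
    middle C a b (c \<star> e) (d \<star> f) \<cdot> (ide C (a \<star> b) \<diamondop> middle C c d e f) \<cdot> massoc C (a \<star> b) (c \<star> d) (e \<star> f)"
proof -
  let ?a = "Leaf a" and ?b = "Leaf b" and ?c = "Leaf c" and ?d = "Leaf d" and ?e = "Leaf e" and ?f = "Leaf f"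
  obtain \<phi> where \<phi>: "rep_swap ?b ?c \<phi>" using rep_swap_Leaf[of b c] by auto
  obtain \<psi> where \<psi>: "rep_swap ?b ?e \<psi>" using rep_swap_Leaf[of b e] by auto
  obtain \<theta> where \<theta>: "rep_swap ?d ?e \<theta>" using rep_swap_Leaf[of d e] by auto
  note [simp] = repD(6-8)[OF \<phi>, simplified] repD(6-8)[OF \<psi>, simplified] repD(6-8)[OF \<theta>, simplified]
  note L = rep_comp[OF rep_comp[OF rep_tensor[OF rep_middle[of ?a ?d, OF _ _ \<phi>] rep_ide[of "Node ?e ?f"]]
      rep_middle[of "Node ?a ?c" ?f, OF _ _ rep_swap_Node_left[OF \<psi> \<theta>]]]
      rep_tensor[OF rep_massoc[of ?a ?c ?e] rep_massoc[of ?b ?d ?f]], unfolded ev.simps]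
  note R = rep_comp[OF rep_comp[OF rep_massoc[of "Node ?a ?b" "Node ?c ?d" "Node ?e ?f"]
      rep_tensor[OF rep_ide[of "Node ?a ?b"] rep_middle[of ?c ?f, OF _ _ \<theta>]]]
      rep_middle[of ?a "Node ?d ?f", OF _ _ rep_swap_Node_right[OF \<phi> \<psi>]], unfolded ev.simps]
  \<comment> \<open>Exchanging \<open>b\<close> with \<open>c\<close> commutes with exchanging
    \<open>d\<close> and \<open>e\<close> further to the right.\<close>
  have nat: "\<phi> (e \<star> (d \<star> (f \<star> t))) \<cdot> (ide C b \<diamondop> (ide C c \<diamondop> \<theta> (f \<star> t))) =
      (ide C c \<diamondop> (ide C b \<diamondop> \<theta> (f \<star> t))) \<cdot> \<phi> (d \<star> (e \<star> (f \<star> t)))" if "t \<in> Ob C" for t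
    using rep_natural[OF \<phi>, of "\<theta> (f \<star> t)"] that by simp
  show ?thesis
    by (rule rep_faithful[OF L R]) (simp_all add: nat nest_arr_comp tar_merge assoc)
qed

text \<open>Entering the units as \<open>Unit\<close> makes every factor act as an identity, so the
  two actions coincide.\<close>

lemma middle_left_unit:
  assumes [simp]: "a \<in> Ob C" "b \<in> Ob C"
  shows "(mlunit C a \<diamondop> mlunit C b) \<cdot> middle C (munit C) (munit C) a b \<cdot> (inv_arr C (mlunit C (munit C)) \<diamondop> ide C (a \<star> b)) =
    mlunit C (a \<star> b)"
proof -
  note L = rep_comp[OF rep_comp[OF rep_tensor[OF rep_inv(1)[OF rep_mlunit[of Unit]] rep_ide[of "Node (Leaf a) (Leaf b)"]]
      rep_middle[of Unit "Leaf b", OF _ _ rep_swap_Unit_left[of "Leaf a"]]]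
      rep_tensor[OF rep_mlunit[of "Leaf a"] rep_mlunit[of "Leaf b"]], unfolded ev.simps]
  note R = rep_mlunit[of "Node (Leaf a) (Leaf b)", unfolded ev.simps]
  show ?thesis by (rule rep_faithful[OF L R]) simp_all
qed

lemma middle_right_unit:
  assumes [simp]: "a \<in> Ob C" "b \<in> Ob C"
  shows "(mrunit C a \<diamondop> mrunit C b) \<cdot> middle C a b (munit C) (munit C) \<cdot> (ide C (a \<star> b) \<diamondop> inv_arr C (mlunit C (munit C))) =
    mrunit C (a \<star> b)"
proof -
  note L = rep_comp[OF rep_comp[OF rep_tensor[OF rep_ide[of "Node (Leaf a) (Leaf b)"] rep_inv(1)[OF rep_mlunit[of Unit]]]
      rep_middle[of "Leaf a" Unit, OF _ _ rep_swap_Unit_right[of "Leaf b"]]]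
      rep_tensor[OF rep_mrunit[of "Leaf a"] rep_mrunit[of "Leaf b"]], unfolded ev.simps]
  note R = rep_mrunit[of "Node (Leaf a) (Leaf b)", unfolded ev.simps]
  show ?thesis by (rule rep_faithful[OF L R]) simp_all
qed

text \<open>The symmetry of the two blocks consists of four elementary exchanges. The following
  \<open>middle\<close> undoes the one between \<open>a\<close> and \<open>d\<close>, and the other
  three are those on the left.\<close>

lemma middle_sym:
  assumes [simp]: "a \<in> Ob C" "b \<in> Ob C" "c \<in> Ob C" "d \<in> Ob C"
  shows "(msym C a c \<diamondop> msym C b d) \<cdot> middle C a b c d = middle C c d a b \<cdot> msym C (a \<star> b) (c \<star> d)"
proof -
  let ?a = "Leaf a" and ?b = "Leaf b" and ?c = "Leaf c" and ?d = "Leaf d"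
  obtain ac where ac: "rep_swap ?a ?c ac" using rep_swap_Leaf[of a c] by auto
  obtain ad where ad: "rep_swap ?a ?d ad" using rep_swap_Leaf[of a d] by auto
  obtain bc where bc: "rep_swap ?b ?c bc" using rep_swap_Leaf[of b c] by auto
  obtain bd where bd: "rep_swap ?b ?d bd" using rep_swap_Leaf[of b d] by auto
  obtain da where da: "rep_swap ?d ?a da" using rep_swap_Leaf[of d a] by auto
  note [simp] = repD(6-8)[OF ac, simplified] repD(6-8)[OF ad, simplified] repD(6-8)[OF bc, simplified]
    repD(6-8)[OF bd, simplified] repD(6-8)[OF da, simplified]
  note L = rep_comp[OF rep_middle[of ?a ?d, OF _ _ bc] rep_tensor[OF ac bd], unfolded ev.simps]
  note R = rep_comp[OF rep_swap_Node_left[OF rep_swap_Node_right[OF ac ad] rep_swap_Node_right[OF bc bd]]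
      rep_middle[of ?c ?b, OF _ _ da], unfolded ev.simps]
  show ?thesis
  proof -
    \<comment> \<open>The exchange of \<open>a\<close> with \<open>d\<close> meets its
      inverse.\<close>
    have 1: "da (b \<star> t) \<cdot> ad (b \<star> t) = ide C (a \<star> (d \<star> (b \<star> t)))" if "t \<in> Ob C" for t
      using swap_swap[OF _ _ ad da, of "b \<star> t"] that by simp
    \<comment> \<open>Exchanging \<open>a\<close> with \<open>c\<close> and \<open>b\<close> with
      \<open>d\<close> affects disjoint factors, so the order may be changed.\<close>
    have 2: "(ide C c \<diamondop> (ide C a \<diamondop> bd t)) \<cdot> ac (b \<star> (d \<star> t)) \<cdot> (ide C a \<diamondop> bc (d \<star> t)) =
        ac (d \<star> (b \<star> t)) \<cdot> (ide C a \<diamondop> (ide C c \<diamondop> bd t)) \<cdot> (ide C a \<diamondop> bc (d \<star> t))" if "t \<in> Ob C" for t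
      using reassoc[OF rep_natural[OF ac, of "bd t", symmetric], of "ide C a \<diamondop> bc (d \<star> t)"] that
      by (simp add: assoc)
    show ?thesis
      by (rule rep_faithful[OF L R]) (simp_all add: 1 2 nest_arr_comp tar_merge assoc)
  qed
qed

text \<open>Needed for restrictions to the first factor, where every second variable is the unit;
  \<open>middle_unit_left\<close> is the counterpart for the second factor.\<close>

lemma middle_unit_right:
  assumes [simp]: "a \<in> Ob C" "c \<in> Ob C"
  shows "mrunit C (a \<star> c) \<cdot> (ide C (a \<star> c) \<diamondop> mlunit C (munit C)) \<cdot> middle C a (munit C) c (munit C) =
    mrunit C a \<diamondop> mrunit C c"
proof -
  note L = rep_comp[OF rep_comp[OF rep_middle[of "Leaf a" Unit, OF _ _ rep_swap_Unit_left[of "Leaf c"]]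
      rep_tensor[OF rep_ide[of "Node (Leaf a) (Leaf c)"] rep_mlunit[of Unit]]]
      rep_mrunit[of "Node (Leaf a) (Leaf c)"], unfolded ev.simps]
  note R = rep_tensor[OF rep_mrunit[of "Leaf a"] rep_mrunit[of "Leaf c"], unfolded ev.simps]
  show ?thesis by (rule rep_faithful[OF L R]) simp_all
qed

lemma middle_unit_left:
  assumes [simp]: "b \<in> Ob C" "d \<in> Ob C"
  shows "mlunit C (b \<star> d) \<cdot> (mlunit C (munit C) \<diamondop> ide C (b \<star> d)) \<cdot> middle C (munit C) b (munit C) d =
    mlunit C b \<diamondop> mlunit C d"
proof -
  note L = rep_comp[OF rep_comp[OF rep_middle[of Unit "Leaf d", OF _ _ rep_swap_Unit_right[of "Leaf b"]]
      rep_tensor[OF rep_mlunit[of Unit] rep_ide[of "Node (Leaf b) (Leaf d)"]]]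
      rep_mlunit[of "Node (Leaf b) (Leaf d)"], unfolded ev.simps]
  note R = rep_tensor[OF rep_mlunit[of "Leaf b"] rep_mlunit[of "Leaf d"], unfolded ev.simps]
  show ?thesis by (rule rep_faithful[OF L R]) simp_all
qed

text \<open>Both unitors of \<open>I\<close> act as identities, hence agree by faithfulness;
  \<open>msym_munit\<close> follows in the same way.\<close>

lemma mrunit_munit: "mrunit C (munit C) = mlunit C (munit C)"
  using rep_mrunit[of Unit, unfolded ev.simps nest.simps] rep_mlunit[of Unit, unfolded ev.simps nest.simps]
  by (rule rep_faithful) simp_all

lemma msym_munit: "msym C (munit C) (munit C) = ide C (munit C \<star> munit C)"
  using rep_swap_Unit_left[of Unit, unfolded ev.simps] rep_ide[of "Node Unit Unit", unfolded ev.simps]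
  by (rule rep_faithful) simp_all

text \<open>The triangle at \<open>I, I\<close>, rewritten with \<open>mrunit_munit\<close>: the
  unitor is an associative multiplication on \<open>I\<close>, as the constraints of the unit
  inclusions require.\<close>

lemma munit_assoc:
  "mlunit C (munit C) \<cdot> (mlunit C (munit C) \<diamondop> ide C (munit C)) =
    mlunit C (munit C) \<cdot> (ide C (munit C) \<diamondop> mlunit C (munit C)) \<cdot> massoc C (munit C) (munit C) (munit C)"
  using triangle[of "munit C" "munit C"] by (simp add: mrunit_munit)

end

section \<open>Strong symmetric monoidal functors\<close>

text \<open>The clauses of \<open>strong_sm_functor\<close> other than linearity, so that functors
  on the cartesian product \<open>prod_smcat\<close> are included.\<close>

definition sm_functor ::
  "('o1, 'a1, 'r, 'y) smcat_scheme \<Rightarrow> ('o2, 'a2, 's, 'z) smcat_scheme \<Rightarrow>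
   ('o1, 'a1, 'o2, 'a2) smfct \<Rightarrow> bool"
where
  "sm_functor C D F \<longleftrightarrow> is_functor C D F \<and>
    (\<forall>x \<in> Ob C. \<forall>y \<in> Ob C. is_iso D (fo F x \<star>\<^bsub>D\<^esub> fo F y) (fo F (x \<star>\<^bsub>C\<^esub> y)) (fmu F x y)) \<and>
    is_iso D (munit D) (fo F (munit C)) (feps F) \<and>
    (\<forall>x x' y y' f g. f \<in> Hom C x x' \<longrightarrow> g \<in> Hom C y y' \<longrightarrow>
      fa F (f \<diamondop>\<^bsub>C\<^esub> g) \<cdot>\<^bsub>D\<^esub> fmu F x y = fmu F x' y' \<cdot>\<^bsub>D\<^esub> (fa F f \<diamondop>\<^bsub>D\<^esub> fa F g)) \<and>
    (\<forall>x \<in> Ob C. \<forall>y \<in> Ob C. \<forall>z \<in> Ob C.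
      fa F (massoc C x y z) \<cdot>\<^bsub>D\<^esub> fmu F (x \<star>\<^bsub>C\<^esub> y) z \<cdot>\<^bsub>D\<^esub> (fmu F x y \<diamondop>\<^bsub>D\<^esub> ide D (fo F z)) =
      fmu F x (y \<star>\<^bsub>C\<^esub> z) \<cdot>\<^bsub>D\<^esub> (ide D (fo F x) \<diamondop>\<^bsub>D\<^esub> fmu F y z) \<cdot>\<^bsub>D\<^esub> massoc D (fo F x) (fo F y) (fo F z)) \<and>
    (\<forall>x \<in> Ob C.
      fa F (mlunit C x) \<cdot>\<^bsub>D\<^esub> fmu F (munit C) x \<cdot>\<^bsub>D\<^esub> (feps F \<diamondop>\<^bsub>D\<^esub> ide D (fo F x)) = mlunit D (fo F x)) \<and>
    (\<forall>x \<in> Ob C.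
      fa F (mrunit C x) \<cdot>\<^bsub>D\<^esub> fmu F x (munit C) \<cdot>\<^bsub>D\<^esub> (ide D (fo F x) \<diamondop>\<^bsub>D\<^esub> feps F) = mrunit D (fo F x)) \<and>
    (\<forall>x \<in> Ob C. \<forall>y \<in> Ob C.
      fa F (msym C x y) \<cdot>\<^bsub>D\<^esub> fmu F x y = fmu F y x \<cdot>\<^bsub>D\<^esub> msym D (fo F x) (fo F y))"

lemma strong_sm_functor_iff:
  "strong_sm_functor R C D F \<longleftrightarrow> linear_functor R C D F \<and> sm_functor C D F"
  unfolding strong_sm_functor_def sm_functor_def linear_functor_def by blast

lemma sm_functor_is_functor: "sm_functor C D F \<Longrightarrow> is_functor C D F"
  by (simp add: sm_functor_def)

lemma sm_functor_simps:
  assumes "sm_functor C D F"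
  shows "x \<in> Ob C \<Longrightarrow> y \<in> Ob C \<Longrightarrow> iso_arr D (fmu F x y)"
    and "x \<in> Ob C \<Longrightarrow> y \<in> Ob C \<Longrightarrow> fmu F x y \<in> Ar D"
    and "x \<in> Ob C \<Longrightarrow> y \<in> Ob C \<Longrightarrow> Dom D (fmu F x y) = fo F x \<star>\<^bsub>D\<^esub> fo F y"
    and "x \<in> Ob C \<Longrightarrow> y \<in> Ob C \<Longrightarrow> Cod D (fmu F x y) = fo F (x \<star>\<^bsub>C\<^esub> y)"
    and "iso_arr D (feps F)" "feps F \<in> Ar D" "Dom D (feps F) = munit D" "Cod D (feps F) = fo F (munit C)"
proof -
  have 1: "\<And>x y. x \<in> Ob C \<Longrightarrow> y \<in> Ob C \<Longrightarrow> is_iso D (fo F x \<star>\<^bsub>D\<^esub> fo F y) (fo F (x \<star>\<^bsub>C\<^esub> y)) (fmu F x y)"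
    and 2: "is_iso D (munit D) (fo F (munit C)) (feps F)"
    using assms unfolding sm_functor_def by blast+
  show "x \<in> Ob C \<Longrightarrow> y \<in> Ob C \<Longrightarrow> iso_arr D (fmu F x y)"
    and "x \<in> Ob C \<Longrightarrow> y \<in> Ob C \<Longrightarrow> fmu F x y \<in> Ar D"
    and "x \<in> Ob C \<Longrightarrow> y \<in> Ob C \<Longrightarrow> Dom D (fmu F x y) = fo F x \<star>\<^bsub>D\<^esub> fo F y"
    and "x \<in> Ob C \<Longrightarrow> y \<in> Ob C \<Longrightarrow> Cod D (fmu F x y) = fo F (x \<star>\<^bsub>C\<^esub> y)"
    using 1[of x y] by (simp_all add: is_iso_iff) (simp add: iso_arr_def)
  show "iso_arr D (feps F)" "feps F \<in> Ar D" "Dom D (feps F) = munit D" "Cod D (feps F) = fo F (munit C)"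
    using 2 by (simp_all add: is_iso_iff) (simp add: iso_arr_def)
qed

lemma fmu_natural:
  assumes "sm_functor C D F" "f \<in> Ar C" "g \<in> Ar C"
  shows "fa F (f \<diamondop>\<^bsub>C\<^esub> g) \<cdot>\<^bsub>D\<^esub> fmu F (Dom C f) (Dom C g) = fmu F (Cod C f) (Cod C g) \<cdot>\<^bsub>D\<^esub> (fa F f \<diamondop>\<^bsub>D\<^esub> fa F g)"
  using assms unfolding sm_functor_def Hom_def by blast

lemma
  assumes "sm_functor C D F"
  shows fmu_assoc: "x \<in> Ob C \<Longrightarrow> y \<in> Ob C \<Longrightarrow> z \<in> Ob C \<Longrightarrow>
      fa F (massoc C x y z) \<cdot>\<^bsub>D\<^esub> fmu F (x \<star>\<^bsub>C\<^esub> y) z \<cdot>\<^bsub>D\<^esub> (fmu F x y \<diamondop>\<^bsub>D\<^esub> ide D (fo F z)) =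
      fmu F x (y \<star>\<^bsub>C\<^esub> z) \<cdot>\<^bsub>D\<^esub> (ide D (fo F x) \<diamondop>\<^bsub>D\<^esub> fmu F y z) \<cdot>\<^bsub>D\<^esub> massoc D (fo F x) (fo F y) (fo F z)"
    and fmu_left_unit: "x \<in> Ob C \<Longrightarrow>
      fa F (mlunit C x) \<cdot>\<^bsub>D\<^esub> fmu F (munit C) x \<cdot>\<^bsub>D\<^esub> (feps F \<diamondop>\<^bsub>D\<^esub> ide D (fo F x)) = mlunit D (fo F x)"
    and fmu_right_unit: "x \<in> Ob C \<Longrightarrow>
      fa F (mrunit C x) \<cdot>\<^bsub>D\<^esub> fmu F x (munit C) \<cdot>\<^bsub>D\<^esub> (ide D (fo F x) \<diamondop>\<^bsub>D\<^esub> feps F) = mrunit D (fo F x)"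
    and fmu_sym: "x \<in> Ob C \<Longrightarrow> y \<in> Ob C \<Longrightarrow>
      fa F (msym C x y) \<cdot>\<^bsub>D\<^esub> fmu F x y = fmu F y x \<cdot>\<^bsub>D\<^esub> msym D (fo F x) (fo F y)"
  using assms unfolding sm_functor_def by blast+

lemma sm_functorI:
  assumes "is_functor C D F"
    and "\<And>x y. x \<in> Ob C \<Longrightarrow> y \<in> Ob C \<Longrightarrow>
      iso_arr D (fmu F x y) \<and> Dom D (fmu F x y) = fo F x \<star>\<^bsub>D\<^esub> fo F y \<and> Cod D (fmu F x y) = fo F (x \<star>\<^bsub>C\<^esub> y)"
    and "iso_arr D (feps F) \<and> Dom D (feps F) = munit D \<and> Cod D (feps F) = fo F (munit C)"
    and "\<And>f g. f \<in> Ar C \<Longrightarrow> g \<in> Ar C \<Longrightarrow>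
      fa F (f \<diamondop>\<^bsub>C\<^esub> g) \<cdot>\<^bsub>D\<^esub> fmu F (Dom C f) (Dom C g) = fmu F (Cod C f) (Cod C g) \<cdot>\<^bsub>D\<^esub> (fa F f \<diamondop>\<^bsub>D\<^esub> fa F g)"
    and "\<And>x y z. x \<in> Ob C \<Longrightarrow> y \<in> Ob C \<Longrightarrow> z \<in> Ob C \<Longrightarrow>
      fa F (massoc C x y z) \<cdot>\<^bsub>D\<^esub> fmu F (x \<star>\<^bsub>C\<^esub> y) z \<cdot>\<^bsub>D\<^esub> (fmu F x y \<diamondop>\<^bsub>D\<^esub> ide D (fo F z)) =
      fmu F x (y \<star>\<^bsub>C\<^esub> z) \<cdot>\<^bsub>D\<^esub> (ide D (fo F x) \<diamondop>\<^bsub>D\<^esub> fmu F y z) \<cdot>\<^bsub>D\<^esub> massoc D (fo F x) (fo F y) (fo F z)"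
    and "\<And>x. x \<in> Ob C \<Longrightarrow>
      fa F (mlunit C x) \<cdot>\<^bsub>D\<^esub> fmu F (munit C) x \<cdot>\<^bsub>D\<^esub> (feps F \<diamondop>\<^bsub>D\<^esub> ide D (fo F x)) = mlunit D (fo F x)"
    and "\<And>x. x \<in> Ob C \<Longrightarrow>
      fa F (mrunit C x) \<cdot>\<^bsub>D\<^esub> fmu F x (munit C) \<cdot>\<^bsub>D\<^esub> (ide D (fo F x) \<diamondop>\<^bsub>D\<^esub> feps F) = mrunit D (fo F x)"
    and "\<And>x y. x \<in> Ob C \<Longrightarrow> y \<in> Ob C \<Longrightarrow>
      fa F (msym C x y) \<cdot>\<^bsub>D\<^esub> fmu F x y = fmu F y x \<cdot>\<^bsub>D\<^esub> msym D (fo F x) (fo F y)"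
  shows "sm_functor C D F"
  unfolding sm_functor_def is_iso_iff Hom_def
  by (intro conjI ballI allI impI) (clarsimp simp: assms)+

lemma comp_smfct_sel [simp]:
  "fo (comp_smfct E G F) x = fo G (fo F x)" "fa (comp_smfct E G F) f = fa G (fa F f)"
  "fmu (comp_smfct E G F) x y = fa G (fmu F x y) \<cdot>\<^bsub>E\<^esub> fmu G (fo F x) (fo F y)"
  "feps (comp_smfct E G F) = fa G (feps F) \<cdot>\<^bsub>E\<^esub> feps G"
  by (simp_all add: comp_smfct_def)

lemma functor_comp_smfct: "is_functor C D F \<Longrightarrow> is_functor D E G \<Longrightarrow> is_functor C E (comp_smfct E G F)"
  by (rule functorI) (simp_all add: functor_simps[of C D F] functor_simps[of D E G])

text \<open>Each diagram for the composite is the image under \<open>G\<close> of the diagram for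
  \<open>F\<close>, pasted to the diagram for \<open>G\<close> along naturality of
  \<open>fmu G\<close>.\<close>

lemma sm_functor_comp:
  assumes C: "sm_category C" and D: "sm_category D" and E: "sm_category E"
    and F: "sm_functor C D F" and G: "sm_functor D E G"
  shows "sm_functor C E (comp_smfct E G F)"
proof -
  interpret C: sm_category C by fact
  interpret D: sm_category D by fact
  interpret E: sm_category E by fact
  note iF = sm_functor_is_functor[OF F] and iG = sm_functor_is_functor[OF G]
  note [simp] = sm_functor_simps[OF F] functor_simps[OF iF] sm_functor_simps[OF G] functor_simps[OF iG]
    functor_iso(1)[OF iG D.category_axioms E.category_axioms]
    functor_iso(1)[OF iF C.category_axioms D.category_axioms]
  show ?thesis
  proof (rule sm_functorI, goal_cases)
    case 1 show ?case using functor_comp_smfct[OF iF iG] .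
  next
    case (4 f g)
    note [simp] = 4
    let ?x = "Dom C f" and ?y = "Dom C g" and ?x' = "Cod C f" and ?y' = "Cod C g"
    have "fa G (fa F (f \<diamondop>\<^bsub>C\<^esub> g)) \<cdot>\<^bsub>E\<^esub> fa G (fmu F ?x ?y) \<cdot>\<^bsub>E\<^esub> fmu G (fo F ?x) (fo F ?y)
       = fa G (fa F (f \<diamondop>\<^bsub>C\<^esub> g) \<cdot>\<^bsub>D\<^esub> fmu F ?x ?y) \<cdot>\<^bsub>E\<^esub> fmu G (fo F ?x) (fo F ?y)"
      by (simp add: E.assoc)
    also have "\<dots> = fa G (fmu F ?x' ?y') \<cdot>\<^bsub>E\<^esub> fa G (fa F f \<diamondop>\<^bsub>D\<^esub> fa F g) \<cdot>\<^bsub>E\<^esub> fmu G (fo F ?x) (fo F ?y)"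
      by (simp add: fmu_natural[OF F] E.assoc)
    also have "\<dots> = fa G (fmu F ?x' ?y') \<cdot>\<^bsub>E\<^esub> fmu G (fo F ?x') (fo F ?y') \<cdot>\<^bsub>E\<^esub> (fa G (fa F f) \<diamondop>\<^bsub>E\<^esub> fa G (fa F g))"
      using fmu_natural[OF G, of "fa F f" "fa F g"] by simp
    finally show ?case by (simp add: E.assoc)
  next
    case (5 x y z)
    note [simp] = 5
    let ?a = "fo F x" and ?b = "fo F y" and ?c = "fo F z" and ?\<mu> = "fmu F" and ?\<nu> = "fmu G"
    have 1: "fa G (?\<mu> (x \<star>\<^bsub>C\<^esub> y) z) \<cdot>\<^bsub>E\<^esub> ?\<nu> (fo F (x \<star>\<^bsub>C\<^esub> y)) ?c \<cdot>\<^bsub>E\<^esub> ((fa G (?\<mu> x y) \<cdot>\<^bsub>E\<^esub> ?\<nu> ?a ?b) \<diamondop>\<^bsub>E\<^esub> ide E (fo G ?c))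
      = fa G (?\<mu> (x \<star>\<^bsub>C\<^esub> y) z) \<cdot>\<^bsub>E\<^esub> ?\<nu> (fo F (x \<star>\<^bsub>C\<^esub> y)) ?c \<cdot>\<^bsub>E\<^esub>
        (fa G (?\<mu> x y) \<diamondop>\<^bsub>E\<^esub> fa G (ide D ?c)) \<cdot>\<^bsub>E\<^esub> (?\<nu> ?a ?b \<diamondop>\<^bsub>E\<^esub> ide E (fo G ?c))"
      by (simp add: E.tar_merge)
    have 2: "?\<nu> (fo F (x \<star>\<^bsub>C\<^esub> y)) ?c \<cdot>\<^bsub>E\<^esub> (fa G (?\<mu> x y) \<diamondop>\<^bsub>E\<^esub> fa G (ide D ?c)) \<cdot>\<^bsub>E\<^esub> (?\<nu> ?a ?b \<diamondop>\<^bsub>E\<^esub> ide E (fo G ?c)) =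
        (fa G (?\<mu> x y \<diamondop>\<^bsub>D\<^esub> ide D ?c) \<cdot>\<^bsub>E\<^esub> ?\<nu> (?a \<star>\<^bsub>D\<^esub> ?b) ?c) \<cdot>\<^bsub>E\<^esub> (?\<nu> ?a ?b \<diamondop>\<^bsub>E\<^esub> ide E (fo G ?c))"
      using fmu_natural[OF G, of "?\<mu> x y" "ide D ?c"] by (intro E.reassoc) simp_all
    have "fa G (fa F (massoc C x y z)) \<cdot>\<^bsub>E\<^esub> fa G (?\<mu> (x \<star>\<^bsub>C\<^esub> y) z) \<cdot>\<^bsub>E\<^esub> ?\<nu> (fo F (x \<star>\<^bsub>C\<^esub> y)) ?c \<cdot>\<^bsub>E\<^esub>
        ((fa G (?\<mu> x y) \<cdot>\<^bsub>E\<^esub> ?\<nu> ?a ?b) \<diamondop>\<^bsub>E\<^esub> ide E (fo G ?c)) =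
        fa G (fa F (massoc C x y z) \<cdot>\<^bsub>D\<^esub> ?\<mu> (x \<star>\<^bsub>C\<^esub> y) z \<cdot>\<^bsub>D\<^esub> (?\<mu> x y \<diamondop>\<^bsub>D\<^esub> ide D ?c)) \<cdot>\<^bsub>E\<^esub> ?\<nu> (?a \<star>\<^bsub>D\<^esub> ?b) ?c
        \<cdot>\<^bsub>E\<^esub> (?\<nu> ?a ?b \<diamondop>\<^bsub>E\<^esub> ide E (fo G ?c))"
      unfolding 1 2 by (simp add: E.assoc)
    also have "\<dots> = fa G (?\<mu> x (y \<star>\<^bsub>C\<^esub> z)) \<cdot>\<^bsub>E\<^esub> fa G (ide D ?a \<diamondop>\<^bsub>D\<^esub> ?\<mu> y z) \<cdot>\<^bsub>E\<^esub>
        fa G (massoc D ?a ?b ?c) \<cdot>\<^bsub>E\<^esub> ?\<nu> (?a \<star>\<^bsub>D\<^esub> ?b) ?c \<cdot>\<^bsub>E\<^esub> (?\<nu> ?a ?b \<diamondop>\<^bsub>E\<^esub> ide E (fo G ?c))"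
      by (simp add: fmu_assoc[OF F] E.assoc)
    also have "fa G (massoc D ?a ?b ?c) \<cdot>\<^bsub>E\<^esub> ?\<nu> (?a \<star>\<^bsub>D\<^esub> ?b) ?c \<cdot>\<^bsub>E\<^esub> (?\<nu> ?a ?b \<diamondop>\<^bsub>E\<^esub> ide E (fo G ?c)) =
        ?\<nu> ?a (?b \<star>\<^bsub>D\<^esub> ?c) \<cdot>\<^bsub>E\<^esub> (ide E (fo G ?a) \<diamondop>\<^bsub>E\<^esub> ?\<nu> ?b ?c) \<cdot>\<^bsub>E\<^esub> massoc E (fo G ?a) (fo G ?b) (fo G ?c)"
      by (simp add: fmu_assoc[OF G])
    also have "fa G (ide D ?a \<diamondop>\<^bsub>D\<^esub> ?\<mu> y z) \<cdot>\<^bsub>E\<^esub> \<dots> = (?\<nu> ?a (fo F (y \<star>\<^bsub>C\<^esub> z)) \<cdot>\<^bsub>E\<^esub> (ide E (fo G ?a) \<diamondop>\<^bsub>E\<^esub> fa G (?\<mu> y z)))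
         \<cdot>\<^bsub>E\<^esub> (ide E (fo G ?a) \<diamondop>\<^bsub>E\<^esub> ?\<nu> ?b ?c) \<cdot>\<^bsub>E\<^esub> massoc E (fo G ?a) (fo G ?b) (fo G ?c)"
      using fmu_natural[OF G, of "ide D ?a" "?\<mu> y z"] by (intro E.reassoc) simp_all
    finally show ?case by (simp add: E.assoc E.tar_merge)
  next
    case (6 x)
    note [simp] = 6
    let ?a = "fo F x"
    have 1: "fmu G (fo F (munit C)) ?a \<cdot>\<^bsub>E\<^esub> ((fa G (feps F) \<cdot>\<^bsub>E\<^esub> feps G) \<diamondop>\<^bsub>E\<^esub> ide E (fo G ?a)) =
       (fa G (feps F \<diamondop>\<^bsub>D\<^esub> ide D ?a) \<cdot>\<^bsub>E\<^esub> fmu G (munit D) ?a) \<cdot>\<^bsub>E\<^esub> (feps G \<diamondop>\<^bsub>E\<^esub> ide E (fo G ?a))"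
      using fmu_natural[OF G, of "feps F" "ide D ?a"] by (simp add: E.assoc E.tar_merge)
    have "fa G (fa F (mlunit C x)) \<cdot>\<^bsub>E\<^esub> fa G (fmu F (munit C) x) \<cdot>\<^bsub>E\<^esub>
        fmu G (fo F (munit C)) ?a \<cdot>\<^bsub>E\<^esub> ((fa G (feps F) \<cdot>\<^bsub>E\<^esub> feps G) \<diamondop>\<^bsub>E\<^esub> ide E (fo G ?a)) =
       fa G (fa F (mlunit C x) \<cdot>\<^bsub>D\<^esub> fmu F (munit C) x \<cdot>\<^bsub>D\<^esub> (feps F \<diamondop>\<^bsub>D\<^esub> ide D ?a)) \<cdot>\<^bsub>E\<^esub> fmu G (munit D) ?a \<cdot>\<^bsub>E\<^esub> (feps G \<diamondop>\<^bsub>E\<^esub> ide E (fo G ?a))"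
      unfolding 1 by (simp add: E.assoc)
    also have "\<dots> = mlunit E (fo G ?a)" by (simp only: fmu_left_unit[OF F 6]) (simp add: fmu_left_unit[OF G])
    finally show ?case by (simp add: E.assoc)
  next
    case (7 x)
    note [simp] = 7
    let ?a = "fo F x"
    have 2: "fmu G ?a (fo F (munit C)) \<cdot>\<^bsub>E\<^esub> (ide E (fo G ?a) \<diamondop>\<^bsub>E\<^esub> (fa G (feps F) \<cdot>\<^bsub>E\<^esub> feps G)) =
       (fa G (ide D ?a \<diamondop>\<^bsub>D\<^esub> feps F) \<cdot>\<^bsub>E\<^esub> fmu G ?a (munit D)) \<cdot>\<^bsub>E\<^esub> (ide E (fo G ?a) \<diamondop>\<^bsub>E\<^esub> feps G)"
      using fmu_natural[OF G, of "ide D ?a" "feps F"] by (simp add: E.assoc E.tar_merge)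
    have "fa G (fa F (mrunit C x)) \<cdot>\<^bsub>E\<^esub> fa G (fmu F x (munit C)) \<cdot>\<^bsub>E\<^esub>
        fmu G ?a (fo F (munit C)) \<cdot>\<^bsub>E\<^esub> (ide E (fo G ?a) \<diamondop>\<^bsub>E\<^esub> (fa G (feps F) \<cdot>\<^bsub>E\<^esub> feps G)) =
       fa G (fa F (mrunit C x) \<cdot>\<^bsub>D\<^esub> fmu F x (munit C) \<cdot>\<^bsub>D\<^esub> (ide D ?a \<diamondop>\<^bsub>D\<^esub> feps F)) \<cdot>\<^bsub>E\<^esub> fmu G ?a (munit D) \<cdot>\<^bsub>E\<^esub> (ide E (fo G ?a) \<diamondop>\<^bsub>E\<^esub> feps G)"
      unfolding 2 by (simp add: E.assoc)
    also have "\<dots> = mrunit E (fo G ?a)" by (simp only: fmu_right_unit[OF F 7]) (simp add: fmu_right_unit[OF G])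
    finally show ?case by (simp add: E.assoc)
  next
    case (8 x y)
    note [simp] = 8
    let ?a = "fo F x" and ?b = "fo F y"
    have "fa G (fa F (msym C x y)) \<cdot>\<^bsub>E\<^esub> fa G (fmu F x y) \<cdot>\<^bsub>E\<^esub> fmu G ?a ?b =
       fa G (fa F (msym C x y) \<cdot>\<^bsub>D\<^esub> fmu F x y) \<cdot>\<^bsub>E\<^esub> fmu G ?a ?b"
      by (simp add: E.assoc)
    also have "\<dots> = fa G (fmu F y x) \<cdot>\<^bsub>E\<^esub> fmu G ?b ?a \<cdot>\<^bsub>E\<^esub> msym E (fo G ?a) (fo G ?b)"
      by (simp add: fmu_sym[OF F] E.assoc fmu_sym[OF G])
    finally show ?case by (simp add: E.assoc)
  qed (simp_all)
qed

text \<open>Since \<open>middle\<close> consists of associators and one symmetry, compatibility of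
  \<open>F\<close> with these yields compatibility with \<open>middle\<close>. The comparison passes
  through right-nested words, where the only move is an exchange of neighbours.\<close>

lemma fmu_middle:
  assumes C: "sm_category C" and D: "sm_category D" and F: "sm_functor C D F"
    and [simp]: "x \<in> Ob C" "y \<in> Ob C" "z \<in> Ob C" "w \<in> Ob C"
  shows "fa F (middle C x y z w) \<cdot>\<^bsub>D\<^esub> fmu F (x \<star>\<^bsub>C\<^esub> y) (z \<star>\<^bsub>C\<^esub> w) \<cdot>\<^bsub>D\<^esub> (fmu F x y \<diamondop>\<^bsub>D\<^esub> fmu F z w) =
    fmu F (x \<star>\<^bsub>C\<^esub> z) (y \<star>\<^bsub>C\<^esub> w) \<cdot>\<^bsub>D\<^esub> (fmu F x z \<diamondop>\<^bsub>D\<^esub> fmu F y w) \<cdot>\<^bsub>D\<^esub> middle D (fo F x) (fo F y) (fo F z) (fo F w)"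
proof -
  interpret C: sm_category C by fact
  interpret D: sm_category D by fact
  note iF = sm_functor_is_functor[OF F]
  note [simp] = sm_functor_simps[OF F] functor_simps[OF iF]
    functor_iso[OF iF C.category_axioms D.category_axioms]
  \<comment> \<open>The inner exchange contained in \<open>middle\<close>, in \<open>C\<close> and
    then in \<open>D\<close>.\<close>
  define swap where "swap y z w = massoc C z y w \<cdot>\<^bsub>C\<^esub> (msym C y z \<diamondop>\<^bsub>C\<^esub> ide C w) \<cdot>\<^bsub>C\<^esub> inv_arr C (massoc C y z w)" for y z w
  define swapD where "swapD y z w = massoc D z y w \<cdot>\<^bsub>D\<^esub> (msym D y z \<diamondop>\<^bsub>D\<^esub> ide D w) \<cdot>\<^bsub>D\<^esub> inv_arr D (massoc D y z w)" for y z w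
  have [simp]: "swap y z w \<in> Ar C" "Dom C (swap y z w) = y \<star>\<^bsub>C\<^esub> (z \<star>\<^bsub>C\<^esub> w)" "Cod C (swap y z w) = z \<star>\<^bsub>C\<^esub> (y \<star>\<^bsub>C\<^esub> w)"
    if "y \<in> Ob C" "z \<in> Ob C" "w \<in> Ob C" for y z w
    using that by (simp_all add: swap_def)
  have [simp]: "swapD y z w \<in> Ar D" "Dom D (swapD y z w) = y \<star>\<^bsub>D\<^esub> (z \<star>\<^bsub>D\<^esub> w)" "Cod D (swapD y z w) = z \<star>\<^bsub>D\<^esub> (y \<star>\<^bsub>D\<^esub> w)"
    if "y \<in> Ob D" "z \<in> Ob D" "w \<in> Ob D" for y z w
    using that by (simp_all add: swapD_def)
  let ?m = "\<lambda>x y. x \<star>\<^bsub>C\<^esub> y" and ?I = "\<lambda>x. ide D (fo F x)"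
  \<comment> \<open>The iterated constraint on a right-nested word of length three;
    \<open>\<mu>4\<close> below extends it to length four.\<close>
  define \<mu>3 where "\<mu>3 y z w = fmu F y (z \<star>\<^bsub>C\<^esub> w) \<cdot>\<^bsub>D\<^esub> (?I y \<diamondop>\<^bsub>D\<^esub> fmu F z w)" for y z w
  have [simp]: "\<mu>3 y z w \<in> Ar D" "Dom D (\<mu>3 y z w) = fo F y \<star>\<^bsub>D\<^esub> (fo F z \<star>\<^bsub>D\<^esub> fo F w)" "Cod D (\<mu>3 y z w) = fo F (y \<star>\<^bsub>C\<^esub> (z \<star>\<^bsub>C\<^esub> w))"
    if "y \<in> Ob C" "z \<in> Ob C" "w \<in> Ob C" for y z w
    using that by (simp_all add: \<mu>3_def)
  have assoc3: "fa F (massoc C y z w) \<cdot>\<^bsub>D\<^esub> fmu F (y \<star>\<^bsub>C\<^esub> z) w \<cdot>\<^bsub>D\<^esub> (fmu F y z \<diamondop>\<^bsub>D\<^esub> ?I w) = \<mu>3 y z w \<cdot>\<^bsub>D\<^esub> massoc D (fo F y) (fo F z) (fo F w)"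
    if "y \<in> Ob C" "z \<in> Ob C" "w \<in> Ob C" for y z w
    using that by (simp add: \<mu>3_def fmu_assoc[OF F] D.assoc)
  have swap3: "fa F (swap y z w) \<cdot>\<^bsub>D\<^esub> \<mu>3 y z w = \<mu>3 z y w \<cdot>\<^bsub>D\<^esub> swapD (fo F y) (fo F z) (fo F w)"
  proof -
    have a: "\<mu>3 y z w = fa F (massoc C y z w) \<cdot>\<^bsub>D\<^esub> fmu F (y \<star>\<^bsub>C\<^esub> z) w \<cdot>\<^bsub>D\<^esub> (fmu F y z \<diamondop>\<^bsub>D\<^esub> ?I w) \<cdot>\<^bsub>D\<^esub> inv_arr D (massoc D (fo F y) (fo F z) (fo F w))"
      using arg_cong[OF assoc3[of y z w], of "\<lambda>k. k \<cdot>\<^bsub>D\<^esub> inv_arr D (massoc D (fo F y) (fo F z) (fo F w))"]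
      by (simp add: D.assoc)
    have "fa F (swap y z w) \<cdot>\<^bsub>D\<^esub> \<mu>3 y z w = fa F (massoc C z y w) \<cdot>\<^bsub>D\<^esub> fa F (msym C y z \<diamondop>\<^bsub>C\<^esub> ide C w) \<cdot>\<^bsub>D\<^esub>
        fmu F (y \<star>\<^bsub>C\<^esub> z) w \<cdot>\<^bsub>D\<^esub> (fmu F y z \<diamondop>\<^bsub>D\<^esub> ?I w) \<cdot>\<^bsub>D\<^esub> inv_arr D (massoc D (fo F y) (fo F z) (fo F w))"
      unfolding a swap_def by (simp add: D.assoc)
    also have "fa F (msym C y z \<diamondop>\<^bsub>C\<^esub> ide C w) \<cdot>\<^bsub>D\<^esub> fmu F (y \<star>\<^bsub>C\<^esub> z) w \<cdot>\<^bsub>D\<^esub> (fmu F y z \<diamondop>\<^bsub>D\<^esub> ?I w) \<cdot>\<^bsub>D\<^esub> inv_arr D (massoc D (fo F y) (fo F z) (fo F w))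
      = (fmu F (z \<star>\<^bsub>C\<^esub> y) w \<cdot>\<^bsub>D\<^esub> (fa F (msym C y z) \<diamondop>\<^bsub>D\<^esub> ?I w)) \<cdot>\<^bsub>D\<^esub> (fmu F y z \<diamondop>\<^bsub>D\<^esub> ?I w) \<cdot>\<^bsub>D\<^esub> inv_arr D (massoc D (fo F y) (fo F z) (fo F w))"
      using fmu_natural[OF F, of "msym C y z" "ide C w"] by (intro D.reassoc) simp_all
    also have "\<dots> = fmu F (z \<star>\<^bsub>C\<^esub> y) w \<cdot>\<^bsub>D\<^esub> (fmu F z y \<diamondop>\<^bsub>D\<^esub> ?I w) \<cdot>\<^bsub>D\<^esub> (msym D (fo F y) (fo F z) \<diamondop>\<^bsub>D\<^esub> ?I w) \<cdot>\<^bsub>D\<^esub> inv_arr D (massoc D (fo F y) (fo F z) (fo F w))"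
      by (simp add: D.assoc D.tar_merge fmu_sym[OF F])
    also have "fa F (massoc C z y w) \<cdot>\<^bsub>D\<^esub> \<dots> = (fa F (massoc C z y w) \<cdot>\<^bsub>D\<^esub> fmu F (z \<star>\<^bsub>C\<^esub> y) w \<cdot>\<^bsub>D\<^esub> (fmu F z y \<diamondop>\<^bsub>D\<^esub> ?I w)) \<cdot>\<^bsub>D\<^esub>
       (msym D (fo F y) (fo F z) \<diamondop>\<^bsub>D\<^esub> ?I w) \<cdot>\<^bsub>D\<^esub> inv_arr D (massoc D (fo F y) (fo F z) (fo F w))"
      by (simp add: D.assoc)
    also have "\<dots> = \<mu>3 z y w \<cdot>\<^bsub>D\<^esub> swapD (fo F y) (fo F z) (fo F w)"
      by (simp add: assoc3 swapD_def D.assoc)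
    finally show ?thesis .
  qed
  define \<mu>4 where "\<mu>4 x y z w = fmu F x (y \<star>\<^bsub>C\<^esub> (z \<star>\<^bsub>C\<^esub> w)) \<cdot>\<^bsub>D\<^esub> (?I x \<diamondop>\<^bsub>D\<^esub> \<mu>3 y z w)" for x y z w
  have [simp]: "\<mu>4 x y z w \<in> Ar D" "Dom D (\<mu>4 x y z w) = fo F x \<star>\<^bsub>D\<^esub> (fo F y \<star>\<^bsub>D\<^esub> (fo F z \<star>\<^bsub>D\<^esub> fo F w))"
    "Cod D (\<mu>4 x y z w) = fo F (x \<star>\<^bsub>C\<^esub> (y \<star>\<^bsub>C\<^esub> (z \<star>\<^bsub>C\<^esub> w)))"
    if "x \<in> Ob C" "y \<in> Ob C" "z \<in> Ob C" "w \<in> Ob C" for x y z w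
    using that by (simp_all add: \<mu>4_def)
  \<comment> \<open>Relates the constraint for the bracketing in the claim to the right-nested one;
    it is used both before and after the exchange.\<close>
  have assoc4: "fa F (massoc C x y (z \<star>\<^bsub>C\<^esub> w)) \<cdot>\<^bsub>D\<^esub> fmu F (x \<star>\<^bsub>C\<^esub> y) (z \<star>\<^bsub>C\<^esub> w) \<cdot>\<^bsub>D\<^esub> (fmu F x y \<diamondop>\<^bsub>D\<^esub> fmu F z w) =
      \<mu>4 x y z w \<cdot>\<^bsub>D\<^esub> massoc D (fo F x) (fo F y) (fo F z \<star>\<^bsub>D\<^esub> fo F w)"
    if [simp]: "x \<in> Ob C" "y \<in> Ob C" "z \<in> Ob C" "w \<in> Ob C" for x y z w
  proof -
    have "fa F (massoc C x y (z \<star>\<^bsub>C\<^esub> w)) \<cdot>\<^bsub>D\<^esub> fmu F (x \<star>\<^bsub>C\<^esub> y) (z \<star>\<^bsub>C\<^esub> w) \<cdot>\<^bsub>D\<^esub> (fmu F x y \<diamondop>\<^bsub>D\<^esub> fmu F z w) =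
      (fa F (massoc C x y (z \<star>\<^bsub>C\<^esub> w)) \<cdot>\<^bsub>D\<^esub> fmu F (x \<star>\<^bsub>C\<^esub> y) (z \<star>\<^bsub>C\<^esub> w) \<cdot>\<^bsub>D\<^esub> (fmu F x y \<diamondop>\<^bsub>D\<^esub> ?I (z \<star>\<^bsub>C\<^esub> w))) \<cdot>\<^bsub>D\<^esub>
        (ide D (fo F x \<star>\<^bsub>D\<^esub> fo F y) \<diamondop>\<^bsub>D\<^esub> fmu F z w)"
      by (simp add: D.assoc D.tar_merge)
    also have "\<dots> = \<mu>3 x y (z \<star>\<^bsub>C\<^esub> w) \<cdot>\<^bsub>D\<^esub> massoc D (fo F x) (fo F y) (fo F (z \<star>\<^bsub>C\<^esub> w)) \<cdot>\<^bsub>D\<^esub> (ide D (fo F x \<star>\<^bsub>D\<^esub> fo F y) \<diamondop>\<^bsub>D\<^esub> fmu F z w)"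
      by (simp add: assoc3 D.assoc)
    also have "massoc D (fo F x) (fo F y) (fo F (z \<star>\<^bsub>C\<^esub> w)) \<cdot>\<^bsub>D\<^esub> (ide D (fo F x \<star>\<^bsub>D\<^esub> fo F y) \<diamondop>\<^bsub>D\<^esub> fmu F z w) =
       (?I x \<diamondop>\<^bsub>D\<^esub> (?I y \<diamondop>\<^bsub>D\<^esub> fmu F z w)) \<cdot>\<^bsub>D\<^esub> massoc D (fo F x) (fo F y) (fo F z \<star>\<^bsub>D\<^esub> fo F w)"
      using D.massoc_nat[of "?I x" "?I y" "fmu F z w" "fo F x" "fo F y"] by simp
    finally show ?thesis by (simp add: \<mu>4_def \<mu>3_def D.assoc D.tar_merge)
  qed
  let ?x = "fo F x" and ?y = "fo F y" and ?z = "fo F z" and ?w = "fo F w"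
  let ?aD = "massoc D ?x ?y (?z \<star>\<^bsub>D\<^esub> ?w)" and ?aD' = "massoc D ?x ?z (?y \<star>\<^bsub>D\<^esub> ?w)"
  have "fa F (ide C x \<diamondop>\<^bsub>C\<^esub> swap y z w) \<cdot>\<^bsub>D\<^esub> \<mu>4 x y z w \<cdot>\<^bsub>D\<^esub> ?aD =
     fa F (ide C x \<diamondop>\<^bsub>C\<^esub> swap y z w) \<cdot>\<^bsub>D\<^esub> fmu F x (y \<star>\<^bsub>C\<^esub> (z \<star>\<^bsub>C\<^esub> w)) \<cdot>\<^bsub>D\<^esub> (?I x \<diamondop>\<^bsub>D\<^esub> \<mu>3 y z w) \<cdot>\<^bsub>D\<^esub> ?aD"
    by (simp add: \<mu>4_def D.assoc)
  also have "\<dots> = (fmu F x (z \<star>\<^bsub>C\<^esub> (y \<star>\<^bsub>C\<^esub> w)) \<cdot>\<^bsub>D\<^esub> (?I x \<diamondop>\<^bsub>D\<^esub> fa F (swap y z w))) \<cdot>\<^bsub>D\<^esub> (?I x \<diamondop>\<^bsub>D\<^esub> \<mu>3 y z w) \<cdot>\<^bsub>D\<^esub> ?aD"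
    using fmu_natural[OF F, of "ide C x" "swap y z w"] by (intro D.reassoc) simp_all
  also have "\<dots> = \<mu>4 x z y w \<cdot>\<^bsub>D\<^esub> (?I x \<diamondop>\<^bsub>D\<^esub> swapD ?y ?z ?w) \<cdot>\<^bsub>D\<^esub> ?aD"
    by (simp add: D.assoc D.tar_merge swap3 \<mu>4_def)
  finally have sw: "fa F (ide C x \<diamondop>\<^bsub>C\<^esub> swap y z w) \<cdot>\<^bsub>D\<^esub> \<mu>4 x y z w \<cdot>\<^bsub>D\<^esub> ?aD =
     \<mu>4 x z y w \<cdot>\<^bsub>D\<^esub> (?I x \<diamondop>\<^bsub>D\<^esub> swapD ?y ?z ?w) \<cdot>\<^bsub>D\<^esub> ?aD" .
  have a4: "\<mu>4 x z y w = fa F (massoc C x z (y \<star>\<^bsub>C\<^esub> w)) \<cdot>\<^bsub>D\<^esub> fmu F (x \<star>\<^bsub>C\<^esub> z) (y \<star>\<^bsub>C\<^esub> w) \<cdot>\<^bsub>D\<^esub> (fmu F x z \<diamondop>\<^bsub>D\<^esub> fmu F y w) \<cdot>\<^bsub>D\<^esub> inv_arr D ?aD'"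
    using arg_cong[OF assoc4[of x z y w], of "\<lambda>k. k \<cdot>\<^bsub>D\<^esub> inv_arr D ?aD'"]
    by (simp add: D.assoc)
  have "fa F (middle C x y z w) \<cdot>\<^bsub>D\<^esub> fmu F (x \<star>\<^bsub>C\<^esub> y) (z \<star>\<^bsub>C\<^esub> w) \<cdot>\<^bsub>D\<^esub> (fmu F x y \<diamondop>\<^bsub>D\<^esub> fmu F z w) =
     inv_arr D (fa F (massoc C x z (y \<star>\<^bsub>C\<^esub> w))) \<cdot>\<^bsub>D\<^esub> fa F (ide C x \<diamondop>\<^bsub>C\<^esub> swap y z w) \<cdot>\<^bsub>D\<^esub>
      fa F (massoc C x y (z \<star>\<^bsub>C\<^esub> w)) \<cdot>\<^bsub>D\<^esub> fmu F (x \<star>\<^bsub>C\<^esub> y) (z \<star>\<^bsub>C\<^esub> w) \<cdot>\<^bsub>D\<^esub> (fmu F x y \<diamondop>\<^bsub>D\<^esub> fmu F z w)"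
    unfolding middle_def swap_def[symmetric] by (simp add: D.assoc)
  also have "\<dots> = inv_arr D (fa F (massoc C x z (y \<star>\<^bsub>C\<^esub> w))) \<cdot>\<^bsub>D\<^esub> \<mu>4 x z y w \<cdot>\<^bsub>D\<^esub> (?I x \<diamondop>\<^bsub>D\<^esub> swapD ?y ?z ?w) \<cdot>\<^bsub>D\<^esub> ?aD"
    by (simp add: assoc4 sw)
  also have "\<dots> = fmu F (x \<star>\<^bsub>C\<^esub> z) (y \<star>\<^bsub>C\<^esub> w) \<cdot>\<^bsub>D\<^esub> (fmu F x z \<diamondop>\<^bsub>D\<^esub> fmu F y w) \<cdot>\<^bsub>D\<^esub> middle D ?x ?y ?z ?w"
    unfolding middle_def swapD_def[symmetric] a4 by (simp add: D.assoc)
  finally show ?thesis .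
qed

section \<open>Products of symmetric monoidal categories\<close>

text \<open>Arrows are pairs rather than tensors. Their sets carry no chosen module structure, hence
  \<open>HomM = undefined\<close>; the field is present only to reuse the record type.\<close>

definition prod_smcat ::
  "('ao, 'aa, 'r, 'y) smcat_scheme \<Rightarrow> ('bo, 'ba, 's, 'z) smcat_scheme \<Rightarrow> ('ao \<times> 'bo, 'aa \<times> 'ba, 'r) smcat"
where
  "prod_smcat A B =
    \<lparr>Ob = Ob A \<times> Ob B, Ar = Ar A \<times> Ar B,
     Dom = map_prod (Dom A) (Dom B), Cod = map_prod (Cod A) (Cod B),
     Comp = \<lambda>(g, g') (f, f'). (g \<cdot>\<^bsub>A\<^esub> f, g' \<cdot>\<^bsub>B\<^esub> f'), ide = map_prod (ide A) (ide B),
     HomM = undefined,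
     tob = \<lambda>(a, b) (a', b'). (a \<star>\<^bsub>A\<^esub> a', b \<star>\<^bsub>B\<^esub> b'),
     tar = \<lambda>(f, g) (f', g'). (f \<diamondop>\<^bsub>A\<^esub> f', g \<diamondop>\<^bsub>B\<^esub> g'),
     munit = (munit A, munit B),
     massoc = \<lambda>(a, b) (a', b') (a'', b''). (massoc A a a' a'', massoc B b b' b''),
     mlunit = map_prod (mlunit A) (mlunit B), mrunit = map_prod (mrunit A) (mrunit B),
     msym = \<lambda>(a, b) (a', b'). (msym A a a', msym B b b')\<rparr>"

lemma prod_smcat_sel [simp]:
  "Ob (prod_smcat A B) = Ob A \<times> Ob B"
  "Ar (prod_smcat A B) = Ar A \<times> Ar B"
  "Dom (prod_smcat A B) (f, g) = (Dom A f, Dom B g)"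
  "Cod (prod_smcat A B) (f, g) = (Cod A f, Cod B g)"
  "(f', g') \<cdot>\<^bsub>prod_smcat A B\<^esub> (f, g) = (f' \<cdot>\<^bsub>A\<^esub> f, g' \<cdot>\<^bsub>B\<^esub> g)"
  "ide (prod_smcat A B) (a, b) = (ide A a, ide B b)"
  "(a, b) \<star>\<^bsub>prod_smcat A B\<^esub> (a', b') = (a \<star>\<^bsub>A\<^esub> a', b \<star>\<^bsub>B\<^esub> b')"
  "(f, g) \<diamondop>\<^bsub>prod_smcat A B\<^esub> (f', g') = (f \<diamondop>\<^bsub>A\<^esub> f', g \<diamondop>\<^bsub>B\<^esub> g')"
  "munit (prod_smcat A B) = (munit A, munit B)"
  "massoc (prod_smcat A B) (a, b) (a', b') (a'', b'') = (massoc A a a' a'', massoc B b b' b'')"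
  "mlunit (prod_smcat A B) (a, b) = (mlunit A a, mlunit B b)"
  "mrunit (prod_smcat A B) (a, b) = (mrunit A a, mrunit B b)"
  "msym (prod_smcat A B) (a, b) (a', b') = (msym A a a', msym B b b')"
  by (simp_all add: prod_smcat_def)

lemma category_prod_smcat:
  assumes "category A" "category B"
  shows "category (prod_smcat A B)"
proof -
  interpret A: category A by fact
  interpret B: category B by fact
  show ?thesis by unfold_locales (auto simp: Hom_def A.assoc B.assoc)
qed

lemma iso_prod_smcat:
  assumes "category A" "category B"
  shows "iso_arr (prod_smcat A B) (f, g) \<longleftrightarrow> iso_arr A f \<and> iso_arr B g"
    and "iso_arr A f \<Longrightarrow> iso_arr B g \<Longrightarrow> inv_arr (prod_smcat A B) (f, g) = (inv_arr A f, inv_arr B g)"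
proof -
  interpret A: category A by fact
  interpret B: category B by fact
  interpret X: category "prod_smcat A B" by (rule category_prod_smcat) fact+
  show *: "iso_arr (prod_smcat A B) (f, g) \<longleftrightarrow> iso_arr A f \<and> iso_arr B g"
  proof
    assume i: "iso_arr (prod_smcat A B) (f, g)"
    obtain f' g' where fg: "inv_arr (prod_smcat A B) (f, g) = (f', g')" by fastforce
    show "iso_arr A f \<and> iso_arr B g"
      using X.iso_Ar[OF i] X.inv_typed[OF i] X.inv_comp(1,2)[OF i] unfolding fg
      by (auto intro: A.iso_arrI[where g = f'] B.iso_arrI[where g = g'])
  next
    assume "iso_arr A f \<and> iso_arr B g"
    then show "iso_arr (prod_smcat A B) (f, g)"
      by (intro X.iso_arrI[where g = "(inv_arr A f, inv_arr B g)"]) auto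
  qed
  show "iso_arr A f \<Longrightarrow> iso_arr B g \<Longrightarrow> inv_arr (prod_smcat A B) (f, g) = (inv_arr A f, inv_arr B g)"
    by (rule X.inv_eqI) (auto simp: *)
qed

lemma sm_category_prod_smcat:
  assumes "sm_category A" "sm_category B"
  shows "sm_category (prod_smcat A B)"
proof -
  interpret A: sm_category A by fact
  interpret B: sm_category B by fact
  interpret X: category "prod_smcat A B" by (rule category_prod_smcat) unfold_locales
  show ?thesis
    by unfold_locales
      (clarsimp simp: Hom_def is_iso_iff iso_prod_smcat[OF A.category_axioms B.category_axioms]
        A.tar_merge B.tar_merge A.massoc_nat B.massoc_nat A.mlunit_nat B.mlunit_nat A.mrunit_nat B.mrunit_nat
        A.msym_nat B.msym_nat A.pentagon B.pentagon A.triangle B.triangle A.msym_symmetric B.msym_symmetric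
        A.hexagon B.hexagon; fail)+
qed

lemma middle_prod_smcat:
  assumes "sm_category A" "sm_category B"
    and "a \<in> Ob A" "b \<in> Ob B" "a' \<in> Ob A" "b' \<in> Ob B" "a'' \<in> Ob A" "b'' \<in> Ob B" "a''' \<in> Ob A" "b''' \<in> Ob B"
  shows "middle (prod_smcat A B) (a, b) (a', b') (a'', b'') (a''', b''') = (middle A a a' a'' a''', middle B b b' b'' b''')"
proof -
  interpret A: sm_category A by fact
  interpret B: sm_category B by fact
  show ?thesis
    using assms(3-) by (simp add: middle_def iso_prod_smcat[OF A.category_axioms B.category_axioms])
qed

definition tensor_fct :: "('o, 'a, 'r, 'z) smcat_scheme \<Rightarrow> ('o \<times> 'o, 'a \<times> 'a, 'o, 'a) smfct" where
  "tensor_fct C =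
    \<lparr>fo = \<lambda>(x, y). x \<star>\<^bsub>C\<^esub> y, fa = \<lambda>(f, g). f \<diamondop>\<^bsub>C\<^esub> g,
     fmu = \<lambda>(x, y) (z, w). middle C x y z w, feps = inv_arr C (mlunit C (munit C))\<rparr>"

lemma tensor_fct_sel [simp]:
  "fo (tensor_fct C) (x, y) = x \<star>\<^bsub>C\<^esub> y" "fa (tensor_fct C) (f, g) = f \<diamondop>\<^bsub>C\<^esub> g"
  "fmu (tensor_fct C) (x, y) (z, w) = middle C x y z w" "feps (tensor_fct C) = inv_arr C (mlunit C (munit C))"
  by (simp_all add: tensor_fct_def)

text \<open>The axioms are exactly the identities for \<open>middle\<close> established above; this
  is where the symmetry of \<open>C\<close> is essential.\<close>

lemma sm_functor_tensor_fct:
  assumes "sm_category C"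
  shows "sm_functor (prod_smcat C C) C (tensor_fct C)"
proof -
  interpret C: sm_category C by fact
  show ?thesis
    by (rule sm_functorI)
      (auto intro!: functorI simp: C.tar_merge C.middle_nat C.middle_assoc C.middle_left_unit C.middle_right_unit C.middle_sym)
qed

definition prod_smfct ::
  "('ao, 'aa, 'co, 'ca) smfct \<Rightarrow> ('bo, 'ba, 'do, 'da) smfct \<Rightarrow> ('ao \<times> 'bo, 'aa \<times> 'ba, 'co \<times> 'do, 'ca \<times> 'da) smfct"
where
  "prod_smfct F G =
    \<lparr>fo = map_prod (fo F) (fo G), fa = map_prod (fa F) (fa G),
     fmu = \<lambda>(x, y) (z, w). (fmu F x z, fmu G y w), feps = (feps F, feps G)\<rparr>"

lemma prod_smfct_sel [simp]:
  "fo (prod_smfct F G) (x, y) = (fo F x, fo G y)" "fa (prod_smfct F G) (f, g) = (fa F f, fa G g)"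
  "fmu (prod_smfct F G) (x, y) (z, w) = (fmu F x z, fmu G y w)" "feps (prod_smfct F G) = (feps F, feps G)"
  by (simp_all add: prod_smfct_def)

lemma sm_functor_prod_smfct:
  assumes "sm_functor A C F" "sm_functor B D G" "category C" "category D"
  shows "sm_functor (prod_smcat A B) (prod_smcat C D) (prod_smfct F G)"
proof -
  note iF = sm_functor_is_functor[OF assms(1)] and iG = sm_functor_is_functor[OF assms(2)]
  note [simp] = sm_functor_simps[OF assms(1)] functor_simps[OF iF] sm_functor_simps[OF assms(2)] functor_simps[OF iG]
  show ?thesis
    by (rule sm_functorI)
      (auto intro!: functorI simp: iso_prod_smcat[OF assms(3,4)] fmu_natural[OF assms(1)] fmu_natural[OF assms(2)]
        fmu_assoc[OF assms(1)] fmu_assoc[OF assms(2)] fmu_left_unit[OF assms(1)] fmu_left_unit[OF assms(2)]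
        fmu_right_unit[OF assms(1)] fmu_right_unit[OF assms(2)] fmu_sym[OF assms(1)] fmu_sym[OF assms(2)])
qed

text \<open>The version of \<open>incl_left\<close> with pairs of arrows in place of pure
  tensors.\<close>

definition unit_incl_left ::
  "('ao, 'aa, 'r, 'y) smcat_scheme \<Rightarrow> ('bo, 'ba, 's, 'z) smcat_scheme \<Rightarrow> ('ao, 'aa, 'ao \<times> 'bo, 'aa \<times> 'ba) smfct"
where
  "unit_incl_left A B =
    \<lparr>fo = \<lambda>a. (a, munit B), fa = \<lambda>f. (f, ide B (munit B)),
     fmu = \<lambda>a a'. (ide A (a \<star>\<^bsub>A\<^esub> a'), mlunit B (munit B)),
     feps = (ide A (munit A), ide B (munit B))\<rparr>"

definition unit_incl_right ::
  "('ao, 'aa, 'r, 'y) smcat_scheme \<Rightarrow> ('bo, 'ba, 's, 'z) smcat_scheme \<Rightarrow> ('bo, 'ba, 'ao \<times> 'bo, 'aa \<times> 'ba) smfct"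
where
  "unit_incl_right A B =
    \<lparr>fo = \<lambda>b. (munit A, b), fa = \<lambda>g. (ide A (munit A), g),
     fmu = \<lambda>b b'. (mlunit A (munit A), ide B (b \<star>\<^bsub>B\<^esub> b')),
     feps = (ide A (munit A), ide B (munit B))\<rparr>"

lemma unit_incl_sel [simp]:
  "fo (unit_incl_left A B) a = (a, munit B)" "fa (unit_incl_left A B) f = (f, ide B (munit B))"
  "fmu (unit_incl_left A B) a a' = (ide A (a \<star>\<^bsub>A\<^esub> a'), mlunit B (munit B))"
  "feps (unit_incl_left A B) = (ide A (munit A), ide B (munit B))"
  "fo (unit_incl_right A B) b = (munit A, b)" "fa (unit_incl_right A B) g = (ide A (munit A), g)"
  "fmu (unit_incl_right A B) b b' = (mlunit A (munit A), ide B (b \<star>\<^bsub>B\<^esub> b'))"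
  "feps (unit_incl_right A B) = (ide A (munit A), ide B (munit B))"
  by (simp_all add: unit_incl_left_def unit_incl_right_def)

text \<open>One coordinate is trivial; in the other the axioms say that \<open>I\<close> with its
  unitor is a commutative monoid, which is the content of \<open>munit_assoc\<close>,
  \<open>mrunit_munit\<close> and \<open>msym_munit\<close>.\<close>

lemma sm_functor_unit_incl:
  assumes "sm_category A" "sm_category B"
  shows "sm_functor A (prod_smcat A B) (unit_incl_left A B)"
    and "sm_functor B (prod_smcat A B) (unit_incl_right A B)"
proof -
  interpret A: sm_category A by fact
  interpret B: sm_category B by fact
  note iso = iso_prod_smcat[OF A.category_axioms B.category_axioms]
  show "sm_functor A (prod_smcat A B) (unit_incl_left A B)"
    by (rule sm_functorI) (auto intro!: functorI simp: iso B.munit_assoc B.msym_munit B.mrunit_munit)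
  show "sm_functor B (prod_smcat A B) (unit_incl_right A B)"
    by (rule sm_functorI) (auto intro!: functorI simp: iso A.munit_assoc A.msym_munit A.mrunit_munit)
qed

section \<open>Monoidal transformations\<close>

lemma monoidal_nat_transD:
  assumes "monoidal_nat_trans C D F G \<eta>"
  shows "nat_trans C D F G \<eta>"
    and "x \<in> Ob C \<Longrightarrow> y \<in> Ob C \<Longrightarrow> \<eta> (x \<star>\<^bsub>C\<^esub> y) \<cdot>\<^bsub>D\<^esub> fmu F x y = fmu G x y \<cdot>\<^bsub>D\<^esub> (\<eta> x \<diamondop>\<^bsub>D\<^esub> \<eta> y)"
    and "\<eta> (munit C) \<cdot>\<^bsub>D\<^esub> feps F = feps G"
  using assms by (auto simp: monoidal_nat_trans_def)

lemma monoidal_nat_transI: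
  assumes "nat_trans C D F G \<eta>"
    and "\<And>x y. x \<in> Ob C \<Longrightarrow> y \<in> Ob C \<Longrightarrow> \<eta> (x \<star>\<^bsub>C\<^esub> y) \<cdot>\<^bsub>D\<^esub> fmu F x y = fmu G x y \<cdot>\<^bsub>D\<^esub> (\<eta> x \<diamondop>\<^bsub>D\<^esub> \<eta> y)"
    and "\<eta> (munit C) \<cdot>\<^bsub>D\<^esub> feps F = feps G"
  shows "monoidal_nat_trans C D F G \<eta>"
  using assms by (auto simp: monoidal_nat_trans_def)

lemma monoidal_nat_trans_whisker:
  assumes C: "sm_category C" and D: "sm_category D" and E: "sm_category E"
    and K: "sm_functor C D K" and F: "sm_functor D E F" and G: "sm_functor D E G"
    and \<eta>: "monoidal_nat_trans D E F G \<eta>"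
  shows "monoidal_nat_trans C E (comp_smfct E F K) (comp_smfct E G K) (\<lambda>x. \<eta> (fo K x))"
proof -
  interpret C: sm_category C by fact
  interpret D: sm_category D by fact
  interpret E: sm_category E by fact
  note iK = sm_functor_is_functor[OF K] and iF = sm_functor_is_functor[OF F] and iG = sm_functor_is_functor[OF G]
  note \<eta>n = monoidal_nat_transD(1)[OF \<eta>]
  note [simp] = sm_functor_simps[OF K] functor_simps[OF iK] sm_functor_simps[OF F] functor_simps[OF iF]
    sm_functor_simps[OF G] functor_simps[OF iG] nat_trans_simps[OF \<eta>n]
  show ?thesis
  proof (rule monoidal_nat_transI)
    show "nat_trans C E (comp_smfct E F K) (comp_smfct E G K) (\<lambda>x. \<eta> (fo K x))"
      by (rule nat_trans_cong[OF nat_trans_whisker[OF \<eta>n iK] C.category_axioms]) simp_all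
  next
    fix x y assume [simp]: "x \<in> Ob C" "y \<in> Ob C"
    have "\<eta> (fo K (x \<star>\<^bsub>C\<^esub> y)) \<cdot>\<^bsub>E\<^esub> fa F (fmu K x y) \<cdot>\<^bsub>E\<^esub> fmu F (fo K x) (fo K y) =
       (fa G (fmu K x y) \<cdot>\<^bsub>E\<^esub> \<eta> (fo K x \<star>\<^bsub>D\<^esub> fo K y)) \<cdot>\<^bsub>E\<^esub> fmu F (fo K x) (fo K y)"
      using nat_trans_natural[OF \<eta>n, of "fmu K x y"] by (intro E.reassoc) simp_all
    also have "\<dots> = fa G (fmu K x y) \<cdot>\<^bsub>E\<^esub> fmu G (fo K x) (fo K y) \<cdot>\<^bsub>E\<^esub> (\<eta> (fo K x) \<diamondop>\<^bsub>E\<^esub> \<eta> (fo K y))"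
      by (simp add: E.assoc monoidal_nat_transD(2)[OF \<eta>])
    finally show "\<eta> (fo K (x \<star>\<^bsub>C\<^esub> y)) \<cdot>\<^bsub>E\<^esub> fmu (comp_smfct E F K) x y =
        fmu (comp_smfct E G K) x y \<cdot>\<^bsub>E\<^esub> (\<eta> (fo K x) \<diamondop>\<^bsub>E\<^esub> \<eta> (fo K y))"
      by (simp add: E.assoc)
  next
    have "\<eta> (fo K (munit C)) \<cdot>\<^bsub>E\<^esub> fa F (feps K) \<cdot>\<^bsub>E\<^esub> feps F = (fa G (feps K) \<cdot>\<^bsub>E\<^esub> \<eta> (munit D)) \<cdot>\<^bsub>E\<^esub> feps F"
      using nat_trans_natural[OF \<eta>n, of "feps K"] by (intro E.reassoc) simp_all
    then show "\<eta> (fo K (munit C)) \<cdot>\<^bsub>E\<^esub> feps (comp_smfct E F K) = feps (comp_smfct E G K)"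
      by (simp add: E.assoc monoidal_nat_transD(3)[OF \<eta>])
  qed
qed

lemma monoidal_nat_trans_cong:
  assumes \<eta>: "monoidal_nat_trans C D F G \<eta>" and C: "sm_category C"
    and "\<And>x. x \<in> Ob C \<Longrightarrow> fo F x = fo F' x" "\<And>f. f \<in> Ar C \<Longrightarrow> fa F f = fa F' f"
      "\<And>x y. x \<in> Ob C \<Longrightarrow> y \<in> Ob C \<Longrightarrow> fmu F x y = fmu F' x y" "feps F = feps F'"
    and "\<And>x. x \<in> Ob C \<Longrightarrow> fo G x = fo G' x" "\<And>f. f \<in> Ar C \<Longrightarrow> fa G f = fa G' f"
      "\<And>x y. x \<in> Ob C \<Longrightarrow> y \<in> Ob C \<Longrightarrow> fmu G x y = fmu G' x y" "feps G = feps G'"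
    and "\<And>x. x \<in> Ob C \<Longrightarrow> \<eta> x = \<eta>' x"
  shows "monoidal_nat_trans C D F' G' \<eta>'"
proof -
  interpret C: sm_category C by fact
  show ?thesis
  proof (rule monoidal_nat_transI)
    show "nat_trans C D F' G' \<eta>'"
      by (rule nat_trans_cong[OF monoidal_nat_transD(1)[OF \<eta>] C.category_axioms]) (use assms in auto)
  qed (use monoidal_nat_transD(2,3)[OF \<eta>] assms(3-) in auto)
qed

lemma monoidal_nat_trans_ide:
  assumes "sm_category C" "sm_category D" "sm_functor C D F"
  shows "monoidal_nat_trans C D F F (\<lambda>x. ide D (fo F x))"
proof -
  interpret C: sm_category C by fact
  interpret D: sm_category D by fact
  note iF = sm_functor_is_functor[OF assms(3)]
  note [simp] = sm_functor_simps[OF assms(3)] functor_simps[OF iF]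
  show ?thesis by (intro monoidal_nat_transI nat_transI) simp_all
qed

lemma monoidal_nat_trans_vcomp:
  assumes C: "sm_category C" and D: "sm_category D"
    and F: "sm_functor C D F" and G: "sm_functor C D G" and H: "sm_functor C D H"
    and \<eta>: "monoidal_nat_trans C D F G \<eta>" and \<theta>: "monoidal_nat_trans C D G H \<theta>"
  shows "monoidal_nat_trans C D F H (\<lambda>x. \<theta> x \<cdot>\<^bsub>D\<^esub> \<eta> x)"
proof -
  interpret C: sm_category C by fact
  interpret D: sm_category D by fact
  note iF = sm_functor_is_functor[OF F] and iG = sm_functor_is_functor[OF G] and iH = sm_functor_is_functor[OF H]
  note \<eta>n = monoidal_nat_transD(1)[OF \<eta>] and \<theta>n = monoidal_nat_transD(1)[OF \<theta>]
  note [simp] = sm_functor_simps[OF F] functor_simps[OF iF] sm_functor_simps[OF G] functor_simps[OF iG]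
    sm_functor_simps[OF H] functor_simps[OF iH] nat_trans_simps[OF \<eta>n] nat_trans_simps[OF \<theta>n]
  show ?thesis
  proof (rule monoidal_nat_transI)
    show "nat_trans C D F H (\<lambda>x. \<theta> x \<cdot>\<^bsub>D\<^esub> \<eta> x)"
      by (rule nat_trans_vcomp[OF \<eta>n \<theta>n C.category_axioms D.category_axioms iF iG iH])
  next
    fix x y assume [simp]: "x \<in> Ob C" "y \<in> Ob C"
    have "\<theta> (x \<star>\<^bsub>C\<^esub> y) \<cdot>\<^bsub>D\<^esub> \<eta> (x \<star>\<^bsub>C\<^esub> y) \<cdot>\<^bsub>D\<^esub> fmu F x y = (\<theta> (x \<star>\<^bsub>C\<^esub> y) \<cdot>\<^bsub>D\<^esub> fmu G x y) \<cdot>\<^bsub>D\<^esub> (\<eta> x \<diamondop>\<^bsub>D\<^esub> \<eta> y)"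
      by (simp add: D.assoc monoidal_nat_transD(2)[OF \<eta>])
    also have "\<dots> = fmu H x y \<cdot>\<^bsub>D\<^esub> ((\<theta> x \<cdot>\<^bsub>D\<^esub> \<eta> x) \<diamondop>\<^bsub>D\<^esub> (\<theta> y \<cdot>\<^bsub>D\<^esub> \<eta> y))"
      by (simp add: D.assoc monoidal_nat_transD(2)[OF \<theta>] D.tar_merge)
    finally show "(\<theta> (x \<star>\<^bsub>C\<^esub> y) \<cdot>\<^bsub>D\<^esub> \<eta> (x \<star>\<^bsub>C\<^esub> y)) \<cdot>\<^bsub>D\<^esub> fmu F x y =
        fmu H x y \<cdot>\<^bsub>D\<^esub> ((\<theta> x \<cdot>\<^bsub>D\<^esub> \<eta> x) \<diamondop>\<^bsub>D\<^esub> (\<theta> y \<cdot>\<^bsub>D\<^esub> \<eta> y))"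
      by (simp add: D.assoc)
  next
    show "(\<theta> (munit C) \<cdot>\<^bsub>D\<^esub> \<eta> (munit C)) \<cdot>\<^bsub>D\<^esub> feps F = feps H"
      by (simp add: D.assoc monoidal_nat_transD(3)[OF \<eta>] monoidal_nat_transD(3)[OF \<theta>])
  qed
qed

lemma monoidal_nat_trans_inv:
  assumes C: "sm_category C" and D: "sm_category D"
    and F: "sm_functor C D F" and G: "sm_functor C D G"
    and \<eta>: "monoidal_nat_trans C D F G \<eta>" and iso: "\<And>x. x \<in> Ob C \<Longrightarrow> iso_arr D (\<eta> x)"
  shows "monoidal_nat_trans C D G F (\<lambda>x. inv_arr D (\<eta> x))"
proof -
  interpret C: sm_category C by fact
  interpret D: sm_category D by fact
  note iF = sm_functor_is_functor[OF F] and iG = sm_functor_is_functor[OF G]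
  note \<eta>n = monoidal_nat_transD(1)[OF \<eta>]
  note [simp] = sm_functor_simps[OF F] functor_simps[OF iF] sm_functor_simps[OF G] functor_simps[OF iG]
    nat_trans_simps[OF \<eta>n] iso
  show ?thesis
  proof (rule monoidal_nat_transI)
    show "nat_trans C D G F (\<lambda>x. inv_arr D (\<eta> x))"
      by (rule nat_trans_inv[OF \<eta>n C.category_axioms D.category_axioms iF iG iso])
  next
    fix x y assume [simp]: "x \<in> Ob C" "y \<in> Ob C"
    have "fmu F x y \<cdot>\<^bsub>D\<^esub> inv_arr D (\<eta> x \<diamondop>\<^bsub>D\<^esub> \<eta> y) = inv_arr D (\<eta> (x \<star>\<^bsub>C\<^esub> y)) \<cdot>\<^bsub>D\<^esub> fmu G x y"
      by (rule D.swap_inv) (simp_all add: monoidal_nat_transD(2)[OF \<eta>])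
    then show "inv_arr D (\<eta> (x \<star>\<^bsub>C\<^esub> y)) \<cdot>\<^bsub>D\<^esub> fmu G x y = fmu F x y \<cdot>\<^bsub>D\<^esub> (inv_arr D (\<eta> x) \<diamondop>\<^bsub>D\<^esub> inv_arr D (\<eta> y))"
      by simp
  next
    show "inv_arr D (\<eta> (munit C)) \<cdot>\<^bsub>D\<^esub> feps G = feps F"
      by (simp add: monoidal_nat_transD(3)[OF \<eta>, symmetric])
  qed
qed

section \<open>Monoidal functors out of a product\<close>

locale sm_pair = A: sm_category A + B: sm_category B + C: sm_category C
  for A :: "('ao, 'aa, 'r, 'u) smcat_scheme" and B :: "('bo, 'ba, 'r, 'v) smcat_scheme"
    and C :: "('co, 'ca, 'r, 'w) smcat_scheme" (structure)
begin

abbreviation "X \<equiv> prod_smcat A B"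

sublocale X: sm_category X
  by (rule sm_category_prod_smcat) unfold_locales

lemmas iso_X = iso_prod_smcat[OF A.category_axioms B.category_axioms]

abbreviation left_part :: "('ao \<times> 'bo, 'aa \<times> 'ba, 'co, 'ca) smfct \<Rightarrow> ('ao, 'aa, 'co, 'ca) smfct" where
  "left_part E \<equiv> comp_smfct C E (unit_incl_left A B)"

abbreviation right_part :: "('ao \<times> 'bo, 'aa \<times> 'ba, 'co, 'ca) smfct \<Rightarrow> ('bo, 'ba, 'co, 'ca) smfct" where
  "right_part E \<equiv> comp_smfct C E (unit_incl_right A B)"

text \<open>
  \<open>split_iso E a b : E (a, I) \<star> E (I, b) \<rightarrow> E (a, b)\<close> exhibits a monoidal functor on the product as
  determined by its restrictions to the two factors.
\<close>

definition split_iso :: "('ao \<times> 'bo, 'aa \<times> 'ba, 'co, 'ca) smfct \<Rightarrow> 'ao \<Rightarrow> 'bo \<Rightarrow> 'ca" where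
  "split_iso E a b = fa E (mrunit A a, mlunit B b) \<cdot> fmu E (a, munit B) (munit A, b)"

context
  fixes E assumes E: "sm_functor X C E"
begin

private lemmas iE = sm_functor_is_functor[OF E]
private lemmas E_simps [simp] = sm_functor_simps[OF E] functor_simps[OF iE]
  functor_iso(1)[OF iE X.category_axioms C.category_axioms] iso_X(1)

lemma split_iso_typed [simp]:
  assumes "a \<in> Ob A" "b \<in> Ob B"
  shows "iso_arr C (split_iso E a b)" "split_iso E a b \<in> Ar C"
    "Dom C (split_iso E a b) = fo E (a, munit B) \<star> fo E (munit A, b)" "Cod C (split_iso E a b) = fo E (a, b)"
  using assms by (simp_all add: split_iso_def)

text \<open>Naturality of the unitors in \<open>A\<close> and \<open>B\<close> combined with
  naturality of \<open>fmu E\<close>.\<close>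

lemma split_iso_natural:
  assumes [simp]: "f \<in> Ar A" "g \<in> Ar B"
  shows "fa E (f, g) \<cdot> split_iso E (Dom A f) (Dom B g) =
    split_iso E (Cod A f) (Cod B g) \<cdot> (fa E (f, ide B (munit B)) \<diamondop> fa E (ide A (munit A), g))"
proof -
  let ?a = "Dom A f" and ?b = "Dom B g" and ?a' = "Cod A f" and ?b' = "Cod B g"
  have "fa E (f, g) \<cdot> split_iso E ?a ?b = fa E ((f, g) \<cdot>\<^bsub>X\<^esub> (mrunit A ?a, mlunit B ?b)) \<cdot> fmu E (?a, munit B) (munit A, ?b)"
    unfolding split_iso_def by (subst functor_simps(6)[OF iE]) (simp_all add: C.assoc)
  also have "(f, g) \<cdot>\<^bsub>X\<^esub> (mrunit A ?a, mlunit B ?b) = (mrunit A ?a', mlunit B ?b') \<cdot>\<^bsub>X\<^esub> ((f, ide B (munit B)) \<diamondop>\<^bsub>X\<^esub> (ide A (munit A), g))"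
    by (simp add: A.mrunit_nat B.mlunit_nat)
  also have "fa E \<dots> \<cdot> fmu E (?a, munit B) (munit A, ?b) =
     fa E (mrunit A ?a', mlunit B ?b') \<cdot> fa E ((f, ide B (munit B)) \<diamondop>\<^bsub>X\<^esub> (ide A (munit A), g)) \<cdot> fmu E (?a, munit B) (munit A, ?b)"
    by (subst functor_simps(6)[OF iE]) (simp_all add: C.assoc)
  also have "fa E ((f, ide B (munit B)) \<diamondop>\<^bsub>X\<^esub> (ide A (munit A), g)) \<cdot> fmu E (?a, munit B) (munit A, ?b) =
     fmu E (?a', munit B) (munit A, ?b') \<cdot> (fa E (f, ide B (munit B)) \<diamondop> fa E (ide A (munit A), g))"
    using fmu_natural[OF E, of "(f, ide B (munit B))" "(ide A (munit A), g)"] by simp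
  finally show ?thesis by (simp add: split_iso_def C.assoc)
qed

text \<open>\<open>fmu_middle\<close> for the four objects
  \<open>(a, I), (I, b), (a', I), (I, b')\<close> moves the comparison into the product category,
  where an identity between unit constraints remains. This formula is what makes a transformation
  built from two restrictions monoidal.\<close>

lemma split_iso_fmu:
  assumes [simp]: "a \<in> Ob A" "b \<in> Ob B" "a' \<in> Ob A" "b' \<in> Ob B"
  shows "fmu E (a, b) (a', b') \<cdot> (split_iso E a b \<diamondop> split_iso E a' b') =
    split_iso E (a \<star>\<^bsub>A\<^esub> a') (b \<star>\<^bsub>B\<^esub> b') \<cdot> (fmu (left_part E) a a' \<diamondop> fmu (right_part E) b b') \<cdot>
     middle C (fo E (a, munit B)) (fo E (munit A, b)) (fo E (a', munit B)) (fo E (munit A, b'))"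
proof -
  let ?I = "munit A" and ?J = "munit B"
  let ?x = "(a, ?J)" and ?y = "(?I, b)" and ?x' = "(a', ?J)" and ?y' = "(?I, b')"
  let ?l = "(ide A (a \<star>\<^bsub>A\<^esub> a'), mlunit B ?J)" and ?r = "(mlunit A ?I, ide B (b \<star>\<^bsub>B\<^esub> b'))"
  let ?m = "middle C (fo E ?x) (fo E ?y) (fo E ?x') (fo E ?y')"
  let ?\<mu>\<mu> = "fmu E ?x ?x' \<diamondop> fmu E ?y ?y'"
  let ?xx = "(a \<star>\<^bsub>A\<^esub> a', ?J \<star>\<^bsub>B\<^esub> ?J)" and ?yy = "(?I \<star>\<^bsub>A\<^esub> ?I, b \<star>\<^bsub>B\<^esub> b')"
  let ?u = "(mrunit A (a \<star>\<^bsub>A\<^esub> a'), mlunit B (b \<star>\<^bsub>B\<^esub> b'))"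
  let ?mX = "(middle A a ?I a' ?I, middle B ?J b ?J b')"
  let ?v = "(mrunit A a, mlunit B b)" and ?v' = "(mrunit A a', mlunit B b')"
  have 1: "fmu E (a \<star>\<^bsub>A\<^esub> a', ?J) (?I, b \<star>\<^bsub>B\<^esub> b') \<cdot> (fa E ?l \<diamondop> fa E ?r) \<cdot> ?\<mu>\<mu> \<cdot> ?m =
      (fa E (?l \<diamondop>\<^bsub>X\<^esub> ?r) \<cdot> fmu E ?xx ?yy) \<cdot> ?\<mu>\<mu> \<cdot> ?m"
    using fmu_natural[OF E, of ?l ?r] by (intro C.reassoc) simp_all
  have 2: "fmu E ?xx ?yy \<cdot> ?\<mu>\<mu> \<cdot> ?m = fa E ?mX \<cdot> fmu E (?x \<star>\<^bsub>X\<^esub> ?y) (?x' \<star>\<^bsub>X\<^esub> ?y') \<cdot> (fmu E ?x ?y \<diamondop> fmu E ?x' ?y')"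
    using fmu_middle[OF X.sm_category_axioms C.sm_category_axioms E, of ?x ?y ?x' ?y']
    by (simp add: middle_prod_smcat[OF A.sm_category_axioms B.sm_category_axioms])
  \<comment> \<open>Coordinatewise this is \<open>middle_unit_right\<close> in \<open>A\<close> and
    \<open>middle_unit_left\<close> in \<open>B\<close>.\<close>
  have 3: "?u \<cdot>\<^bsub>X\<^esub> (?l \<diamondop>\<^bsub>X\<^esub> ?r) \<cdot>\<^bsub>X\<^esub> ?mX = ?v \<diamondop>\<^bsub>X\<^esub> ?v'"
    by (simp add: A.middle_unit_right B.middle_unit_left)
  have 4: "fa E ?u \<cdot> fa E (?l \<diamondop>\<^bsub>X\<^esub> ?r) \<cdot> fa E ?mX \<cdot> fmu E (?x \<star>\<^bsub>X\<^esub> ?y) (?x' \<star>\<^bsub>X\<^esub> ?y') \<cdot> (fmu E ?x ?y \<diamondop> fmu E ?x' ?y') =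
      fa E (?u \<cdot>\<^bsub>X\<^esub> (?l \<diamondop>\<^bsub>X\<^esub> ?r) \<cdot>\<^bsub>X\<^esub> ?mX) \<cdot> fmu E (?x \<star>\<^bsub>X\<^esub> ?y) (?x' \<star>\<^bsub>X\<^esub> ?y') \<cdot> (fmu E ?x ?y \<diamondop> fmu E ?x' ?y')"
    by (subst functor_simps(6)[OF iE], simp, simp, simp, subst functor_simps(6)[OF iE]) (simp_all add: C.assoc)
  have 5: "fa E (?v \<diamondop>\<^bsub>X\<^esub> ?v') \<cdot> fmu E (?x \<star>\<^bsub>X\<^esub> ?y) (?x' \<star>\<^bsub>X\<^esub> ?y') \<cdot> (fmu E ?x ?y \<diamondop> fmu E ?x' ?y') =
      (fmu E (a, b) (a', b') \<cdot> (fa E ?v \<diamondop> fa E ?v')) \<cdot> (fmu E ?x ?y \<diamondop> fmu E ?x' ?y')"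
    using fmu_natural[OF E, of ?v ?v'] by (intro C.reassoc) simp_all
  have "split_iso E (a \<star>\<^bsub>A\<^esub> a') (b \<star>\<^bsub>B\<^esub> b') \<cdot> (fmu (left_part E) a a' \<diamondop> fmu (right_part E) b b') \<cdot> ?m =
     fa E ?u \<cdot> fmu E (a \<star>\<^bsub>A\<^esub> a', ?J) (?I, b \<star>\<^bsub>B\<^esub> b') \<cdot> (fa E ?l \<diamondop> fa E ?r) \<cdot> ?\<mu>\<mu> \<cdot> ?m"
    by (simp add: split_iso_def C.assoc C.tar_merge)
  also have "\<dots> = fa E ?u \<cdot> fa E (?l \<diamondop>\<^bsub>X\<^esub> ?r) \<cdot> fmu E ?xx ?yy \<cdot> ?\<mu>\<mu> \<cdot> ?m"
    unfolding 1 by (simp add: C.assoc)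
  also have "\<dots> = (fmu E (a, b) (a', b') \<cdot> (fa E ?v \<diamondop> fa E ?v')) \<cdot> (fmu E ?x ?y \<diamondop> fmu E ?x' ?y')"
    unfolding 2 4 3 5 ..
  also have "\<dots> = fmu E (a, b) (a', b') \<cdot> (split_iso E a b \<diamondop> split_iso E a' b')"
    by (simp add: split_iso_def C.assoc C.tar_merge)
  finally show ?thesis ..
qed

text \<open>At \<open>a = I\<close> both unitors in \<open>split_iso\<close> are left unitors, by
  \<open>mrunit_munit\<close>, and the left unit axiom of \<open>E\<close> applies.\<close>

lemma split_iso_left_unit:
  assumes [simp]: "b \<in> Ob B"
  shows "split_iso E (munit A) b \<cdot> (feps E \<diamondop> ide C (fo E (munit A, b))) = mlunit C (fo E (munit A, b))"
  using fmu_left_unit[OF E, of "(munit A, b)"] by (simp add: split_iso_def C.assoc A.mrunit_munit)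

lemma split_iso_right_unit:
  assumes [simp]: "a \<in> Ob A"
  shows "split_iso E a (munit B) \<cdot> (ide C (fo E (a, munit B)) \<diamondop> feps E) = mrunit C (fo E (a, munit B))"
  using fmu_right_unit[OF E, of "(a, munit B)"] by (simp add: split_iso_def C.assoc B.mrunit_munit)

lemma split_iso_unit:
  "split_iso E (munit A) (munit B) \<cdot> (feps E \<diamondop> feps E) = feps E \<cdot> mlunit C (munit C)"
proof -
  have "split_iso E (munit A) (munit B) \<cdot> (feps E \<diamondop> feps E) =
     (split_iso E (munit A) (munit B) \<cdot> (feps E \<diamondop> ide C (fo E (munit A, munit B)))) \<cdot> (ide C (munit C) \<diamondop> feps E)"
    by (simp add: C.assoc C.tar_merge)
  then show ?thesis by (simp add: split_iso_left_unit C.mlunit_nat)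
qed

lemma sm_functor_left_part: "sm_functor A C (left_part E)"
  by (rule sm_functor_comp[OF _ _ _ sm_functor_unit_incl(1) E]) unfold_locales

lemma sm_functor_right_part: "sm_functor B C (right_part E)"
  by (rule sm_functor_comp[OF _ _ _ sm_functor_unit_incl(2) E]) unfold_locales

end

section \<open>Monoidal transformations on the product and their restrictions\<close>

context
  fixes E E' assumes E: "sm_functor X C E" and E': "sm_functor X C E'"
begin

private lemmas i1 = sm_functor_is_functor[OF E] and i2 = sm_functor_is_functor[OF E']
private lemmas EE_simps [simp] = sm_functor_simps[OF E] functor_simps[OF i1] sm_functor_simps[OF E'] functor_simps[OF i2]
  split_iso_typed[OF E] split_iso_typed[OF E']

text \<open>Naturality at the pair of unitors followed by compatibility with \<open>fmu\<close>. As
  \<open>split_iso\<close> is invertible, the values of \<open>\<theta>\<close> are forced by its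
  two restrictions.\<close>

lemma monoidal_trans_split:
  assumes \<theta>: "monoidal_nat_trans X C E E' \<theta>" and [simp]: "a \<in> Ob A" "b \<in> Ob B"
  shows "\<theta> (a, b) \<cdot> split_iso E a b = split_iso E' a b \<cdot> (\<theta> (a, munit B) \<diamondop> \<theta> (munit A, b))"
proof -
  note \<theta>n = monoidal_nat_transD(1)[OF \<theta>]
  note [simp] = nat_trans_simps[OF \<theta>n]
  have "\<theta> (a, b) \<cdot> split_iso E a b = (fa E' (mrunit A a, mlunit B b) \<cdot> \<theta> (a \<star>\<^bsub>A\<^esub> munit A, munit B \<star>\<^bsub>B\<^esub> b)) \<cdot> fmu E (a, munit B) (munit A, b)"
    unfolding split_iso_def using nat_trans_natural[OF \<theta>n, of "(mrunit A a, mlunit B b)"] by (intro C.reassoc) simp_all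
  then show ?thesis
    using monoidal_nat_transD(2)[OF \<theta>, of "(a, munit B)" "(munit A, b)"] by (simp add: split_iso_def C.assoc)
qed

lemma monoidal_trans_eqI:
  assumes \<theta>: "monoidal_nat_trans X C E E' \<theta>" and \<theta>': "monoidal_nat_trans X C E E' \<theta>'"
    and "\<And>a. a \<in> Ob A \<Longrightarrow> \<theta> (a, munit B) = \<theta>' (a, munit B)" "\<And>b. b \<in> Ob B \<Longrightarrow> \<theta> (munit A, b) = \<theta>' (munit A, b)"
    and x: "x \<in> Ob X"
  shows "\<theta> x = \<theta>' x"
proof -
  note [simp] = nat_trans_simps[OF monoidal_nat_transD(1)[OF \<theta>]] nat_trans_simps[OF monoidal_nat_transD(1)[OF \<theta>']]
  obtain a b where [simp]: "x = (a, b)" "a \<in> Ob A" "b \<in> Ob B" using x by auto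
  have "\<theta> x \<cdot> split_iso E a b = \<theta>' x \<cdot> split_iso E a b"
    using monoidal_trans_split[OF \<theta>, of a b] monoidal_trans_split[OF \<theta>', of a b] assms(3,4) by simp
  then show ?thesis by (rule C.iso_cancel_right[rotated -1]) simp_all
qed

text \<open>The formula in \<open>monoidal_trans_split\<close> dictates \<open>\<theta>\<close>.
  Every property is then verified after composition with an isomorphism built from
  \<open>split_iso E\<close> or a unitor.\<close>

lemma monoidal_trans_extend:
  assumes \<alpha>: "monoidal_nat_trans A C (left_part E) (left_part E') \<alpha>"
    and \<beta>: "monoidal_nat_trans B C (right_part E) (right_part E') \<beta>"
  shows "\<exists>\<theta>. monoidal_nat_trans X C E E' \<theta> \<and>
    (\<forall>a\<in>Ob A. \<theta> (a, munit B) = \<alpha> a) \<and> (\<forall>b\<in>Ob B. \<theta> (munit A, b) = \<beta> b)"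
proof -
  note \<alpha>n = monoidal_nat_transD(1)[OF \<alpha>] and \<beta>n = monoidal_nat_transD(1)[OF \<beta>]
  note [simp] = nat_trans_simps[OF \<alpha>n, simplified] nat_trans_simps[OF \<beta>n, simplified]
  \<comment> \<open>The only possible value, by \<open>monoidal_trans_split\<close>.\<close>
  define \<theta> where "\<theta> x = split_iso E' (fst x) (snd x) \<cdot> (\<alpha> (fst x) \<diamondop> \<beta> (snd x)) \<cdot> inv_arr C (split_iso E (fst x) (snd x))" for x
  have [simp]: "\<theta> (a, b) \<in> Ar C" "Dom C (\<theta> (a, b)) = fo E (a, b)" "Cod C (\<theta> (a, b)) = fo E' (a, b)"
    if "a \<in> Ob A" "b \<in> Ob B" for a b using that by (simp_all add: \<theta>_def)
  have \<theta>s: "\<theta> (a, b) \<cdot> split_iso E a b = split_iso E' a b \<cdot> (\<alpha> a \<diamondop> \<beta> b)" if "a \<in> Ob A" "b \<in> Ob B" for a b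
    using that by (simp add: \<theta>_def C.assoc)
  have \<alpha>\<epsilon>: "\<alpha> (munit A) \<cdot> feps E = feps E'" and \<beta>\<epsilon>: "\<beta> (munit B) \<cdot> feps E = feps E'"
    using monoidal_nat_transD(3)[OF \<alpha>] monoidal_nat_transD(3)[OF \<beta>]
      functor_simps(5)[OF i1, of "(munit A, munit B)"] functor_simps(5)[OF i2, of "(munit A, munit B)"] by simp_all
  have "nat_trans X C E E' \<theta>"
  proof (rule nat_transI)
    fix h assume "h \<in> Ar X"
    then obtain f g where [simp]: "h = (f, g)" "f \<in> Ar A" "g \<in> Ar B" by auto
    let ?a = "Dom A f" and ?b = "Dom B g" and ?a' = "Cod A f" and ?b' = "Cod B g"
    let ?f = "fa E (f, ide B (munit B))" and ?g = "fa E (ide A (munit A), g)"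
    have "(fa E' h \<cdot> \<theta> (?a, ?b)) \<cdot> split_iso E ?a ?b = fa E' h \<cdot> split_iso E' ?a ?b \<cdot> (\<alpha> ?a \<diamondop> \<beta> ?b)"
      by (simp add: C.assoc \<theta>s)
    also have "\<dots> = (split_iso E' ?a' ?b' \<cdot> (fa E' (f, ide B (munit B)) \<diamondop> fa E' (ide A (munit A), g))) \<cdot> (\<alpha> ?a \<diamondop> \<beta> ?b)"
      using split_iso_natural[OF E', of f g] by (intro C.reassoc) simp_all
    also have "\<dots> = split_iso E' ?a' ?b' \<cdot> (\<alpha> ?a' \<diamondop> \<beta> ?b') \<cdot> (?f \<diamondop> ?g)"
      using nat_trans_natural[OF \<alpha>n, of f] nat_trans_natural[OF \<beta>n, of g] by (simp add: C.assoc C.tar_merge)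
    also have "\<dots> = (\<theta> (?a', ?b') \<cdot> split_iso E ?a' ?b') \<cdot> (?f \<diamondop> ?g)"
      by (simp add: \<theta>s C.assoc)
    also have "\<dots> = (\<theta> (?a', ?b') \<cdot> fa E h) \<cdot> split_iso E ?a ?b"
      using split_iso_natural[OF E, of f g] by (simp add: C.assoc)
    finally have "fa E' h \<cdot> \<theta> (?a, ?b) = \<theta> (?a', ?b') \<cdot> fa E h"
      by (rule C.iso_cancel_right[rotated -1]) simp_all
    then show "fa E' h \<cdot> \<theta> (Dom X h) = \<theta> (Cod X h) \<cdot> fa E h" by simp
  qed auto
  moreover have "\<theta> ((a, b) \<star>\<^bsub>X\<^esub> (a', b')) \<cdot> fmu E (a, b) (a', b') = fmu E' (a, b) (a', b') \<cdot> (\<theta> (a, b) \<diamondop> \<theta> (a', b'))"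
    if [simp]: "a \<in> Ob A" "b \<in> Ob B" "a' \<in> Ob A" "b' \<in> Ob B" for a b a' b'
  proof -
    let ?s = "split_iso E" and ?s' = "split_iso E'"
    let ?aa = "a \<star>\<^bsub>A\<^esub> a'" and ?bb = "b \<star>\<^bsub>B\<^esub> b'" and ?I = "munit A" and ?J = "munit B"
    let ?m = "middle C (fo E (a, ?J)) (fo E (?I, b)) (fo E (a', ?J)) (fo E (?I, b'))"
    let ?m' = "middle C (fo E' (a, ?J)) (fo E' (?I, b)) (fo E' (a', ?J)) (fo E' (?I, b'))"
    let ?L = "fmu (left_part E) a a'" and ?R = "fmu (right_part E) b b'"
    let ?L' = "fmu (left_part E') a a'" and ?R' = "fmu (right_part E') b b'"
    \<comment> \<open>Keeping the constraints of \<open>left_part\<close> and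
      \<open>right_part\<close> folded lets them be handled as single arrows.\<close>
    note [simp del] = comp_smfct_sel(3)
    note [simp] = sm_functor_simps[OF sm_functor_left_part[OF E], simplified]
      sm_functor_simps[OF sm_functor_left_part[OF E'], simplified]
      sm_functor_simps[OF sm_functor_right_part[OF E], simplified]
      sm_functor_simps[OF sm_functor_right_part[OF E'], simplified]
    have "(\<theta> (?aa, ?bb) \<cdot> fmu E (a, b) (a', b')) \<cdot> (?s a b \<diamondop> ?s a' b') =
       \<theta> (?aa, ?bb) \<cdot> ?s ?aa ?bb \<cdot> (?L \<diamondop> ?R) \<cdot> ?m"
      by (simp add: C.assoc split_iso_fmu[OF E])
    also have "\<dots> = (?s' ?aa ?bb \<cdot> (\<alpha> ?aa \<diamondop> \<beta> ?bb)) \<cdot> (?L \<diamondop> ?R) \<cdot> ?m"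
      using \<theta>s[of ?aa ?bb] by (intro C.reassoc) simp_all
    also have "\<dots> = ?s' ?aa ?bb \<cdot> (?L' \<diamondop> ?R') \<cdot> ((\<alpha> a \<diamondop> \<alpha> a') \<diamondop> (\<beta> b \<diamondop> \<beta> b')) \<cdot> ?m"
      by (simp add: C.assoc C.tar_merge monoidal_nat_transD(2)[OF \<alpha>] monoidal_nat_transD(2)[OF \<beta>])
    also have "((\<alpha> a \<diamondop> \<alpha> a') \<diamondop> (\<beta> b \<diamondop> \<beta> b')) \<cdot> ?m = ?m' \<cdot> ((\<alpha> a \<diamondop> \<beta> b) \<diamondop> (\<alpha> a' \<diamondop> \<beta> b'))"
      using C.middle_nat[of "\<alpha> a" "\<beta> b" "\<alpha> a'" "\<beta> b'"] by simp
    also have "?s' ?aa ?bb \<cdot> (?L' \<diamondop> ?R') \<cdot> \<dots> =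
       (?s' ?aa ?bb \<cdot> (?L' \<diamondop> ?R') \<cdot> ?m') \<cdot> ((\<alpha> a \<diamondop> \<beta> b) \<diamondop> (\<alpha> a' \<diamondop> \<beta> b'))"
      by (simp add: C.assoc)
    also have "\<dots> = (fmu E' (a, b) (a', b') \<cdot> (?s' a b \<diamondop> ?s' a' b')) \<cdot> ((\<alpha> a \<diamondop> \<beta> b) \<diamondop> (\<alpha> a' \<diamondop> \<beta> b'))"
      by (simp only: split_iso_fmu[OF E' that])
    also have "\<dots> = (fmu E' (a, b) (a', b') \<cdot> (\<theta> (a, b) \<diamondop> \<theta> (a', b'))) \<cdot> (?s a b \<diamondop> ?s a' b')"
      by (simp add: C.assoc C.tar_merge \<theta>s)
    finally have "\<theta> (?aa, ?bb) \<cdot> fmu E (a, b) (a', b') = fmu E' (a, b) (a', b') \<cdot> (\<theta> (a, b) \<diamondop> \<theta> (a', b'))"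
      by (rule C.iso_cancel_right[rotated -1]) simp_all
    then show ?thesis by simp
  qed
  moreover have "\<theta> (munit X) \<cdot> feps E = feps E'"
  proof -
    let ?I = "munit A" and ?J = "munit B"
    have "(\<theta> (?I, ?J) \<cdot> feps E) \<cdot> mlunit C (munit C) = (\<theta> (?I, ?J) \<cdot> split_iso E ?I ?J) \<cdot> (feps E \<diamondop> feps E)"
      by (simp add: C.assoc split_iso_unit[OF E])
    also have "\<dots> = feps E' \<cdot> mlunit C (munit C)"
      by (simp add: \<theta>s C.assoc C.tar_merge \<alpha>\<epsilon> \<beta>\<epsilon> split_iso_unit[OF E'])
    finally have "\<theta> (?I, ?J) \<cdot> feps E = feps E'"
      by (rule C.iso_cancel_right[rotated -1]) simp_all
    then show ?thesis by simp
  qed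
  ultimately have "monoidal_nat_trans X C E E' \<theta>" by (intro monoidal_nat_transI) auto
  moreover have "\<theta> (a, munit B) = \<alpha> a" if [simp]: "a \<in> Ob A" for a
  proof -
    let ?J = "munit B"
    \<comment> \<open>Composition with \<open>feps E\<close> in the second factor turns
      \<open>split_iso E a I\<close> into a right unitor, which reduces the claim to naturality of
      that unitor.\<close>
    have "(\<theta> (a, ?J) \<cdot> split_iso E a ?J) \<cdot> (ide C (fo E (a, ?J)) \<diamondop> feps E) =
       split_iso E' a ?J \<cdot> (ide C (fo E' (a, ?J)) \<diamondop> feps E') \<cdot> (\<alpha> a \<diamondop> ide C (munit C))"
      unfolding \<theta>s[OF that B.munit_ob] by (simp add: C.assoc C.tar_merge \<beta>\<epsilon>)
    also have "\<dots> = mrunit C (fo E' (a, ?J)) \<cdot> (\<alpha> a \<diamondop> ide C (munit C))"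
      using split_iso_right_unit[OF E', of a] by (intro C.reassoc) simp_all
    finally have "\<theta> (a, ?J) \<cdot> mrunit C (fo E (a, ?J)) = \<alpha> a \<cdot> mrunit C (fo E (a, ?J))"
      by (simp add: C.assoc split_iso_right_unit[OF E] C.mrunit_nat)
    then show ?thesis by (rule C.iso_cancel_right[rotated -1]) simp_all
  qed
  moreover have "\<theta> (munit A, b) = \<beta> b" if [simp]: "b \<in> Ob B" for b
  proof -
    let ?I = "munit A"
    have "(\<theta> (?I, b) \<cdot> split_iso E ?I b) \<cdot> (feps E \<diamondop> ide C (fo E (?I, b))) =
       split_iso E' ?I b \<cdot> (feps E' \<diamondop> ide C (fo E' (?I, b))) \<cdot> (ide C (munit C) \<diamondop> \<beta> b)"
      unfolding \<theta>s[OF A.munit_ob that] by (simp add: C.assoc C.tar_merge \<alpha>\<epsilon>)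
    also have "\<dots> = mlunit C (fo E' (?I, b)) \<cdot> (ide C (munit C) \<diamondop> \<beta> b)"
      using split_iso_left_unit[OF E', of b] by (intro C.reassoc) simp_all
    finally have "\<theta> (?I, b) \<cdot> mlunit C (fo E (?I, b)) = \<beta> b \<cdot> mlunit C (fo E (?I, b))"
      by (simp add: C.assoc split_iso_left_unit[OF E] C.mlunit_nat)
    then show ?thesis by (rule C.iso_cancel_right[rotated -1]) simp_all
  qed
  ultimately show ?thesis by blast
qed

end

section \<open>The monoidal functor determined by a pair\<close>

abbreviation copair :: "('ao, 'aa, 'co, 'ca) smfct \<Rightarrow> ('bo, 'ba, 'co, 'ca) smfct \<Rightarrow> ('ao \<times> 'bo, 'aa \<times> 'ba, 'co, 'ca) smfct" where
  "copair F G \<equiv> comp_smfct C (tensor_fct C) (prod_smfct F G)"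

context
  fixes F G assumes F: "sm_functor A C F" and G: "sm_functor B C G"
begin

private lemmas iF = sm_functor_is_functor[OF F] and iG = sm_functor_is_functor[OF G]
private lemmas FG_simps [simp] = sm_functor_simps[OF F] functor_simps[OF iF] sm_functor_simps[OF G] functor_simps[OF iG]
  functor_iso(1)[OF iF A.category_axioms C.category_axioms] functor_iso(1)[OF iG B.category_axioms C.category_axioms]

lemma sm_functor_copair: "sm_functor X C (copair F G)"
  by (rule sm_functor_comp[OF _ sm_category_prod_smcat _ sm_functor_prod_smfct[OF F G] sm_functor_tensor_fct]) unfold_locales

text \<open>The restriction sends \<open>a\<close> to \<open>F a \<star> G I\<close>. The factor
  \<open>G I\<close> is identified with the unit by the inverse of \<open>feps G\<close> and removed
  by the right unitor; monoidality reflects that \<open>feps G\<close> respects the multiplications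
  of \<open>I\<close> and \<open>G I\<close>.\<close>

lemma copair_left:
  "\<exists>\<theta>. monoidal_nat_trans A C (left_part (copair F G)) F \<theta> \<and> (\<forall>a\<in>Ob A. iso_arr C (\<theta> a))"
proof -
  let ?I = "munit B" and ?J = "munit C"
  let ?G = "fo G ?I" and ?\<epsilon> = "feps G"
  define \<theta> where "\<theta> a = mrunit C (fo F a) \<cdot> (ide C (fo F a) \<diamondop> inv_arr C ?\<epsilon>)" for a
  have [simp]: "iso_arr C (\<theta> a)" "\<theta> a \<in> Ar C" "Dom C (\<theta> a) = fo F a \<star> ?G" "Cod C (\<theta> a) = fo F a"
    if "a \<in> Ob A" for a using that by (simp_all add: \<theta>_def)
  have \<theta>\<epsilon>: "\<theta> a \<cdot> (ide C (fo F a) \<diamondop> ?\<epsilon>) = mrunit C (fo F a)" if "a \<in> Ob A" for a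
    using that by (simp add: \<theta>_def C.assoc C.tar_merge)
  have "monoidal_nat_trans A C (left_part (copair F G)) F \<theta>"
  proof (rule monoidal_nat_transI)
    show "nat_trans A C (left_part (copair F G)) F \<theta>"
    proof (rule nat_transI)
      fix f assume [simp]: "f \<in> Ar A"
      have "fa F f \<cdot> mrunit C (fo F (Dom A f)) \<cdot> (ide C (fo F (Dom A f)) \<diamondop> inv_arr C ?\<epsilon>) =
         (mrunit C (fo F (Cod A f)) \<cdot> (fa F f \<diamondop> ide C ?J)) \<cdot> (ide C (fo F (Dom A f)) \<diamondop> inv_arr C ?\<epsilon>)"
        using C.mrunit_nat[of "fa F f"] by (intro C.reassoc) simp_all
      then show "fa F f \<cdot> \<theta> (Dom A f) = \<theta> (Cod A f) \<cdot> fa (left_part (copair F G)) f"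
        by (simp add: \<theta>_def C.assoc C.tar_merge)
    qed simp_all
  next
    fix a a' assume [simp]: "a \<in> Ob A" "a' \<in> Ob A"
    let ?a = "fo F a" and ?a' = "fo F a'" and ?aa = "fo F (a \<star>\<^bsub>A\<^esub> a')"
    let ?m = "middle C ?a ?G ?a' ?G" and ?m' = "middle C ?a ?J ?a' ?J"
    \<comment> \<open>Composition with this isomorphism replaces both copies of \<open>G I\<close>
      by \<open>I\<close>, after which \<open>middle_unit_right\<close> applies.\<close>
    let ?e = "(ide C ?a \<diamondop> ?\<epsilon>) \<diamondop> (ide C ?a' \<diamondop> ?\<epsilon>)"
    have m: "?m \<cdot> ?e = ((ide C (?a \<star> ?a')) \<diamondop> (?\<epsilon> \<diamondop> ?\<epsilon>)) \<cdot> ?m'"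
      using C.middle_nat[of "ide C ?a" ?\<epsilon> "ide C ?a'" ?\<epsilon>] by simp
    \<comment> \<open>The multiplication of \<open>G I\<close> induced by that of \<open>I\<close>,
      pulled back along \<open>feps G\<close>, is the unitor.\<close>
    have l: "fa G (mlunit B ?I) \<cdot> fmu G ?I ?I \<cdot> (?\<epsilon> \<diamondop> ?\<epsilon>) = ?\<epsilon> \<cdot> mlunit C ?J"
    proof -
      have "fa G (mlunit B ?I) \<cdot> fmu G ?I ?I \<cdot> (?\<epsilon> \<diamondop> ?\<epsilon>) =
        (fa G (mlunit B ?I) \<cdot> fmu G ?I ?I \<cdot> (?\<epsilon> \<diamondop> ide C ?G)) \<cdot> (ide C ?J \<diamondop> ?\<epsilon>)"
        by (simp add: C.assoc C.tar_merge)
      also have "\<dots> = mlunit C ?G \<cdot> (ide C ?J \<diamondop> ?\<epsilon>)" by (simp only: fmu_left_unit[OF G B.munit_ob])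
      finally show ?thesis by (simp add: C.mlunit_nat)
    qed
    have "(\<theta> (a \<star>\<^bsub>A\<^esub> a') \<cdot> fmu (left_part (copair F G)) a a') \<cdot> ?e =
       \<theta> (a \<star>\<^bsub>A\<^esub> a') \<cdot> (ide C ?aa \<diamondop> fa G (mlunit B ?I)) \<cdot> (fmu F a a' \<diamondop> fmu G ?I ?I) \<cdot> ?m \<cdot> ?e"
      by (simp add: C.assoc)
    also have "\<dots> = \<theta> (a \<star>\<^bsub>A\<^esub> a') \<cdot> (fmu F a a' \<diamondop> (fa G (mlunit B ?I) \<cdot> fmu G ?I ?I \<cdot> (?\<epsilon> \<diamondop> ?\<epsilon>))) \<cdot> ?m'"
      unfolding m by (simp add: C.tar_merge C.assoc)
    also have "\<dots> = (\<theta> (a \<star>\<^bsub>A\<^esub> a') \<cdot> (ide C ?aa \<diamondop> ?\<epsilon>)) \<cdot> (fmu F a a' \<diamondop> mlunit C ?J) \<cdot> ?m'"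
      unfolding l by (simp add: C.tar_merge C.assoc)
    also have "\<dots> = mrunit C ?aa \<cdot> (fmu F a a' \<diamondop> ide C ?J) \<cdot> (ide C (?a \<star> ?a') \<diamondop> mlunit C ?J) \<cdot> ?m'"
      by (simp add: \<theta>\<epsilon> C.tar_merge)
    also have "\<dots> = (fmu F a a' \<cdot> mrunit C (?a \<star> ?a')) \<cdot> (ide C (?a \<star> ?a') \<diamondop> mlunit C ?J) \<cdot> ?m'"
      using C.mrunit_nat[of "fmu F a a'"] by (intro C.reassoc) simp_all
    also have "\<dots> = fmu F a a' \<cdot> (mrunit C ?a \<diamondop> mrunit C ?a')"
      by (simp add: C.assoc C.middle_unit_right)
    also have "\<dots> = (fmu F a a' \<cdot> (\<theta> a \<diamondop> \<theta> a')) \<cdot> ?e"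
      by (simp add: C.assoc C.tar_merge \<theta>\<epsilon>)
    finally show "\<theta> (a \<star>\<^bsub>A\<^esub> a') \<cdot> fmu (left_part (copair F G)) a a' = fmu F a a' \<cdot> (\<theta> a \<diamondop> \<theta> a')"
      by (rule C.iso_cancel_right[rotated -1]) simp_all
  next
    let ?K = "munit A"
    have "\<theta> ?K \<cdot> feps (left_part (copair F G)) = (\<theta> ?K \<cdot> (ide C (fo F ?K) \<diamondop> ?\<epsilon>)) \<cdot> (feps F \<diamondop> ide C ?J) \<cdot> inv_arr C (mlunit C ?J)"
      by (simp add: C.assoc C.tar_merge)
    also have "\<dots> = mrunit C (fo F ?K) \<cdot> (feps F \<diamondop> ide C ?J) \<cdot> inv_arr C (mlunit C ?J)" by (simp add: \<theta>\<epsilon>)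
    also have "\<dots> = (feps F \<cdot> mrunit C ?J) \<cdot> inv_arr C (mlunit C ?J)"
      using C.mrunit_nat[of "feps F"] by (intro C.reassoc) simp_all
    finally show "\<theta> ?K \<cdot> feps (left_part (copair F G)) = feps F" by (simp add: C.assoc C.mrunit_munit)
  qed
  then show ?thesis by (intro exI[of _ \<theta>]) simp
qed

text \<open>The mirror image of \<open>copair_left\<close>, with the left unitor and
  \<open>middle_unit_left\<close>.\<close>

lemma copair_right:
  "\<exists>\<theta>. monoidal_nat_trans B C (right_part (copair F G)) G \<theta> \<and> (\<forall>b\<in>Ob B. iso_arr C (\<theta> b))"
proof -
  let ?I = "munit A" and ?J = "munit C"
  let ?F = "fo F ?I" and ?\<epsilon> = "feps F"
  define \<theta> where "\<theta> b = mlunit C (fo G b) \<cdot> (inv_arr C ?\<epsilon> \<diamondop> ide C (fo G b))" for b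
  have [simp]: "iso_arr C (\<theta> b)" "\<theta> b \<in> Ar C" "Dom C (\<theta> b) = ?F \<star> fo G b" "Cod C (\<theta> b) = fo G b"
    if "b \<in> Ob B" for b using that by (simp_all add: \<theta>_def)
  have \<theta>\<epsilon>: "\<theta> b \<cdot> (?\<epsilon> \<diamondop> ide C (fo G b)) = mlunit C (fo G b)" if "b \<in> Ob B" for b
    using that by (simp add: \<theta>_def C.assoc C.tar_merge)
  have "monoidal_nat_trans B C (right_part (copair F G)) G \<theta>"
  proof (rule monoidal_nat_transI)
    show "nat_trans B C (right_part (copair F G)) G \<theta>"
    proof (rule nat_transI)
      fix f assume [simp]: "f \<in> Ar B"
      have "fa G f \<cdot> mlunit C (fo G (Dom B f)) \<cdot> (inv_arr C ?\<epsilon> \<diamondop> ide C (fo G (Dom B f))) =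
         (mlunit C (fo G (Cod B f)) \<cdot> (ide C ?J \<diamondop> fa G f)) \<cdot> (inv_arr C ?\<epsilon> \<diamondop> ide C (fo G (Dom B f)))"
        using C.mlunit_nat[of "fa G f"] by (intro C.reassoc) simp_all
      then show "fa G f \<cdot> \<theta> (Dom B f) = \<theta> (Cod B f) \<cdot> fa (right_part (copair F G)) f"
        by (simp add: \<theta>_def C.assoc C.tar_merge)
    qed simp_all
  next
    fix b b' assume [simp]: "b \<in> Ob B" "b' \<in> Ob B"
    let ?b = "fo G b" and ?b' = "fo G b'" and ?bb = "fo G (b \<star>\<^bsub>B\<^esub> b')"
    let ?m = "middle C ?F ?b ?F ?b'" and ?m' = "middle C ?J ?b ?J ?b'"
    let ?e = "(?\<epsilon> \<diamondop> ide C ?b) \<diamondop> (?\<epsilon> \<diamondop> ide C ?b')"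
    have m: "?m \<cdot> ?e = ((?\<epsilon> \<diamondop> ?\<epsilon>) \<diamondop> ide C (?b \<star> ?b')) \<cdot> ?m'"
      using C.middle_nat[of ?\<epsilon> "ide C ?b" ?\<epsilon> "ide C ?b'"] by simp
    have l: "fa F (mlunit A ?I) \<cdot> fmu F ?I ?I \<cdot> (?\<epsilon> \<diamondop> ?\<epsilon>) = ?\<epsilon> \<cdot> mlunit C ?J"
    proof -
      have "fa F (mlunit A ?I) \<cdot> fmu F ?I ?I \<cdot> (?\<epsilon> \<diamondop> ?\<epsilon>) =
        (fa F (mlunit A ?I) \<cdot> fmu F ?I ?I \<cdot> (?\<epsilon> \<diamondop> ide C ?F)) \<cdot> (ide C ?J \<diamondop> ?\<epsilon>)"
        by (simp add: C.assoc C.tar_merge)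
      also have "\<dots> = mlunit C ?F \<cdot> (ide C ?J \<diamondop> ?\<epsilon>)" by (simp only: fmu_left_unit[OF F A.munit_ob])
      finally show ?thesis by (simp add: C.mlunit_nat)
    qed
    have "(\<theta> (b \<star>\<^bsub>B\<^esub> b') \<cdot> fmu (right_part (copair F G)) b b') \<cdot> ?e =
       \<theta> (b \<star>\<^bsub>B\<^esub> b') \<cdot> (fa F (mlunit A ?I) \<diamondop> ide C ?bb) \<cdot> (fmu F ?I ?I \<diamondop> fmu G b b') \<cdot> ?m \<cdot> ?e"
      by (simp add: C.assoc)
    also have "\<dots> = \<theta> (b \<star>\<^bsub>B\<^esub> b') \<cdot> ((fa F (mlunit A ?I) \<cdot> fmu F ?I ?I \<cdot> (?\<epsilon> \<diamondop> ?\<epsilon>)) \<diamondop> fmu G b b') \<cdot> ?m'"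
      unfolding m by (simp add: C.tar_merge C.assoc)
    also have "\<dots> = (\<theta> (b \<star>\<^bsub>B\<^esub> b') \<cdot> (?\<epsilon> \<diamondop> ide C ?bb)) \<cdot> (mlunit C ?J \<diamondop> fmu G b b') \<cdot> ?m'"
      unfolding l by (simp add: C.tar_merge C.assoc)
    also have "\<dots> = mlunit C ?bb \<cdot> (ide C ?J \<diamondop> fmu G b b') \<cdot> (mlunit C ?J \<diamondop> ide C (?b \<star> ?b')) \<cdot> ?m'"
      by (simp add: \<theta>\<epsilon> C.tar_merge)
    also have "\<dots> = (fmu G b b' \<cdot> mlunit C (?b \<star> ?b')) \<cdot> (mlunit C ?J \<diamondop> ide C (?b \<star> ?b')) \<cdot> ?m'"
      using C.mlunit_nat[of "fmu G b b'"] by (intro C.reassoc) simp_all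
    also have "\<dots> = fmu G b b' \<cdot> (mlunit C ?b \<diamondop> mlunit C ?b')"
      by (simp add: C.assoc C.middle_unit_left)
    also have "\<dots> = (fmu G b b' \<cdot> (\<theta> b \<diamondop> \<theta> b')) \<cdot> ?e"
      by (simp add: C.assoc C.tar_merge \<theta>\<epsilon>)
    finally show "\<theta> (b \<star>\<^bsub>B\<^esub> b') \<cdot> fmu (right_part (copair F G)) b b' = fmu G b b' \<cdot> (\<theta> b \<diamondop> \<theta> b')"
      by (rule C.iso_cancel_right[rotated -1]) simp_all
  next
    let ?K = "munit B"
    have "\<theta> ?K \<cdot> feps (right_part (copair F G)) = (\<theta> ?K \<cdot> (?\<epsilon> \<diamondop> ide C (fo G ?K))) \<cdot> (ide C ?J \<diamondop> feps G) \<cdot> inv_arr C (mlunit C ?J)"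
      by (simp add: C.assoc C.tar_merge)
    also have "\<dots> = mlunit C (fo G ?K) \<cdot> (ide C ?J \<diamondop> feps G) \<cdot> inv_arr C (mlunit C ?J)" by (simp add: \<theta>\<epsilon>)
    also have "\<dots> = (feps G \<cdot> mlunit C ?J) \<cdot> inv_arr C (mlunit C ?J)"
      using C.mlunit_nat[of "feps G"] by (intro C.reassoc) simp_all
    finally show "\<theta> ?K \<cdot> feps (right_part (copair F G)) = feps G" by (simp add: C.assoc)
  qed
  then show ?thesis by (intro exI[of _ \<theta>]) simp
qed

end

end

section \<open>Free modules and quotient modules\<close>

lemma free_module_sel [simp]:
  "carrier (free_module R S) = {v. (\<forall>s. v s \<in> carrier R) \<and> finite {s. v s \<noteq> \<zero>\<^bsub>R\<^esub>} \<and> {s. v s \<noteq> \<zero>\<^bsub>R\<^esub>} \<subseteq> S}"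
  "\<zero>\<^bsub>free_module R S\<^esub> = (\<lambda>_. \<zero>\<^bsub>R\<^esub>)"
  "v \<oplus>\<^bsub>free_module R S\<^esub> w = (\<lambda>s. v s \<oplus>\<^bsub>R\<^esub> w s)"
  "r \<odot>\<^bsub>free_module R S\<^esub> v = (\<lambda>s. r \<otimes>\<^bsub>R\<^esub> v s)"
  by (simp_all add: free_module_def)

lemma module_free_module:
  fixes R :: "('r, 'k) ring_scheme" and S :: "'s set"
  assumes "cring R"
  shows "module R (free_module R S)"
proof -
  interpret R: cring R by fact
  have supp_add: "{s. v s \<oplus>\<^bsub>R\<^esub> w s \<noteq> \<zero>\<^bsub>R\<^esub>} \<subseteq> {s. v s \<noteq> \<zero>\<^bsub>R\<^esub>} \<union> {s. w s \<noteq> \<zero>\<^bsub>R\<^esub>}"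
    if "\<forall>s. v s \<in> carrier R" "\<forall>s. w s \<in> carrier R" for v w :: "'s \<Rightarrow> 'r"
    using that by auto
  have supp_smult: "{s. r \<otimes>\<^bsub>R\<^esub> v s \<noteq> \<zero>\<^bsub>R\<^esub>} \<subseteq> {s. v s \<noteq> \<zero>\<^bsub>R\<^esub>}"
    if "r \<in> carrier R" "\<forall>s. v s \<in> carrier R" for r and v :: "'s \<Rightarrow> 'r"
    using that by auto
  have supp_minus: "{s. \<ominus>\<^bsub>R\<^esub> v s \<noteq> \<zero>\<^bsub>R\<^esub>} \<subseteq> {s. v s \<noteq> \<zero>\<^bsub>R\<^esub>}"
    if "\<forall>s. v s \<in> carrier R" for v :: "'s \<Rightarrow> 'r"
    using that by auto
  show ?thesis
  proof (rule moduleI)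
    show "abelian_group (free_module R S)"
    proof (rule abelian_groupI)
      fix v w assume v: "v \<in> carrier (free_module R S)" and w: "w \<in> carrier (free_module R S)"
      show "v \<oplus>\<^bsub>free_module R S\<^esub> w \<in> carrier (free_module R S)"
        using v w supp_add[of v w] by (auto intro: finite_subset[OF supp_add])
    next
      fix v assume v: "v \<in> carrier (free_module R S)"
      then show "\<exists>w\<in>carrier (free_module R S). w \<oplus>\<^bsub>free_module R S\<^esub> v = \<zero>\<^bsub>free_module R S\<^esub>"
        using supp_minus[of v]
        by (intro bexI[of _ "\<lambda>s. \<ominus>\<^bsub>R\<^esub> v s"]) (auto simp: R.l_neg intro: finite_subset[OF supp_minus])
    qed (auto simp: R.a_ac)
  next
    fix r v assume "r \<in> carrier R" "v \<in> carrier (free_module R S)"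
    then show "r \<odot>\<^bsub>free_module R S\<^esub> v \<in> carrier (free_module R S)"
      using supp_smult[of r v] by (auto intro: finite_subset[OF supp_smult])
  qed (auto simp: R.l_distr R.r_distr R.m_assoc assms)
qed

lemma single_closed: "cring R \<Longrightarrow> s \<in> S \<Longrightarrow> single R s \<in> carrier (free_module R S)"
proof -
  assume "cring R" and s: "s \<in> S"
  then interpret R: cring R by simp
  have "{t. single R s t \<noteq> \<zero>\<^bsub>R\<^esub>} \<subseteq> {s}" by (auto simp: single_def)
  then show ?thesis using s by (auto simp: single_def intro: finite_subset)
qed

text \<open>Induction over a finite set containing the support: a vector is the sum of its entry at
  one index and the vector with that entry erased.\<close>

lemma free_module_induct:
  assumes "cring R" and v: "v \<in> carrier (free_module R S)"
    and zero: "P (\<zero>\<^bsub>free_module R S\<^esub>)"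
    and add: "\<And>v w. v \<in> carrier (free_module R S) \<Longrightarrow> w \<in> carrier (free_module R S) \<Longrightarrow> P v \<Longrightarrow> P w \<Longrightarrow> P (v \<oplus>\<^bsub>free_module R S\<^esub> w)"
    and single: "\<And>r s. r \<in> carrier R \<Longrightarrow> s \<in> S \<Longrightarrow> P (r \<odot>\<^bsub>free_module R S\<^esub> single R s)"
  shows "P v"
proof -
  interpret R: cring R by fact
  interpret F: module R "free_module R S" by (rule module_free_module) fact
  have "\<forall>v. v \<in> carrier (free_module R S) \<longrightarrow> {s. v s \<noteq> \<zero>\<^bsub>R\<^esub>} \<subseteq> T \<longrightarrow> P v" if "finite T" "T \<subseteq> S" for T
    using that
  proof (induction T)
    case empty
    have "P v" if "\<forall>s. v s = \<zero>\<^bsub>R\<^esub>" for v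
    proof -
      have "v = \<zero>\<^bsub>free_module R S\<^esub>" using that by auto
      then show ?thesis using zero by simp
    qed
    then show ?case by auto
  next
    case (insert t T)
    show ?case
    proof (intro allI impI)
      fix v assume v: "v \<in> carrier (free_module R S)" and supp: "{s. v s \<noteq> \<zero>\<^bsub>R\<^esub>} \<subseteq> insert t T"
      let ?w = "v(t := \<zero>\<^bsub>R\<^esub>)"
      have "{s. ?w s \<noteq> \<zero>\<^bsub>R\<^esub>} \<subseteq> {s. v s \<noteq> \<zero>\<^bsub>R\<^esub>}" by auto
      then have w: "?w \<in> carrier (free_module R S)" using v by (auto intro: finite_subset)
      have "{s. ?w s \<noteq> \<zero>\<^bsub>R\<^esub>} \<subseteq> T" using supp by auto
      then have "P ?w" using insert.IH insert.prems w by blast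
      moreover have s: "v t \<odot>\<^bsub>free_module R S\<^esub> single R t \<in> carrier (free_module R S)"
        using v insert.prems by (intro F.smult_closed single_closed assms(1)) auto
      moreover have "P (v t \<odot>\<^bsub>free_module R S\<^esub> single R t)" using single v insert.prems by auto
      moreover have "v = ?w \<oplus>\<^bsub>free_module R S\<^esub> (v t \<odot>\<^bsub>free_module R S\<^esub> single R t)"
        using v by (auto simp: single_def fun_eq_iff)
      ultimately show "P v" using add[OF w s] by simp
    qed
  qed
  then show ?thesis using v by auto
qed

locale submodule_of_module = M: module R M
  for R :: "('r, 'k) ring_scheme" (structure) and M :: "('r, 'm, 'z) module_scheme" and H +
  assumes submodule: "submodule H R M"
begin

abbreviation coset :: "'m \<Rightarrow> 'm set" where
  "coset x \<equiv> H +>\<^bsub>M\<^esub> x"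

lemmas subH = M.submoduleE[OF submodule]

lemma zero_H: "\<zero>\<^bsub>M\<^esub> \<in> H"
  using subgroup.one_closed[OF submodule.axioms(1)[OF submodule]] by simp

sublocale abelian_subgroup H M
  by (intro abelian_subgroupI3 additive_subgroupI submodule.axioms(1)[OF submodule]) unfold_locales

lemma coset_eq_iff:
  assumes "x \<in> carrier M" "y \<in> carrier M"
  shows "coset x = coset y \<longleftrightarrow> x \<ominus>\<^bsub>M\<^esub> y \<in> H"
proof -
  have "coset x = coset y \<longleftrightarrow> x \<in> coset y"
    using a_rcos_self[OF assms(1)] a_repr_independence'[OF _ assms(2), of x] by metis
  then show ?thesis using a_rcos_module[OF assms(2,1)] by (simp add: M.minus_eq)
qed

lemma coset_self: "x \<in> carrier M \<Longrightarrow> x \<in> coset x"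
  by (rule a_rcos_self)

lemma coset_elem:
  assumes "x \<in> carrier M" "y \<in> coset x"
  shows "y \<in> carrier M" "coset y = coset x"
  using a_elemrcos_carrier[OF assms] a_repr_independence'[OF assms(2,1)] by (simp_all only:)

lemma coset_elem_obtain:
  assumes "y \<in> coset x"
  obtains h where "h \<in> H" "y = h \<oplus>\<^bsub>M\<^esub> x"
  using assms by (auto simp: a_r_coset_def')

lemma quotient_carrier: "carrier (quotient_module M H) = coset ` carrier M"
  by (auto simp: quotient_module_def A_RCOSETS_def')

lemma quotient_add:
  "x \<in> carrier M \<Longrightarrow> y \<in> carrier M \<Longrightarrow> coset x \<oplus>\<^bsub>quotient_module M H\<^esub> coset y = coset (x \<oplus>\<^bsub>M\<^esub> y)"
  by (simp add: quotient_module_def a_rcos_sum)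

lemma quotient_zero: "\<zero>\<^bsub>quotient_module M H\<^esub> = coset \<zero>\<^bsub>M\<^esub>"
  using a_rcos_const[OF zero_H] by (simp add: quotient_module_def)

text \<open>Scalars preserve \<open>H\<close>, so the union in the definition of scalar
  multiplication is over a constant family of cosets.\<close>

lemma quotient_smult:
  assumes r: "r \<in> carrier R" and x: "x \<in> carrier M"
  shows "r \<odot>\<^bsub>quotient_module M H\<^esub> coset x = coset (r \<odot>\<^bsub>M\<^esub> x)"
proof -
  have "coset (r \<odot>\<^bsub>M\<^esub> y) = coset (r \<odot>\<^bsub>M\<^esub> x)" if y: "y \<in> coset x" for y
  proof -
    have yc: "y \<in> carrier M" by (rule coset_elem(1)[OF x y])
    have "y \<ominus>\<^bsub>M\<^esub> x \<in> H"
      by (rule iffD1[OF coset_eq_iff[OF yc x] coset_elem(2)[OF x y]])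
    then have "r \<odot>\<^bsub>M\<^esub> (y \<ominus>\<^bsub>M\<^esub> x) \<in> H" using subH(4) r by auto
    moreover have "r \<odot>\<^bsub>M\<^esub> (y \<ominus>\<^bsub>M\<^esub> x) = r \<odot>\<^bsub>M\<^esub> y \<ominus>\<^bsub>M\<^esub> r \<odot>\<^bsub>M\<^esub> x"
      using r x yc by (simp add: M.minus_eq M.smult_r_distr M.smult_r_minus)
    ultimately show ?thesis using r x yc by (simp add: coset_eq_iff)
  qed
  then have "(\<Union>y\<in>coset x. coset (r \<odot>\<^bsub>M\<^esub> y)) = coset (r \<odot>\<^bsub>M\<^esub> x)"
    by (intro SUP_eq_const) (use coset_self[OF x] in blast)+
  then show ?thesis by (simp add: quotient_module_def)
qed

lemma module_quotient: "module R (quotient_module M H)"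
proof (rule moduleI)
  show "abelian_group (quotient_module M H)"
  proof (rule abelian_groupI)
    fix X assume "X \<in> carrier (quotient_module M H)"
    then obtain x where x: "x \<in> carrier M" "X = coset x" by (auto simp: quotient_carrier)
    then show "\<exists>Y\<in>carrier (quotient_module M H). Y \<oplus>\<^bsub>quotient_module M H\<^esub> X = \<zero>\<^bsub>quotient_module M H\<^esub>"
      by (intro bexI[of _ "coset (\<ominus>\<^bsub>M\<^esub> x)"]) (auto simp: quotient_carrier quotient_add quotient_zero M.l_neg)
  qed (auto simp: quotient_carrier quotient_add quotient_zero M.a_ac)
qed (auto simp: quotient_carrier quotient_add quotient_smult M.smult_l_distr M.smult_r_distr M.smult_assoc1
    intro: M.R.cring_axioms)

end

text \<open>The intersection is over a nonempty family, as \<open>carrier M\<close> belongs to it;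
  the family is closed under intersection.\<close>

lemma submodule_generated:
  assumes "module R M" "X \<subseteq> carrier M"
  shows "submodule (submodule_generated R M X) R M" "X \<subseteq> submodule_generated R M X"
    and "submodule K R M \<Longrightarrow> X \<subseteq> K \<Longrightarrow> submodule_generated R M X \<subseteq> K"
proof -
  interpret M: module R M by fact
  have ne: "carrier M \<in> {H. submodule H R M \<and> X \<subseteq> H}" using assms(2) M.carrier_is_submodule by simp
  have 0: "\<zero>\<^bsub>M\<^esub> \<in> H" if "submodule H R M" for H
    using subgroup.one_closed[OF submodule.axioms(1)[OF that]] by simp
  show "submodule (submodule_generated R M X) R M"
    unfolding submodule_generated_def
  proof (rule M.submoduleI)
    show "\<Inter> {H. submodule H R M \<and> X \<subseteq> H} \<subseteq> carrier M" using ne by blast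
    show "\<zero>\<^bsub>M\<^esub> \<in> \<Inter> {H. submodule H R M \<and> X \<subseteq> H}" using 0 by blast
  qed (use M.submoduleE(3-5) in blast)+
  show "X \<subseteq> submodule_generated R M X"
    "submodule K R M \<Longrightarrow> X \<subseteq> K \<Longrightarrow> submodule_generated R M X \<subseteq> K"
    by (auto simp: submodule_generated_def)
qed

lemma linear_mapD:
  assumes "linear_map R M N h"
  shows "m \<in> carrier M \<Longrightarrow> h m \<in> carrier N"
    and "m \<in> carrier M \<Longrightarrow> m' \<in> carrier M \<Longrightarrow> h (m \<oplus>\<^bsub>M\<^esub> m') = h m \<oplus>\<^bsub>N\<^esub> h m'"
    and "r \<in> carrier R \<Longrightarrow> m \<in> carrier M \<Longrightarrow> h (r \<odot>\<^bsub>M\<^esub> m) = r \<odot>\<^bsub>N\<^esub> h m"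
  using assms by (auto simp: linear_map_def)

lemma linear_mapI:
  assumes "\<And>m. m \<in> carrier M \<Longrightarrow> h m \<in> carrier N"
    and "\<And>m m'. m \<in> carrier M \<Longrightarrow> m' \<in> carrier M \<Longrightarrow> h (m \<oplus>\<^bsub>M\<^esub> m') = h m \<oplus>\<^bsub>N\<^esub> h m'"
    and "\<And>r m. r \<in> carrier R \<Longrightarrow> m \<in> carrier M \<Longrightarrow> h (r \<odot>\<^bsub>M\<^esub> m) = r \<odot>\<^bsub>N\<^esub> h m"
  shows "linear_map R M N h"
  using assms by (auto simp: linear_map_def)

lemma linear_map_zero:
  assumes "module R M" "module R N" "linear_map R M N h"
  shows "h \<zero>\<^bsub>M\<^esub> = \<zero>\<^bsub>N\<^esub>"
proof -
  interpret M: module R M by fact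
  interpret N: module R N by fact
  have "h (\<zero>\<^bsub>R\<^esub> \<odot>\<^bsub>M\<^esub> \<zero>\<^bsub>M\<^esub>) = \<zero>\<^bsub>R\<^esub> \<odot>\<^bsub>N\<^esub> h \<zero>\<^bsub>M\<^esub>"
    by (rule linear_mapD(3)[OF assms(3)]) auto
  then show ?thesis using linear_mapD(1)[OF assms(3), of "\<zero>\<^bsub>M\<^esub>"] by simp
qed

text \<open>Subtraction is addition of the multiple by minus one, and both operations are
  preserved.\<close>

lemma linear_map_minus:
  assumes "module R M" "module R N" "linear_map R M N h" "m \<in> carrier M" "m' \<in> carrier M"
  shows "h (m \<ominus>\<^bsub>M\<^esub> m') = h m \<ominus>\<^bsub>N\<^esub> h m'"
proof -
  interpret M: module R M by fact
  interpret N: module R N by fact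
  note c = linear_mapD(1)[OF assms(3)]
  have "m \<ominus>\<^bsub>M\<^esub> m' = m \<oplus>\<^bsub>M\<^esub> (\<ominus>\<^bsub>R\<^esub> \<one>\<^bsub>R\<^esub>) \<odot>\<^bsub>M\<^esub> m'" using assms(4,5) by (simp add: M.smult_l_minus M.minus_eq)
  then have "h (m \<ominus>\<^bsub>M\<^esub> m') = h m \<oplus>\<^bsub>N\<^esub> (\<ominus>\<^bsub>R\<^esub> \<one>\<^bsub>R\<^esub>) \<odot>\<^bsub>N\<^esub> h m'"
    using assms(4,5) by (simp add: linear_mapD[OF assms(3)])
  then show ?thesis using assms(4,5) c by (simp add: N.smult_l_minus N.minus_eq)
qed

lemma linear_map_comp: "linear_map R M N h \<Longrightarrow> linear_map R N Q k \<Longrightarrow> linear_map R M Q (\<lambda>m. k (h m))"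
  by (auto simp: linear_map_def Pi_iff)

lemma bilinear_mapD:
  assumes "bilinear_map R M N Q b"
  shows "m \<in> carrier M \<Longrightarrow> linear_map R N Q (b m)" "n \<in> carrier N \<Longrightarrow> linear_map R M Q (\<lambda>m. b m n)"
    and "m \<in> carrier M \<Longrightarrow> n \<in> carrier N \<Longrightarrow> b m n \<in> carrier Q"
  using assms by (auto simp: bilinear_map_def dest: linear_mapD(1))

section \<open>The universal property of the tensor product of modules\<close>

definition linear_extension ::
  "('r, 'k) ring_scheme \<Rightarrow> ('r, 'q, 'z) module_scheme \<Rightarrow> ('s \<Rightarrow> 'q) \<Rightarrow> ('s \<Rightarrow> 'r) \<Rightarrow> 'q"
where
  "linear_extension R Q b v = finsum Q (\<lambda>s. v s \<odot>\<^bsub>Q\<^esub> b s) {s. v s \<noteq> \<zero>\<^bsub>R\<^esub>}"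

lemma linear_extension:
  assumes "module R Q" and b: "b \<in> S \<rightarrow> carrier Q"
  shows "linear_map R (free_module R S) Q (linear_extension R Q b)"
    and "s \<in> S \<Longrightarrow> linear_extension R Q b (single R s) = b s"
proof -
  interpret Q: module R Q by fact
  note cR = Q.R.cring_axioms
  \<comment> \<open>Enlarging the index set adds only zero terms. Two vectors and their sum can then
    be summed over one common set.\<close>
  have ext: "linear_extension R Q b v = finsum Q (\<lambda>s. v s \<odot>\<^bsub>Q\<^esub> b s) T"
    if "\<forall>s. v s \<in> carrier R" "{s. v s \<noteq> \<zero>\<^bsub>R\<^esub>} \<subseteq> T" "T \<subseteq> S" "finite T" for v T
  proof -
    have "b s \<in> carrier Q" if "s \<in> T" for s using b \<open>T \<subseteq> S\<close> that by auto
    then show ?thesis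
      unfolding linear_extension_def using that
      by (intro Q.M.add.finprod_mono_neutral_cong_left) auto
  qed
  show "linear_map R (free_module R S) Q (linear_extension R Q b)"
  proof (rule linear_mapI)
    fix v assume v: "v \<in> carrier (free_module R S)"
    let ?T = "{s. v s \<noteq> \<zero>\<^bsub>R\<^esub>}"
    have "finsum Q (\<lambda>s. v s \<odot>\<^bsub>Q\<^esub> b s) ?T \<in> carrier Q"
      by (rule Q.finsum_closed) (use v b in auto)
    then show "linear_extension R Q b v \<in> carrier Q" by (simp add: linear_extension_def)
    fix w assume w: "w \<in> carrier (free_module R S)"
    let ?U = "?T \<union> {s. w s \<noteq> \<zero>\<^bsub>R\<^esub>}"
    have bc: "b x \<in> carrier Q" if "v x \<noteq> \<zero>\<^bsub>R\<^esub> \<or> w x \<noteq> \<zero>\<^bsub>R\<^esub>" for x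
      using that v w b by auto
    have "linear_extension R Q b (\<lambda>s. v s \<oplus>\<^bsub>R\<^esub> w s) = finsum Q (\<lambda>s. (v s \<oplus>\<^bsub>R\<^esub> w s) \<odot>\<^bsub>Q\<^esub> b s) ?U"
      by (rule ext) (use v w in auto)
    also have "\<dots> = finsum Q (\<lambda>s. v s \<odot>\<^bsub>Q\<^esub> b s \<oplus>\<^bsub>Q\<^esub> w s \<odot>\<^bsub>Q\<^esub> b s) ?U"
      by (rule Q.finsum_cong') (use v w bc in \<open>auto simp: Q.smult_l_distr\<close>)
    also have "\<dots> = finsum Q (\<lambda>s. v s \<odot>\<^bsub>Q\<^esub> b s) ?U \<oplus>\<^bsub>Q\<^esub> finsum Q (\<lambda>s. w s \<odot>\<^bsub>Q\<^esub> b s) ?U"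
      by (rule Q.finsum_addf) (use v w bc in auto)
    also have "finsum Q (\<lambda>s. v s \<odot>\<^bsub>Q\<^esub> b s) ?U = linear_extension R Q b v"
      by (rule ext[symmetric]) (use v w in auto)
    also have "finsum Q (\<lambda>s. w s \<odot>\<^bsub>Q\<^esub> b s) ?U = linear_extension R Q b w"
      by (rule ext[symmetric]) (use v w in auto)
    finally show "linear_extension R Q b (v \<oplus>\<^bsub>free_module R S\<^esub> w) = linear_extension R Q b v \<oplus>\<^bsub>Q\<^esub> linear_extension R Q b w"
      by simp
  next
    fix r v assume r: "r \<in> carrier R" and v: "v \<in> carrier (free_module R S)"
    let ?T = "{s. v s \<noteq> \<zero>\<^bsub>R\<^esub>}"
    have bc: "b x \<in> carrier Q" if "v x \<noteq> \<zero>\<^bsub>R\<^esub>" for x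
      using that v b by auto
    have "linear_extension R Q b (\<lambda>s. r \<otimes>\<^bsub>R\<^esub> v s) = finsum Q (\<lambda>s. (r \<otimes>\<^bsub>R\<^esub> v s) \<odot>\<^bsub>Q\<^esub> b s) ?T"
      by (rule ext) (use v r in auto)
    also have "\<dots> = finsum Q (\<lambda>s. r \<odot>\<^bsub>Q\<^esub> (v s \<odot>\<^bsub>Q\<^esub> b s)) ?T"
      by (rule Q.finsum_cong') (use v r bc in \<open>auto simp: Q.smult_assoc1\<close>)
    also have "\<dots> = r \<odot>\<^bsub>Q\<^esub> linear_extension R Q b v"
      unfolding linear_extension_def
      by (rule Q.finsum_smult_ldistr[symmetric]) (use v r bc in auto)
    finally show "linear_extension R Q b (r \<odot>\<^bsub>free_module R S\<^esub> v) = r \<odot>\<^bsub>Q\<^esub> linear_extension R Q b v" by simp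
  qed
  show "linear_extension R Q b (single R s) = b s" if s: "s \<in> S"
  proof -
    have "linear_extension R Q b (single R s) = finsum Q (\<lambda>t. single R s t \<odot>\<^bsub>Q\<^esub> b t) {s}"
      by (rule ext) (use s in \<open>auto simp: single_def\<close>)
    moreover have "b s \<in> carrier Q" using s b by auto
    ultimately show ?thesis
      using Q.finsum_insert[of "{}" s "\<lambda>t. single R s t \<odot>\<^bsub>Q\<^esub> b t"] by (simp add: single_def)
  qed
qed

locale tensor_modules = M: module R M + N: module R N
  for R :: "('r, 'k) ring_scheme" (structure) and M :: "('r, 'm, 'y) module_scheme" and N :: "('r, 'n, 'z) module_scheme"
begin

abbreviation "free \<equiv> tensor_free R M N"
abbreviation "rels \<equiv> tensor_relations R M N"
abbreviation "tensor \<equiv> tensor_module R M N"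
abbreviation "pure \<equiv> tensor_pure R M N"

sublocale F: module R free
  unfolding tensor_free_def by (rule module_free_module) unfold_locales

text \<open>The relations inside \<open>tensor_relations\<close>, named so that they can be compared
  with a kernel.\<close>

definition generators :: "('m \<times> 'n \<Rightarrow> 'r) set" where
  "generators =
     {single R (m \<oplus>\<^bsub>M\<^esub> m', n) \<ominus>\<^bsub>free\<^esub> (single R (m, n) \<oplus>\<^bsub>free\<^esub> single R (m', n)) | m m' n.
        m \<in> carrier M \<and> m' \<in> carrier M \<and> n \<in> carrier N} \<union>
     {single R (m, n \<oplus>\<^bsub>N\<^esub> n') \<ominus>\<^bsub>free\<^esub> (single R (m, n) \<oplus>\<^bsub>free\<^esub> single R (m, n')) | m n n'.
        m \<in> carrier M \<and> n \<in> carrier N \<and> n' \<in> carrier N} \<union>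
     {single R (r \<odot>\<^bsub>M\<^esub> m, n) \<ominus>\<^bsub>free\<^esub> (r \<odot>\<^bsub>free\<^esub> single R (m, n)) | r m n.
        r \<in> carrier R \<and> m \<in> carrier M \<and> n \<in> carrier N} \<union>
     {single R (m, r \<odot>\<^bsub>N\<^esub> n) \<ominus>\<^bsub>free\<^esub> (r \<odot>\<^bsub>free\<^esub> single R (m, n)) | r m n.
        r \<in> carrier R \<and> m \<in> carrier M \<and> n \<in> carrier N}"

lemma rels_eq: "rels = submodule_generated R free generators"
  by (simp only: tensor_relations_def generators_def Let_def)

lemma single_free [simp]: "m \<in> carrier M \<Longrightarrow> n \<in> carrier N \<Longrightarrow> single R (m, n) \<in> carrier free"
  unfolding tensor_free_def by (rule single_closed) (auto intro: M.R.cring_axioms)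

lemma generators_closed: "generators \<subseteq> carrier free"
  unfolding generators_def
  by (safe; intro F.minus_closed F.a_closed F.smult_closed single_free M.a_closed N.a_closed M.smult_closed N.smult_closed; assumption)

lemma submodule_rels: "submodule_of_module R free rels"
  unfolding rels_eq
  by (intro submodule_of_module.intro submodule_of_module_axioms.intro F.module_axioms
    submodule_generated(1) generators_closed)

sublocale Q: submodule_of_module R free rels
  by (rule submodule_rels)

lemma generators_rels: "generators \<subseteq> rels"
  using submodule_generated(2)[OF F.module_axioms generators_closed] by (simp add: rels_eq)

sublocale T: module R tensor
  unfolding tensor_module_def by (rule Q.module_quotient)

lemma pure_closed [simp]: "m \<in> carrier M \<Longrightarrow> n \<in> carrier N \<Longrightarrow> pure m n \<in> carrier tensor"
  by (auto simp: tensor_module_def tensor_pure_def Q.quotient_carrier)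

lemma generatorsI:
  "m \<in> carrier M \<Longrightarrow> m' \<in> carrier M \<Longrightarrow> n \<in> carrier N \<Longrightarrow>
    single R (m \<oplus>\<^bsub>M\<^esub> m', n) \<ominus>\<^bsub>free\<^esub> (single R (m, n) \<oplus>\<^bsub>free\<^esub> single R (m', n)) \<in> generators"
  "m \<in> carrier M \<Longrightarrow> n \<in> carrier N \<Longrightarrow> n' \<in> carrier N \<Longrightarrow>
    single R (m, n \<oplus>\<^bsub>N\<^esub> n') \<ominus>\<^bsub>free\<^esub> (single R (m, n) \<oplus>\<^bsub>free\<^esub> single R (m, n')) \<in> generators"
  "r \<in> carrier R \<Longrightarrow> m \<in> carrier M \<Longrightarrow> n \<in> carrier N \<Longrightarrow>
    single R (r \<odot>\<^bsub>M\<^esub> m, n) \<ominus>\<^bsub>free\<^esub> (r \<odot>\<^bsub>free\<^esub> single R (m, n)) \<in> generators"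
  "r \<in> carrier R \<Longrightarrow> m \<in> carrier M \<Longrightarrow> n \<in> carrier N \<Longrightarrow>
    single R (m, r \<odot>\<^bsub>N\<^esub> n) \<ominus>\<^bsub>free\<^esub> (r \<odot>\<^bsub>free\<^esub> single R (m, n)) \<in> generators"
  unfolding generators_def by blast+

lemma pure_bilinear: "bilinear_map R M N tensor pure"
proof -
  \<comment> \<open>Each bilinearity law equates two cosets whose representatives differ by a
    generator.\<close>
  have gen: "Q.coset x = Q.coset y" if "x \<ominus>\<^bsub>free\<^esub> y \<in> generators" "x \<in> carrier free" "y \<in> carrier free" for x y
    using Q.coset_eq_iff[OF that(2,3)] generators_rels that(1) by blast
  have "pure (m \<oplus>\<^bsub>M\<^esub> m') n = pure m n \<oplus>\<^bsub>tensor\<^esub> pure m' n"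
    if "m \<in> carrier M" "m' \<in> carrier M" "n \<in> carrier N" for m m' n
    using gen[OF generatorsI(1)[OF that]] that
    by (simp add: tensor_pure_def tensor_module_def Q.quotient_add)
  moreover have "pure m (n \<oplus>\<^bsub>N\<^esub> n') = pure m n \<oplus>\<^bsub>tensor\<^esub> pure m n'"
    if "m \<in> carrier M" "n \<in> carrier N" "n' \<in> carrier N" for m n n'
    using gen[OF generatorsI(2)[OF that]] that
    by (simp add: tensor_pure_def tensor_module_def Q.quotient_add)
  moreover have "pure (r \<odot>\<^bsub>M\<^esub> m) n = r \<odot>\<^bsub>tensor\<^esub> pure m n"
    if "r \<in> carrier R" "m \<in> carrier M" "n \<in> carrier N" for m r n
    using gen[OF generatorsI(3)[OF that]] that
    by (simp add: tensor_pure_def tensor_module_def Q.quotient_smult)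
  moreover have "pure m (r \<odot>\<^bsub>N\<^esub> n) = r \<odot>\<^bsub>tensor\<^esub> pure m n"
    if "r \<in> carrier R" "m \<in> carrier M" "n \<in> carrier N" for m r n
    using gen[OF generatorsI(4)[OF that]] that
    by (simp add: tensor_pure_def tensor_module_def Q.quotient_smult)
  ultimately show ?thesis by (simp add: bilinear_map_def linear_map_def)
qed

text \<open>Induction in the free module, pushed to the quotient: basis vectors become pure tensors,
  and zero is a zero multiple of one.\<close>

lemma tensor_induct [consumes 1, case_names pure add smult]:
  assumes X: "X \<in> carrier tensor"
    and pure: "\<And>m n. m \<in> carrier M \<Longrightarrow> n \<in> carrier N \<Longrightarrow> P (pure m n)"
    and add: "\<And>X Y. X \<in> carrier tensor \<Longrightarrow> Y \<in> carrier tensor \<Longrightarrow> P X \<Longrightarrow> P Y \<Longrightarrow> P (X \<oplus>\<^bsub>tensor\<^esub> Y)"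
    and smult: "\<And>r X. r \<in> carrier R \<Longrightarrow> X \<in> carrier tensor \<Longrightarrow> P X \<Longrightarrow> P (r \<odot>\<^bsub>tensor\<^esub> X)"
  shows "P X"
proof -
  have cos [simp]: "Q.coset v \<in> carrier tensor" if "v \<in> carrier free" for v
    using that by (auto simp: tensor_module_def Q.quotient_carrier)
  have sm: "P (Q.coset (r \<odot>\<^bsub>free\<^esub> single R (m, n)))" if "r \<in> carrier R" "m \<in> carrier M" "n \<in> carrier N" for r m n
    using smult[OF that(1) pure_closed[OF that(2,3)] pure[OF that(2,3)]] that
    by (simp add: tensor_pure_def tensor_module_def Q.quotient_smult)
  obtain v where v: "v \<in> carrier free" "X = Q.coset v"
    using X by (auto simp: tensor_module_def Q.quotient_carrier)
  have "P (Q.coset v)"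
  proof (rule free_module_induct[where P = "\<lambda>v. P (Q.coset v)" and S = "carrier M \<times> carrier N", OF M.R.cring_axioms v(1)[unfolded tensor_free_def]], fold tensor_free_def)
    have "\<zero>\<^bsub>free\<^esub> = \<zero> \<odot>\<^bsub>free\<^esub> single R (\<zero>\<^bsub>M\<^esub>, \<zero>\<^bsub>N\<^esub>)" by simp
    then show "P (Q.coset \<zero>\<^bsub>free\<^esub>)" using sm[of \<zero> "\<zero>\<^bsub>M\<^esub>" "\<zero>\<^bsub>N\<^esub>"] by simp
    show "P (Q.coset (v \<oplus>\<^bsub>free\<^esub> w))"
      if "v \<in> carrier free" "w \<in> carrier free" "P (Q.coset v)" "P (Q.coset w)" for v w
      using add[OF cos[OF that(1)] cos[OF that(2)] that(3,4)] that(1,2)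
      by (simp add: tensor_module_def Q.quotient_add)
    show "P (Q.coset (r \<odot>\<^bsub>free\<^esub> single R s))" if "r \<in> carrier R" "s \<in> carrier M \<times> carrier N" for r s
      using sm that by auto
  qed
  then show ?thesis using v by simp
qed

text \<open>The linear extension of \<open>b\<close> to the free module kills all generators, hence
  all relations, so it is constant on cosets and the representative picked by \<open>SOME\<close>
  does not influence the value.\<close>

lemma tensor_lift:
  assumes "module R K" and b: "bilinear_map R M N K b"
  shows tensor_lift_linear: "linear_map R tensor K (tensor_lift R K b)"
    and tensor_lift_pure: "m \<in> carrier M \<Longrightarrow> n \<in> carrier N \<Longrightarrow> tensor_lift R K b (pure m n) = b m n"
proof -
  interpret K: module R K by fact
  let ?l = "linear_extension R K (\<lambda>(m, n). b m n)"
  have bP: "(\<lambda>(m, n). b m n) \<in> carrier M \<times> carrier N \<rightarrow> carrier K"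
    using bilinear_mapD(3)[OF b] by auto
  have lin: "linear_map R free K ?l"
    unfolding tensor_free_def by (rule linear_extension(1)[OF assms(1) bP])
  have ls [simp]: "?l (single R (m, n)) = b m n" if "m \<in> carrier M" "n \<in> carrier N" for m n
    using linear_extension(2)[OF assms(1) bP, of "(m, n)"] that by simp
  note l = linear_mapD[OF lin] linear_map_zero[OF F.module_axioms K.module_axioms lin]
    linear_map_minus[OF F.module_axioms K.module_axioms lin]
  \<comment> \<open>A kernel is a submodule, so it suffices that it contains the generators.\<close>
  let ?ker = "{v \<in> carrier free. ?l v = \<zero>\<^bsub>K\<^esub>}"
  have minus: "?l (\<ominus>\<^bsub>free\<^esub> v) = \<ominus>\<^bsub>K\<^esub> ?l v" if "v \<in> carrier free" for v
    using l(5)[of "\<zero>\<^bsub>free\<^esub>" v] that l(1)[of v] l(4) by (simp add: F.minus_eq K.minus_eq)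
  have "submodule ?ker R free"
    by (rule F.submoduleI) (auto simp: l minus)
  moreover have "generators \<subseteq> ?ker"
  proof
    fix v assume v: "v \<in> generators"
    then have vc: "v \<in> carrier free" using generators_closed by auto
    have "x \<ominus>\<^bsub>K\<^esub> x = \<zero>\<^bsub>K\<^esub>" if "x \<in> carrier K" for x using that by (simp add: K.minus_eq K.r_neg)
    then have "?l v = \<zero>\<^bsub>K\<^esub>"
      using v bilinear_mapD(3)[OF b]
        linear_mapD(2)[OF bilinear_mapD(1)[OF b]] linear_mapD(3)[OF bilinear_mapD(1)[OF b]]
        linear_mapD(2)[OF bilinear_mapD(2)[OF b]] linear_mapD(3)[OF bilinear_mapD(2)[OF b]]
      unfolding generators_def by (auto simp: l)
    then show "v \<in> ?ker" using vc by simp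
  qed
  ultimately have rels: "rels \<subseteq> ?ker"
    unfolding rels_eq by (rule submodule_generated(3)[OF F.module_axioms generators_closed])
  have lift: "tensor_lift R K b (Q.coset v) = ?l v" if v: "v \<in> carrier free" for v
  proof -
    \<comment> \<open>The representative used by \<open>tensor_lift\<close>; it differs from
      \<open>v\<close> by a relation, which is killed.\<close>
    define w where "w = (SOME w. w \<in> Q.coset v)"
    have "w \<in> Q.coset v" unfolding w_def by (rule someI[of _ v]) (rule Q.coset_self[OF v])
    then obtain h where h: "h \<in> rels" "w = h \<oplus>\<^bsub>free\<^esub> v" by (rule Q.coset_elem_obtain)
    have "tensor_lift R K b (Q.coset v) = ?l w"
      by (simp add: tensor_lift_def linear_extension_def w_def[symmetric] case_prod_unfold)
    also have "\<dots> = ?l v" using h rels v by (auto simp: l subset_iff)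
    finally show ?thesis .
  qed
  show "linear_map R tensor K (tensor_lift R K b)"
    by (rule linear_mapI)
      (auto simp: tensor_module_def Q.quotient_carrier Q.quotient_add Q.quotient_smult lift l)
  show "tensor_lift R K b (pure m n) = b m n" if "m \<in> carrier M" "n \<in> carrier N"
    using that by (simp add: tensor_pure_def lift)
qed

lemma linear_map_tensor_eqI:
  assumes "linear_map R tensor K h" "linear_map R tensor K h'"
    and "\<And>m n. m \<in> carrier M \<Longrightarrow> n \<in> carrier N \<Longrightarrow> h (pure m n) = h' (pure m n)" and "X \<in> carrier tensor"
  shows "h X = h' X"
  using assms(4) by (induction X rule: tensor_induct) (simp_all add: assms(3) linear_mapD[OF assms(1)] linear_mapD[OF assms(2)])

end

section \<open>Bilinear maps on two tensor products\<close>

lemma linear_map_add: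
  assumes "module R N" "linear_map R M N h" "linear_map R M N k"
  shows "linear_map R M N (\<lambda>m. h m \<oplus>\<^bsub>N\<^esub> k m)"
proof -
  interpret N: module R N by fact
  show ?thesis
    using linear_mapD[OF assms(2)] linear_mapD[OF assms(3)]
    by (intro linear_mapI) (simp_all add: N.smult_r_distr N.a_ac)
qed

lemma linear_map_smult:
  assumes "module R N" "linear_map R M N h" "r \<in> carrier R"
  shows "linear_map R M N (\<lambda>m. r \<odot>\<^bsub>N\<^esub> h m)"
proof -
  interpret N: module R N by fact
  show ?thesis
    using linear_mapD[OF assms(2)] assms(3)
    by (intro linear_mapI) (simp_all add: N.smult_r_distr N.smult_assoc1[symmetric] N.R.m_comm)
qed

lemma bilinear_mapI:
  "(\<And>m. m \<in> carrier M \<Longrightarrow> linear_map R N Q (b m)) \<Longrightarrow> (\<And>n. n \<in> carrier N \<Longrightarrow> linear_map R M Q (\<lambda>m. b m n)) \<Longrightarrow>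
    bilinear_map R M N Q b"
  by (simp add: bilinear_map_def)

text \<open>\<open>linear_map_tensor_eqI\<close> in the first argument, and then in the second with
  a pure tensor fixed in the first.\<close>

lemma bilinear_map_tensor_eqI:
  assumes 1: "tensor_modules R M1 N1" and 2: "tensor_modules R M2 N2"
    and b: "bilinear_map R (tensor_module R M1 N1) (tensor_module R M2 N2) K b"
    and b': "bilinear_map R (tensor_module R M1 N1) (tensor_module R M2 N2) K b'"
    and eq: "\<And>f g h k. f \<in> carrier M1 \<Longrightarrow> g \<in> carrier N1 \<Longrightarrow> h \<in> carrier M2 \<Longrightarrow> k \<in> carrier N2 \<Longrightarrow>
      b (tensor_pure R M1 N1 f g) (tensor_pure R M2 N2 h k) = b' (tensor_pure R M1 N1 f g) (tensor_pure R M2 N2 h k)"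
    and s: "s \<in> carrier (tensor_module R M1 N1)" and t: "t \<in> carrier (tensor_module R M2 N2)"
  shows "b s t = b' s t"
proof (rule tensor_modules.linear_map_tensor_eqI[OF 1 bilinear_mapD(2)[OF b t] bilinear_mapD(2)[OF b' t] _ s])
  fix f g assume fg: "f \<in> carrier M1" "g \<in> carrier N1"
  note p = tensor_modules.pure_closed[OF 1 fg]
  show "b (tensor_pure R M1 N1 f g) t = b' (tensor_pure R M1 N1 f g) t"
    by (rule tensor_modules.linear_map_tensor_eqI[OF 2 bilinear_mapD(1)[OF b p] bilinear_mapD(1)[OF b' p] _ t])
      (rule eq[OF fg])
qed

text \<open>The abstract form of \<open>tensor_op\<close>. Two nested lifts require that the inner
  one depend bilinearly on \<open>f\<close> and \<open>g\<close> for every \<open>t\<close>, so that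
  the outer lift exists, and that the outer one be linear in \<open>t\<close>.\<close>

lemma tensor_lift2:
  assumes 1: "tensor_modules R M1 N1" and 2: "tensor_modules R M2 N2" and 0: "tensor_modules R M N"
    and p: "bilinear_map R M1 M2 M p" and q: "bilinear_map R N1 N2 N q"
  defines "K \<equiv> tensor_module R M N"
  defines "b \<equiv> \<lambda>s t. tensor_lift R K (\<lambda>f g. tensor_lift R K (\<lambda>h k. tensor_pure R M N (p f h) (q g k)) t) s"
  shows "bilinear_map R (tensor_module R M1 N1) (tensor_module R M2 N2) K b"
    and "f \<in> carrier M1 \<Longrightarrow> g \<in> carrier N1 \<Longrightarrow> h \<in> carrier M2 \<Longrightarrow> k \<in> carrier N2 \<Longrightarrow>
      b (tensor_pure R M1 N1 f g) (tensor_pure R M2 N2 h k) = tensor_pure R M N (p f h) (q g k)"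
proof -
  interpret T1: tensor_modules R M1 N1 by fact
  interpret T2: tensor_modules R M2 N2 by fact
  interpret T: tensor_modules R M N by fact
  have K: "module R K" unfolding K_def by (rule T.T.module_axioms)
  note pure = T.pure_bilinear[folded K_def]
  let ?b = "\<lambda>f g h k. T.pure (p f h) (q g k)"
  let ?c = "\<lambda>t f g. tensor_lift R K (?b f g) t"
  note pc = bilinear_mapD(3)[OF p] and qc = bilinear_mapD(3)[OF q]
  have b: "bilinear_map R M2 N2 K (?b f g)" if "f \<in> carrier M1" "g \<in> carrier N1" for f g
  proof (rule bilinear_mapI)
    show "linear_map R N2 K (?b f g h)" if "h \<in> carrier M2" for h
      by (rule linear_map_comp[OF bilinear_mapD(1)[OF q] bilinear_mapD(1)[OF pure]])
        (use pc \<open>f \<in> _\<close> \<open>g \<in> _\<close> that in auto)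
    show "linear_map R M2 K (\<lambda>h. ?b f g h k)" if "k \<in> carrier N2" for k
      by (rule linear_map_comp[OF bilinear_mapD(1)[OF p] bilinear_mapD(2)[OF pure]])
        (use qc \<open>f \<in> _\<close> \<open>g \<in> _\<close> that in auto)
  qed
  note bl = T2.tensor_lift_linear[OF K b] and bp = T2.tensor_lift_pure[OF K b]
  \<comment> \<open>For fixed \<open>f\<close> and \<open>g\<close> each required identity is linear
    in \<open>t\<close>, hence is checked on pure tensors.\<close>
  have c: "bilinear_map R M1 N1 K (?c t)" if t: "t \<in> carrier T2.tensor" for t
  proof (rule bilinear_mapI)
    fix f assume f: "f \<in> carrier M1"
    show "linear_map R N1 K (?c t f)"
    proof (rule linear_mapI)
      show "?c t f g \<in> carrier K" if "g \<in> carrier N1" for g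
        by (rule linear_mapD(1)[OF bl[OF f that] t])
    next
      fix g g' assume g: "g \<in> carrier N1" "g' \<in> carrier N1"
      then have gg: "g \<oplus>\<^bsub>N1\<^esub> g' \<in> carrier N1" by simp
      show "?c t f (g \<oplus>\<^bsub>N1\<^esub> g') = ?c t f g \<oplus>\<^bsub>K\<^esub> ?c t f g'"
      proof (rule T2.linear_map_tensor_eqI[OF bl[OF f gg] linear_map_add[OF K bl[OF f g(1)] bl[OF f g(2)]] _ t])
        fix h k assume "h \<in> carrier M2" "k \<in> carrier N2"
        then show "?c (T2.pure h k) f (g \<oplus>\<^bsub>N1\<^esub> g') = ?c (T2.pure h k) f g \<oplus>\<^bsub>K\<^esub> ?c (T2.pure h k) f g'"
          using linear_mapD(2)[OF bilinear_mapD(2)[OF q]] linear_mapD(2)[OF bilinear_mapD(1)[OF pure]]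
          by (simp add: bp f g gg pc qc)
      qed
    next
      fix r g assume r: "r \<in> carrier R" and g: "g \<in> carrier N1"
      then have rg: "r \<odot>\<^bsub>N1\<^esub> g \<in> carrier N1" by simp
      show "?c t f (r \<odot>\<^bsub>N1\<^esub> g) = r \<odot>\<^bsub>K\<^esub> ?c t f g"
      proof (rule T2.linear_map_tensor_eqI[OF bl[OF f rg] linear_map_smult[OF K bl[OF f g] r] _ t])
        fix h k assume "h \<in> carrier M2" "k \<in> carrier N2"
        then show "?c (T2.pure h k) f (r \<odot>\<^bsub>N1\<^esub> g) = r \<odot>\<^bsub>K\<^esub> ?c (T2.pure h k) f g"
          using linear_mapD(3)[OF bilinear_mapD(2)[OF q]] linear_mapD(3)[OF bilinear_mapD(1)[OF pure]]
          by (simp add: bp f g rg r pc qc)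
      qed
    qed
  next
    fix g assume g: "g \<in> carrier N1"
    show "linear_map R M1 K (\<lambda>f. ?c t f g)"
    proof (rule linear_mapI)
      show "?c t f g \<in> carrier K" if "f \<in> carrier M1" for f
        by (rule linear_mapD(1)[OF bl[OF that g] t])
    next
      fix f f' assume f: "f \<in> carrier M1" "f' \<in> carrier M1"
      then have ff: "f \<oplus>\<^bsub>M1\<^esub> f' \<in> carrier M1" by simp
      show "?c t (f \<oplus>\<^bsub>M1\<^esub> f') g = ?c t f g \<oplus>\<^bsub>K\<^esub> ?c t f' g"
      proof (rule T2.linear_map_tensor_eqI[OF bl[OF ff g] linear_map_add[OF K bl[OF f(1) g] bl[OF f(2) g]] _ t])
        fix h k assume "h \<in> carrier M2" "k \<in> carrier N2"
        then show "?c (T2.pure h k) (f \<oplus>\<^bsub>M1\<^esub> f') g = ?c (T2.pure h k) f g \<oplus>\<^bsub>K\<^esub> ?c (T2.pure h k) f' g"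
          using linear_mapD(2)[OF bilinear_mapD(2)[OF p]] linear_mapD(2)[OF bilinear_mapD(2)[OF pure]]
          by (simp add: bp f g ff pc qc)
      qed
    next
      fix r f assume r: "r \<in> carrier R" and f: "f \<in> carrier M1"
      then have rf: "r \<odot>\<^bsub>M1\<^esub> f \<in> carrier M1" by simp
      show "?c t (r \<odot>\<^bsub>M1\<^esub> f) g = r \<odot>\<^bsub>K\<^esub> ?c t f g"
      proof (rule T2.linear_map_tensor_eqI[OF bl[OF rf g] linear_map_smult[OF K bl[OF f g] r] _ t])
        fix h k assume "h \<in> carrier M2" "k \<in> carrier N2"
        then show "?c (T2.pure h k) (r \<odot>\<^bsub>M1\<^esub> f) g = r \<odot>\<^bsub>K\<^esub> ?c (T2.pure h k) f g"
          using linear_mapD(3)[OF bilinear_mapD(2)[OF p]] linear_mapD(3)[OF bilinear_mapD(2)[OF pure]]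
          by (simp add: bp f g rf r pc qc)
      qed
    qed
  qed
  note cl = T1.tensor_lift_linear[OF K c] and cp = T1.tensor_lift_pure[OF K c]
  show "bilinear_map R T1.tensor T2.tensor K b"
  proof (rule bilinear_mapI)
    show "linear_map R T1.tensor K (\<lambda>s. b s t)" if "t \<in> carrier T2.tensor" for t
      unfolding b_def by (rule cl[OF that])
  next
    fix s assume s: "s \<in> carrier T1.tensor"
    show "linear_map R T2.tensor K (b s)"
      unfolding b_def
    proof (rule linear_mapI)
      show "tensor_lift R K (?c t) s \<in> carrier K" if "t \<in> carrier T2.tensor" for t
        by (rule linear_mapD(1)[OF cl[OF that] s])
    next
      fix t t' assume t: "t \<in> carrier T2.tensor" "t' \<in> carrier T2.tensor"
      then have tt: "t \<oplus>\<^bsub>T2.tensor\<^esub> t' \<in> carrier T2.tensor" by simp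
      show "tensor_lift R K (?c (t \<oplus>\<^bsub>T2.tensor\<^esub> t')) s = tensor_lift R K (?c t) s \<oplus>\<^bsub>K\<^esub> tensor_lift R K (?c t') s"
      proof (rule T1.linear_map_tensor_eqI[OF cl[OF tt] linear_map_add[OF K cl[OF t(1)] cl[OF t(2)]] _ s])
        fix f g assume fg: "f \<in> carrier M1" "g \<in> carrier N1"
        show "tensor_lift R K (?c (t \<oplus>\<^bsub>T2.tensor\<^esub> t')) (T1.pure f g) =
            tensor_lift R K (?c t) (T1.pure f g) \<oplus>\<^bsub>K\<^esub> tensor_lift R K (?c t') (T1.pure f g)"
          unfolding cp[OF tt fg] cp[OF t(1) fg] cp[OF t(2) fg] by (rule linear_mapD(2)[OF bl[OF fg] t])
      qed
    next
      fix r t assume r: "r \<in> carrier R" and t: "t \<in> carrier T2.tensor"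
      then have rt: "r \<odot>\<^bsub>T2.tensor\<^esub> t \<in> carrier T2.tensor" by simp
      show "tensor_lift R K (?c (r \<odot>\<^bsub>T2.tensor\<^esub> t)) s = r \<odot>\<^bsub>K\<^esub> tensor_lift R K (?c t) s"
      proof (rule T1.linear_map_tensor_eqI[OF cl[OF rt] linear_map_smult[OF K cl[OF t] r] _ s])
        fix f g assume fg: "f \<in> carrier M1" "g \<in> carrier N1"
        show "tensor_lift R K (?c (r \<odot>\<^bsub>T2.tensor\<^esub> t)) (T1.pure f g) = r \<odot>\<^bsub>K\<^esub> tensor_lift R K (?c t) (T1.pure f g)"
          unfolding cp[OF rt fg] cp[OF t fg] by (rule linear_mapD(3)[OF bl[OF fg] r t])
      qed
    qed
  qed
  show "f \<in> carrier M1 \<Longrightarrow> g \<in> carrier N1 \<Longrightarrow> h \<in> carrier M2 \<Longrightarrow> k \<in> carrier N2 \<Longrightarrow>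
      b (T1.pure f g) (T2.pure h k) = T.pure (p f h) (q g k)"
    unfolding b_def by (subst cp) (auto simp: bp)
qed

section \<open>Bilinear functors and the tensor product of categories\<close>

lemma linear_functor_map:
  "linear_functor R C D F \<Longrightarrow> x \<in> Ob C \<Longrightarrow> y \<in> Ob C \<Longrightarrow> linear_map R (HomM C x y) (HomM D (fo F x) (fo F y)) (fa F)"
  unfolding linear_functor_def by blast

lemma tensor_cat_sel [simp]:
  "Ob (tensor_cat R A B) = Ob A \<times> Ob B"
  "(x, y, s) \<in> Ar (tensor_cat R A B) \<longleftrightarrow> x \<in> Ob A \<times> Ob B \<and> y \<in> Ob A \<times> Ob B \<and> s \<in> carrier (tensor_hom R A B x y)"
  "Dom (tensor_cat R A B) (x, y, s) = x" "Cod (tensor_cat R A B) (x, y, s) = y"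
  "ide (tensor_cat R A B) (a, b) = tensor_arr R A B (ide A a) (ide B b)"
  "(y, z, s) \<cdot>\<^bsub>tensor_cat R A B\<^esub> (x, y', t) = tensor_op R A B (Comp A) (Comp B) x z s t"
  "HomM (tensor_cat R A B) x y = tagged_module x y (tensor_hom R A B x y)"
  by (simp_all add: tensor_cat_def)

lemma tagged_module_sel [simp]:
  "carrier (tagged_module x y M) = {x} \<times> {y} \<times> carrier M"
  "(x', y', m) \<oplus>\<^bsub>tagged_module x y M\<^esub> (x'', y'', m') = (x, y, m \<oplus>\<^bsub>M\<^esub> m')"
  "r \<odot>\<^bsub>tagged_module x y M\<^esub> (x', y', m) = (x, y, r \<odot>\<^bsub>M\<^esub> m)"
  by (simp_all add: tagged_module_def)

lemma linear_map_tagged: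
  "linear_map R (tagged_module x y M) N h \<longleftrightarrow> linear_map R M N (\<lambda>m. h (x, y, m))"
  by (auto simp: linear_map_def Pi_iff)

context linear_category
begin

lemma carrier_HomM': "x \<in> Ob C \<Longrightarrow> y \<in> Ob C \<Longrightarrow> f \<in> carrier (HomM C x y) \<longleftrightarrow> f \<in> Ar C \<and> Dom C f = x \<and> Cod C f = y"
  by (simp add: carrier_HomM Hom_def)

lemma comp_left_linear:
  assumes "g \<in> Ar C" "x \<in> Ob C"
  shows "linear_map R (HomM C x (Dom C g)) (HomM C x (Cod C g)) (\<lambda>f. g \<cdot> f)"
  using assms bilinear_mapD(1)[OF comp_bilinear[of x "Dom C g" "Cod C g"], of g] by (simp add: carrier_HomM')

lemma comp_right_linear:
  assumes "f \<in> Ar C" "z \<in> Ob C"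
  shows "linear_map R (HomM C (Cod C f) z) (HomM C (Dom C f) z) (\<lambda>g. g \<cdot> f)"
  using assms bilinear_mapD(2)[OF comp_bilinear[of "Dom C f" "Cod C f" z], of f] by (simp add: carrier_HomM')

end

locale tensor_categories = A: linear_category R A + B: linear_category R B
  for R :: "('r, 'k) ring_scheme" and A :: "('ao, 'aa, 'r, 'u) lcat_scheme" and B :: "('bo, 'ba, 'r, 'v) lcat_scheme"
begin

abbreviation "T \<equiv> tensor_cat R A B"
abbreviation "thom \<equiv> tensor_hom R A B"
abbreviation "tarr \<equiv> tensor_arr R A B"

lemma tensor_modules_hom:
  assumes "x \<in> Ob A \<times> Ob B" "y \<in> Ob A \<times> Ob B"
  shows "tensor_modules R (HomM A (fst x) (fst y)) (HomM B (snd x) (snd y))"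
  using assms by (auto intro!: tensor_modules.intro A.module_HomM B.module_HomM)

lemma pure_thom:
  assumes "f \<in> Ar A" "g \<in> Ar B"
  shows "tensor_pure R (HomM A (Dom A f) (Cod A f)) (HomM B (Dom B g) (Cod B g)) f g \<in> carrier (thom (Dom A f, Dom B g) (Cod A f, Cod B g))"
proof -
  interpret tensor_modules R "HomM A (Dom A f) (Cod A f)" "HomM B (Dom B g) (Cod B g)"
    using tensor_modules_hom[of "(Dom A f, Dom B g)" "(Cod A f, Cod B g)"] assms by simp
  show ?thesis using assms by (simp add: tensor_hom_def A.carrier_HomM' B.carrier_HomM')
qed

lemma tarr_typed [simp]:
  assumes "f \<in> Ar A" "g \<in> Ar B"
  shows "tarr f g \<in> Ar T" "Dom T (tarr f g) = (Dom A f, Dom B g)" "Cod T (tarr f g) = (Cod A f, Cod B g)"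
  using assms pure_thom[OF assms] by (simp_all add: tensor_arr_def)

text \<open>The projections remove source and target from an arrow, so that bilinearity can be
  stated between untagged tensor modules, where \<open>tensor_lift2\<close> applies.\<close>

lemma tensor_op_bilinear:
  assumes "x \<in> Ob A \<times> Ob B" "x' \<in> Ob A \<times> Ob B" "y \<in> Ob A \<times> Ob B" "y' \<in> Ob A \<times> Ob B"
    "z \<in> Ob A \<times> Ob B" "z' \<in> Ob A \<times> Ob B"
    and p: "bilinear_map R (HomM A (fst x) (fst x')) (HomM A (fst y) (fst y')) (HomM A (fst z) (fst z')) p"
    and q: "bilinear_map R (HomM B (snd x) (snd x')) (HomM B (snd y) (snd y')) (HomM B (snd z) (snd z')) q"
  shows "bilinear_map R (thom x x') (thom y y') (thom z z') (\<lambda>s t. snd (snd (tensor_op R A B p q z z' s t)))"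
    and "f \<in> carrier (HomM A (fst x) (fst x')) \<Longrightarrow> g \<in> carrier (HomM B (snd x) (snd x')) \<Longrightarrow>
      h \<in> carrier (HomM A (fst y) (fst y')) \<Longrightarrow> k \<in> carrier (HomM B (snd y) (snd y')) \<Longrightarrow>
      tensor_op R A B p q z z' (tensor_pure R (HomM A (fst x) (fst x')) (HomM B (snd x) (snd x')) f g)
       (tensor_pure R (HomM A (fst y) (fst y')) (HomM B (snd y) (snd y')) h k) =
      (z, z', tensor_pure R (HomM A (fst z) (fst z')) (HomM B (snd z) (snd z')) (p f h) (q g k))"
  using tensor_lift2[OF tensor_modules_hom tensor_modules_hom tensor_modules_hom p q] assms(1-6)
  by (simp_all add: tensor_op_def tensor_hom_def)

lemma tensor_op_tarr:
  assumes f: "f \<in> Ar A" "g \<in> Ar B" "h \<in> Ar A" "k \<in> Ar B" and z: "z \<in> Ob A \<times> Ob B" "z' \<in> Ob A \<times> Ob B"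
    and p: "bilinear_map R (HomM A (Dom A f) (Cod A f)) (HomM A (Dom A h) (Cod A h)) (HomM A (fst z) (fst z')) p"
    and q: "bilinear_map R (HomM B (Dom B g) (Cod B g)) (HomM B (Dom B k) (Cod B k)) (HomM B (snd z) (snd z')) q"
  shows "tensor_op R A B p q z z' (snd (snd (tarr f g))) (snd (snd (tarr h k))) = tarr (p f h) (q g k)"
proof -
  have "p f h \<in> carrier (HomM A (fst z) (fst z'))"
    by (rule bilinear_mapD(3)[OF p]) (use f in \<open>simp_all add: A.carrier_HomM'\<close>)
  moreover have "q g k \<in> carrier (HomM B (snd z) (snd z'))"
    by (rule bilinear_mapD(3)[OF q]) (use f in \<open>simp_all add: B.carrier_HomM'\<close>)
  moreover have "fst z \<in> Ob A" "fst z' \<in> Ob A" "snd z \<in> Ob B" "snd z' \<in> Ob B" using z by auto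
  ultimately have [simp]: "Dom A (p f h) = fst z" "Cod A (p f h) = fst z'" "Dom B (q g k) = snd z" "Cod B (q g k) = snd z'"
    by (simp_all add: A.carrier_HomM' B.carrier_HomM')
  show ?thesis
    using tensor_op_bilinear(2)[of "(Dom A f, Dom B g)" "(Cod A f, Cod B g)" "(Dom A h, Dom B k)" "(Cod A h, Cod B k)" z z' p q f g h k]
      f z p q by (simp add: tensor_arr_def A.carrier_HomM' B.carrier_HomM')
qed

lemma tarr_comp:
  assumes "f \<in> Ar A" "g \<in> Ar B" "f' \<in> Ar A" "g' \<in> Ar B" "Dom A f' = Cod A f" "Dom B g' = Cod B g"
  shows "tarr f' g' \<cdot>\<^bsub>T\<^esub> tarr f g = tarr (f' \<cdot>\<^bsub>A\<^esub> f) (g' \<cdot>\<^bsub>B\<^esub> g)"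
proof -
  have "tarr f' g' \<cdot>\<^bsub>T\<^esub> tarr f g = tensor_op R A B (Comp A) (Comp B) (Dom A f, Dom B g) (Cod A f', Cod B g')
      (snd (snd (tarr f' g'))) (snd (snd (tarr f g)))"
    by (simp add: tensor_arr_def)
  also have "\<dots> = tarr (f' \<cdot>\<^bsub>A\<^esub> f) (g' \<cdot>\<^bsub>B\<^esub> g)"
    using assms A.comp_bilinear[of "Dom A f" "Cod A f" "Cod A f'"] B.comp_bilinear[of "Dom B g" "Cod B g" "Cod B g'"]
    by (intro tensor_op_tarr) auto
  finally show ?thesis .
qed

lemma tarr_bilinear:
  assumes "x \<in> Ob A \<times> Ob B" "y \<in> Ob A \<times> Ob B"
  shows "bilinear_map R (HomM A (fst x) (fst y)) (HomM B (snd x) (snd y)) (HomM T x y) (\<lambda>f g. tarr f g)"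
proof -
  interpret M: tensor_modules R "HomM A (fst x) (fst y)" "HomM B (snd x) (snd y)"
    using tensor_modules_hom[OF assms] .
  have *: "tarr f g = (x, y, M.pure f g)"
    if "f \<in> carrier (HomM A (fst x) (fst y))" "g \<in> carrier (HomM B (snd x) (snd y))" for f g
    using that assms by (auto simp: tensor_arr_def A.carrier_HomM' B.carrier_HomM')
  show ?thesis
    using M.pure_bilinear unfolding bilinear_map_def linear_map_def
    by (simp add: * tensor_hom_def[symmetric] Pi_iff)
qed

lemma linear_functor_thom:
  assumes "linear_functor R T C K" "x \<in> Ob A \<times> Ob B" "y \<in> Ob A \<times> Ob B"
  shows "linear_map R (thom x y) (HomM C (fo K x) (fo K y)) (\<lambda>s. fa K (x, y, s))"
  using linear_functor_map[OF assms(1), of x y] assms(2,3) by (simp add: linear_map_tagged)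

lemma linear_functor_bilinear:
  assumes "linear_functor R T C K" "x \<in> Ob A \<times> Ob B" "y \<in> Ob A \<times> Ob B"
  shows "bilinear_map R (HomM A (fst x) (fst y)) (HomM B (snd x) (snd y)) (HomM C (fo K x) (fo K y)) (\<lambda>f g. fa K (tarr f g))"
proof -
  have l: "linear_map R (HomM T x y) (HomM C (fo K x) (fo K y)) (fa K)"
    using linear_functor_map[OF assms(1), of x y] assms(2,3) by simp
  show ?thesis
    by (rule bilinear_mapI)
      (rule linear_map_comp[OF bilinear_mapD(1)[OF tarr_bilinear[OF assms(2,3)]] l] linear_map_comp[OF bilinear_mapD(2)[OF tarr_bilinear[OF assms(2,3)]] l]; assumption)+
qed

text \<open>Both sides of a naturality square are linear in the arrow, and pure tensors generate the
  hom-modules. This lemma carries families natural on \<open>A \<times> B\<close> over to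
  \<open>A \<otimes> B\<close>.\<close>

lemma tensor_nat_transI:
  assumes C: "linear_category R C" and K: "linear_functor R T C K" and K': "linear_functor R T C K'"
    and \<eta>: "\<And>x. x \<in> Ob A \<times> Ob B \<Longrightarrow> \<eta> x \<in> Ar C \<and> Dom C (\<eta> x) = fo K x \<and> Cod C (\<eta> x) = fo K' x"
    and nat: "\<And>f g. f \<in> Ar A \<Longrightarrow> g \<in> Ar B \<Longrightarrow>
      fa K' (tarr f g) \<cdot>\<^bsub>C\<^esub> \<eta> (Dom A f, Dom B g) = \<eta> (Cod A f, Cod B g) \<cdot>\<^bsub>C\<^esub> fa K (tarr f g)"
  shows "nat_trans T C K K' \<eta>"
proof (rule nat_transI)
  show "x \<in> Ob T \<Longrightarrow> \<eta> x \<in> Ar C \<and> Dom C (\<eta> x) = fo K x \<and> Cod C (\<eta> x) = fo K' x" for x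
    using \<eta> by simp
  interpret C: linear_category R C by fact
  fix u assume u: "u \<in> Ar T"
  obtain x y s where us: "u = (x, y, s)" and x: "x \<in> Ob A \<times> Ob B" and y: "y \<in> Ob A \<times> Ob B" and s: "s \<in> carrier (thom x y)"
    using u by (cases u) auto
  interpret M: tensor_modules R "HomM A (fst x) (fst y)" "HomM B (snd x) (snd y)"
    using tensor_modules_hom[OF x y] .
  have "fo K x \<in> Ob C" "fo K' y \<in> Ob C"
    using K K' x y by (auto simp: linear_functor_def is_functor_def)
  then have 1: "linear_map R M.tensor (HomM C (fo K x) (fo K' y)) (\<lambda>s. fa K' (x, y, s) \<cdot>\<^bsub>C\<^esub> \<eta> x)"
    and 2: "linear_map R M.tensor (HomM C (fo K x) (fo K' y)) (\<lambda>s. \<eta> y \<cdot>\<^bsub>C\<^esub> fa K (x, y, s))"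
    using linear_map_comp[OF linear_functor_thom[OF K' x y], of "HomM C (fo K x) (fo K' y)" "\<lambda>g. g \<cdot>\<^bsub>C\<^esub> \<eta> x"]
      linear_map_comp[OF linear_functor_thom[OF K x y], of "HomM C (fo K x) (fo K' y)" "\<lambda>g. \<eta> y \<cdot>\<^bsub>C\<^esub> g"]
      C.comp_right_linear[of "\<eta> x" "fo K' y"] C.comp_left_linear[of "\<eta> y" "fo K x"] \<eta>[OF x] \<eta>[OF y]
    by (simp_all add: tensor_hom_def)
  have "fa K' (x, y, s) \<cdot>\<^bsub>C\<^esub> \<eta> x = \<eta> y \<cdot>\<^bsub>C\<^esub> fa K (x, y, s)"
  proof (rule M.linear_map_tensor_eqI[OF 1 2])
    fix f g assume fg: "f \<in> carrier (HomM A (fst x) (fst y))" "g \<in> carrier (HomM B (snd x) (snd y))"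
    have *: "tarr f g = (x, y, M.pure f g)" "f \<in> Ar A" "g \<in> Ar B" "x = (Dom A f, Dom B g)" "y = (Cod A f, Cod B g)"
      using fg x y by (auto simp: tensor_arr_def A.carrier_HomM' B.carrier_HomM')
    show "fa K' (x, y, M.pure f g) \<cdot>\<^bsub>C\<^esub> \<eta> x = \<eta> y \<cdot>\<^bsub>C\<^esub> fa K (x, y, M.pure f g)"
      using nat[OF *(2,3)] *(1,4,5) by simp
  qed (use s in \<open>simp add: tensor_hom_def\<close>)
  then show "fa K' u \<cdot>\<^bsub>C\<^esub> \<eta> (Dom T u) = \<eta> (Cod T u) \<cdot>\<^bsub>C\<^esub> fa K u" by (simp add: us)
qed

text \<open>On every hom-module the functor is the lift of \<open>h\<close>. The behaviour of
  \<open>h\<close> on pairs of arrows suffices, because preservation of composition is an identity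
  of bilinear maps.\<close>

lemma tensor_functor_exists:
  assumes C: "linear_category R C"
    and ob: "\<And>x. x \<in> Ob A \<times> Ob B \<Longrightarrow> o' x \<in> Ob C"
    and bil: "\<And>x y. x \<in> Ob A \<times> Ob B \<Longrightarrow> y \<in> Ob A \<times> Ob B \<Longrightarrow>
      bilinear_map R (HomM A (fst x) (fst y)) (HomM B (snd x) (snd y)) (HomM C (o' x) (o' y)) h"
    and ide: "\<And>a b. a \<in> Ob A \<Longrightarrow> b \<in> Ob B \<Longrightarrow> h (ide A a) (ide B b) = ide C (o' (a, b))"
    and comp: "\<And>f g f' g'. f \<in> Ar A \<Longrightarrow> g \<in> Ar B \<Longrightarrow> f' \<in> Ar A \<Longrightarrow> g' \<in> Ar B \<Longrightarrow> Dom A f' = Cod A f \<Longrightarrow> Dom B g' = Cod B g \<Longrightarrow>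
      h (f' \<cdot>\<^bsub>A\<^esub> f) (g' \<cdot>\<^bsub>B\<^esub> g) = h f' g' \<cdot>\<^bsub>C\<^esub> h f g"
  obtains K :: "('ao \<times> 'bo, ('ao, 'aa, 'bo, 'ba, 'r) tensor_arrow, 'co, 'ca) fct"
  where "linear_functor R T (C :: ('co, 'ca, 'r, 'w) lcat_scheme) K" "\<And>x. fo K x = o' x"
    "\<And>f g. f \<in> Ar A \<Longrightarrow> g \<in> Ar B \<Longrightarrow> fa K (tarr f g) = h f g"
proof -
  interpret C: linear_category R C by fact
  define K :: "('ao \<times> 'bo, ('ao, 'aa, 'bo, 'ba, 'r) tensor_arrow, 'co, 'ca) fct" where
    "K = \<lparr>fo = o', fa = \<lambda>(x, y, s). tensor_lift R (HomM C (o' x) (o' y)) h s\<rparr>"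
  have Ksel: "fo K x = o' x" "fa K (x, y, s) = tensor_lift R (HomM C (o' x) (o' y)) h s" for x y s
    by (simp_all add: K_def)
  have lin: "linear_map R (thom x y) (HomM C (o' x) (o' y)) (\<lambda>s. fa K (x, y, s))"
    and pure: "f \<in> carrier (HomM A (fst x) (fst y)) \<Longrightarrow> g \<in> carrier (HomM B (snd x) (snd y)) \<Longrightarrow>
      fa K (x, y, tensor_pure R (HomM A (fst x) (fst y)) (HomM B (snd x) (snd y)) f g) = h f g"
    if xy: "x \<in> Ob A \<times> Ob B" "y \<in> Ob A \<times> Ob B" for x y f g
    using tensor_modules.tensor_lift[OF tensor_modules_hom[OF xy] C.module_HomM[OF ob[OF xy(1)] ob[OF xy(2)]] bil[OF xy]]
    by (simp_all add: Ksel tensor_hom_def)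
  have tarr: "fa K (tarr f g) = h f g" if fg: "f \<in> Ar A" "g \<in> Ar B" for f g
    using pure[of "(Dom A f, Dom B g)" "(Cod A f, Cod B g)" f g] fg
    by (simp add: tensor_arr_def A.carrier_HomM' B.carrier_HomM')
  have cl: "fa K (x, y, s) \<in> Ar C \<and> Dom C (fa K (x, y, s)) = o' x \<and> Cod C (fa K (x, y, s)) = o' y"
    if "x \<in> Ob A \<times> Ob B" "y \<in> Ob A \<times> Ob B" "s \<in> carrier (thom x y)" for x y s
    using linear_mapD(1)[OF lin[OF that(1,2)] that(3)] ob[OF that(1)] ob[OF that(2)] by (simp only: C.carrier_HomM')
  have comp': "fa K ((y, z, s) \<cdot>\<^bsub>T\<^esub> (x, y, t)) = fa K (y, z, s) \<cdot>\<^bsub>C\<^esub> fa K (x, y, t)"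
    if x: "x \<in> Ob A \<times> Ob B" and y: "y \<in> Ob A \<times> Ob B" and z: "z \<in> Ob A \<times> Ob B"
      and s: "s \<in> carrier (thom y z)" and t: "t \<in> carrier (thom x y)" for x y z s t
  proof -
    have x': "fst x \<in> Ob A" "snd x \<in> Ob B" and y': "fst y \<in> Ob A" "snd y \<in> Ob B" and z': "fst z \<in> Ob A" "snd z \<in> Ob B"
      using x y z by auto
    let ?op = "\<lambda>s t. snd (snd (tensor_op R A B (Comp A) (Comp B) x z s t))"
    note op = tensor_op_bilinear[OF y z x y x z A.comp_bilinear[OF x'(1) y'(1) z'(1)] B.comp_bilinear[OF x'(2) y'(2) z'(2)]]
    have eq: "tensor_op R A B (Comp A) (Comp B) x z s t = (x, z, ?op s t)" for s t
      by (simp add: tensor_op_def)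
    have "fa K (x, z, ?op s t) = fa K (y, z, s) \<cdot>\<^bsub>C\<^esub> fa K (x, y, t)"
    \<comment> \<open>Both sides are bilinear in the two tensors, so functoriality on pure tensors
      is enough.\<close>
    proof (rule bilinear_map_tensor_eqI[OF tensor_modules_hom[OF y z] tensor_modules_hom[OF x y], folded tensor_hom_def])
      show "bilinear_map R (thom y z) (thom x y) (HomM C (o' x) (o' z)) (\<lambda>s t. fa K (x, z, ?op s t))"
        by (rule bilinear_mapI)
          (rule linear_map_comp[OF bilinear_mapD(1)[OF op(1)] lin[OF x z]] linear_map_comp[OF bilinear_mapD(2)[OF op(1)] lin[OF x z]]; assumption)+
      have b: "bilinear_map R (HomM C (o' y) (o' z)) (HomM C (o' x) (o' y)) (HomM C (o' x) (o' z)) (\<lambda>g f. g \<cdot>\<^bsub>C\<^esub> f)"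
        by (rule C.comp_bilinear) (use ob x y z in auto)
      show "bilinear_map R (thom y z) (thom x y) (HomM C (o' x) (o' z)) (\<lambda>s t. fa K (y, z, s) \<cdot>\<^bsub>C\<^esub> fa K (x, y, t))"
      proof (rule bilinear_mapI)
        show "linear_map R (thom x y) (HomM C (o' x) (o' z)) (\<lambda>t. fa K (y, z, s) \<cdot>\<^bsub>C\<^esub> fa K (x, y, t))"
          if "s \<in> carrier (thom y z)" for s
          by (rule linear_map_comp[OF lin[OF x y] bilinear_mapD(1)[OF b linear_mapD(1)[OF lin[OF y z] that]]])
        show "linear_map R (thom y z) (HomM C (o' x) (o' z)) (\<lambda>s. fa K (y, z, s) \<cdot>\<^bsub>C\<^esub> fa K (x, y, t))"
          if "t \<in> carrier (thom x y)" for t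
          by (rule linear_map_comp[OF lin[OF y z] bilinear_mapD(2)[OF b linear_mapD(1)[OF lin[OF x y] that]]])
      qed
      fix f g f' g'
      assume fg: "f \<in> carrier (HomM A (fst y) (fst z))" "g \<in> carrier (HomM B (snd y) (snd z))"
        "f' \<in> carrier (HomM A (fst x) (fst y))" "g' \<in> carrier (HomM B (snd x) (snd y))"
      then have *: "f \<in> Ar A" "g \<in> Ar B" "f' \<in> Ar A" "g' \<in> Ar B" "Dom A f = Cod A f'" "Dom B g = Cod B g'"
        "f \<cdot>\<^bsub>A\<^esub> f' \<in> carrier (HomM A (fst x) (fst z))" "g \<cdot>\<^bsub>B\<^esub> g' \<in> carrier (HomM B (snd x) (snd z))"
        using x' y' z' by (auto simp: A.carrier_HomM' B.carrier_HomM')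
      show "fa K (x, z, ?op (tensor_pure R (HomM A (fst y) (fst z)) (HomM B (snd y) (snd z)) f g)
           (tensor_pure R (HomM A (fst x) (fst y)) (HomM B (snd x) (snd y)) f' g')) =
         fa K (y, z, tensor_pure R (HomM A (fst y) (fst z)) (HomM B (snd y) (snd z)) f g) \<cdot>\<^bsub>C\<^esub>
         fa K (x, y, tensor_pure R (HomM A (fst x) (fst y)) (HomM B (snd x) (snd y)) f' g')"
        unfolding op(2)[OF fg] by (simp add: pure[OF x z *(7,8)] pure[OF y z fg(1,2)] pure[OF x y fg(3,4)] comp *)
    qed (use s t in auto)
    then show ?thesis unfolding tensor_cat_sel(6) by (subst eq)
  qed
  have "is_functor T C K"
  proof (rule functorI)
    show "fo K x \<in> Ob C" if "x \<in> Ob T" for x using that ob by (simp add: Ksel)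
    show "fa K u \<in> Ar C \<and> Dom C (fa K u) = fo K (Dom T u) \<and> Cod C (fa K u) = fo K (Cod T u)" if "u \<in> Ar T" for u
      using that cl by (cases u) (auto simp: Ksel(1))
    show "fa K (ide T x) = ide C (fo K x)" if "x \<in> Ob T" for x
      using that by (auto simp: tarr ide Ksel(1))
    show "fa K (v \<cdot>\<^bsub>T\<^esub> u) = fa K v \<cdot>\<^bsub>C\<^esub> fa K u" if "u \<in> Ar T" "v \<in> Ar T" "Dom T v = Cod T u" for u v
      using that comp' by (cases u, cases v) (auto simp del: tensor_cat_sel(6))
  qed
  then have "linear_functor R T C K"
    using lin unfolding linear_functor_def by (simp add: linear_map_tagged Ksel(1))
  then show ?thesis using Ksel(1) tarr by (rule that)
qed

end

section \<open>Right exact linear functors\<close>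

text \<open>Stated for all extensions of the record \<open>fct\<close>, so that it applies to
  monoidal functors as they stand.\<close>

definition lin_rex ::
  "('r, 'k) ring_scheme \<Rightarrow> ('o1, 'a1, 'r, 'y) lcat_scheme \<Rightarrow> ('o2, 'a2, 'r, 'z) lcat_scheme \<Rightarrow>
   ('o1, 'a1, 'o2, 'a2, 'w) fct_scheme \<Rightarrow> bool"
where
  "lin_rex R C D F \<longleftrightarrow> linear_functor R C D F \<and> right_exact C D F"

lemma linear_functor_is_functor: "linear_functor R C D F \<Longrightarrow> is_functor C D F"
  by (simp add: linear_functor_def)

lemma lin_rex_is_functor: "lin_rex R C D F \<Longrightarrow> is_functor C D F"
  by (simp add: lin_rex_def linear_functor_def)

lemma is_cocone_cong:
  assumes J: "category J"
    and "\<And>j. j \<in> Ob J \<Longrightarrow> fo K j = fo K' j" "\<And>u. u \<in> Ar J \<Longrightarrow> fa K u = fa K' u" "\<And>j. j \<in> Ob J \<Longrightarrow> \<iota> j = \<iota>' j"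
  shows "is_cocone J C K c \<iota> \<longleftrightarrow> is_cocone J C K' c \<iota>'"
proof -
  interpret J: category J by fact
  have "u \<in> Hom J i j \<Longrightarrow> u \<in> Ar J \<and> i \<in> Ob J \<and> j \<in> Ob J" for u i j
    by (auto simp: Hom_def)
  then show ?thesis
    unfolding is_cocone_def using assms(2-) by (metis (no_types, lifting))
qed

lemma is_colimit_cong:
  assumes J: "category J"
    and K: "\<And>j. j \<in> Ob J \<Longrightarrow> fo K j = fo K' j" "\<And>u. u \<in> Ar J \<Longrightarrow> fa K u = fa K' u" and \<iota>: "\<And>j. j \<in> Ob J \<Longrightarrow> \<iota> j = \<iota>' j"
  shows "is_colimit J C K c \<iota> \<longleftrightarrow> is_colimit J C K' c \<iota>'"
proof -
  have 1: "is_cocone J C K d \<kappa> \<longleftrightarrow> is_cocone J C K' d \<kappa>" for d \<kappa>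
    by (rule is_cocone_cong[OF J K]) auto
  have 2: "is_cocone J C K' c \<iota> \<longleftrightarrow> is_cocone J C K' c \<iota>'"
    by (rule is_cocone_cong[OF J]) (simp_all add: \<iota>)
  have 3: "(\<forall>j\<in>Ob J. h \<cdot>\<^bsub>C\<^esub> \<iota> j = \<kappa> j) \<longleftrightarrow> (\<forall>j\<in>Ob J. h \<cdot>\<^bsub>C\<^esub> \<iota>' j = \<kappa> j)" for h \<kappa>
    using \<iota> by auto
  show ?thesis unfolding is_colimit_def 1 2 3 by (rule refl)
qed

text \<open>A diagram in \<open>C\<close> and its colimit cocone involve only objects and arrows of
  \<open>C\<close>, where the two functors agree.\<close>

lemma right_exact_cong:
  assumes "right_exact C D F" "category C"
    and F: "\<And>x. x \<in> Ob C \<Longrightarrow> fo F x = fo F' x" "\<And>f. f \<in> Ar C \<Longrightarrow> fa F f = fa F' f"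
  shows "right_exact C D F'"
  unfolding right_exact_def
proof (intro allI impI, elim conjE)
  fix J :: "(nat, nat) cat" and K :: "(nat, nat, 'a, 'b) fct" and c \<iota>
  assume J: "finite_category J" and K: "is_functor J C K" and col: "is_colimit J C K c \<iota>"
  have jc: "category J" using J by (simp add: finite_category_def)
  have c: "c \<in> Ob C" and \<iota>: "\<And>j. j \<in> Ob J \<Longrightarrow> \<iota> j \<in> Ar C"
    using col by (auto simp: is_colimit_def is_cocone_def Hom_def)
  have "is_colimit J D (comp_fct F K) (fo F c) (\<lambda>j. fa F (\<iota> j))"
    using assms(1) J K col by (simp add: right_exact_def)
  then show "is_colimit J D (comp_fct F' K) (fo F' c) (\<lambda>j. fa F' (\<iota> j))"
    using is_colimit_cong[OF jc, of "comp_fct F K" "comp_fct F' K" "\<lambda>j. fa F (\<iota> j)" "\<lambda>j. fa F' (\<iota> j)" D "fo F c"]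
      functor_simps[OF K] F c \<iota> by simp
qed

lemma linear_functor_cong:
  assumes F: "linear_functor R C D F" and C: "linear_category R C"
    and F': "\<And>x. x \<in> Ob C \<Longrightarrow> fo F x = fo F' x" "\<And>f. f \<in> Ar C \<Longrightarrow> fa F f = fa F' f"
  shows "linear_functor R C D F'"
proof -
  interpret C: linear_category R C by fact
  note fs = functor_simps[OF linear_functor_is_functor[OF F]]
  have "is_functor C D F'"
  proof (rule functorI)
    fix f g assume "f \<in> Ar C" "g \<in> Ar C" "Dom C g = Cod C f"
    then show "fa F' (g \<cdot>\<^bsub>C\<^esub> f) = fa F' g \<cdot>\<^bsub>D\<^esub> fa F' f"
      using fs(6)[of f g] F'(2)[of "g \<cdot>\<^bsub>C\<^esub> f"] F'(2)[of f] F'(2)[of g] by simp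
  qed (use fs in \<open>simp_all add: F'[symmetric]\<close>)
  moreover have "linear_map R (HomM C x y) (HomM D (fo F' x) (fo F' y)) (fa F')" if xy: "x \<in> Ob C" "y \<in> Ob C" for x y
  proof -
    interpret M: module R "HomM C x y" by (rule C.module_HomM[OF xy])
    have "fa F f = fa F' f" if "f \<in> carrier (HomM C x y)" for f
      using that F' xy by (simp add: C.carrier_HomM')
    then show ?thesis
      using linear_functor_map[OF F xy] F' xy unfolding linear_map_def by (auto simp: Pi_iff)
  qed
  ultimately show ?thesis by (simp add: linear_functor_def)
qed

lemma lin_rex_cong:
  assumes "lin_rex R C D F" "linear_category R C"
    and "\<And>x. x \<in> Ob C \<Longrightarrow> fo F x = fo F' x" "\<And>f. f \<in> Ar C \<Longrightarrow> fa F f = fa F' f"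
  shows "lin_rex R C D F'"
  using linear_functor_cong[of R C D F F'] right_exact_cong[of C D F F'] assms
  by (auto simp: lin_rex_def linear_category_def)

lemma right_exact_comp:
  assumes "is_functor C D F" "right_exact C D F" "right_exact D E G"
  shows "right_exact C E (comp_fct G F)"
  unfolding right_exact_def
proof (intro allI impI, elim conjE)
  fix J :: "(nat, nat) cat" and K :: "(nat, nat, 'a, 'b) fct" and c \<iota>
  assume J: "finite_category J" and K: "is_functor J C K" and col: "is_colimit J C K c \<iota>"
  have "is_colimit J D (comp_fct F K) (fo F c) (\<lambda>j. fa F (\<iota> j))"
    using assms(2) J K col by (simp add: right_exact_def)
  then have "is_colimit J E (comp_fct G (comp_fct F K)) (fo G (fo F c)) (\<lambda>j. fa G (fa F (\<iota> j)))"
    using assms(3) J functor_comp[OF K assms(1)] unfolding right_exact_def by blast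
  then show "is_colimit J E (comp_fct (comp_fct G F) K) (fo (comp_fct G F) c) (\<lambda>j. fa (comp_fct G F) (\<iota> j))"
    by (simp add: comp_fct_def)
qed

lemma linear_functor_comp:
  assumes "linear_functor R C D F" "linear_functor R D E G"
  shows "linear_functor R C E (comp_fct G F)"
proof -
  have "linear_map R (HomM C x y) (HomM E (fo G (fo F x)) (fo G (fo F y))) (\<lambda>f. fa G (fa F f))"
    if "x \<in> Ob C" "y \<in> Ob C" for x y
    using that functor_simps(1)[OF linear_functor_is_functor[OF assms(1)]]
    by (intro linear_map_comp[OF linear_functor_map[OF assms(1)] linear_functor_map[OF assms(2)]]) auto
  then show ?thesis
    using functor_comp[OF linear_functor_is_functor[OF assms(1)] linear_functor_is_functor[OF assms(2)]]
    by (simp add: linear_functor_def comp_fct_def)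
qed

lemma lin_rex_comp: "lin_rex R C D F \<Longrightarrow> lin_rex R D E G \<Longrightarrow> lin_rex R C E (comp_fct G F)"
  by (auto simp: lin_rex_def intro: linear_functor_comp right_exact_comp linear_functor_is_functor)

abbreviation tensor_left :: "('o, 'a, 'r, 'z) smcat_scheme \<Rightarrow> 'o \<Rightarrow> ('o, 'a, 'o, 'a) fct" where
  "tensor_left C x \<equiv> \<lparr>fo = \<lambda>y. x \<star>\<^bsub>C\<^esub> y, fa = \<lambda>g. ide C x \<diamondop>\<^bsub>C\<^esub> g\<rparr>"

abbreviation tensor_right :: "('o, 'a, 'r, 'z) smcat_scheme \<Rightarrow> 'o \<Rightarrow> ('o, 'a, 'o, 'a) fct" where
  "tensor_right C y \<equiv> \<lparr>fo = \<lambda>x. x \<star>\<^bsub>C\<^esub> y, fa = \<lambda>f. f \<diamondop>\<^bsub>C\<^esub> ide C y\<rparr>"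

lemma lin_rex_tensor:
  assumes C: "rex_sm_category R C" and x: "x \<in> Ob C"
  shows "lin_rex R C C (tensor_left C x)" "lin_rex R C C (tensor_right C x)"
proof -
  interpret L: symmetric_monoidal_linear_category R C
    using C by (simp add: rex_sm_category_def)
  interpret C: sm_category C by (rule L.sm_category)
  have "linear_map R (HomM C y y') (HomM C (x \<star>\<^bsub>C\<^esub> y) (x \<star>\<^bsub>C\<^esub> y')) (\<lambda>g. ide C x \<diamondop>\<^bsub>C\<^esub> g)"
    and "linear_map R (HomM C y y') (HomM C (y \<star>\<^bsub>C\<^esub> x) (y' \<star>\<^bsub>C\<^esub> x)) (\<lambda>f. f \<diamondop>\<^bsub>C\<^esub> ide C x)"
    if "y \<in> Ob C" "y' \<in> Ob C" for y y'
    using bilinear_mapD(1)[OF L.tar_bilinear[OF x x that], of "ide C x"]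
      bilinear_mapD(2)[OF L.tar_bilinear[OF that x x], of "ide C x"] x by (simp_all add: L.carrier_HomM')
  moreover have "is_functor C C (tensor_left C x)" "is_functor C C (tensor_right C x)"
    using x by (auto intro!: functorI simp: C.tar_merge)
  ultimately show "lin_rex R C C (tensor_left C x)" "lin_rex R C C (tensor_right C x)"
    using C x by (simp_all add: lin_rex_def linear_functor_def rex_sm_category_def)
qed

section \<open>Extension along a dense monoidal functor\<close>

text \<open>Two consequences of the universal property: precomposition with \<open>Z\<close> is
  faithful and full on right exact linear functors. \<open>X\<close> is merely symmetric monoidal,
  which admits \<open>prod_smcat A B\<close>. The quantified functors have the fixed type
  \<open>fct\<close>, as a locale assumption cannot be polymorphic.\<close>

locale dense_functor = P: sm_category P + C: sm_category C + X: sm_category X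
  for R :: "('r, 'k) ring_scheme" and P :: "('po, 'pa, 'r) smcat" and C :: "('co, 'ca, 'r) smcat" (structure)
    and X :: "('xo, 'xa, 'r) smcat" and Z :: "('xo, 'xa, 'po, 'pa) smfct" +
  assumes Z: "sm_functor X P Z"
    and rexP: "rex_sm_category R P" and rexC: "rex_sm_category R C"
    and Z_faithful: "\<And>(F :: ('po, 'pa, 'co, 'ca) fct) (F' :: ('po, 'pa, 'co, 'ca) fct) \<eta> \<eta>' p. lin_rex R P C F \<Longrightarrow> lin_rex R P C F' \<Longrightarrow>
      nat_trans P C F F' \<eta> \<Longrightarrow> nat_trans P C F F' \<eta>' \<Longrightarrow> (\<And>x. x \<in> Ob X \<Longrightarrow> \<eta> (fo Z x) = \<eta>' (fo Z x)) \<Longrightarrow>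
      p \<in> Ob P \<Longrightarrow> \<eta> p = \<eta>' p"
    and Z_full: "\<And>(F :: ('po, 'pa, 'co, 'ca) fct) (F' :: ('po, 'pa, 'co, 'ca) fct) \<theta>. lin_rex R P C F \<Longrightarrow> lin_rex R P C F' \<Longrightarrow>
      nat_trans X C (comp_fct F Z) (comp_fct F' Z) \<theta> \<Longrightarrow>
      \<exists>\<eta>. nat_trans P C F F' \<eta> \<and> (\<forall>x\<in>Ob X. \<eta> (fo Z x) = \<theta> x)"
begin

lemmas iZ = sm_functor_is_functor[OF Z]
lemmas Z_simps [simp] = sm_functor_simps[OF Z] functor_simps[OF iZ]

abbreviation PP where "PP \<equiv> prod_smcat P P"

definition fix1 :: "('po \<times> 'po, 'pa \<times> 'pa, 'co, 'ca) fct \<Rightarrow> 'po \<Rightarrow> ('po, 'pa, 'co, 'ca) fct" where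
  "fix1 T p = \<lparr>fo = \<lambda>q. fo T (p, q), fa = \<lambda>g. fa T (ide P p, g)\<rparr>"

definition fix2 :: "('po \<times> 'po, 'pa \<times> 'pa, 'co, 'ca) fct \<Rightarrow> 'po \<Rightarrow> ('po, 'pa, 'co, 'ca) fct" where
  "fix2 T q = \<lparr>fo = \<lambda>p. fo T (p, q), fa = \<lambda>f. fa T (f, ide P q)\<rparr>"

lemma fix_sel [simp]:
  "fo (fix1 T p) q = fo T (p, q)" "fa (fix1 T p) g = fa T (ide P p, g)"
  "fo (fix2 T q) p = fo T (p, q)" "fa (fix2 T q) f = fa T (f, ide P q)"
  by (simp_all add: fix1_def fix2_def)

text \<open>Functoriality is taken on the cartesian product, while linearity and right exactness are
  required in each variable separately; this is enough to apply the assumptions on \<open>Z\<close>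
  one variable at a time.\<close>

definition birex :: "('po \<times> 'po, 'pa \<times> 'pa, 'co, 'ca) fct \<Rightarrow> bool" where
  "birex T \<longleftrightarrow> is_functor PP C T \<and> (\<forall>p\<in>Ob P. lin_rex R P C (fix1 T p) \<and> lin_rex R P C (fix2 T p))"

lemma birexD:
  assumes "birex T"
  shows "is_functor PP C T" "p \<in> Ob P \<Longrightarrow> lin_rex R P C (fix1 T p)" "p \<in> Ob P \<Longrightarrow> lin_rex R P C (fix2 T p)"
  using assms by (auto simp: birex_def)

lemma nat_trans_fix:
  assumes \<eta>: "nat_trans PP C T T' \<eta>" and [simp]: "p \<in> Ob P"
  shows "nat_trans P C (fix1 T p) (fix1 T' p) (\<lambda>q. \<eta> (p, q))" "nat_trans P C (fix2 T p) (fix2 T' p) (\<lambda>q. \<eta> (q, p))"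
  using nat_trans_natural[OF \<eta>, of "(ide P p, f)" for f] nat_trans_natural[OF \<eta>, of "(f, ide P p)" for f]
  by (auto intro!: nat_transI simp: nat_trans_simps[OF \<eta>])

text \<open>Agreement spreads from \<open>(Z x, Z y)\<close> to \<open>(p, Z y)\<close> by
  \<open>Z_faithful\<close> in the first variable, and from there to \<open>(p, q)\<close> in the
  second.\<close>

lemma bi_unique:
  assumes T: "birex T" and T': "birex T'" and \<eta>: "nat_trans PP C T T' \<eta>" and \<eta>': "nat_trans PP C T T' \<eta>'"
    and eq: "\<And>x y. x \<in> Ob X \<Longrightarrow> y \<in> Ob X \<Longrightarrow> \<eta> (fo Z x, fo Z y) = \<eta>' (fo Z x, fo Z y)"
    and pq: "p \<in> Ob P" "q \<in> Ob P"
  shows "\<eta> (p, q) = \<eta>' (p, q)"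
proof -
  have 1: "\<eta> (p, fo Z y) = \<eta>' (p, fo Z y)" if y: "y \<in> Ob X" for y
    by (rule Z_faithful[OF birexD(3)[OF T] birexD(3)[OF T'] nat_trans_fix(2)[OF \<eta>] nat_trans_fix(2)[OF \<eta>']])
      (use y pq eq in simp_all)
  show ?thesis
    by (rule Z_faithful[OF birexD(2)[OF T] birexD(2)[OF T'] nat_trans_fix(1)[OF \<eta>] nat_trans_fix(1)[OF \<eta>']])
      (use pq 1 in simp_all)
qed

text \<open>Fullness extends \<open>\<theta>\<close> in the first variable and then in the second.
  Each extension is natural only in the variable being extended; naturality in the other one is
  recovered by \<open>Z_faithful\<close>, because both sides of the square are transformations that
  agree on the image of \<open>Z\<close>.\<close>

lemma bi_exists:
  assumes T: "birex T" and T': "birex T'"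
    and typed: "\<And>x y. x \<in> Ob X \<Longrightarrow> y \<in> Ob X \<Longrightarrow>
      \<theta> x y \<in> Ar C \<and> Dom C (\<theta> x y) = fo T (fo Z x, fo Z y) \<and> Cod C (\<theta> x y) = fo T' (fo Z x, fo Z y)"
    and nat: "\<And>f g. f \<in> Ar X \<Longrightarrow> g \<in> Ar X \<Longrightarrow>
      fa T' (fa Z f, fa Z g) \<cdot> \<theta> (Dom X f) (Dom X g) = \<theta> (Cod X f) (Cod X g) \<cdot> fa T (fa Z f, fa Z g)"
  shows "\<exists>\<eta>. nat_trans PP C T T' \<eta> \<and> (\<forall>x\<in>Ob X. \<forall>y\<in>Ob X. \<eta> (fo Z x, fo Z y) = \<theta> x y)"
proof -
  note iT = birexD(1)[OF T] and iT' = birexD(1)[OF T']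
  have TS [simp]: "fo T (p, q) \<in> Ob C" "fo T' (p, q) \<in> Ob C" if "p \<in> Ob P" "q \<in> Ob P" for p q
    using functor_simps(1)[OF iT, of "(p, q)"] functor_simps(1)[OF iT', of "(p, q)"] that by simp_all
  have TA [simp]: "fa T (f, g) \<in> Ar C" "Dom C (fa T (f, g)) = fo T (Dom P f, Dom P g)" "Cod C (fa T (f, g)) = fo T (Cod P f, Cod P g)"
    "fa T' (f, g) \<in> Ar C" "Dom C (fa T' (f, g)) = fo T' (Dom P f, Dom P g)" "Cod C (fa T' (f, g)) = fo T' (Cod P f, Cod P g)"
    if "f \<in> Ar P" "g \<in> Ar P" for f g
    using functor_simps(2-4)[OF iT, of "(f, g)"] functor_simps(2-4)[OF iT', of "(f, g)"] that by simp_all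
  have Tc: "fa T (f', g') \<cdot> fa T (f, g) = fa T (f' \<cdot>\<^bsub>P\<^esub> f, g' \<cdot>\<^bsub>P\<^esub> g)"
    "fa T' (f', g') \<cdot> fa T' (f, g) = fa T' (f' \<cdot>\<^bsub>P\<^esub> f, g' \<cdot>\<^bsub>P\<^esub> g)"
    if "f \<in> Ar P" "g \<in> Ar P" "f' \<in> Ar P" "g' \<in> Ar P" "Dom P f' = Cod P f" "Dom P g' = Cod P g" for f g f' g'
    using functor_simps(6)[OF iT, of "(f, g)" "(f', g')"] functor_simps(6)[OF iT', of "(f, g)" "(f', g')"] that by simp_all
  \<comment> \<open>Extension in the first variable, with the second fixed at
    \<open>Z y\<close>.\<close>
  have "\<exists>\<eta>. nat_trans P C (fix2 T (fo Z y)) (fix2 T' (fo Z y)) \<eta> \<and> (\<forall>x\<in>Ob X. \<eta> (fo Z x) = \<theta> x y)" if y: "y \<in> Ob X" for y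
  proof (rule Z_full[OF birexD(3)[OF T] birexD(3)[OF T']])
    show "nat_trans X C (comp_fct (fix2 T (fo Z y)) Z) (comp_fct (fix2 T' (fo Z y)) Z) (\<lambda>x. \<theta> x y)"
      using y typed nat[of _ "ide X y"] by (auto intro!: nat_transI)
  qed (use y in simp_all)
  then obtain \<zeta> where \<zeta>: "\<And>y. y \<in> Ob X \<Longrightarrow> nat_trans P C (fix2 T (fo Z y)) (fix2 T' (fo Z y)) (\<lambda>p. \<zeta> p y)"
    and \<zeta>\<theta>: "\<And>x y. x \<in> Ob X \<Longrightarrow> y \<in> Ob X \<Longrightarrow> \<zeta> (fo Z x) y = \<theta> x y"
  proof -
    assume *: "\<And>\<zeta>. (\<And>y. y \<in> Ob X \<Longrightarrow> nat_trans P C (fix2 T (fo Z y)) (fix2 T' (fo Z y)) (\<lambda>p. \<zeta> p y)) \<Longrightarrow>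
        (\<And>x y. x \<in> Ob X \<Longrightarrow> y \<in> Ob X \<Longrightarrow> \<zeta> (fo Z x) y = \<theta> x y) \<Longrightarrow> thesis"
      and ex: "\<And>y. y \<in> Ob X \<Longrightarrow> \<exists>\<eta>. nat_trans P C (fix2 T (fo Z y)) (fix2 T' (fo Z y)) \<eta> \<and> (\<forall>x\<in>Ob X. \<eta> (fo Z x) = \<theta> x y)"
    obtain \<zeta> where "\<And>y. y \<in> Ob X \<Longrightarrow> nat_trans P C (fix2 T (fo Z y)) (fix2 T' (fo Z y)) (\<zeta> y) \<and> (\<forall>x\<in>Ob X. \<zeta> y (fo Z x) = \<theta> x y)"
      using ex by metis
    then show thesis by (intro *[of "\<lambda>p y. \<zeta> y p"]) auto
  qed
  have \<zeta>t [simp]: "\<zeta> p y \<in> Ar C" "Dom C (\<zeta> p y) = fo T (p, fo Z y)" "Cod C (\<zeta> p y) = fo T' (p, fo Z y)"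
    if "p \<in> Ob P" "y \<in> Ob X" for p y
    using nat_trans_simps[OF \<zeta>[OF that(2)] that(1)] by simp_all
  have \<zeta>n: "fa T' (f, ide P (fo Z y)) \<cdot> \<zeta> (Dom P f) y = \<zeta> (Cod P f) y \<cdot> fa T (f, ide P (fo Z y))"
    if "f \<in> Ar P" "y \<in> Ob X" for f y
    using nat_trans_natural[OF \<zeta>[OF that(2)] that(1)] by simp
  \<comment> \<open>For a fixed arrow \<open>g\<close> both sides are natural in \<open>p\<close>,
    and at \<open>p = Z x\<close> they agree by naturality of \<open>\<theta>\<close>. Without this,
    \<open>\<zeta> p\<close> could not be extended in the second variable.\<close>
  have \<zeta>n2: "fa T' (ide P p, fa Z g) \<cdot> \<zeta> p (Dom X g) = \<zeta> p (Cod X g) \<cdot> fa T (ide P p, fa Z g)"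
    if g [simp]: "g \<in> Ar X" and p: "p \<in> Ob P" for g p
  proof (rule Z_faithful[where F = "fix2 T (fo Z (Dom X g))" and F' = "fix2 T' (fo Z (Cod X g))"
        and \<eta> = "\<lambda>p. fa T' (ide P p, fa Z g) \<cdot> \<zeta> p (Dom X g)" and \<eta>' = "\<lambda>p. \<zeta> p (Cod X g) \<cdot> fa T (ide P p, fa Z g)"])
    show "lin_rex R P C (fix2 T (fo Z (Dom X g)))" "lin_rex R P C (fix2 T' (fo Z (Cod X g)))"
      using birexD(3)[OF T] birexD(3)[OF T'] by simp_all
    show "nat_trans P C (fix2 T (fo Z (Dom X g))) (fix2 T' (fo Z (Cod X g))) (\<lambda>p. fa T' (ide P p, fa Z g) \<cdot> \<zeta> p (Dom X g))"
    proof (rule nat_transI)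
      fix f assume [simp]: "f \<in> Ar P"
      let ?y = "fo Z (Dom X g)" and ?y' = "fo Z (Cod X g)"
      have "fa T' (f, ide P ?y') \<cdot> fa T' (ide P (Dom P f), fa Z g) \<cdot> \<zeta> (Dom P f) (Dom X g) =
         fa T' (f, fa Z g) \<cdot> \<zeta> (Dom P f) (Dom X g)"
        by (intro C.reassoc) (simp_all add: Tc)
      also have "\<dots> = (fa T' (ide P (Cod P f), fa Z g) \<cdot> fa T' (f, ide P ?y)) \<cdot> \<zeta> (Dom P f) (Dom X g)"
        by (simp add: Tc)
      also have "\<dots> = (fa T' (ide P (Cod P f), fa Z g) \<cdot> \<zeta> (Cod P f) (Dom X g)) \<cdot> fa T (f, ide P ?y)"
        by (simp add: C.assoc \<zeta>n)
      finally show "fa (fix2 T' ?y') f \<cdot> fa T' (ide P (Dom P f), fa Z g) \<cdot> \<zeta> (Dom P f) (Dom X g) =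
          (fa T' (ide P (Cod P f), fa Z g) \<cdot> \<zeta> (Cod P f) (Dom X g)) \<cdot> fa (fix2 T ?y) f" by simp
    qed simp_all
    show "nat_trans P C (fix2 T (fo Z (Dom X g))) (fix2 T' (fo Z (Cod X g))) (\<lambda>p. \<zeta> p (Cod X g) \<cdot> fa T (ide P p, fa Z g))"
    proof (rule nat_transI)
      fix f assume [simp]: "f \<in> Ar P"
      let ?y = "fo Z (Dom X g)" and ?y' = "fo Z (Cod X g)"
      have "fa T' (f, ide P ?y') \<cdot> \<zeta> (Dom P f) (Cod X g) \<cdot> fa T (ide P (Dom P f), fa Z g) =
         (\<zeta> (Cod P f) (Cod X g) \<cdot> fa T (f, ide P ?y')) \<cdot> fa T (ide P (Dom P f), fa Z g)"
        by (intro C.reassoc) (simp_all add: \<zeta>n)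
      also have "\<dots> = (\<zeta> (Cod P f) (Cod X g) \<cdot> fa T (ide P (Cod P f), fa Z g)) \<cdot> fa T (f, ide P ?y)"
        by (simp add: C.assoc Tc)
      finally show "fa (fix2 T' ?y') f \<cdot> \<zeta> (Dom P f) (Cod X g) \<cdot> fa T (ide P (Dom P f), fa Z g) =
          (\<zeta> (Cod P f) (Cod X g) \<cdot> fa T (ide P (Cod P f), fa Z g)) \<cdot> fa (fix2 T ?y) f" by simp
    qed simp_all
    fix x assume "x \<in> Ob X"
    then show "fa T' (ide P (fo Z x), fa Z g) \<cdot> \<zeta> (fo Z x) (Dom X g) = \<zeta> (fo Z x) (Cod X g) \<cdot> fa T (ide P (fo Z x), fa Z g)"
      using nat[of "ide X x" g] by (simp add: \<zeta>\<theta>)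
  qed (rule p)
  \<comment> \<open>Extension in the second variable, now at an arbitrary \<open>p\<close>.\<close>
  have "\<exists>\<eta>. nat_trans P C (fix1 T p) (fix1 T' p) \<eta> \<and> (\<forall>y\<in>Ob X. \<eta> (fo Z y) = \<zeta> p y)" if p: "p \<in> Ob P" for p
  proof (rule Z_full[OF birexD(2)[OF T] birexD(2)[OF T']])
    show "nat_trans X C (comp_fct (fix1 T p) Z) (comp_fct (fix1 T' p) Z) (\<zeta> p)"
      using p by (auto intro!: nat_transI simp: \<zeta>n2)
  qed (use p in simp_all)
  then obtain \<eta> where \<eta>: "\<And>p. p \<in> Ob P \<Longrightarrow> nat_trans P C (fix1 T p) (fix1 T' p) (\<eta> p) \<and> (\<forall>y\<in>Ob X. \<eta> p (fo Z y) = \<zeta> p y)"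
    by metis
  have \<eta>t [simp]: "\<eta> p q \<in> Ar C" "Dom C (\<eta> p q) = fo T (p, q)" "Cod C (\<eta> p q) = fo T' (p, q)" if "p \<in> Ob P" "q \<in> Ob P" for p q
    using nat_trans_simps[OF conjunct1[OF \<eta>[OF that(1)]] that(2)] by simp_all
  have \<eta>n: "fa T' (ide P p, g) \<cdot> \<eta> p (Dom P g) = \<eta> p (Cod P g) \<cdot> fa T (ide P p, g)"
    if "g \<in> Ar P" "p \<in> Ob P" for g p
    using nat_trans_natural[OF conjunct1[OF \<eta>[OF that(2)]] that(1)] by simp
  have \<eta>\<zeta>: "\<eta> p (fo Z y) = \<zeta> p y" if "p \<in> Ob P" "y \<in> Ob X" for p y
    using \<eta> that by auto
  \<comment> \<open>The extensions for different \<open>p\<close> were chosen independently; their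
    compatibility follows by \<open>Z_faithful\<close> in \<open>q\<close>, where at
    \<open>q = Z y\<close> it is naturality of \<open>\<zeta>\<close>.\<close>
  have \<eta>n2: "fa T' (f, ide P q) \<cdot> \<eta> (Dom P f) q = \<eta> (Cod P f) q \<cdot> fa T (f, ide P q)"
    if f [simp]: "f \<in> Ar P" and q: "q \<in> Ob P" for f q
  proof (rule Z_faithful[where F = "fix1 T (Dom P f)" and F' = "fix1 T' (Cod P f)"
        and \<eta> = "\<lambda>q. fa T' (f, ide P q) \<cdot> \<eta> (Dom P f) q" and \<eta>' = "\<lambda>q. \<eta> (Cod P f) q \<cdot> fa T (f, ide P q)"])
    show "lin_rex R P C (fix1 T (Dom P f))" "lin_rex R P C (fix1 T' (Cod P f))"
      using birexD(2)[OF T] birexD(2)[OF T'] by simp_all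
    show "nat_trans P C (fix1 T (Dom P f)) (fix1 T' (Cod P f)) (\<lambda>q. fa T' (f, ide P q) \<cdot> \<eta> (Dom P f) q)"
    proof (rule nat_transI)
      fix g assume [simp]: "g \<in> Ar P"
      have "fa T' (ide P (Cod P f), g) \<cdot> fa T' (f, ide P (Dom P g)) \<cdot> \<eta> (Dom P f) (Dom P g) =
         fa T' (f, g) \<cdot> \<eta> (Dom P f) (Dom P g)"
        by (intro C.reassoc) (simp_all add: Tc)
      also have "\<dots> = (fa T' (f, ide P (Cod P g)) \<cdot> fa T' (ide P (Dom P f), g)) \<cdot> \<eta> (Dom P f) (Dom P g)"
        by (simp add: Tc)
      also have "\<dots> = (fa T' (f, ide P (Cod P g)) \<cdot> \<eta> (Dom P f) (Cod P g)) \<cdot> fa T (ide P (Dom P f), g)"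
        by (simp add: C.assoc \<eta>n)
      finally show "fa (fix1 T' (Cod P f)) g \<cdot> fa T' (f, ide P (Dom P g)) \<cdot> \<eta> (Dom P f) (Dom P g) =
          (fa T' (f, ide P (Cod P g)) \<cdot> \<eta> (Dom P f) (Cod P g)) \<cdot> fa (fix1 T (Dom P f)) g" by simp
    qed simp_all
    show "nat_trans P C (fix1 T (Dom P f)) (fix1 T' (Cod P f)) (\<lambda>q. \<eta> (Cod P f) q \<cdot> fa T (f, ide P q))"
    proof (rule nat_transI)
      fix g assume [simp]: "g \<in> Ar P"
      have "fa T' (ide P (Cod P f), g) \<cdot> \<eta> (Cod P f) (Dom P g) \<cdot> fa T (f, ide P (Dom P g)) =
         (\<eta> (Cod P f) (Cod P g) \<cdot> fa T (ide P (Cod P f), g)) \<cdot> fa T (f, ide P (Dom P g))"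
        by (intro C.reassoc) (simp_all add: \<eta>n)
      also have "\<dots> = (\<eta> (Cod P f) (Cod P g) \<cdot> fa T (f, ide P (Cod P g))) \<cdot> fa T (ide P (Dom P f), g)"
        by (simp add: C.assoc Tc)
      finally show "fa (fix1 T' (Cod P f)) g \<cdot> \<eta> (Cod P f) (Dom P g) \<cdot> fa T (f, ide P (Dom P g)) =
          (\<eta> (Cod P f) (Cod P g) \<cdot> fa T (f, ide P (Cod P g))) \<cdot> fa (fix1 T (Dom P f)) g" by simp
    qed simp_all
    fix y assume "y \<in> Ob X"
    then show "fa T' (f, ide P (fo Z y)) \<cdot> \<eta> (Dom P f) (fo Z y) = \<eta> (Cod P f) (fo Z y) \<cdot> fa T (f, ide P (fo Z y))"
      by (simp add: \<eta>\<zeta> \<zeta>n)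
  qed (rule q)
  have "nat_trans PP C T T' (\<lambda>(p, q). \<eta> p q)"
  proof (rule nat_transI)
    fix h assume "h \<in> Ar PP"
    then obtain f g where [simp]: "h = (f, g)" "f \<in> Ar P" "g \<in> Ar P" by auto
    have "fa T' (f, g) \<cdot> \<eta> (Dom P f) (Dom P g) = (fa T' (f, ide P (Cod P g)) \<cdot> fa T' (ide P (Dom P f), g)) \<cdot> \<eta> (Dom P f) (Dom P g)"
      by (simp add: Tc)
    also have "\<dots> = fa T' (f, ide P (Cod P g)) \<cdot> \<eta> (Dom P f) (Cod P g) \<cdot> fa T (ide P (Dom P f), g)"
      by (simp add: C.assoc \<eta>n)
    also have "\<dots> = (\<eta> (Cod P f) (Cod P g) \<cdot> fa T (f, ide P (Cod P g))) \<cdot> fa T (ide P (Dom P f), g)"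
      by (intro C.reassoc) (simp_all add: \<eta>n2)
    finally show "fa T' h \<cdot> (case Dom PP h of (p, q) \<Rightarrow> \<eta> p q) = (case Cod PP h of (p, q) \<Rightarrow> \<eta> p q) \<cdot> fa T h"
      by (simp add: C.assoc Tc)
  qed auto
  then show ?thesis by (intro exI[of _ "\<lambda>(p, q). \<eta> p q"]) (simp add: \<eta>\<zeta> \<zeta>\<theta>)
qed

text \<open>The inverse family extends too, and by \<open>bi_unique\<close> the two extensions are
  mutually inverse.\<close>

lemma bi_exists_iso:
  assumes T: "birex T" and T': "birex T'"
    and typed: "\<And>x y. x \<in> Ob X \<Longrightarrow> y \<in> Ob X \<Longrightarrow>
      iso_arr C (\<theta> x y) \<and> Dom C (\<theta> x y) = fo T (fo Z x, fo Z y) \<and> Cod C (\<theta> x y) = fo T' (fo Z x, fo Z y)"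
    and nat: "\<And>f g. f \<in> Ar X \<Longrightarrow> g \<in> Ar X \<Longrightarrow>
      fa T' (fa Z f, fa Z g) \<cdot> \<theta> (Dom X f) (Dom X g) = \<theta> (Cod X f) (Cod X g) \<cdot> fa T (fa Z f, fa Z g)"
  shows "\<exists>\<eta>. nat_trans PP C T T' \<eta> \<and> (\<forall>p\<in>Ob P. \<forall>q\<in>Ob P. iso_arr C (\<eta> (p, q))) \<and>
    (\<forall>x\<in>Ob X. \<forall>y\<in>Ob X. \<eta> (fo Z x, fo Z y) = \<theta> x y)"
proof -
  note iT = birexD(1)[OF T] and iT' = birexD(1)[OF T']
  have PPc: "category PP" by (rule category_prod_smcat) unfold_locales
  have TA: "fa T (fa Z f, fa Z g) \<in> Ar C" "Dom C (fa T (fa Z f, fa Z g)) = fo T (fo Z (Dom X f), fo Z (Dom X g))"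
    "Cod C (fa T (fa Z f, fa Z g)) = fo T (fo Z (Cod X f), fo Z (Cod X g))"
    "fa T' (fa Z f, fa Z g) \<in> Ar C" "Dom C (fa T' (fa Z f, fa Z g)) = fo T' (fo Z (Dom X f), fo Z (Dom X g))"
    "Cod C (fa T' (fa Z f, fa Z g)) = fo T' (fo Z (Cod X f), fo Z (Cod X g))"
    if "f \<in> Ar X" "g \<in> Ar X" for f g
    using functor_simps(2-4)[OF iT, of "(fa Z f, fa Z g)"] functor_simps(2-4)[OF iT', of "(fa Z f, fa Z g)"] that by simp_all
  obtain \<eta> where \<eta>: "nat_trans PP C T T' \<eta>" "\<And>x y. x \<in> Ob X \<Longrightarrow> y \<in> Ob X \<Longrightarrow> \<eta> (fo Z x, fo Z y) = \<theta> x y"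
    using bi_exists[OF T T', of \<theta>] typed nat by auto
  have "\<exists>\<zeta>. nat_trans PP C T' T \<zeta> \<and> (\<forall>x\<in>Ob X. \<forall>y\<in>Ob X. \<zeta> (fo Z x, fo Z y) = inv_arr C (\<theta> x y))"
    by (rule bi_exists[OF T' T]) (use typed nat TA in \<open>auto intro!: C.swap_inv\<close>)
  then obtain \<zeta> where \<zeta>: "nat_trans PP C T' T \<zeta>" "\<And>x y. x \<in> Ob X \<Longrightarrow> y \<in> Ob X \<Longrightarrow> \<zeta> (fo Z x, fo Z y) = inv_arr C (\<theta> x y)"
    by auto
  have id: "nat_trans PP C T T (\<lambda>u. ide C (fo T u))" if "is_functor PP C T" for T :: "('po \<times> 'po, 'pa \<times> 'pa, 'co, 'ca) fct"
  proof (rule nat_transI)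
    fix u assume "u \<in> Ar PP"
    then show "fa T u \<cdot> ide C (fo T (Dom PP u)) = ide C (fo T (Cod PP u)) \<cdot> fa T u"
      using functor_simps[OF that] by (simp del: prod_smcat_sel)
  qed (use functor_simps[OF that] in \<open>simp del: prod_smcat_sel\<close>)
  \<comment> \<open>The composite and the identity are transformations that agree on the image of
    \<open>Z\<close> in both variables.\<close>
  have 1: "\<zeta> (p, q) \<cdot> \<eta> (p, q) = ide C (fo T (p, q))" if "p \<in> Ob P" "q \<in> Ob P" for p q
    by (rule bi_unique[OF T T nat_trans_vcomp[OF \<eta>(1) \<zeta>(1) PPc C.category_axioms iT iT' iT] id[OF iT]])
      (use typed that in \<open>simp_all add: \<eta>(2) \<zeta>(2)\<close>)
  have 2: "\<eta> (p, q) \<cdot> \<zeta> (p, q) = ide C (fo T' (p, q))" if "p \<in> Ob P" "q \<in> Ob P" for p q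
    by (rule bi_unique[OF T' T' nat_trans_vcomp[OF \<zeta>(1) \<eta>(1) PPc C.category_axioms iT' iT iT'] id[OF iT']])
      (use typed that in \<open>simp_all add: \<eta>(2) \<zeta>(2)\<close>)
  have "iso_arr C (\<eta> (p, q))" if "p \<in> Ob P" "q \<in> Ob P" for p q
    using nat_trans_simps[OF \<eta>(1), of "(p, q)"] nat_trans_simps[OF \<zeta>(1), of "(p, q)"] 1 2 that
    by (intro C.iso_arrI[where g = "\<zeta> (p, q)"]) auto
  then show ?thesis using \<eta> by blast
qed

end

section \<open>Monoidal structure determined along \<open>Z\<close>\<close>

context dense_functor
begin

lemma linear_P: "linear_category R P"
  using rexP by (simp add: rex_sm_category_def symmetric_monoidal_linear_category_def)

text \<open>The bifunctors between which the structure maps live: constraints go from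
  \<open>tensor_after F\<close> to \<open>tensor_before F\<close>, the symmetry equation compares
  maps into \<open>tensor_before_flip F\<close>, and \<open>tensor_before3 F r\<close> receives both
  sides of associativity with the third variable fixed.\<close>

definition tensor_after :: "('po, 'pa, 'co, 'ca, 'w) fct_scheme \<Rightarrow> ('po \<times> 'po, 'pa \<times> 'pa, 'co, 'ca) fct" where
  "tensor_after F = \<lparr>fo = \<lambda>(p, q). fo F p \<star> fo F q, fa = \<lambda>(f, g). fa F f \<diamondop> fa F g\<rparr>"

definition tensor_before :: "('po, 'pa, 'co, 'ca, 'w) fct_scheme \<Rightarrow> ('po \<times> 'po, 'pa \<times> 'pa, 'co, 'ca) fct" where
  "tensor_before F = \<lparr>fo = \<lambda>(p, q). fo F (p \<star>\<^bsub>P\<^esub> q), fa = \<lambda>(f, g). fa F (f \<diamondop>\<^bsub>P\<^esub> g)\<rparr>"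

definition tensor_before_flip :: "('po, 'pa, 'co, 'ca, 'w) fct_scheme \<Rightarrow> ('po \<times> 'po, 'pa \<times> 'pa, 'co, 'ca) fct" where
  "tensor_before_flip F = \<lparr>fo = \<lambda>(p, q). fo F (q \<star>\<^bsub>P\<^esub> p), fa = \<lambda>(f, g). fa F (g \<diamondop>\<^bsub>P\<^esub> f)\<rparr>"

definition tensor_before3 :: "('po, 'pa, 'co, 'ca, 'w) fct_scheme \<Rightarrow> 'po \<Rightarrow> ('po \<times> 'po, 'pa \<times> 'pa, 'co, 'ca) fct" where
  "tensor_before3 F r = \<lparr>fo = \<lambda>(p, q). fo F (p \<star>\<^bsub>P\<^esub> (q \<star>\<^bsub>P\<^esub> r)), fa = \<lambda>(f, g). fa F (f \<diamondop>\<^bsub>P\<^esub> (g \<diamondop>\<^bsub>P\<^esub> ide P r))\<rparr>"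

lemma tensor_sel [simp]:
  "fo (tensor_after F) (p, q) = fo F p \<star> fo F q" "fa (tensor_after F) (f, g) = fa F f \<diamondop> fa F g"
  "fo (tensor_before F) (p, q) = fo F (p \<star>\<^bsub>P\<^esub> q)" "fa (tensor_before F) (f, g) = fa F (f \<diamondop>\<^bsub>P\<^esub> g)"
  "fo (tensor_before_flip F) (p, q) = fo F (q \<star>\<^bsub>P\<^esub> p)" "fa (tensor_before_flip F) (f, g) = fa F (g \<diamondop>\<^bsub>P\<^esub> f)"
  "fo (tensor_before3 F r) (p, q) = fo F (p \<star>\<^bsub>P\<^esub> (q \<star>\<^bsub>P\<^esub> r))"
  "fa (tensor_before3 F r) (f, g) = fa F (f \<diamondop>\<^bsub>P\<^esub> (g \<diamondop>\<^bsub>P\<^esub> ide P r))"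
  by (simp_all add: tensor_after_def tensor_before_def tensor_before_flip_def tensor_before3_def)

text \<open>The partial functors need only agree with some right exact linear functor on the objects
  and arrows of \<open>P\<close>; typically the witness is a composite with
  \<open>tensor_left\<close> or \<open>tensor_right\<close>.\<close>

lemma birexI:
  assumes "is_functor PP C T"
    and "\<And>p. p \<in> Ob P \<Longrightarrow> \<exists>G :: ('po, 'pa, 'co, 'ca) fct. lin_rex R P C G \<and> (\<forall>q\<in>Ob P. fo G q = fo T (p, q)) \<and> (\<forall>g\<in>Ar P. fa G g = fa T (ide P p, g))"
    and "\<And>q. q \<in> Ob P \<Longrightarrow> \<exists>G :: ('po, 'pa, 'co, 'ca) fct. lin_rex R P C G \<and> (\<forall>p\<in>Ob P. fo G p = fo T (p, q)) \<and> (\<forall>f\<in>Ar P. fa G f = fa T (f, ide P q))"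
  shows "birex T"
  unfolding birex_def
proof (intro conjI ballI)
  fix p assume p: "p \<in> Ob P"
  show "lin_rex R P C (fix1 T p)" using assms(2)[OF p] by (auto intro: lin_rex_cong[OF _ linear_P])
  show "lin_rex R P C (fix2 T p)" using assms(3)[OF p] by (auto intro: lin_rex_cong[OF _ linear_P])
qed (rule assms(1))

context
  fixes F :: "('po, 'pa, 'co, 'ca, 'w) fct_scheme"
  assumes F: "lin_rex R P C F"
begin

private lemmas iF = lin_rex_is_functor[OF F]
private lemmas F_simps [simp] = functor_simps[OF iF]

lemma functor_comp_mult: "f \<in> Ar P \<Longrightarrow> g \<in> Ar P \<Longrightarrow> Dom P g = Cod P f \<Longrightarrow> fa F g \<cdot> fa F f = fa F (g \<cdot>\<^bsub>P\<^esub> f)"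
  by simp

lemma birex_tensor_after: "birex (tensor_after F)"
proof (rule birexI)
  show "is_functor PP C (tensor_after F)" by (rule functorI) (auto simp: C.tar_merge)
  show "\<exists>G :: ('po, 'pa, 'co, 'ca) fct. lin_rex R P C G \<and> (\<forall>q\<in>Ob P. fo G q = fo (tensor_after F) (p, q)) \<and> (\<forall>g\<in>Ar P. fa G g = fa (tensor_after F) (ide P p, g))"
    if "p \<in> Ob P" for p
    by (rule exI[of _ "comp_fct (tensor_left C (fo F p)) F"])
      (use that in \<open>auto intro!: lin_rex_comp[OF F] lin_rex_tensor[OF rexC]\<close>)
  show "\<exists>G :: ('po, 'pa, 'co, 'ca) fct. lin_rex R P C G \<and> (\<forall>p\<in>Ob P. fo G p = fo (tensor_after F) (p, q)) \<and> (\<forall>f\<in>Ar P. fa G f = fa (tensor_after F) (f, ide P q))"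
    if "q \<in> Ob P" for q
    by (rule exI[of _ "comp_fct (tensor_right C (fo F q)) F"])
      (use that in \<open>auto intro!: lin_rex_comp[OF F] lin_rex_tensor[OF rexC]\<close>)
qed

lemma birex_tensor_before: "birex (tensor_before F)"
proof (rule birexI)
  show "is_functor PP C (tensor_before F)" by (rule functorI) (auto simp: P.tar_merge[symmetric])
  show "\<exists>G :: ('po, 'pa, 'co, 'ca) fct. lin_rex R P C G \<and> (\<forall>q\<in>Ob P. fo G q = fo (tensor_before F) (p, q)) \<and> (\<forall>g\<in>Ar P. fa G g = fa (tensor_before F) (ide P p, g))"
    if "p \<in> Ob P" for p
    by (rule exI[of _ "comp_fct F (tensor_left P p)"])
      (use that in \<open>auto intro!: lin_rex_comp[OF _ F] lin_rex_tensor[OF rexP]\<close>)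
  show "\<exists>G :: ('po, 'pa, 'co, 'ca) fct. lin_rex R P C G \<and> (\<forall>p\<in>Ob P. fo G p = fo (tensor_before F) (p, q)) \<and> (\<forall>f\<in>Ar P. fa G f = fa (tensor_before F) (f, ide P q))"
    if "q \<in> Ob P" for q
    by (rule exI[of _ "comp_fct F (tensor_right P q)"])
      (use that in \<open>auto intro!: lin_rex_comp[OF _ F] lin_rex_tensor[OF rexP]\<close>)
qed

lemma birex_tensor_before_flip: "birex (tensor_before_flip F)"
proof (rule birexI)
  show "is_functor PP C (tensor_before_flip F)" by (rule functorI) (auto simp: P.tar_merge[symmetric])
  show "\<exists>G :: ('po, 'pa, 'co, 'ca) fct. lin_rex R P C G \<and> (\<forall>q\<in>Ob P. fo G q = fo (tensor_before_flip F) (p, q)) \<and> (\<forall>g\<in>Ar P. fa G g = fa (tensor_before_flip F) (ide P p, g))"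
    if "p \<in> Ob P" for p
    by (rule exI[of _ "comp_fct F (tensor_right P p)"])
      (use that in \<open>auto intro!: lin_rex_comp[OF _ F] lin_rex_tensor[OF rexP]\<close>)
  show "\<exists>G :: ('po, 'pa, 'co, 'ca) fct. lin_rex R P C G \<and> (\<forall>p\<in>Ob P. fo G p = fo (tensor_before_flip F) (p, q)) \<and> (\<forall>f\<in>Ar P. fa G f = fa (tensor_before_flip F) (f, ide P q))"
    if "q \<in> Ob P" for q
    by (rule exI[of _ "comp_fct F (tensor_left P q)"])
      (use that in \<open>auto intro!: lin_rex_comp[OF _ F] lin_rex_tensor[OF rexP]\<close>)
qed

lemma birex_tensor_before3:
  assumes r: "r \<in> Ob P"
  shows "birex (tensor_before3 F r)"
proof (rule birexI)
  show "is_functor PP C (tensor_before3 F r)"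
    using r by (intro functorI) (auto simp: P.tar_merge functor_comp_mult simp del: F_simps(6))
  show "\<exists>G :: ('po, 'pa, 'co, 'ca) fct. lin_rex R P C G \<and> (\<forall>q\<in>Ob P. fo G q = fo (tensor_before3 F r) (p, q)) \<and> (\<forall>g\<in>Ar P. fa G g = fa (tensor_before3 F r) (ide P p, g))"
    if "p \<in> Ob P" for p
    by (rule exI[of _ "comp_fct F (comp_fct (tensor_left P p) (tensor_right P r))"])
      (use that r in \<open>auto intro!: lin_rex_comp[OF _ F] lin_rex_comp[of R P P _ P] lin_rex_tensor[OF rexP]\<close>)
  show "\<exists>G :: ('po, 'pa, 'co, 'ca) fct. lin_rex R P C G \<and> (\<forall>p\<in>Ob P. fo G p = fo (tensor_before3 F r) (p, q)) \<and> (\<forall>f\<in>Ar P. fa G f = fa (tensor_before3 F r) (f, ide P q))"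
    if "q \<in> Ob P" for q
    by (rule exI[of _ "comp_fct F (tensor_right P (q \<star>\<^bsub>P\<^esub> r))"])
      (use that r in \<open>auto intro!: lin_rex_comp[OF _ F] lin_rex_tensor[OF rexP]\<close>)
qed

end

lemma birex_comp:
  assumes T: "birex T" and G: "lin_rex R C C G"
  shows "birex (comp_fct G T)"
proof -
  have 1: "fix1 (comp_fct G T) p = comp_fct G (fix1 T p)" "fix2 (comp_fct G T) p = comp_fct G (fix2 T p)" for p
    by (simp_all add: fix1_def fix2_def comp_fct_def)
  show ?thesis
    using T functor_comp[OF birexD(1)[OF T] lin_rex_is_functor[OF G]] lin_rex_comp[OF _ G]
    by (auto simp: birex_def 1)
qed

text \<open>The two sides of compatibility with \<open>fmu\<close> are transformations from
  \<open>tensor_after F\<close> to \<open>tensor_before G\<close>, so by \<open>bi_unique\<close>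
  they need to agree only on the image of \<open>Z\<close>.\<close>

lemma monoidal_of_restriction:
  assumes F: "lin_rex R P C F" "sm_functor P C F" and G: "lin_rex R P C G" "sm_functor P C G"
    and \<eta>: "nat_trans P C F G \<eta>"
    and mon: "monoidal_nat_trans X C (comp_smfct C F Z) (comp_smfct C G Z) (\<lambda>x. \<eta> (fo Z x))"
  shows "monoidal_nat_trans P C F G \<eta>"
proof -
  note iF = sm_functor_is_functor[OF F(2)] and iG = sm_functor_is_functor[OF G(2)]
  note [simp] = sm_functor_simps[OF F(2)] functor_simps[OF iF] sm_functor_simps[OF G(2)] functor_simps[OF iG]
    nat_trans_simps[OF \<eta>] functor_iso(1)[OF iG P.category_axioms C.category_axioms]
  have L: "nat_trans PP C (tensor_after F) (tensor_before G) (\<lambda>(p, q). \<eta> (p \<star>\<^bsub>P\<^esub> q) \<cdot> fmu F p q)"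
  proof (rule nat_transI)
    fix h assume "h \<in> Ar PP"
    then obtain f g where [simp]: "h = (f, g)" "f \<in> Ar P" "g \<in> Ar P" by auto
    have "fa G (f \<diamondop>\<^bsub>P\<^esub> g) \<cdot> \<eta> (Dom P f \<star>\<^bsub>P\<^esub> Dom P g) \<cdot> fmu F (Dom P f) (Dom P g) =
       (\<eta> (Cod P f \<star>\<^bsub>P\<^esub> Cod P g) \<cdot> fa F (f \<diamondop>\<^bsub>P\<^esub> g)) \<cdot> fmu F (Dom P f) (Dom P g)"
      using nat_trans_natural[OF \<eta>, of "f \<diamondop>\<^bsub>P\<^esub> g"] by (intro C.reassoc) simp_all
    then show "fa (tensor_before G) h \<cdot> (case Dom PP h of (p, q) \<Rightarrow> \<eta> (p \<star>\<^bsub>P\<^esub> q) \<cdot> fmu F p q) =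
        (case Cod PP h of (p, q) \<Rightarrow> \<eta> (p \<star>\<^bsub>P\<^esub> q) \<cdot> fmu F p q) \<cdot> fa (tensor_after F) h"
      by (simp add: C.assoc fmu_natural[OF F(2)])
  qed auto
  have R: "nat_trans PP C (tensor_after F) (tensor_before G) (\<lambda>(p, q). fmu G p q \<cdot> (\<eta> p \<diamondop> \<eta> q))"
  proof (rule nat_transI)
    fix h assume "h \<in> Ar PP"
    then obtain f g where [simp]: "h = (f, g)" "f \<in> Ar P" "g \<in> Ar P" by auto
    have "fa G (f \<diamondop>\<^bsub>P\<^esub> g) \<cdot> fmu G (Dom P f) (Dom P g) \<cdot> (\<eta> (Dom P f) \<diamondop> \<eta> (Dom P g)) =
       (fmu G (Cod P f) (Cod P g) \<cdot> (fa G f \<diamondop> fa G g)) \<cdot> (\<eta> (Dom P f) \<diamondop> \<eta> (Dom P g))"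
      using fmu_natural[OF G(2), of f g] by (intro C.reassoc) simp_all
    then show "fa (tensor_before G) h \<cdot> (case Dom PP h of (p, q) \<Rightarrow> fmu G p q \<cdot> (\<eta> p \<diamondop> \<eta> q)) =
        (case Cod PP h of (p, q) \<Rightarrow> fmu G p q \<cdot> (\<eta> p \<diamondop> \<eta> q)) \<cdot> fa (tensor_after F) h"
      using nat_trans_natural[OF \<eta>, of f] nat_trans_natural[OF \<eta>, of g] by (simp add: C.assoc C.tar_merge)
  qed auto
  \<comment> \<open>After composition with the invertible \<open>G (fmu Z x y)\<close>, naturality
    of \<open>\<eta>\<close> at \<open>fmu Z x y\<close> turns the claim into monoidality of the
    restriction.\<close>
  have eq: "\<eta> (fo Z x \<star>\<^bsub>P\<^esub> fo Z y) \<cdot> fmu F (fo Z x) (fo Z y) = fmu G (fo Z x) (fo Z y) \<cdot> (\<eta> (fo Z x) \<diamondop> \<eta> (fo Z y))"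
    if [simp]: "x \<in> Ob X" "y \<in> Ob X" for x y
  proof -
    have "fa G (fmu Z x y) \<cdot> \<eta> (fo Z x \<star>\<^bsub>P\<^esub> fo Z y) \<cdot> fmu F (fo Z x) (fo Z y) =
       (\<eta> (fo Z (x \<star>\<^bsub>X\<^esub> y)) \<cdot> fa F (fmu Z x y)) \<cdot> fmu F (fo Z x) (fo Z y)"
      using nat_trans_natural[OF \<eta>, of "fmu Z x y"] by (intro C.reassoc) simp_all
    also have "\<dots> = fa G (fmu Z x y) \<cdot> fmu G (fo Z x) (fo Z y) \<cdot> (\<eta> (fo Z x) \<diamondop> \<eta> (fo Z y))"
      using monoidal_nat_transD(2)[OF mon that] by (simp add: C.assoc)
    finally show ?thesis by (rule C.iso_cancel_left[rotated -1]) simp_all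
  qed
  have unit: "\<eta> (munit P) \<cdot> feps F = feps G"
  proof -
    have "fa G (feps Z) \<cdot> \<eta> (munit P) \<cdot> feps F = (\<eta> (fo Z (munit X)) \<cdot> fa F (feps Z)) \<cdot> feps F"
      using nat_trans_natural[OF \<eta>, of "feps Z"] by (intro C.reassoc) simp_all
    also have "\<dots> = fa G (feps Z) \<cdot> feps G"
      using monoidal_nat_transD(3)[OF mon] by (simp add: C.assoc)
    finally show ?thesis by (rule C.iso_cancel_left[rotated -1]) simp_all
  qed
  show ?thesis
  proof (rule monoidal_nat_transI[OF \<eta> _ unit])
    fix p q assume pq: "p \<in> Ob P" "q \<in> Ob P"
    show "\<eta> (p \<star>\<^bsub>P\<^esub> q) \<cdot> fmu F p q = fmu G p q \<cdot> (\<eta> p \<diamondop> \<eta> q)"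
      using bi_unique[OF birex_tensor_after[OF F(1)] birex_tensor_before[OF G(1)] L R _ pq] eq by simp
  qed
qed

text \<open>The required restriction forces the constraint on the image of \<open>Z\<close>, and
  \<open>bi_exists_iso\<close> extends it to \<open>P\<close>. Every axiom equates two
  transformations between functors right exact in each variable; it holds on the image of
  \<open>Z\<close> because it holds for \<open>E\<close> and for \<open>Z\<close>, and hence
  everywhere.\<close>

lemma extend_structure:
  fixes F :: "('po, 'pa, 'co, 'ca) fct"
  assumes F: "lin_rex R P C F" and E: "sm_functor X C E"
    and Eo: "\<And>x. x \<in> Ob X \<Longrightarrow> fo E x = fo F (fo Z x)" and Ea: "\<And>f. f \<in> Ar X \<Longrightarrow> fa E f = fa F (fa Z f)"
  obtains F' :: "('po, 'pa, 'co, 'ca) smfct" where "\<And>p. fo F' p = fo F p" "\<And>f. fa F' f = fa F f" "sm_functor P C F'"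
    "\<And>x y. x \<in> Ob X \<Longrightarrow> y \<in> Ob X \<Longrightarrow> fa F (fmu Z x y) \<cdot> fmu F' (fo Z x) (fo Z y) = fmu E x y"
    "fa F (feps Z) \<cdot> feps F' = feps E"
proof -
  note iF = lin_rex_is_functor[OF F] and iE = sm_functor_is_functor[OF E]
  note isoF = functor_iso[OF iF P.category_axioms C.category_axioms]
  note [simp] = functor_simps[OF iF] isoF Eo Ea sm_functor_simps[OF E]
  \<comment> \<open>The equation relating the constraint of \<open>F'\<close> to
    \<open>fmu E\<close> leaves this value at \<open>(Z x, Z y)\<close>.\<close>
  define \<theta> where "\<theta> x y = inv_arr C (fa F (fmu Z x y)) \<cdot> fmu E x y" for x y
  have [simp]: "iso_arr C (\<theta> x y)" "\<theta> x y \<in> Ar C" "Dom C (\<theta> x y) = fo F (fo Z x) \<star> fo F (fo Z y)"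
    "Cod C (\<theta> x y) = fo F (fo Z x \<star>\<^bsub>P\<^esub> fo Z y)" if "x \<in> Ob X" "y \<in> Ob X" for x y
    using that by (simp_all add: \<theta>_def)
  have \<theta>: "fa F (fmu Z x y) \<cdot> \<theta> x y = fmu E x y" if "x \<in> Ob X" "y \<in> Ob X" for x y
    using that by (simp add: \<theta>_def)
  have "\<exists>\<eta>. nat_trans PP C (tensor_after F) (tensor_before F) \<eta> \<and> (\<forall>p\<in>Ob P. \<forall>q\<in>Ob P. iso_arr C (\<eta> (p, q))) \<and>
     (\<forall>x\<in>Ob X. \<forall>y\<in>Ob X. \<eta> (fo Z x, fo Z y) = \<theta> x y)"
  proof (rule bi_exists_iso[OF birex_tensor_after[OF F] birex_tensor_before[OF F]])
    fix f g assume [simp]: "f \<in> Ar X" "g \<in> Ar X"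
    let ?d = "fmu Z (Dom X f) (Dom X g)" and ?c = "fmu Z (Cod X f) (Cod X g)"
    have "fa F ?c \<cdot> fa F (fa Z f \<diamondop>\<^bsub>P\<^esub> fa Z g) \<cdot> \<theta> (Dom X f) (Dom X g) =
        fa F (?c \<cdot>\<^bsub>P\<^esub> (fa Z f \<diamondop>\<^bsub>P\<^esub> fa Z g)) \<cdot> \<theta> (Dom X f) (Dom X g)"
      by (simp add: C.assoc)
    also have "\<dots> = fa F (fa Z (f \<diamondop>\<^bsub>X\<^esub> g)) \<cdot> fa F ?d \<cdot> \<theta> (Dom X f) (Dom X g)"
      unfolding fmu_natural[OF Z \<open>f \<in> Ar X\<close> \<open>g \<in> Ar X\<close>, symmetric] by (simp add: C.assoc)
    also have "\<dots> = fa E (f \<diamondop>\<^bsub>X\<^esub> g) \<cdot> fmu E (Dom X f) (Dom X g)" by (simp add: \<theta>)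
    also have "\<dots> = fmu E (Cod X f) (Cod X g) \<cdot> (fa E f \<diamondop> fa E g)" by (rule fmu_natural[OF E]) simp_all
    also have "\<dots> = (fa F ?c \<cdot> \<theta> (Cod X f) (Cod X g)) \<cdot> (fa F (fa Z f) \<diamondop> fa F (fa Z g))" by (simp add: \<theta>)
    also have "\<dots> = fa F ?c \<cdot> \<theta> (Cod X f) (Cod X g) \<cdot> (fa F (fa Z f) \<diamondop> fa F (fa Z g))" by (simp add: C.assoc)
    finally have "fa F (fa Z f \<diamondop>\<^bsub>P\<^esub> fa Z g) \<cdot> \<theta> (Dom X f) (Dom X g) = \<theta> (Cod X f) (Cod X g) \<cdot> (fa F (fa Z f) \<diamondop> fa F (fa Z g))"
      by (rule C.iso_cancel_left[rotated -1]) simp_all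
    then show "fa (tensor_before F) (fa Z f, fa Z g) \<cdot> \<theta> (Dom X f) (Dom X g) =
        \<theta> (Cod X f) (Cod X g) \<cdot> fa (tensor_after F) (fa Z f, fa Z g)" by simp
  qed simp_all
  then obtain \<eta> where \<eta>: "nat_trans PP C (tensor_after F) (tensor_before F) \<eta>" "\<forall>p\<in>Ob P. \<forall>q\<in>Ob P. iso_arr C (\<eta> (p, q))"
    "\<forall>x\<in>Ob X. \<forall>y\<in>Ob X. \<eta> (fo Z x, fo Z y) = \<theta> x y" by blast
  define \<mu> where "\<mu> p q = \<eta> (p, q)" for p q
  \<comment> \<open>The unit constraint is forced in the same way, with \<open>feps Z\<close> in
    place of \<open>fmu Z x y\<close>.\<close>
  define \<epsilon> where "\<epsilon> = inv_arr C (fa F (feps Z)) \<cdot> feps E"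
  have [simp]: "iso_arr C (\<mu> p q)" "\<mu> p q \<in> Ar C" "Dom C (\<mu> p q) = fo F p \<star> fo F q" "Cod C (\<mu> p q) = fo F (p \<star>\<^bsub>P\<^esub> q)"
    if "p \<in> Ob P" "q \<in> Ob P" for p q
    using that \<eta>(2) nat_trans_simps[OF \<eta>(1), of "(p, q)"] by (simp_all add: \<mu>_def)
  have [simp]: "iso_arr C \<epsilon>" "\<epsilon> \<in> Ar C" "Dom C \<epsilon> = munit C" "Cod C \<epsilon> = fo F (munit P)"
    by (simp_all add: \<epsilon>_def)
  have \<mu>n: "fa F (f \<diamondop>\<^bsub>P\<^esub> g) \<cdot> \<mu> (Dom P f) (Dom P g) = \<mu> (Cod P f) (Cod P g) \<cdot> (fa F f \<diamondop> fa F g)"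
    if "f \<in> Ar P" "g \<in> Ar P" for f g
    using nat_trans_natural[OF \<eta>(1), of "(f, g)"] that by (simp add: \<mu>_def)
  have \<mu>Z: "fa F (fmu Z x y) \<cdot> \<mu> (fo Z x) (fo Z y) = fmu E x y" if "x \<in> Ob X" "y \<in> Ob X" for x y
    using that \<theta> \<eta>(3) by (simp add: \<mu>_def)
  have \<epsilon>Z: "fa F (feps Z) \<cdot> \<epsilon> = feps E" by (simp add: \<epsilon>_def)

  \<comment> \<open>The two sides of the associativity axiom. They depend on three variables, so
    they are compared first on the image of \<open>Z\<close>, then for arbitrary \<open>r\<close>,
    and finally for arbitrary \<open>p\<close> and \<open>q\<close>.\<close>
  define l where "l p q r = fa F (massoc P p q r) \<cdot> \<mu> (p \<star>\<^bsub>P\<^esub> q) r \<cdot> (\<mu> p q \<diamondop> ide C (fo F r))" for p q r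
  define k where "k p q r = \<mu> p (q \<star>\<^bsub>P\<^esub> r) \<cdot> (ide C (fo F p) \<diamondop> \<mu> q r) \<cdot> massoc C (fo F p) (fo F q) (fo F r)" for p q r
  have lk [simp]: "l p q r \<in> Ar C" "Dom C (l p q r) = (fo F p \<star> fo F q) \<star> fo F r" "Cod C (l p q r) = fo F (p \<star>\<^bsub>P\<^esub> (q \<star>\<^bsub>P\<^esub> r))"
    "k p q r \<in> Ar C" "Dom C (k p q r) = (fo F p \<star> fo F q) \<star> fo F r" "Cod C (k p q r) = fo F (p \<star>\<^bsub>P\<^esub> (q \<star>\<^bsub>P\<^esub> r))"
    if "p \<in> Ob P" "q \<in> Ob P" "r \<in> Ob P" for p q r
    using that by (simp_all add: l_def k_def)
  have ln: "fa F (f \<diamondop>\<^bsub>P\<^esub> (g \<diamondop>\<^bsub>P\<^esub> h)) \<cdot> l (Dom P f) (Dom P g) (Dom P h) = l (Cod P f) (Cod P g) (Cod P h) \<cdot> ((fa F f \<diamondop> fa F g) \<diamondop> fa F h)"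
    if [simp]: "f \<in> Ar P" "g \<in> Ar P" "h \<in> Ar P" for f g h
  proof -
    let ?p = "Dom P f" and ?q = "Dom P g" and ?r = "Dom P h" and ?p' = "Cod P f" and ?q' = "Cod P g" and ?r' = "Cod P h"
    let ?\<alpha> = "massoc P ?p ?q ?r" and ?\<alpha>' = "massoc P ?p' ?q' ?r'" and ?t = "\<mu> ?p ?q \<diamondop> ide C (fo F ?r)"
    have 1: "fa F (f \<diamondop>\<^bsub>P\<^esub> (g \<diamondop>\<^bsub>P\<^esub> h)) \<cdot> fa F ?\<alpha> = fa F ?\<alpha>' \<cdot> fa F ((f \<diamondop>\<^bsub>P\<^esub> g) \<diamondop>\<^bsub>P\<^esub> h)"
      using arg_cong[OF P.massoc_nat[of f g h, OF _ _ _ refl refl refl], of "fa F"] by simp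
    have 2: "fa F ((f \<diamondop>\<^bsub>P\<^esub> g) \<diamondop>\<^bsub>P\<^esub> h) \<cdot> \<mu> (?p \<star>\<^bsub>P\<^esub> ?q) ?r \<cdot> ?t = (\<mu> (?p' \<star>\<^bsub>P\<^esub> ?q') ?r' \<cdot> (fa F (f \<diamondop>\<^bsub>P\<^esub> g) \<diamondop> fa F h)) \<cdot> ?t"
      using \<mu>n[of "f \<diamondop>\<^bsub>P\<^esub> g" h] by (intro C.reassoc) simp_all
    have "fa F (f \<diamondop>\<^bsub>P\<^esub> (g \<diamondop>\<^bsub>P\<^esub> h)) \<cdot> l ?p ?q ?r = (fa F ?\<alpha>' \<cdot> fa F ((f \<diamondop>\<^bsub>P\<^esub> g) \<diamondop>\<^bsub>P\<^esub> h)) \<cdot> \<mu> (?p \<star>\<^bsub>P\<^esub> ?q) ?r \<cdot> ?t"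
      unfolding l_def by (intro C.reassoc 1) simp_all
    also have "\<dots> = fa F ?\<alpha>' \<cdot> fa F ((f \<diamondop>\<^bsub>P\<^esub> g) \<diamondop>\<^bsub>P\<^esub> h) \<cdot> \<mu> (?p \<star>\<^bsub>P\<^esub> ?q) ?r \<cdot> ?t" by (simp add: C.assoc)
    also have "\<dots> = fa F ?\<alpha>' \<cdot> \<mu> (?p' \<star>\<^bsub>P\<^esub> ?q') ?r' \<cdot> (fa F (f \<diamondop>\<^bsub>P\<^esub> g) \<diamondop> fa F h) \<cdot> ?t"
      unfolding 2 by (simp add: C.assoc)
    also have "\<dots> = l ?p' ?q' ?r' \<cdot> ((fa F f \<diamondop> fa F g) \<diamondop> fa F h)"
      by (simp add: l_def C.assoc C.tar_merge \<mu>n)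
    finally show ?thesis .
  qed
  have kn: "fa F (f \<diamondop>\<^bsub>P\<^esub> (g \<diamondop>\<^bsub>P\<^esub> h)) \<cdot> k (Dom P f) (Dom P g) (Dom P h) = k (Cod P f) (Cod P g) (Cod P h) \<cdot> ((fa F f \<diamondop> fa F g) \<diamondop> fa F h)"
    if [simp]: "f \<in> Ar P" "g \<in> Ar P" "h \<in> Ar P" for f g h
  proof -
    let ?p = "Dom P f" and ?q = "Dom P g" and ?r = "Dom P h" and ?p' = "Cod P f" and ?q' = "Cod P g" and ?r' = "Cod P h"
    let ?\<alpha> = "massoc C (fo F ?p) (fo F ?q) (fo F ?r)" and ?\<alpha>' = "massoc C (fo F ?p') (fo F ?q') (fo F ?r')"
    have "fa F (f \<diamondop>\<^bsub>P\<^esub> (g \<diamondop>\<^bsub>P\<^esub> h)) \<cdot> k ?p ?q ?r = (\<mu> ?p' (?q' \<star>\<^bsub>P\<^esub> ?r') \<cdot> (fa F f \<diamondop> fa F (g \<diamondop>\<^bsub>P\<^esub> h))) \<cdot> (ide C (fo F ?p) \<diamondop> \<mu> ?q ?r) \<cdot> ?\<alpha>"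
      unfolding k_def using \<mu>n[of f "g \<diamondop>\<^bsub>P\<^esub> h"] by (intro C.reassoc) simp_all
    also have "\<dots> = \<mu> ?p' (?q' \<star>\<^bsub>P\<^esub> ?r') \<cdot> (ide C (fo F ?p') \<diamondop> \<mu> ?q' ?r') \<cdot> (fa F f \<diamondop> (fa F g \<diamondop> fa F h)) \<cdot> ?\<alpha>"
      by (simp add: C.assoc C.tar_merge \<mu>n)
    also have "(fa F f \<diamondop> (fa F g \<diamondop> fa F h)) \<cdot> ?\<alpha> = ?\<alpha>' \<cdot> ((fa F f \<diamondop> fa F g) \<diamondop> fa F h)"
      by (simp add: C.massoc_nat)
    finally show ?thesis by (simp add: k_def C.assoc)
  qed
  have lkZ: "l (fo Z x) (fo Z y) (fo Z z) = k (fo Z x) (fo Z y) (fo Z z)" if [simp]: "x \<in> Ob X" "y \<in> Ob X" "z \<in> Ob X" for x y z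
  proof -
    let ?x = "fo Z x" and ?y = "fo Z y" and ?z = "fo Z z" and ?xy = "fo Z (x \<star>\<^bsub>X\<^esub> y)" and ?yz = "fo Z (y \<star>\<^bsub>X\<^esub> z)"
    let ?I = "\<lambda>p. ide C (fo F p)"
    \<comment> \<open>The constraint of \<open>Z\<close> on a right-nested triple. Its image under
      \<open>F\<close> is invertible, and composing with it turns both sides into the two sides of
      associativity for \<open>E\<close>.\<close>
    let ?\<nu> = "fmu Z x (y \<star>\<^bsub>X\<^esub> z) \<cdot>\<^bsub>P\<^esub> (ide P ?x \<diamondop>\<^bsub>P\<^esub> fmu Z y z)"
    have a: "?\<nu> \<cdot>\<^bsub>P\<^esub> massoc P ?x ?y ?z = fa Z (massoc X x y z) \<cdot>\<^bsub>P\<^esub> fmu Z (x \<star>\<^bsub>X\<^esub> y) z \<cdot>\<^bsub>P\<^esub> (fmu Z x y \<diamondop>\<^bsub>P\<^esub> ide P ?z)"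
      by (simp add: fmu_assoc[OF Z] P.assoc)
    have 1: "fa F (fmu Z x y \<diamondop>\<^bsub>P\<^esub> ide P ?z) \<cdot> \<mu> (?x \<star>\<^bsub>P\<^esub> ?y) ?z \<cdot> (\<mu> ?x ?y \<diamondop> ?I ?z) =
       (\<mu> ?xy ?z \<cdot> (fa F (fmu Z x y) \<diamondop> ?I ?z)) \<cdot> (\<mu> ?x ?y \<diamondop> ?I ?z)"
      using \<mu>n[of "fmu Z x y" "ide P ?z"] by (intro C.reassoc) simp_all
    have 2: "fa F (ide P ?x \<diamondop>\<^bsub>P\<^esub> fmu Z y z) \<cdot> \<mu> ?x (?y \<star>\<^bsub>P\<^esub> ?z) \<cdot> (?I ?x \<diamondop> \<mu> ?y ?z) \<cdot> massoc C (fo F ?x) (fo F ?y) (fo F ?z) =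
       (\<mu> ?x ?yz \<cdot> (?I ?x \<diamondop> fa F (fmu Z y z))) \<cdot> (?I ?x \<diamondop> \<mu> ?y ?z) \<cdot> massoc C (fo F ?x) (fo F ?y) (fo F ?z)"
      using \<mu>n[of "ide P ?x" "fmu Z y z"] by (intro C.reassoc) simp_all
    have "fa F ?\<nu> \<cdot> l ?x ?y ?z = fa F (?\<nu> \<cdot>\<^bsub>P\<^esub> massoc P ?x ?y ?z) \<cdot> \<mu> (?x \<star>\<^bsub>P\<^esub> ?y) ?z \<cdot> (\<mu> ?x ?y \<diamondop> ?I ?z)"
      by (simp add: l_def C.assoc)
    also have "\<dots> = fa F (fa Z (massoc X x y z)) \<cdot> fa F (fmu Z (x \<star>\<^bsub>X\<^esub> y) z) \<cdot>
       fa F (fmu Z x y \<diamondop>\<^bsub>P\<^esub> ide P ?z) \<cdot> \<mu> (?x \<star>\<^bsub>P\<^esub> ?y) ?z \<cdot> (\<mu> ?x ?y \<diamondop> ?I ?z)"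
      unfolding a by (simp add: C.assoc)
    also have "\<dots> = fa F (fa Z (massoc X x y z)) \<cdot> (fa F (fmu Z (x \<star>\<^bsub>X\<^esub> y) z) \<cdot> \<mu> ?xy ?z) \<cdot>
       ((fa F (fmu Z x y) \<cdot> \<mu> ?x ?y) \<diamondop> ?I ?z)"
      unfolding 1 by (simp add: C.assoc C.tar_merge)
    also have "\<dots> = fa E (massoc X x y z) \<cdot> fmu E (x \<star>\<^bsub>X\<^esub> y) z \<cdot> (fmu E x y \<diamondop> ide C (fo E z))"
      by (simp add: \<mu>Z)
    also have "\<dots> = fmu E x (y \<star>\<^bsub>X\<^esub> z) \<cdot> (ide C (fo E x) \<diamondop> fmu E y z) \<cdot> massoc C (fo E x) (fo E y) (fo E z)"
      by (rule fmu_assoc[OF E that])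
    also have "\<dots> = (fa F (fmu Z x (y \<star>\<^bsub>X\<^esub> z)) \<cdot> \<mu> ?x ?yz) \<cdot> (?I ?x \<diamondop> (fa F (fmu Z y z) \<cdot> \<mu> ?y ?z)) \<cdot> massoc C (fo F ?x) (fo F ?y) (fo F ?z)"
      by (simp add: \<mu>Z)
    also have "\<dots> = fa F (fmu Z x (y \<star>\<^bsub>X\<^esub> z)) \<cdot> (\<mu> ?x ?yz \<cdot> (?I ?x \<diamondop> fa F (fmu Z y z))) \<cdot> (?I ?x \<diamondop> \<mu> ?y ?z) \<cdot> massoc C (fo F ?x) (fo F ?y) (fo F ?z)"
      by (simp add: C.assoc C.tar_merge)
    also have "\<dots> = fa F ?\<nu> \<cdot> k ?x ?y ?z" unfolding 2[symmetric] k_def by (simp add: C.assoc)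
    finally show ?thesis by (rule C.iso_cancel_left[rotated -1]) simp_all
  qed
  \<comment> \<open>With the first two variables on the image of \<open>Z\<close>, both sides are
    transformations in \<open>r\<close> alone between right exact linear functors.\<close>
  have lk1: "l (fo Z x) (fo Z y) r = k (fo Z x) (fo Z y) r" if [simp]: "x \<in> Ob X" "y \<in> Ob X" and r: "r \<in> Ob P" for x y r
  proof (rule Z_faithful[where F = "comp_fct (tensor_left C (fo F (fo Z x) \<star> fo F (fo Z y))) F"
        and F' = "comp_fct F (comp_fct (tensor_left P (fo Z x)) (tensor_left P (fo Z y)))"])
    show "lin_rex R P C (comp_fct (tensor_left C (fo F (fo Z x) \<star> fo F (fo Z y))) F)"
      by (intro lin_rex_comp[OF F] lin_rex_tensor[OF rexC]) simp
    show "lin_rex R P C (comp_fct F (comp_fct (tensor_left P (fo Z x)) (tensor_left P (fo Z y))))"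
      by (intro lin_rex_comp[OF _ F] lin_rex_comp[of R P P _ P] lin_rex_tensor[OF rexP]) simp_all
  qed (use ln[of "ide P (fo Z x)" "ide P (fo Z y)"] kn[of "ide P (fo Z x)" "ide P (fo Z y)"] r lkZ in \<open>auto intro!: nat_transI\<close>)
  have "l p q r = k p q r" if pq: "p \<in> Ob P" "q \<in> Ob P" and r: "r \<in> Ob P" for p q r
  proof -
    \<comment> \<open>The third variable is now arbitrary but fixed, and \<open>bi_unique\<close>
      removes the restriction on the first two.\<close>
    let ?T = "comp_fct (tensor_right C (fo F r)) (tensor_after F)"
    have "(\<lambda>(p, q). l p q r) (p, q) = (\<lambda>(p, q). k p q r) (p, q)"
    proof (rule bi_unique[OF _ birex_tensor_before3[OF F r] _ _ _ pq])
      show "birex ?T" using r by (intro birex_comp birex_tensor_after[OF F] lin_rex_tensor[OF rexC]) simp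
      show "nat_trans PP C ?T (tensor_before3 F r) (\<lambda>(p, q). l p q r)"
        using ln[of _ _ "ide P r"] r by (intro nat_transI) auto
      show "nat_trans PP C ?T (tensor_before3 F r) (\<lambda>(p, q). k p q r)"
        using kn[of _ _ "ide P r"] r by (intro nat_transI) auto
    qed (use lk1 r in simp)
    then show ?thesis by simp
  qed
  note assoc = this[unfolded l_def k_def]

  \<comment> \<open>Both sides are transformations from \<open>tensor_after F\<close> to
    \<open>tensor_before_flip F\<close>; on the image of \<open>Z\<close> the claim follows from the
    symmetry axioms of \<open>Z\<close> and \<open>E\<close>.\<close>
  have sym: "fa F (msym P p q) \<cdot> \<mu> p q = \<mu> q p \<cdot> msym C (fo F p) (fo F q)" if pq: "p \<in> Ob P" "q \<in> Ob P" for p q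
  proof -
    let ?l = "\<lambda>(p, q). fa F (msym P p q) \<cdot> \<mu> p q" and ?k = "\<lambda>(p, q). \<mu> q p \<cdot> msym C (fo F p) (fo F q)"
    have "?l (p, q) = ?k (p, q)"
    proof (rule bi_unique[OF birex_tensor_after[OF F] birex_tensor_before_flip[OF F] _ _ _ pq])
      show "nat_trans PP C (tensor_after F) (tensor_before_flip F) ?l"
      proof (rule nat_transI)
        fix h assume "h \<in> Ar PP"
        then obtain f g where [simp]: "h = (f, g)" "f \<in> Ar P" "g \<in> Ar P" by auto
        let ?p = "Dom P f" and ?q = "Dom P g" and ?p' = "Cod P f" and ?q' = "Cod P g"
        have "fa F (g \<diamondop>\<^bsub>P\<^esub> f) \<cdot> fa F (msym P ?p ?q) = fa F (msym P ?p' ?q') \<cdot> fa F (f \<diamondop>\<^bsub>P\<^esub> g)"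
          using arg_cong[OF P.msym_nat[of f g, OF _ _ refl refl], of "fa F"] by simp
        then have "fa F (g \<diamondop>\<^bsub>P\<^esub> f) \<cdot> fa F (msym P ?p ?q) \<cdot> \<mu> ?p ?q = (fa F (msym P ?p' ?q') \<cdot> fa F (f \<diamondop>\<^bsub>P\<^esub> g)) \<cdot> \<mu> ?p ?q"
          by (rule C.reassoc) simp_all
        then show "fa (tensor_before_flip F) h \<cdot> ?l (Dom PP h) = ?l (Cod PP h) \<cdot> fa (tensor_after F) h"
          by (simp add: C.assoc \<mu>n)
      qed auto
      show "nat_trans PP C (tensor_after F) (tensor_before_flip F) ?k"
      proof (rule nat_transI)
        fix h assume "h \<in> Ar PP"
        then obtain f g where [simp]: "h = (f, g)" "f \<in> Ar P" "g \<in> Ar P" by auto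
        let ?p = "Dom P f" and ?q = "Dom P g" and ?p' = "Cod P f" and ?q' = "Cod P g"
        have "fa F (g \<diamondop>\<^bsub>P\<^esub> f) \<cdot> \<mu> ?q ?p \<cdot> msym C (fo F ?p) (fo F ?q) = (\<mu> ?q' ?p' \<cdot> (fa F g \<diamondop> fa F f)) \<cdot> msym C (fo F ?p) (fo F ?q)"
          using \<mu>n[of g f] by (intro C.reassoc) simp_all
        then show "fa (tensor_before_flip F) h \<cdot> ?k (Dom PP h) = ?k (Cod PP h) \<cdot> fa (tensor_after F) h"
          by (simp add: C.assoc C.msym_nat)
      qed auto
      fix x y assume [simp]: "x \<in> Ob X" "y \<in> Ob X"
      let ?x = "fo Z x" and ?y = "fo Z y"
      have "fa F (fmu Z y x) \<cdot> fa F (msym P ?x ?y) \<cdot> \<mu> ?x ?y = fa F (fmu Z y x \<cdot>\<^bsub>P\<^esub> msym P ?x ?y) \<cdot> \<mu> ?x ?y"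
        by (simp add: C.assoc)
      also have "\<dots> = fa F (fa Z (msym X x y)) \<cdot> fa F (fmu Z x y) \<cdot> \<mu> ?x ?y"
        unfolding fmu_sym[OF Z \<open>x \<in> Ob X\<close> \<open>y \<in> Ob X\<close>, symmetric] by (simp add: C.assoc)
      also have "\<dots> = fa E (msym X x y) \<cdot> fmu E x y" by (simp add: \<mu>Z)
      also have "\<dots> = fmu E y x \<cdot> msym C (fo E x) (fo E y)" by (rule fmu_sym[OF E]) simp_all
      also have "\<dots> = (fa F (fmu Z y x) \<cdot> \<mu> ?y ?x) \<cdot> msym C (fo F ?x) (fo F ?y)" by (simp add: \<mu>Z)
      also have "\<dots> = fa F (fmu Z y x) \<cdot> \<mu> ?y ?x \<cdot> msym C (fo F ?x) (fo F ?y)" by (simp add: C.assoc)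
      finally have "fa F (msym P ?x ?y) \<cdot> \<mu> ?x ?y = \<mu> ?y ?x \<cdot> msym C (fo F ?x) (fo F ?y)"
        by (rule C.iso_cancel_left[rotated -1]) simp_all
      then show "?l (?x, ?y) = ?k (?x, ?y)" by simp
    qed
    then show ?thesis by simp
  qed

  \<comment> \<open>A single variable is involved, so \<open>Z_faithful\<close> applies directly; at
    \<open>Z x\<close> the unit axioms of \<open>Z\<close> and \<open>E\<close> give the
    claim.\<close>
  have lunit: "fa F (mlunit P p) \<cdot> \<mu> (munit P) p \<cdot> (\<epsilon> \<diamondop> ide C (fo F p)) = mlunit C (fo F p)" if p: "p \<in> Ob P" for p
  proof (rule Z_faithful[where F = "comp_fct (tensor_left C (munit C)) F" and F' = F, OF _ F _ _ _ p])
    let ?l = "\<lambda>p. fa F (mlunit P p) \<cdot> \<mu> (munit P) p \<cdot> (\<epsilon> \<diamondop> ide C (fo F p))"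
    show "lin_rex R P C (comp_fct (tensor_left C (munit C)) F)"
      by (intro lin_rex_comp[OF F] lin_rex_tensor[OF rexC]) simp
    show "nat_trans P C (comp_fct (tensor_left C (munit C)) F) F ?l"
    proof (rule nat_transI)
      fix f assume [simp]: "f \<in> Ar P"
      let ?p = "Dom P f" and ?p' = "Cod P f" and ?I = "munit P"
      have 1: "fa F f \<cdot> fa F (mlunit P ?p) = fa F (mlunit P ?p') \<cdot> fa F (ide P ?I \<diamondop>\<^bsub>P\<^esub> f)"
        using arg_cong[OF P.mlunit_nat[of f, OF _ refl], of "fa F"] by simp
      have 2: "fa F (ide P ?I \<diamondop>\<^bsub>P\<^esub> f) \<cdot> \<mu> ?I ?p \<cdot> (\<epsilon> \<diamondop> ide C (fo F ?p)) = (\<mu> ?I ?p' \<cdot> (ide C (fo F ?I) \<diamondop> fa F f)) \<cdot> (\<epsilon> \<diamondop> ide C (fo F ?p))"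
        using \<mu>n[of "ide P ?I" f] by (intro C.reassoc) simp_all
      have "fa F f \<cdot> ?l ?p = (fa F (mlunit P ?p') \<cdot> fa F (ide P ?I \<diamondop>\<^bsub>P\<^esub> f)) \<cdot> \<mu> ?I ?p \<cdot> (\<epsilon> \<diamondop> ide C (fo F ?p))"
        by (intro C.reassoc 1) simp_all
      also have "\<dots> = fa F (mlunit P ?p') \<cdot> fa F (ide P ?I \<diamondop>\<^bsub>P\<^esub> f) \<cdot> \<mu> ?I ?p \<cdot> (\<epsilon> \<diamondop> ide C (fo F ?p))"
        by (simp add: C.assoc)
      also have "\<dots> = ?l ?p' \<cdot> (ide C (munit C) \<diamondop> fa F f)"
        unfolding 2 by (simp add: C.assoc C.tar_merge)
      finally show "fa F f \<cdot> ?l ?p = ?l ?p' \<cdot> fa (comp_fct (tensor_left C (munit C)) F) f" by simp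
    qed simp_all
    show "nat_trans P C (comp_fct (tensor_left C (munit C)) F) F (\<lambda>p. mlunit C (fo F p))"
      by (rule nat_transI) (simp_all add: C.mlunit_nat)
    fix x assume [simp]: "x \<in> Ob X"
    let ?x = "fo Z x" and ?I = "munit P" and ?J = "fo Z (munit X)"
    have 1: "fa F (feps Z \<diamondop>\<^bsub>P\<^esub> ide P ?x) \<cdot> \<mu> ?I ?x \<cdot> (\<epsilon> \<diamondop> ide C (fo F ?x)) =
        (\<mu> ?J ?x \<cdot> (fa F (feps Z) \<diamondop> ide C (fo F ?x))) \<cdot> (\<epsilon> \<diamondop> ide C (fo F ?x))"
      using \<mu>n[of "feps Z" "ide P ?x"] by (intro C.reassoc) simp_all
    have "?l ?x = fa F (fa Z (mlunit X x) \<cdot>\<^bsub>P\<^esub> fmu Z (munit X) x \<cdot>\<^bsub>P\<^esub> (feps Z \<diamondop>\<^bsub>P\<^esub> ide P ?x)) \<cdot> \<mu> ?I ?x \<cdot> (\<epsilon> \<diamondop> ide C (fo F ?x))"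
      by (simp only: fmu_left_unit[OF Z \<open>x \<in> Ob X\<close>])
    also have "\<dots> = fa F (fa Z (mlunit X x)) \<cdot> fa F (fmu Z (munit X) x) \<cdot> fa F (feps Z \<diamondop>\<^bsub>P\<^esub> ide P ?x) \<cdot> \<mu> ?I ?x \<cdot> (\<epsilon> \<diamondop> ide C (fo F ?x))"
      by (simp add: C.assoc)
    also have "\<dots> = fa F (fa Z (mlunit X x)) \<cdot> (fa F (fmu Z (munit X) x) \<cdot> \<mu> ?J ?x) \<cdot> ((fa F (feps Z) \<cdot> \<epsilon>) \<diamondop> ide C (fo F ?x))"
      unfolding 1 by (simp add: C.assoc C.tar_merge)
    also have "\<dots> = mlunit C (fo F ?x)"
      using fmu_left_unit[OF E, of x] by (simp add: \<mu>Z \<epsilon>Z)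
    finally show "?l ?x = mlunit C (fo F ?x)" .
  qed

  have runit: "fa F (mrunit P p) \<cdot> \<mu> p (munit P) \<cdot> (ide C (fo F p) \<diamondop> \<epsilon>) = mrunit C (fo F p)" if p: "p \<in> Ob P" for p
  proof (rule Z_faithful[where F = "comp_fct (tensor_right C (munit C)) F" and F' = F, OF _ F _ _ _ p])
    let ?l = "\<lambda>p. fa F (mrunit P p) \<cdot> \<mu> p (munit P) \<cdot> (ide C (fo F p) \<diamondop> \<epsilon>)"
    show "lin_rex R P C (comp_fct (tensor_right C (munit C)) F)"
      by (intro lin_rex_comp[OF F] lin_rex_tensor[OF rexC]) simp
    show "nat_trans P C (comp_fct (tensor_right C (munit C)) F) F ?l"
    proof (rule nat_transI)
      fix f assume [simp]: "f \<in> Ar P"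
      let ?p = "Dom P f" and ?p' = "Cod P f" and ?I = "munit P"
      have 1: "fa F f \<cdot> fa F (mrunit P ?p) = fa F (mrunit P ?p') \<cdot> fa F (f \<diamondop>\<^bsub>P\<^esub> ide P ?I)"
        using arg_cong[OF P.mrunit_nat[of f, OF _ refl], of "fa F"] by simp
      have 2: "fa F (f \<diamondop>\<^bsub>P\<^esub> ide P ?I) \<cdot> \<mu> ?p ?I \<cdot> (ide C (fo F ?p) \<diamondop> \<epsilon>) = (\<mu> ?p' ?I \<cdot> (fa F f \<diamondop> ide C (fo F ?I))) \<cdot> (ide C (fo F ?p) \<diamondop> \<epsilon>)"
        using \<mu>n[of f "ide P ?I"] by (intro C.reassoc) simp_all
      have "fa F f \<cdot> ?l ?p = (fa F (mrunit P ?p') \<cdot> fa F (f \<diamondop>\<^bsub>P\<^esub> ide P ?I)) \<cdot> \<mu> ?p ?I \<cdot> (ide C (fo F ?p) \<diamondop> \<epsilon>)"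
        by (intro C.reassoc 1) simp_all
      also have "\<dots> = fa F (mrunit P ?p') \<cdot> fa F (f \<diamondop>\<^bsub>P\<^esub> ide P ?I) \<cdot> \<mu> ?p ?I \<cdot> (ide C (fo F ?p) \<diamondop> \<epsilon>)"
        by (simp add: C.assoc)
      also have "\<dots> = ?l ?p' \<cdot> (fa F f \<diamondop> ide C (munit C))"
        unfolding 2 by (simp add: C.assoc C.tar_merge)
      finally show "fa F f \<cdot> ?l ?p = ?l ?p' \<cdot> fa (comp_fct (tensor_right C (munit C)) F) f" by simp
    qed simp_all
    show "nat_trans P C (comp_fct (tensor_right C (munit C)) F) F (\<lambda>p. mrunit C (fo F p))"
      by (rule nat_transI) (simp_all add: C.mrunit_nat)
    fix x assume [simp]: "x \<in> Ob X"
    let ?x = "fo Z x" and ?I = "munit P" and ?J = "fo Z (munit X)"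
    have 1: "fa F (ide P ?x \<diamondop>\<^bsub>P\<^esub> feps Z) \<cdot> \<mu> ?x ?I \<cdot> (ide C (fo F ?x) \<diamondop> \<epsilon>) =
        (\<mu> ?x ?J \<cdot> (ide C (fo F ?x) \<diamondop> fa F (feps Z))) \<cdot> (ide C (fo F ?x) \<diamondop> \<epsilon>)"
      using \<mu>n[of "ide P ?x" "feps Z"] by (intro C.reassoc) simp_all
    have "?l ?x = fa F (fa Z (mrunit X x) \<cdot>\<^bsub>P\<^esub> fmu Z x (munit X) \<cdot>\<^bsub>P\<^esub> (ide P ?x \<diamondop>\<^bsub>P\<^esub> feps Z)) \<cdot> \<mu> ?x ?I \<cdot> (ide C (fo F ?x) \<diamondop> \<epsilon>)"
      by (simp only: fmu_right_unit[OF Z \<open>x \<in> Ob X\<close>])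
    also have "\<dots> = fa F (fa Z (mrunit X x)) \<cdot> fa F (fmu Z x (munit X)) \<cdot> fa F (ide P ?x \<diamondop>\<^bsub>P\<^esub> feps Z) \<cdot> \<mu> ?x ?I \<cdot> (ide C (fo F ?x) \<diamondop> \<epsilon>)"
      by (simp add: C.assoc)
    also have "\<dots> = fa F (fa Z (mrunit X x)) \<cdot> (fa F (fmu Z x (munit X)) \<cdot> \<mu> ?x ?J) \<cdot> (ide C (fo F ?x) \<diamondop> (fa F (feps Z) \<cdot> \<epsilon>))"
      unfolding 1 by (simp add: C.assoc C.tar_merge)
    also have "\<dots> = mrunit C (fo F ?x)"
      using fmu_right_unit[OF E, of x] by (simp add: \<mu>Z \<epsilon>Z)
    finally show "?l ?x = mrunit C (fo F ?x)" .
  qed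

  define F' :: "('po, 'pa, 'co, 'ca) smfct" where "F' = \<lparr>fo = fo F, fa = fa F, fmu = \<mu>, feps = \<epsilon>\<rparr>"
  have F'sel [simp]: "fo F' p = fo F p" "fa F' f = fa F f" "fmu F' p q = \<mu> p q" "feps F' = \<epsilon>" for p f q
    by (simp_all add: F'_def)
  have "sm_functor P C F'"
  proof (rule sm_functorI, goal_cases)
    case 1 then show ?case using iF by (simp add: is_functor_def)
  next
    case (4 f g) then show ?case by (simp add: \<mu>n)
  next
    case (5 x y z) then show ?case using assoc[of x y z] by (simp only: F'sel)
  next
    case (6 x) then show ?case using lunit[of x] by (simp only: F'sel)
  next
    case (7 x) then show ?case using runit[of x] by (simp only: F'sel)
  next
    case (8 x y) then show ?case using sym[of x y] by (simp only: F'sel)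
  qed simp_all
  with F'sel(1,2) show ?thesis by (rule that) (simp_all add: \<mu>Z \<epsilon>Z)
qed

end

text \<open>The hypotheses on \<open>fmu F\<close> and \<open>feps F\<close> are the only values for
  which \<open>\<psi>\<close> is monoidal. Each axiom for \<open>F\<close> becomes the corresponding
  one for \<open>H\<close> after composition with the invertible \<open>\<psi>\<close>.\<close>

lemma transport_structure:
  assumes C: "sm_category C" and D: "sm_category D" and H: "sm_functor C D H" and iF: "is_functor C D F"
    and \<psi>: "nat_trans C D F H \<psi>" and iso: "\<And>x. x \<in> Ob C \<Longrightarrow> iso_arr D (\<psi> x)"
    and fmu: "\<And>x y. x \<in> Ob C \<Longrightarrow> y \<in> Ob C \<Longrightarrow>
      fmu F x y = inv_arr D (\<psi> (x \<star>\<^bsub>C\<^esub> y)) \<cdot>\<^bsub>D\<^esub> fmu H x y \<cdot>\<^bsub>D\<^esub> (\<psi> x \<diamondop>\<^bsub>D\<^esub> \<psi> y)"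
    and feps: "feps F = inv_arr D (\<psi> (munit C)) \<cdot>\<^bsub>D\<^esub> feps H"
  shows "sm_functor C D F" "monoidal_nat_trans C D F H \<psi>"
proof -
  interpret C: sm_category C by fact
  interpret D: sm_category D by fact
  note iH = sm_functor_is_functor[OF H]
  note [simp] = sm_functor_simps[OF H] functor_simps[OF iH] functor_simps[OF iF] nat_trans_simps[OF \<psi>] iso
  have mu [simp]: "iso_arr D (fmu F x y)" "fmu F x y \<in> Ar D" "Dom D (fmu F x y) = fo F x \<star>\<^bsub>D\<^esub> fo F y"
    "Cod D (fmu F x y) = fo F (x \<star>\<^bsub>C\<^esub> y)" if "x \<in> Ob C" "y \<in> Ob C" for x y
    using that by (simp_all add: fmu)
  have ep [simp]: "iso_arr D (feps F)" "feps F \<in> Ar D" "Dom D (feps F) = munit D" "Cod D (feps F) = fo F (munit C)"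
    by (simp_all add: feps)
  have M: "\<psi> (x \<star>\<^bsub>C\<^esub> y) \<cdot>\<^bsub>D\<^esub> fmu F x y = fmu H x y \<cdot>\<^bsub>D\<^esub> (\<psi> x \<diamondop>\<^bsub>D\<^esub> \<psi> y)" if "x \<in> Ob C" "y \<in> Ob C" for x y
    using that by (simp add: fmu)
  have U: "\<psi> (munit C) \<cdot>\<^bsub>D\<^esub> feps F = feps H" by (simp add: feps)
  have M': "\<psi> (x \<star>\<^bsub>C\<^esub> y) \<cdot>\<^bsub>D\<^esub> fmu F x y \<cdot>\<^bsub>D\<^esub> k = fmu H x y \<cdot>\<^bsub>D\<^esub> (\<psi> x \<diamondop>\<^bsub>D\<^esub> \<psi> y) \<cdot>\<^bsub>D\<^esub> k"
    if "x \<in> Ob C" "y \<in> Ob C" "k \<in> Ar D" "Cod D k = fo F x \<star>\<^bsub>D\<^esub> fo F y" for x y k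
    using D.reassoc[OF M[OF that(1,2)], of k] that by (simp add: D.assoc)
  have N: "\<psi> (Cod C f) \<cdot>\<^bsub>D\<^esub> fa F f \<cdot>\<^bsub>D\<^esub> k = fa H f \<cdot>\<^bsub>D\<^esub> \<psi> (Dom C f) \<cdot>\<^bsub>D\<^esub> k"
    if "f \<in> Ar C" "k \<in> Ar D" "Cod D k = fo F (Dom C f)" for f k
    using D.reassoc[OF nat_trans_natural[OF \<psi>, symmetric, of f], of k] that by (simp add: D.assoc)
  show "sm_functor C D F"
  proof (rule sm_functorI, goal_cases)
    case 1 show ?case by (rule iF)
  next
    case (4 f g)
    note [simp] = 4
    let ?x = "Dom C f" and ?y = "Dom C g" and ?x' = "Cod C f" and ?y' = "Cod C g"
    have "\<psi> (?x' \<star>\<^bsub>C\<^esub> ?y') \<cdot>\<^bsub>D\<^esub> fa F (f \<diamondop>\<^bsub>C\<^esub> g) \<cdot>\<^bsub>D\<^esub> fmu F ?x ?y = fa H (f \<diamondop>\<^bsub>C\<^esub> g) \<cdot>\<^bsub>D\<^esub> fmu H ?x ?y \<cdot>\<^bsub>D\<^esub> (\<psi> ?x \<diamondop>\<^bsub>D\<^esub> \<psi> ?y)"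
      using N[of "f \<diamondop>\<^bsub>C\<^esub> g" "fmu F ?x ?y"] by (simp add: M)
    also have "\<dots> = (fmu H ?x' ?y' \<cdot>\<^bsub>D\<^esub> (fa H f \<diamondop>\<^bsub>D\<^esub> fa H g)) \<cdot>\<^bsub>D\<^esub> (\<psi> ?x \<diamondop>\<^bsub>D\<^esub> \<psi> ?y)"
      by (intro D.reassoc fmu_natural[OF H]) simp_all
    also have "\<dots> = \<psi> (?x' \<star>\<^bsub>C\<^esub> ?y') \<cdot>\<^bsub>D\<^esub> fmu F ?x' ?y' \<cdot>\<^bsub>D\<^esub> (fa F f \<diamondop>\<^bsub>D\<^esub> fa F g)"
      using nat_trans_natural[OF \<psi>, of f] nat_trans_natural[OF \<psi>, of g] by (simp add: M' D.assoc D.tar_merge)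
    finally show ?case by (rule D.iso_cancel_left[rotated -1]) simp_all
  next
    case (5 x y z)
    note [simp] = 5
    let ?\<alpha>H = "massoc D (fo H x) (fo H y) (fo H z)" and ?\<alpha>F = "massoc D (fo F x) (fo F y) (fo F z)"
    have "\<psi> (x \<star>\<^bsub>C\<^esub> (y \<star>\<^bsub>C\<^esub> z)) \<cdot>\<^bsub>D\<^esub> fa F (massoc C x y z) \<cdot>\<^bsub>D\<^esub> fmu F (x \<star>\<^bsub>C\<^esub> y) z \<cdot>\<^bsub>D\<^esub> (fmu F x y \<diamondop>\<^bsub>D\<^esub> ide D (fo F z)) =
      fa H (massoc C x y z) \<cdot>\<^bsub>D\<^esub> fmu H (x \<star>\<^bsub>C\<^esub> y) z \<cdot>\<^bsub>D\<^esub> (\<psi> (x \<star>\<^bsub>C\<^esub> y) \<diamondop>\<^bsub>D\<^esub> \<psi> z) \<cdot>\<^bsub>D\<^esub> (fmu F x y \<diamondop>\<^bsub>D\<^esub> ide D (fo F z))"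
      using N[of "massoc C x y z" "fmu F (x \<star>\<^bsub>C\<^esub> y) z \<cdot>\<^bsub>D\<^esub> (fmu F x y \<diamondop>\<^bsub>D\<^esub> ide D (fo F z))"] by (simp add: M')
    also have "\<dots> = (fa H (massoc C x y z) \<cdot>\<^bsub>D\<^esub> fmu H (x \<star>\<^bsub>C\<^esub> y) z \<cdot>\<^bsub>D\<^esub> (fmu H x y \<diamondop>\<^bsub>D\<^esub> ide D (fo H z))) \<cdot>\<^bsub>D\<^esub> ((\<psi> x \<diamondop>\<^bsub>D\<^esub> \<psi> y) \<diamondop>\<^bsub>D\<^esub> \<psi> z)"
      by (simp add: D.assoc D.tar_merge M)
    also have "\<dots> = fmu H x (y \<star>\<^bsub>C\<^esub> z) \<cdot>\<^bsub>D\<^esub> (ide D (fo H x) \<diamondop>\<^bsub>D\<^esub> fmu H y z) \<cdot>\<^bsub>D\<^esub> ?\<alpha>H \<cdot>\<^bsub>D\<^esub> ((\<psi> x \<diamondop>\<^bsub>D\<^esub> \<psi> y) \<diamondop>\<^bsub>D\<^esub> \<psi> z)"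
      unfolding fmu_assoc[OF H 5] by (simp add: D.assoc)
    also have "?\<alpha>H \<cdot>\<^bsub>D\<^esub> ((\<psi> x \<diamondop>\<^bsub>D\<^esub> \<psi> y) \<diamondop>\<^bsub>D\<^esub> \<psi> z) = (\<psi> x \<diamondop>\<^bsub>D\<^esub> (\<psi> y \<diamondop>\<^bsub>D\<^esub> \<psi> z)) \<cdot>\<^bsub>D\<^esub> ?\<alpha>F"
      by (simp add: D.massoc_nat)
    also have "fmu H x (y \<star>\<^bsub>C\<^esub> z) \<cdot>\<^bsub>D\<^esub> (ide D (fo H x) \<diamondop>\<^bsub>D\<^esub> fmu H y z) \<cdot>\<^bsub>D\<^esub> \<dots> =
       \<psi> (x \<star>\<^bsub>C\<^esub> (y \<star>\<^bsub>C\<^esub> z)) \<cdot>\<^bsub>D\<^esub> fmu F x (y \<star>\<^bsub>C\<^esub> z) \<cdot>\<^bsub>D\<^esub> (ide D (fo F x) \<diamondop>\<^bsub>D\<^esub> fmu F y z) \<cdot>\<^bsub>D\<^esub> ?\<alpha>F"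
      by (simp add: M' D.tar_merge M)
    finally show ?case by (rule D.iso_cancel_left[rotated -1]) simp_all
  next
    case (6 x)
    note [simp] = 6
    have "\<psi> x \<cdot>\<^bsub>D\<^esub> fa F (mlunit C x) \<cdot>\<^bsub>D\<^esub> fmu F (munit C) x \<cdot>\<^bsub>D\<^esub> (feps F \<diamondop>\<^bsub>D\<^esub> ide D (fo F x)) =
       (fa H (mlunit C x) \<cdot>\<^bsub>D\<^esub> fmu H (munit C) x \<cdot>\<^bsub>D\<^esub> (feps H \<diamondop>\<^bsub>D\<^esub> ide D (fo H x))) \<cdot>\<^bsub>D\<^esub> (ide D (munit D) \<diamondop>\<^bsub>D\<^esub> \<psi> x)"
      using N[of "mlunit C x" "fmu F (munit C) x \<cdot>\<^bsub>D\<^esub> (feps F \<diamondop>\<^bsub>D\<^esub> ide D (fo F x))"] by (simp add: M' D.tar_merge U D.assoc)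
    also have "\<dots> = \<psi> x \<cdot>\<^bsub>D\<^esub> mlunit D (fo F x)"
      unfolding fmu_left_unit[OF H 6] by (simp add: D.mlunit_nat)
    finally show ?case by (rule D.iso_cancel_left[rotated -1]) simp_all
  next
    case (7 x)
    note [simp] = 7
    have "\<psi> x \<cdot>\<^bsub>D\<^esub> fa F (mrunit C x) \<cdot>\<^bsub>D\<^esub> fmu F x (munit C) \<cdot>\<^bsub>D\<^esub> (ide D (fo F x) \<diamondop>\<^bsub>D\<^esub> feps F) =
       (fa H (mrunit C x) \<cdot>\<^bsub>D\<^esub> fmu H x (munit C) \<cdot>\<^bsub>D\<^esub> (ide D (fo H x) \<diamondop>\<^bsub>D\<^esub> feps H)) \<cdot>\<^bsub>D\<^esub> (\<psi> x \<diamondop>\<^bsub>D\<^esub> ide D (munit D))"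
      using N[of "mrunit C x" "fmu F x (munit C) \<cdot>\<^bsub>D\<^esub> (ide D (fo F x) \<diamondop>\<^bsub>D\<^esub> feps F)"] by (simp add: M' D.tar_merge U D.assoc)
    also have "\<dots> = \<psi> x \<cdot>\<^bsub>D\<^esub> mrunit D (fo F x)"
      unfolding fmu_right_unit[OF H 7] by (simp add: D.mrunit_nat)
    finally show ?case by (rule D.iso_cancel_left[rotated -1]) simp_all
  next
    case (8 x y)
    note [simp] = 8
    have "\<psi> (y \<star>\<^bsub>C\<^esub> x) \<cdot>\<^bsub>D\<^esub> fa F (msym C x y) \<cdot>\<^bsub>D\<^esub> fmu F x y = (fa H (msym C x y) \<cdot>\<^bsub>D\<^esub> fmu H x y) \<cdot>\<^bsub>D\<^esub> (\<psi> x \<diamondop>\<^bsub>D\<^esub> \<psi> y)"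
      using N[of "msym C x y" "fmu F x y"] by (simp add: M D.assoc)
    also have "\<dots> = fmu H y x \<cdot>\<^bsub>D\<^esub> (\<psi> y \<diamondop>\<^bsub>D\<^esub> \<psi> x) \<cdot>\<^bsub>D\<^esub> msym D (fo F x) (fo F y)"
      unfolding fmu_sym[OF H 8] by (simp add: D.assoc D.msym_nat)
    also have "\<dots> = \<psi> (y \<star>\<^bsub>C\<^esub> x) \<cdot>\<^bsub>D\<^esub> fmu F y x \<cdot>\<^bsub>D\<^esub> msym D (fo F x) (fo F y)" by (simp add: M')
    finally show ?case by (rule D.iso_cancel_left[rotated -1]) simp_all
  qed simp_all
  show "monoidal_nat_trans C D F H \<psi>" by (rule monoidal_nat_transI[OF \<psi> M U])
qed

text \<open>Reassociating composites in \<open>E\<close> needs well-typed arrows, so the constraints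
  agree on objects of \<open>B\<close> and the two records need not be equal as such.\<close>

lemma comp_smfct_assoc:
  assumes "sm_functor B C K" "sm_functor C D F" "sm_functor D E G" "category E"
  shows "x \<in> Ob B \<Longrightarrow> y \<in> Ob B \<Longrightarrow> fmu (comp_smfct E (comp_smfct E G F) K) x y = fmu (comp_smfct E G (comp_smfct D F K)) x y"
    and "feps (comp_smfct E (comp_smfct E G F) K) = feps (comp_smfct E G (comp_smfct D F K))"
proof -
  interpret E: category E by fact
  note [simp] = sm_functor_simps[OF assms(1)] functor_simps[OF sm_functor_is_functor[OF assms(1)]]
    sm_functor_simps[OF assms(2)] functor_simps[OF sm_functor_is_functor[OF assms(2)]]
    sm_functor_simps[OF assms(3)] functor_simps[OF sm_functor_is_functor[OF assms(3)]]
  show "x \<in> Ob B \<Longrightarrow> y \<in> Ob B \<Longrightarrow> fmu (comp_smfct E (comp_smfct E G F) K) x y = fmu (comp_smfct E G (comp_smfct D F K)) x y"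
    "feps (comp_smfct E (comp_smfct E G F) K) = feps (comp_smfct E G (comp_smfct D F K))"
    by (simp_all add: E.assoc)
qed

section \<open>Categories of functors\<close>

lemma fun_cat_sel:
  "Ob (fun_cat C D S T) = S"
  "(F, G, \<eta>) \<in> Hom (fun_cat C D S T) F' G' \<longleftrightarrow>
    F = F' \<and> G = G' \<and> F \<in> S \<and> G \<in> S \<and> \<eta> \<in> extensional (Ob C) \<and> T F G \<eta>"
  "(G, H, \<theta>) \<cdot>\<^bsub>fun_cat C D S T\<^esub> (F, G', \<eta>) = (F, H, restrict (\<lambda>x. \<theta> x \<cdot>\<^bsub>D\<^esub> \<eta> x) (Ob C))"
  "ide (fun_cat C D S T) F = (F, F, restrict (\<lambda>x. ide D (fo F x)) (Ob C))"
  by (auto simp: fun_cat_def Hom_def)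

lemma fun_cat_Hom_cases:
  assumes "u \<in> Hom (fun_cat C D S T) F G"
  obtains \<eta> where "u = (F, G, \<eta>)" "F \<in> S" "G \<in> S" "\<eta> \<in> extensional (Ob C)" "T F G \<eta>"
  using assms by (auto simp: fun_cat_def Hom_def)

lemma precomp_fct_sel [simp]:
  "fo (precomp_fct A c K) F = c F K"
  "fa (precomp_fct A c K) (F, G, \<eta>) = (c F K, c G K, restrict (\<lambda>a. \<eta> (fo K a)) (Ob A))"
  by (simp_all add: precomp_fct_def)

lemma rex_sm_cat_Ob:
  "F \<in> Ob (rex_sm_cat R C D) \<longleftrightarrow> lin_rex R C D F \<and> sm_functor C D F"
  by (auto simp: rex_sm_cat_def fun_cat_sel strong_sm_functor_iff lin_rex_def)

lemma rex_sm_cat_Hom: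
  "(F, G, \<eta>) \<in> Hom (rex_sm_cat R C D) F' G' \<longleftrightarrow> F = F' \<and> G = G' \<and> F \<in> Ob (rex_sm_cat R C D) \<and>
    G \<in> Ob (rex_sm_cat R C D) \<and> \<eta> \<in> extensional (Ob C) \<and> monoidal_nat_trans C D F G \<eta>"
  by (simp add: rex_sm_cat_def fun_cat_sel)

lemma rex_sm_cat_Hom_cases:
  assumes "u \<in> Hom (rex_sm_cat R C D) F G"
  obtains \<eta> where "u = (F, G, \<eta>)" "F \<in> Ob (rex_sm_cat R C D)" "G \<in> Ob (rex_sm_cat R C D)"
    "\<eta> \<in> extensional (Ob C)" "monoidal_nat_trans C D F G \<eta>"
  using assms unfolding rex_sm_cat_def by (auto elim!: fun_cat_Hom_cases simp: fun_cat_sel)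

lemma monoidal_nat_trans_restrict:
  "sm_category C \<Longrightarrow> monoidal_nat_trans C D F G \<eta> \<Longrightarrow> monoidal_nat_trans C D F G (restrict \<eta> (Ob C))"
  by (rule monoidal_nat_trans_cong) auto

lemma category_rex_sm_cat:
  assumes C: "sm_category C" and D: "sm_category D"
  shows "category (rex_sm_cat R C D)"
  unfolding rex_sm_cat_def
proof (rule category_fun_cat)
  interpret C: sm_category C by fact
  interpret D: sm_category D by fact
  show "category D" by unfold_locales
  show "Dom C f \<in> Ob C \<and> Cod C f \<in> Ob C" if "f \<in> Ar C" for f using that by simp
next
  fix F G H \<eta> \<theta>
  assume "F \<in> {F. strong_sm_functor R C D F \<and> right_exact C D F}" "G \<in> {F. strong_sm_functor R C D F \<and> right_exact C D F}"
    "H \<in> {F. strong_sm_functor R C D F \<and> right_exact C D F}"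
    and \<eta>: "monoidal_nat_trans C D F G \<eta>" and \<theta>: "monoidal_nat_trans C D G H \<theta>"
  then show "monoidal_nat_trans C D F H (restrict (\<lambda>x. \<theta> x \<cdot>\<^bsub>D\<^esub> \<eta> x) (Ob C))"
    by (intro monoidal_nat_trans_restrict[OF C] monoidal_nat_trans_vcomp[OF C D _ _ _ \<eta> \<theta>])
      (simp_all add: strong_sm_functor_iff)
qed (auto simp: strong_sm_functor_iff sm_functor_is_functor monoidal_nat_transD(1)
    intro!: monoidal_nat_trans_restrict[OF C] monoidal_nat_trans_ide[OF C D])

text \<open>Pointwise inverses of a monoidal transformation are again monoidal, so invertible
  components suffice.\<close>

lemma rex_sm_cat_isoI:
  assumes C: "sm_category C" and D: "sm_category D"
    and F: "F \<in> Ob (rex_sm_cat R C D)" and G: "G \<in> Ob (rex_sm_cat R C D)"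
    and \<eta>: "monoidal_nat_trans C D F G \<eta>" and iso: "\<And>x. x \<in> Ob C \<Longrightarrow> iso_arr D (\<eta> x)"
  shows "is_iso (rex_sm_cat R C D) F G (F, G, restrict \<eta> (Ob C))"
proof -
  interpret C: sm_category C by fact
  interpret D: sm_category D by fact
  note [simp] = iso nat_trans_simps[OF monoidal_nat_transD(1)[OF \<eta>]]
  have inv: "monoidal_nat_trans C D G F (\<lambda>x. inv_arr D (\<eta> x))"
    by (rule monoidal_nat_trans_inv[OF C D _ _ \<eta> iso]) (use F G in \<open>simp_all add: rex_sm_cat_Ob\<close>)
  show ?thesis
    unfolding is_iso_def
  proof (intro conjI bexI[of _ "(G, F, restrict (\<lambda>x. inv_arr D (\<eta> x)) (Ob C))"])
    show "(F, G, restrict \<eta> (Ob C)) \<in> Hom (rex_sm_cat R C D) F G"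
      "(G, F, restrict (\<lambda>x. inv_arr D (\<eta> x)) (Ob C)) \<in> Hom (rex_sm_cat R C D) G F"
      using F G \<eta> inv by (simp_all add: rex_sm_cat_Hom monoidal_nat_trans_restrict[OF C])
  qed (auto simp: rex_sm_cat_def fun_cat_sel intro!: restrict_ext)
qed

lemma prod_cat_sel [simp]:
  "Ob (prod_cat C D) = Ob C \<times> Ob D"
  "(f, g) \<in> Hom (prod_cat C D) (x, y) (x', y') \<longleftrightarrow> f \<in> Hom C x x' \<and> g \<in> Hom D y y'"
  "(f', g') \<cdot>\<^bsub>prod_cat C D\<^esub> (f, g) = (f' \<cdot>\<^bsub>C\<^esub> f, g' \<cdot>\<^bsub>D\<^esub> g)"
  "ide (prod_cat C D) (x, y) = (ide C x, ide D y)"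
  by (auto simp: prod_cat_def Hom_def)

lemma is_iso_prod_cat:
  "is_iso C x x' f \<Longrightarrow> is_iso D y y' g \<Longrightarrow> is_iso (prod_cat C D) (x, y) (x', y') (f, g)"
  unfolding is_iso_def
proof (elim conjE bexE)
  fix f' g' assume "f \<in> Hom C x x'" "g \<in> Hom D y y'" "f' \<in> Hom C x' x" "g' \<in> Hom D y' y"
    "f' \<cdot>\<^bsub>C\<^esub> f = ide C x" "f \<cdot>\<^bsub>C\<^esub> f' = ide C x'" "g' \<cdot>\<^bsub>D\<^esub> g = ide D y" "g \<cdot>\<^bsub>D\<^esub> g' = ide D y'"
  then show "(f, g) \<in> Hom (prod_cat C D) (x, y) (x', y') \<and>
    (\<exists>k\<in>Hom (prod_cat C D) (x', y') (x, y). k \<cdot>\<^bsub>prod_cat C D\<^esub> (f, g) = ide (prod_cat C D) (x, y) \<and>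
      (f, g) \<cdot>\<^bsub>prod_cat C D\<^esub> k = ide (prod_cat C D) (x', y'))"
    by (intro conjI bexI[of _ "(f', g')"]) simp_all
qed

section \<open>Forgetting the tensor product of a test category\<close>

lemma lcat_truncate_sel [simp]:
  "Ob (lcat.truncate C) = Ob C" "Ar (lcat.truncate C) = Ar C" "Dom (lcat.truncate C) = Dom C"
  "Cod (lcat.truncate C) = Cod C" "Comp (lcat.truncate C) = Comp C" "ide (lcat.truncate C) = ide C"
  "HomM (lcat.truncate C) = HomM C"
  by (simp_all add: lcat.truncate_def)

lemma lcat_truncate_Hom [simp]: "Hom (lcat.truncate C) = Hom C"
  by (simp add: fun_eq_iff Hom_def)

lemma lcat_truncate_category: "category C \<Longrightarrow> category (lcat.truncate C)"
  by (simp add: category_def)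

lemma lcat_truncate_linear_category: "linear_category R C \<Longrightarrow> linear_category R (lcat.truncate C)"
  by (simp add: linear_category_def linear_category_axioms_def lcat_truncate_category)

lemma lcat_truncate_is_functor: "is_functor D (lcat.truncate C) F \<longleftrightarrow> is_functor D C F"
  by (simp add: is_functor_def)

lemma lcat_truncate_is_colimit: "is_colimit J (lcat.truncate C) K c \<iota> \<longleftrightarrow> is_colimit J C K c \<iota>"
  by (simp add: is_colimit_def is_cocone_def)

lemma lcat_truncate_finitely_cocomplete: "finitely_cocomplete (lcat.truncate C) \<longleftrightarrow> finitely_cocomplete C"
  by (simp add: finitely_cocomplete_def lcat_truncate_is_functor lcat_truncate_is_colimit)

lemma lcat_truncate_right_exact: "right_exact D (lcat.truncate C) F \<longleftrightarrow> right_exact D C F"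
  by (simp add: right_exact_def lcat_truncate_is_colimit)

lemma lcat_truncate_linear_functor: "linear_functor R D (lcat.truncate C) F \<longleftrightarrow> linear_functor R D C F"
  by (simp add: linear_functor_def lcat_truncate_is_functor)

lemma lcat_truncate_nat_trans: "nat_trans D (lcat.truncate C) = nat_trans D C"
  by (simp add: fun_eq_iff nat_trans_def)

text \<open>The universal property of \<open>Z\<close> ranges over bare \<open>lcat\<close> records.
  A monoidal test category is therefore truncated, and the functor categories that occur stay
  literally the same.\<close>

lemma lcat_truncate_rex_cat: "rex_cat R D (lcat.truncate C) = rex_cat R D C"
  by (simp add: rex_cat_def fun_cat_def lcat_truncate_linear_functor lcat_truncate_right_exact lcat_truncate_nat_trans)

lemma lcat_truncate_separately_rex_cat: "separately_rex_cat R A B (lcat.truncate C) = separately_rex_cat R A B C"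
  by (simp add: separately_rex_cat_def separately_rex_def fun_cat_def lcat_truncate_linear_functor
      lcat_truncate_right_exact lcat_truncate_nat_trans)

lemma nat_trans_restrict: "category C \<Longrightarrow> nat_trans C D F G \<eta> \<Longrightarrow> nat_trans C D F G (restrict \<eta> (Ob C))"
  by (rule nat_trans_cong) auto

lemma nat_trans_restrict_iff:
  assumes "\<And>f. f \<in> Ar C \<Longrightarrow> Dom C f \<in> Ob C \<and> Cod C f \<in> Ob C"
  shows "nat_trans C D F G (restrict \<eta> (Ob C)) \<longleftrightarrow> nat_trans C D F G \<eta>"
proof -
  have "f \<in> Hom C x y \<Longrightarrow> x \<in> Ob C \<and> y \<in> Ob C" for f x y using assms by (auto simp: Hom_def)
  then show ?thesis unfolding nat_trans_def by (auto 0 4)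
qed

text \<open>The closure condition in place of category laws for \<open>C\<close> admits
  \<open>tensor_cat R A B\<close> as source.\<close>

lemma category_fun_cat_nat_trans:
  assumes D: "category D" and dc: "\<And>f. f \<in> Ar C \<Longrightarrow> Dom C f \<in> Ob C \<and> Cod C f \<in> Ob C"
    and S: "\<And>F. F \<in> S \<Longrightarrow> is_functor C D F"
  shows "category (fun_cat C D S (nat_trans C D))"
proof (rule category_fun_cat[OF D dc S])
  interpret D: category D by fact
  fix F assume "F \<in> S"
  then have "nat_trans C D F F (\<lambda>x. ide D (fo F x))"
    using functor_simps[OF S] dc by (intro nat_transI) auto
  then show "nat_trans C D F F (restrict (\<lambda>x. ide D (fo F x)) (Ob C))"
    by (simp add: nat_trans_restrict_iff dc)
next
  fix F G H \<eta> \<theta> assume "F \<in> S" "G \<in> S" "H \<in> S" and \<eta>: "nat_trans C D F G \<eta>" and \<theta>: "nat_trans C D G H \<theta>"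
  then have "nat_trans C D F H (\<lambda>x. \<theta> x \<cdot>\<^bsub>D\<^esub> \<eta> x)"
    by (intro nat_trans_vcomp_dom[OF \<eta> \<theta> D dc] S)
  then show "nat_trans C D F H (restrict (\<lambda>x. \<theta> x \<cdot>\<^bsub>D\<^esub> \<eta> x) (Ob C))"
    by (simp add: nat_trans_restrict_iff dc)
qed

lemma tensor_smcat_sel [simp]:
  "Ob (tensor_smcat R A B) = Ob A \<times> Ob B"
  "Ar (tensor_smcat R A B) = Ar (tensor_cat R A B)"
  "Dom (tensor_smcat R A B) = Dom (tensor_cat R A B)" "Cod (tensor_smcat R A B) = Cod (tensor_cat R A B)"
  "Comp (tensor_smcat R A B) = Comp (tensor_cat R A B)" "ide (tensor_smcat R A B) = ide (tensor_cat R A B)"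
  "(a, b) \<star>\<^bsub>tensor_smcat R A B\<^esub> (a', b') = (a \<star>\<^bsub>A\<^esub> a', b \<star>\<^bsub>B\<^esub> b')"
  "((a, b), (c, d), s) \<diamondop>\<^bsub>tensor_smcat R A B\<^esub> ((a', b'), (c', d'), t) =
     tensor_op R A B (tar A) (tar B) (a \<star>\<^bsub>A\<^esub> a', b \<star>\<^bsub>B\<^esub> b') (c \<star>\<^bsub>A\<^esub> c', d \<star>\<^bsub>B\<^esub> d') s t"
  "munit (tensor_smcat R A B) = (munit A, munit B)"
  "massoc (tensor_smcat R A B) (a, b) (a', b') (a'', b'') = tensor_arr R A B (massoc A a a' a'') (massoc B b b' b'')"
  "mlunit (tensor_smcat R A B) (a, b) = tensor_arr R A B (mlunit A a) (mlunit B b)"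
  "mrunit (tensor_smcat R A B) (a, b) = tensor_arr R A B (mrunit A a) (mrunit B b)"
  "msym (tensor_smcat R A B) (a, b) (a', b') = tensor_arr R A B (msym A a a') (msym B b b')"
  by (simp_all add: tensor_smcat_def lcat.extend_def tensor_cat_def)

section \<open>The right exact tensor product as a coproduct\<close>

lemma rex_sm_categoryD:
  assumes "rex_sm_category R C"
  shows "symmetric_monoidal_linear_category R C" "sm_category C" "linear_category R C" "category C" "finitely_cocomplete C"
  using assms symmetric_monoidal_linear_category.sm_category[of R C]
  by (auto simp: rex_sm_category_def symmetric_monoidal_linear_category_def linear_category_def)

locale rex_tensor =
  fixes U :: "('co \<times> 'ca) itself"
    and R :: "('r, 'k) ring_scheme"
    and A :: "('ao, 'aa, 'r) smcat"
    and B :: "('bo, 'ba, 'r) smcat"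
    and P :: "('po, 'pa, 'r) smcat"
    and Z :: "('ao \<times> 'bo, ('ao, 'aa, 'bo, 'ba, 'r) tensor_arrow, 'po, 'pa) smfct"
  assumes rexA: "rex_sm_category R A" and rexB: "rex_sm_category R B"
    and tensor: "is_rex_tensor U R A B P Z"
    and rexP: "rex_sm_category R P"
    and strong_Z: "strong_sm_functor R (tensor_smcat R A B) P Z"
begin

sublocale A: symmetric_monoidal_linear_category R A by (rule rex_sm_categoryD(1)[OF rexA])
sublocale B: symmetric_monoidal_linear_category R B by (rule rex_sm_categoryD(1)[OF rexB])
sublocale SA: sm_category A by (rule rex_sm_categoryD(2)[OF rexA])
sublocale SB: sm_category B by (rule rex_sm_categoryD(2)[OF rexB])
sublocale SP: sm_category P by (rule rex_sm_categoryD(2)[OF rexP])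
sublocale tensor_categories R A B
  by (intro tensor_categories.intro rex_sm_categoryD(3) rexA rexB)

abbreviation "X \<equiv> prod_smcat A B"

lemma X: "sm_category X"
  by (rule sm_category_prod_smcat) unfold_locales

text \<open>The composite of \<open>Z\<close> with the functor from \<open>A \<times> B\<close> to
  \<open>A \<otimes> B\<close> sending a pair of arrows to its pure tensor.\<close>

definition Zpair :: "('ao \<times> 'bo, 'aa \<times> 'ba, 'po, 'pa) smfct" where
  "Zpair = \<lparr>fo = fo Z, fa = \<lambda>(f, g). fa Z (tensor_arr R A B f g), fmu = fmu Z, feps = feps Z\<rparr>"

lemma Zpair_sel [simp]:
  "fo Zpair x = fo Z x" "fa Zpair (f, g) = fa Z (tensor_arr R A B f g)" "fmu Zpair x y = fmu Z x y" "feps Zpair = feps Z"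
  by (simp_all add: Zpair_def)

lemma separately_rex_Z: "separately_rex R A B P Z"
  using tensor by (simp add: is_rex_tensor_def)

lemma linear_Z: "linear_functor R T P Z"
  using separately_rex_Z by (simp add: separately_rex_def)

lemma is_functor_pair:
  assumes "is_functor T D K"
  shows "is_functor X D \<lparr>fo = fo K, fa = \<lambda>(f, g). fa K (tarr f g)\<rparr>"
proof -
  note K = functor_simps[OF assms]
  have 1: "fa K (tarr (ide A a) (ide B b)) = ide D (fo K (a, b))" if "a \<in> Ob A" "b \<in> Ob B" for a b
    using K(5)[of "(a, b)"] that by simp
  have 2: "fa K (tarr (f' \<cdot>\<^bsub>A\<^esub> f) (g' \<cdot>\<^bsub>B\<^esub> g)) = fa K (tarr f' g') \<cdot>\<^bsub>D\<^esub> fa K (tarr f g)"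
    if "f \<in> Ar A" "g \<in> Ar B" "f' \<in> Ar A" "g' \<in> Ar B" "Dom A f' = Cod A f" "Dom B g' = Cod B g" for f g f' g'
    using K(6)[of "tarr f g" "tarr f' g'"] that by (simp add: tarr_comp)
  show ?thesis
    by (rule functorI) (auto simp: K(1-4) 1 2)
qed

lemma tar_tarr:
  assumes "f \<in> Ar A" "g \<in> Ar B" "f' \<in> Ar A" "g' \<in> Ar B"
  shows "tarr f g \<diamondop>\<^bsub>tensor_smcat R A B\<^esub> tarr f' g' = tarr (f \<diamondop>\<^bsub>A\<^esub> f') (g \<diamondop>\<^bsub>B\<^esub> g')"
proof -
  have "tarr f g \<diamondop>\<^bsub>tensor_smcat R A B\<^esub> tarr f' g' = tensor_op R A B (tar A) (tar B)
     (Dom A f \<star>\<^bsub>A\<^esub> Dom A f', Dom B g \<star>\<^bsub>B\<^esub> Dom B g') (Cod A f \<star>\<^bsub>A\<^esub> Cod A f', Cod B g \<star>\<^bsub>B\<^esub> Cod B g')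
     (snd (snd (tarr f g))) (snd (snd (tarr f' g')))"
    by (simp add: tensor_arr_def)
  also have "\<dots> = tarr (f \<diamondop>\<^bsub>A\<^esub> f') (g \<diamondop>\<^bsub>B\<^esub> g')"
    using assms A.tar_bilinear[of "Dom A f" "Cod A f" "Dom A f'" "Cod A f'"] B.tar_bilinear[of "Dom B g" "Cod B g" "Dom B g'" "Cod B g'"]
    by (intro tensor_op_tarr) auto
  finally show ?thesis .
qed

text \<open>The constraints of \<open>tensor_smcat\<close> are pure tensors of constraints in
  \<open>A\<close> and \<open>B\<close>, so the axioms of \<open>Z\<close> at pure tensors are those
  of \<open>Zpair\<close>.\<close>

lemma sm_functor_Zpair: "sm_functor X P Zpair"
proof -
  have Z: "sm_functor (tensor_smcat R A B) P Z"
    using strong_Z by (simp add: strong_sm_functor_iff)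
  have i: "is_functor X P Zpair"
    using is_functor_pair[OF linear_functor_is_functor[OF linear_Z]] by (simp add: is_functor_def)
  note sZ = sm_functor_simps[OF Z]
  show ?thesis
  proof (rule sm_functorI[OF i])
    fix u v assume "u \<in> Ar X" "v \<in> Ar X"
    then obtain f g f' g' where "u = (f, g)" "v = (f', g')" "f \<in> Ar A" "g \<in> Ar B" "f' \<in> Ar A" "g' \<in> Ar B" by auto
    then show "fa Zpair (u \<diamondop>\<^bsub>X\<^esub> v) \<cdot>\<^bsub>P\<^esub> fmu Zpair (Dom X u) (Dom X v) =
        fmu Zpair (Cod X u) (Cod X v) \<cdot>\<^bsub>P\<^esub> (fa Zpair u \<diamondop>\<^bsub>P\<^esub> fa Zpair v)"
      using fmu_natural[OF Z, of "tarr f g" "tarr f' g'"] by (simp add: tar_tarr)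
  next
    fix x y z assume "x \<in> Ob X" "y \<in> Ob X" "z \<in> Ob X"
    then show "fa Zpair (massoc X x y z) \<cdot>\<^bsub>P\<^esub> fmu Zpair (x \<star>\<^bsub>X\<^esub> y) z \<cdot>\<^bsub>P\<^esub> (fmu Zpair x y \<diamondop>\<^bsub>P\<^esub> ide P (fo Zpair z)) =
      fmu Zpair x (y \<star>\<^bsub>X\<^esub> z) \<cdot>\<^bsub>P\<^esub> (ide P (fo Zpair x) \<diamondop>\<^bsub>P\<^esub> fmu Zpair y z) \<cdot>\<^bsub>P\<^esub> massoc P (fo Zpair x) (fo Zpair y) (fo Zpair z)"
      using fmu_assoc[OF Z, of x y z] by (cases x, cases y, cases z) simp
  next
    fix x assume "x \<in> Ob X"
    then show "fa Zpair (mlunit X x) \<cdot>\<^bsub>P\<^esub> fmu Zpair (munit X) x \<cdot>\<^bsub>P\<^esub> (feps Zpair \<diamondop>\<^bsub>P\<^esub> ide P (fo Zpair x)) = mlunit P (fo Zpair x)"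
      "fa Zpair (mrunit X x) \<cdot>\<^bsub>P\<^esub> fmu Zpair x (munit X) \<cdot>\<^bsub>P\<^esub> (ide P (fo Zpair x) \<diamondop>\<^bsub>P\<^esub> feps Zpair) = mrunit P (fo Zpair x)"
      using fmu_left_unit[OF Z, of x] fmu_right_unit[OF Z, of x] by (cases x; simp)+
  next
    fix x y assume "x \<in> Ob X" "y \<in> Ob X"
    then show "fa Zpair (msym X x y) \<cdot>\<^bsub>P\<^esub> fmu Zpair x y = fmu Zpair y x \<cdot>\<^bsub>P\<^esub> msym P (fo Zpair x) (fo Zpair y)"
      "iso_arr P (fmu Zpair x y) \<and> Dom P (fmu Zpair x y) = fo Zpair x \<star>\<^bsub>P\<^esub> fo Zpair y \<and> Cod P (fmu Zpair x y) = fo Zpair (x \<star>\<^bsub>X\<^esub> y)"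
      using fmu_sym[OF Z, of x y] sZ(1-4)[of x y] by (cases x; cases y; simp)+
  qed (use sZ(5-8) in simp)
qed

lemma comp_Z_incl:
  "comp_smfct P Z (incl_left R A B) = comp_smfct P Zpair (unit_incl_left A B)"
  "comp_smfct P Z (incl_right R A B) = comp_smfct P Zpair (unit_incl_right A B)"
  by (simp_all add: comp_smfct_def incl_left_def incl_right_def)

abbreviation "left_incl \<equiv> comp_smfct P Zpair (unit_incl_left A B)"
abbreviation "right_incl \<equiv> comp_smfct P Zpair (unit_incl_right A B)"

text \<open>\<open>Z\<close> on pure tensors is bilinear, hence linear in \<open>f\<close> with an
  identity in the second slot; right exactness is that of \<open>Z\<close> in the first variable at
  the unit object of \<open>B\<close>.\<close>

lemma left_incl_Ob: "left_incl \<in> Ob (rex_sm_cat R A P)"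
proof -
  let ?I = "munit B"
  have sm: "sm_functor A P left_incl"
    by (rule sm_functor_comp[OF _ X _ sm_functor_unit_incl(1) sm_functor_Zpair]) unfold_locales
  have "linear_map R (HomM A a a') (HomM P (fo Z (a, ?I)) (fo Z (a', ?I))) (\<lambda>f. fa Z (tarr f (ide B ?I)))"
    if "a \<in> Ob A" "a' \<in> Ob A" for a a'
    using bilinear_mapD(2)[OF linear_functor_bilinear[OF linear_Z, of "(a, ?I)" "(a', ?I)"], of "ide B ?I"] that
    by (simp add: B.carrier_HomM')
  then have "linear_functor R A P left_incl"
    using sm_functor_is_functor[OF sm] unfolding linear_functor_def by (simp add: comp_smfct_def)
  moreover have "right_exact A P (comp_fct Z (fix_right R A B ?I))"
    using separately_rex_Z by (simp add: separately_rex_def)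
  then have "right_exact A P left_incl"
    by (rule right_exact_cong) (simp_all add: fix_right_def A.category_axioms)
  ultimately show ?thesis using sm by (simp add: rex_sm_cat_Ob lin_rex_def)
qed

lemma right_incl_Ob: "right_incl \<in> Ob (rex_sm_cat R B P)"
proof -
  let ?I = "munit A"
  have sm: "sm_functor B P right_incl"
    by (rule sm_functor_comp[OF _ X _ sm_functor_unit_incl(2) sm_functor_Zpair]) unfold_locales
  have "linear_map R (HomM B b b') (HomM P (fo Z (?I, b)) (fo Z (?I, b'))) (\<lambda>g. fa Z (tarr (ide A ?I) g))"
    if "b \<in> Ob B" "b' \<in> Ob B" for b b'
    using bilinear_mapD(1)[OF linear_functor_bilinear[OF linear_Z, of "(?I, b)" "(?I, b')"], of "ide A ?I"] that
    by (simp add: A.carrier_HomM')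
  then have "linear_functor R B P right_incl"
    using sm_functor_is_functor[OF sm] unfolding linear_functor_def by (simp add: comp_smfct_def)
  moreover have "right_exact B P (comp_fct Z (fix_left R A B ?I))"
    using separately_rex_Z by (simp add: separately_rex_def)
  then have "right_exact B P right_incl"
    by (rule right_exact_cong) (simp_all add: fix_left_def B.category_axioms)
  ultimately show ?thesis using sm by (simp add: rex_sm_cat_Ob lin_rex_def)
qed

section \<open>The universal property of \<open>Z\<close> at a fixed monoidal test category\<close>

context
  fixes C :: "('co, 'ca, 'r) smcat"
  assumes rexC: "rex_sm_category R C"
begin

interpretation C: sm_category C by (rule rex_sm_categoryD(2)[OF rexC])
interpretation LC: symmetric_monoidal_linear_category R C by (rule rex_sm_categoryD(1)[OF rexC])

lemma precomp_Z_equivalence: "is_equivalence (rex_cat R P C) (separately_rex_cat R A B C) (precomp_fct T comp_fct Z)"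
proof -
  have "is_equivalence (rex_cat R P (lcat.truncate C)) (separately_rex_cat R A B (lcat.truncate C)) (precomp_fct T comp_fct Z)"
    using tensor rex_sm_categoryD(3,5)[OF rexC] lcat_truncate_linear_category lcat_truncate_finitely_cocomplete
    unfolding is_rex_tensor_def by blast
  then show ?thesis by (simp only: lcat_truncate_rex_cat lcat_truncate_separately_rex_cat)
qed

lemma T_dom_cod: "f \<in> Ar T \<Longrightarrow> Dom T f \<in> Ob T \<and> Cod T f \<in> Ob T"
  by (cases f) auto

lemma category_rex_cat: "category (rex_cat R P C)"
  unfolding rex_cat_def
  by (rule category_fun_cat_nat_trans[OF C.category_axioms]) (auto simp: linear_functor_is_functor)

lemma category_separately_rex_cat: "category (separately_rex_cat R A B C)"
  unfolding separately_rex_cat_def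
  by (rule category_fun_cat_nat_trans[OF C.category_axioms T_dom_cod]) (auto simp: separately_rex_def linear_functor_is_functor)

lemmas precomp_Z_ff_es = precomp_Z_equivalence category_rex_cat category_separately_rex_cat

lemma rex_cat_Hom:
  "(F, G, \<eta>) \<in> Hom (rex_cat R P C) F' G' \<longleftrightarrow> F = F' \<and> G = G' \<and> lin_rex R P C F \<and> lin_rex R P C G \<and>
    \<eta> \<in> extensional (Ob P) \<and> nat_trans P C F G \<eta>"
  by (simp add: rex_cat_def fun_cat_sel lin_rex_def)

lemma rex_cat_Ob: "F \<in> Ob (rex_cat R P C) \<longleftrightarrow> lin_rex R P C F"
  by (simp add: rex_cat_def fun_cat_sel lin_rex_def)

text \<open>Read off from the equivalence: precomposition with \<open>Z\<close> is in particular a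
  functor, so it sends objects to objects.\<close>

lemma separately_rex_comp:
  assumes "lin_rex R P C (F :: ('po, 'pa, 'co, 'ca) fct)"
  shows "separately_rex R A B C (comp_fct F Z)"
proof -
  have "is_functor (rex_cat R P C) (separately_rex_cat R A B C) (precomp_fct T comp_fct Z)"
    using precomp_Z_equivalence by (simp add: is_equivalence_def)
  from functor_simps(1)[OF this, of F] assms show ?thesis
    by (simp add: rex_cat_Ob separately_rex_cat_def fun_cat_sel)
qed

text \<open>Faithfulness and fullness of the equivalence given by \<open>Z\<close>, reformulated for
  families on \<open>A \<times> B\<close>.\<close>

lemma dense_functor_Zpair: "dense_functor R P C X Zpair"
proof (intro dense_functor.intro dense_functor_axioms.intro SP.sm_category_axioms C.sm_category_axioms X sm_functor_Zpair rexP rexC)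
  fix F F' :: "('po, 'pa, 'co, 'ca) fct" and \<eta> \<eta>' p
  assume F: "lin_rex R P C F" "lin_rex R P C F'" and \<eta>: "nat_trans P C F F' \<eta>" "nat_trans P C F F' \<eta>'"
    and eq: "\<And>x. x \<in> Ob X \<Longrightarrow> \<eta> (fo Zpair x) = \<eta>' (fo Zpair x)" and p: "p \<in> Ob P"
  note fZ = functor_simps[OF linear_functor_is_functor[OF linear_Z]]
  have "(F, F', restrict \<eta> (Ob P)) = (F, F', restrict \<eta>' (Ob P))"
  proof (rule equivalence_faithful[OF precomp_Z_ff_es])
    show "(F, F', restrict \<eta> (Ob P)) \<in> Hom (rex_cat R P C) F F'" "(F, F', restrict \<eta>' (Ob P)) \<in> Hom (rex_cat R P C) F F'"
      using F \<eta> by (simp_all add: rex_cat_Hom nat_trans_restrict[OF SP.category_axioms])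
    show "fa (precomp_fct T comp_fct Z) (F, F', restrict \<eta> (Ob P)) = fa (precomp_fct T comp_fct Z) (F, F', restrict \<eta>' (Ob P))"
      using eq fZ(1) by (auto intro!: restrict_ext)
  qed
  then show "\<eta> p = \<eta>' p" using p by (auto dest: fun_cong[where x = p])
next
  fix F F' :: "('po, 'pa, 'co, 'ca) fct" and \<theta>
  assume F: "lin_rex R P C F" "lin_rex R P C F'" and \<theta>: "nat_trans X C (comp_fct F Zpair) (comp_fct F' Zpair) \<theta>"
  note fZ = functor_simps[OF linear_functor_is_functor[OF linear_Z]]
  have sF: "separately_rex R A B C (comp_fct F Z)" "separately_rex R A B C (comp_fct F' Z)"
    using separately_rex_comp F by blast+
  \<comment> \<open>The family is given as natural for pairs of arrows only; linearity makes it
    natural for all arrows of \<open>A \<otimes> B\<close>.\<close>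
  have "nat_trans T C (comp_fct F Z) (comp_fct F' Z) \<theta>"
  proof (rule tensor_nat_transI[OF rex_sm_categoryD(3)[OF rexC]])
    show "linear_functor R T C (comp_fct F Z)" "linear_functor R T C (comp_fct F' Z)"
      using sF by (simp_all add: separately_rex_def)
    show "\<theta> x \<in> Ar C \<and> Dom C (\<theta> x) = fo (comp_fct F Z) x \<and> Cod C (\<theta> x) = fo (comp_fct F' Z) x" if "x \<in> Ob A \<times> Ob B" for x
      using nat_trans_simps[OF \<theta>, of x] that by simp
    show "fa (comp_fct F' Z) (tarr f g) \<cdot>\<^bsub>C\<^esub> \<theta> (Dom A f, Dom B g) = \<theta> (Cod A f, Cod B g) \<cdot>\<^bsub>C\<^esub> fa (comp_fct F Z) (tarr f g)"
      if "f \<in> Ar A" "g \<in> Ar B" for f g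
      using nat_trans_natural[OF \<theta>, of "(f, g)"] that by simp
  qed
  then have "(comp_fct F Z, comp_fct F' Z, restrict \<theta> (Ob T)) \<in>
      Hom (separately_rex_cat R A B C) (fo (precomp_fct T comp_fct Z) F) (fo (precomp_fct T comp_fct Z) F')"
    using sF by (simp add: separately_rex_cat_def fun_cat_sel nat_trans_restrict_iff[OF T_dom_cod] del: tensor_cat_sel)
  from equivalence_full[OF precomp_Z_ff_es _ _ this] F
  obtain u where u: "u \<in> Hom (rex_cat R P C) F F'" "fa (precomp_fct T comp_fct Z) u = (comp_fct F Z, comp_fct F' Z, restrict \<theta> (Ob T))"
    by (auto simp: rex_cat_Ob)
  obtain \<eta> where \<eta>: "u = (F, F', \<eta>)" "nat_trans P C F F' \<eta>"
    using u(1) unfolding rex_cat_def by (auto elim!: fun_cat_Hom_cases)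
  have "restrict (\<lambda>x. \<eta> (fo Z x)) (Ob T) = restrict \<theta> (Ob T)" using u(2) by (simp add: \<eta>(1) del: tensor_cat_sel)
  then have "\<eta> (fo Z x) = \<theta> x" if "x \<in> Ob A \<times> Ob B" for x using that by (auto dest: fun_cong[where x = x])
  then show "\<exists>\<eta>. nat_trans P C F F' \<eta> \<and> (\<forall>x\<in>Ob X. \<eta> (fo Zpair x) = \<theta> x)"
    using \<eta>(2) by (intro exI[of _ \<eta>]) simp
qed

text \<open>Essential surjectivity of the equivalence. An isomorphism in the functor category is
  unpacked into a natural family with pointwise inverses.\<close>

lemma extension_exists:
  assumes K: "separately_rex R A B C (K :: ('ao \<times> 'bo, ('ao, 'aa, 'bo, 'ba, 'r) tensor_arrow, 'co, 'ca) fct)"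
  obtains F :: "('po, 'pa, 'co, 'ca) fct" and \<psi> where "lin_rex R P C F" "nat_trans T C (comp_fct F Z) K \<psi>"
    "\<And>x. x \<in> Ob A \<times> Ob B \<Longrightarrow> iso_arr C (\<psi> x)"
proof -
  have "K \<in> Ob (separately_rex_cat R A B C)" using K by (simp add: separately_rex_cat_def fun_cat_sel)
  from equivalence_es[OF precomp_Z_ff_es this, unfolded precomp_fct_sel]
  obtain F :: "('po, 'pa, 'co, 'ca) fct" and k where "F \<in> Ob (rex_cat R P C)"
    and k: "is_iso (separately_rex_cat R A B C) (comp_fct F Z) K k" by blast
  then have F: "lin_rex R P C F" by (simp only: rex_cat_Ob)
  obtain l where kl: "k \<in> Hom (separately_rex_cat R A B C) (comp_fct F Z) K" "l \<in> Hom (separately_rex_cat R A B C) K (comp_fct F Z)"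
    "l \<cdot>\<^bsub>separately_rex_cat R A B C\<^esub> k = ide (separately_rex_cat R A B C) (comp_fct F Z)"
    "k \<cdot>\<^bsub>separately_rex_cat R A B C\<^esub> l = ide (separately_rex_cat R A B C) K"
    using k by (auto simp: is_iso_def)
  obtain \<psi> where \<psi>: "k = (comp_fct F Z, K, \<psi>)" "nat_trans T C (comp_fct F Z) K \<psi>"
    using kl(1) unfolding separately_rex_cat_def by (auto elim!: fun_cat_Hom_cases)
  obtain \<phi> where \<phi>: "l = (K, comp_fct F Z, \<phi>)" "nat_trans T C K (comp_fct F Z) \<phi>"
    using kl(2) unfolding separately_rex_cat_def by (auto elim!: fun_cat_Hom_cases)
  have "iso_arr C (\<psi> x)" if x: "x \<in> Ob A \<times> Ob B" for x
  proof (rule C.iso_arrI[where g = "\<phi> x"])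
    have xT: "x \<in> Ob T" using x by simp
    note s = nat_trans_simps[OF \<psi>(2) xT] nat_trans_simps[OF \<phi>(2) xT]
    show "\<psi> x \<in> Ar C" "\<phi> x \<in> Ar C" "Dom C (\<phi> x) = Cod C (\<psi> x)" "Cod C (\<phi> x) = Dom C (\<psi> x)"
      using s by simp_all
    have 1: "restrict (\<lambda>x. \<phi> x \<cdot>\<^bsub>C\<^esub> \<psi> x) (Ob T) = restrict (\<lambda>x. ide C (fo F (fo Z x))) (Ob T)"
      and 2: "restrict (\<lambda>x. \<psi> x \<cdot>\<^bsub>C\<^esub> \<phi> x) (Ob T) = restrict (\<lambda>x. ide C (fo K x)) (Ob T)"
      using kl(3,4) unfolding \<psi>(1) \<phi>(1) separately_rex_cat_def fun_cat_sel by simp_all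
    show "\<phi> x \<cdot>\<^bsub>C\<^esub> \<psi> x = ide C (Dom C (\<psi> x))" "\<psi> x \<cdot>\<^bsub>C\<^esub> \<phi> x = ide C (Cod C (\<psi> x))"
      using fun_cong[OF 1, of x] fun_cong[OF 2, of x] s x by simp_all
  qed
  then show ?thesis using F \<psi>(2) by (rule_tac that)
qed

end

end

lemma pair_fct_sel [simp]: "fo (pair_fct F G) x = (fo F x, fo G x)" "fa (pair_fct F G) f = (fa F f, fa G f)"
  by (simp_all add: pair_fct_def)

lemma functor_pair_fct:
  assumes "is_functor D C1 F" "is_functor D C2 G"
  shows "is_functor D (prod_cat C1 C2) (pair_fct F G)"
  using assms unfolding is_functor_def by simp

lemma rex_sm_cat_comp:
  assumes A: "rex_sm_category R A" and P: "rex_sm_category R P" and C: "rex_sm_category R C"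
    and K: "K \<in> Ob (rex_sm_cat R A P)" and F: "F \<in> Ob (rex_sm_cat R P C)"
  shows "comp_smfct C F K \<in> Ob (rex_sm_cat R A C)"
proof -
  have KF: "lin_rex R A P K" "lin_rex R P C F" using K F by (simp_all add: rex_sm_cat_Ob)
  have "lin_rex R A C (comp_smfct C F K)"
    by (rule lin_rex_cong[OF lin_rex_comp[OF KF] rex_sm_categoryD(3)[OF A]]) simp_all
  then show ?thesis
    using sm_functor_comp[OF rex_sm_categoryD(2)[OF A] rex_sm_categoryD(2)[OF P] rex_sm_categoryD(2)[OF C]] K F
    by (simp add: rex_sm_cat_Ob)
qed

lemma functor_precomp_fct:
  assumes A: "rex_sm_category R A" and P: "rex_sm_category R P" and C: "rex_sm_category R C"
    and K: "K \<in> Ob (rex_sm_cat R A P)"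
  shows "is_functor (rex_sm_cat R P C) (rex_sm_cat R A C) (precomp_fct A (comp_smfct C) K)"
proof -
  interpret A: sm_category A by (rule rex_sm_categoryD(2)[OF A])
  note cats = rex_sm_categoryD(2)[OF A] rex_sm_categoryD(2)[OF P] rex_sm_categoryD(2)[OF C]
  have sK: "sm_functor A P K" using K by (simp add: rex_sm_cat_Ob)
  note [simp] = functor_simps(1)[OF sm_functor_is_functor[OF sK]]
  let ?\<Phi> = "precomp_fct A (comp_smfct C) K"
  note sel = rex_sm_cat_def fun_cat_sel
  show ?thesis
    unfolding is_functor_def
  proof (intro conjI ballI allI impI)
    show "fo ?\<Phi> F \<in> Ob (rex_sm_cat R A C)" if "F \<in> Ob (rex_sm_cat R P C)" for F
      using rex_sm_cat_comp[OF A P C K that] by simp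
    show "fa ?\<Phi> u \<in> Hom (rex_sm_cat R A C) (fo ?\<Phi> F) (fo ?\<Phi> G)" if "u \<in> Hom (rex_sm_cat R P C) F G" for F G u
      using that
    proof (rule rex_sm_cat_Hom_cases)
      fix \<eta> assume u: "u = (F, G, \<eta>)" and F: "F \<in> Ob (rex_sm_cat R P C)" and G: "G \<in> Ob (rex_sm_cat R P C)"
        and \<eta>: "monoidal_nat_trans P C F G \<eta>"
      then show ?thesis
        using rex_sm_cat_comp[OF A P C K F] rex_sm_cat_comp[OF A P C K G]
          monoidal_nat_trans_whisker[OF cats sK _ _ \<eta>]
        by (simp add: rex_sm_cat_Hom rex_sm_cat_Ob monoidal_nat_trans_restrict[OF cats(1)])
    qed
    show "fa ?\<Phi> (ide (rex_sm_cat R P C) F) = ide (rex_sm_cat R A C) (fo ?\<Phi> F)" if "F \<in> Ob (rex_sm_cat R P C)" for F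
      by (auto simp: sel intro!: restrict_ext)
    show "fa ?\<Phi> (v \<cdot>\<^bsub>rex_sm_cat R P C\<^esub> u) = fa ?\<Phi> v \<cdot>\<^bsub>rex_sm_cat R A C\<^esub> fa ?\<Phi> u"
      if u: "u \<in> Hom (rex_sm_cat R P C) F G" and v: "v \<in> Hom (rex_sm_cat R P C) G H" for F G H u v
      by (rule rex_sm_cat_Hom_cases[OF u], rule rex_sm_cat_Hom_cases[OF v]) (auto simp: sel intro!: restrict_ext)
  qed
qed

section \<open>Restriction of monoidal functors along the two inclusions\<close>

context rex_tensor
begin

context
  fixes C :: "('co, 'ca, 'r) smcat"
  assumes rexC: "rex_sm_category R C"
begin

interpretation C: sm_category C by (rule rex_sm_categoryD(2)[OF rexC])
interpretation LC: symmetric_monoidal_linear_category R C by (rule rex_sm_categoryD(1)[OF rexC])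
interpretation pair: sm_pair A B C
  by (intro sm_pair.intro SA.sm_category_axioms SB.sm_category_axioms C.sm_category_axioms)
abbreviation "left_part \<equiv> pair.left_part"
abbreviation "right_part \<equiv> pair.right_part"
interpretation D: dense_functor R P C X Zpair by (rule dense_functor_Zpair[OF rexC])

text \<open>Restricting to \<open>A \<times> B\<close> and then to \<open>A\<close> amounts to
  restricting to \<open>A\<close> directly, up to reassociation of composites.\<close>

lemma left_part_comp:
  assumes "sm_functor P C F"
  shows "a \<in> Ob A \<Longrightarrow> a' \<in> Ob A \<Longrightarrow> fmu (left_part (comp_smfct C F Zpair)) a a' = fmu (comp_smfct C F left_incl) a a'"
    and "feps (left_part (comp_smfct C F Zpair)) = feps (comp_smfct C F left_incl)"
  using comp_smfct_assoc[OF sm_functor_unit_incl(1)[OF SA.sm_category_axioms SB.sm_category_axioms] sm_functor_Zpair assms C.category_axioms]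
  by blast+

lemma right_part_comp:
  assumes "sm_functor P C F"
  shows "b \<in> Ob B \<Longrightarrow> b' \<in> Ob B \<Longrightarrow> fmu (right_part (comp_smfct C F Zpair)) b b' = fmu (comp_smfct C F right_incl) b b'"
    and "feps (right_part (comp_smfct C F Zpair)) = feps (comp_smfct C F right_incl)"
  using comp_smfct_assoc[OF sm_functor_unit_incl(2)[OF SA.sm_category_axioms SB.sm_category_axioms] sm_functor_Zpair assms C.category_axioms]
  by blast+

lemma sm_functor_comp_Zpair: "sm_functor P C F \<Longrightarrow> sm_functor X C (comp_smfct C F Zpair)"
  by (rule sm_functor_comp[OF X SP.sm_category_axioms C.sm_category_axioms sm_functor_Zpair])

lemma whisker_Zpair:
  "sm_functor P C F \<Longrightarrow> sm_functor P C G \<Longrightarrow> monoidal_nat_trans P C F G \<eta> \<Longrightarrow>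
    monoidal_nat_trans X C (comp_smfct C F Zpair) (comp_smfct C G Zpair) (\<lambda>x. \<eta> (fo Zpair x))"
  by (rule monoidal_nat_trans_whisker[OF X SP.sm_category_axioms C.sm_category_axioms sm_functor_Zpair])

text \<open>Composition with \<open>id_fct\<close> forgets the monoidal structure of a record,
  producing the type \<open>fct\<close> that \<open>dense_functor\<close> expects.\<close>

lemma lin_rex_underlying: "lin_rex R P C F \<Longrightarrow> lin_rex R P C (comp_fct id_fct F)"
  by (rule lin_rex_cong[OF _ rex_sm_categoryD(3)[OF rexP]]) simp_all

lemma nat_trans_underlying:
  "nat_trans P C (F :: ('po, 'pa, 'co, 'ca) smfct) G \<eta> \<longleftrightarrow> nat_trans P C (comp_fct id_fct F) (comp_fct id_fct G) \<eta>"
  by (simp add: nat_trans_def)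

abbreviation "\<Phi> \<equiv> pair_fct (precomp_fct A (comp_smfct C) left_incl) (precomp_fct B (comp_smfct C) right_incl)"

text \<open>The restrictions to \<open>A\<close> and \<open>B\<close> determine the values on the
  image of \<open>Z\<close> by monoidality, and these determine all values by right
  exactness.\<close>

lemma restriction_faithful:
  assumes u: "u \<in> Hom (rex_sm_cat R P C) F G" and u': "u' \<in> Hom (rex_sm_cat R P C) F G" and eq: "fa \<Phi> u = fa \<Phi> u'"
  shows "u = u'"
proof -
  obtain \<eta> where \<eta>: "u = (F, G, \<eta>)" "F \<in> Ob (rex_sm_cat R P C)" "G \<in> Ob (rex_sm_cat R P C)"
    "\<eta> \<in> extensional (Ob P)" "monoidal_nat_trans P C F G \<eta>" by (rule rex_sm_cat_Hom_cases[OF u])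
  obtain \<eta>' where \<eta>': "u' = (F, G, \<eta>')" "\<eta>' \<in> extensional (Ob P)" "monoidal_nat_trans P C F G \<eta>'"
    by (rule rex_sm_cat_Hom_cases[OF u'])
  have F: "lin_rex R P C F" "sm_functor P C F" and G: "lin_rex R P C G" "sm_functor P C G"
    using \<eta>(2,3) by (simp_all add: rex_sm_cat_Ob)
  have 1: "restrict (\<lambda>a. \<eta> (fo Z (a, munit B))) (Ob A) = restrict (\<lambda>a. \<eta>' (fo Z (a, munit B))) (Ob A)"
    and 2: "restrict (\<lambda>b. \<eta> (fo Z (munit A, b))) (Ob B) = restrict (\<lambda>b. \<eta>' (fo Z (munit A, b))) (Ob B)"
    using eq unfolding \<eta>(1) \<eta>'(1) by simp_all
  have Zeq: "\<eta> (fo Zpair x) = \<eta>' (fo Zpair x)" if "x \<in> Ob X" for x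
  proof (rule pair.monoidal_trans_eqI[OF sm_functor_comp_Zpair[OF F(2)] sm_functor_comp_Zpair[OF G(2)]
        whisker_Zpair[OF F(2) G(2) \<eta>(5)] whisker_Zpair[OF F(2) G(2) \<eta>'(3)] _ _ that])
    show "\<eta> (fo Zpair (a, munit B)) = \<eta>' (fo Zpair (a, munit B))" if "a \<in> Ob A" for a
      using fun_cong[OF 1, of a] that by simp
    show "\<eta> (fo Zpair (munit A, b)) = \<eta>' (fo Zpair (munit A, b))" if "b \<in> Ob B" for b
      using fun_cong[OF 2, of b] that by simp
  qed
  note n = monoidal_nat_transD(1)[OF \<eta>(5), unfolded nat_trans_underlying]
    monoidal_nat_transD(1)[OF \<eta>'(3), unfolded nat_trans_underlying]
  have "\<eta> p = \<eta>' p" if "p \<in> Ob P" for p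
    by (rule D.Z_faithful[OF lin_rex_underlying[OF F(1)] lin_rex_underlying[OF G(1)] n Zeq that])
  then have "\<eta> = \<eta>'" by (rule extensionalityI[OF \<eta>(4) \<eta>'(2)])
  then show ?thesis by (simp add: \<eta>(1) \<eta>'(1))
qed

text \<open>A pair of transformations is first glued to one on \<open>A \<times> B\<close>, then
  extended along \<open>Z\<close>, and the extension is monoidal because its restriction is.\<close>

lemma restriction_full:
  assumes F: "F \<in> Ob (rex_sm_cat R P C)" and G: "G \<in> Ob (rex_sm_cat R P C)"
    and k: "k \<in> Hom (prod_cat (rex_sm_cat R A C) (rex_sm_cat R B C)) (fo \<Phi> F) (fo \<Phi> G)"
  shows "\<exists>u\<in>Hom (rex_sm_cat R P C) F G. fa \<Phi> u = k"
proof -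
  obtain u v where uv: "k = (u, v)" by (cases k)
  have u: "u \<in> Hom (rex_sm_cat R A C) (comp_smfct C F left_incl) (comp_smfct C G left_incl)"
    and v: "v \<in> Hom (rex_sm_cat R B C) (comp_smfct C F right_incl) (comp_smfct C G right_incl)"
    using k by (simp_all add: uv)
  obtain \<alpha> where \<alpha>: "u = (comp_smfct C F left_incl, comp_smfct C G left_incl, \<alpha>)" "\<alpha> \<in> extensional (Ob A)"
    "monoidal_nat_trans A C (comp_smfct C F left_incl) (comp_smfct C G left_incl) \<alpha>"
    by (rule rex_sm_cat_Hom_cases[OF u])
  obtain \<beta> where \<beta>: "v = (comp_smfct C F right_incl, comp_smfct C G right_incl, \<beta>)" "\<beta> \<in> extensional (Ob B)"
    "monoidal_nat_trans B C (comp_smfct C F right_incl) (comp_smfct C G right_incl) \<beta>"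
    by (rule rex_sm_cat_Hom_cases[OF v])
  have F': "lin_rex R P C F" "sm_functor P C F" and G': "lin_rex R P C G" "sm_functor P C G"
    using F G by (simp_all add: rex_sm_cat_Ob)
  let ?E = "comp_smfct C F Zpair" and ?E' = "comp_smfct C G Zpair"
  have "monoidal_nat_trans A C (left_part ?E) (left_part ?E') \<alpha>"
    by (rule monoidal_nat_trans_cong[OF \<alpha>(3) SA.sm_category_axioms])
      (simp_all only: left_part_comp[OF F'(2)] left_part_comp[OF G'(2)], simp_all)
  moreover have "monoidal_nat_trans B C (right_part ?E) (right_part ?E') \<beta>"
    by (rule monoidal_nat_trans_cong[OF \<beta>(3) SB.sm_category_axioms])
      (simp_all only: right_part_comp[OF F'(2)] right_part_comp[OF G'(2)], simp_all)
  ultimately obtain \<theta> where \<theta>: "monoidal_nat_trans X C ?E ?E' \<theta>"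
    "\<And>a. a \<in> Ob A \<Longrightarrow> \<theta> (a, munit B) = \<alpha> a" "\<And>b. b \<in> Ob B \<Longrightarrow> \<theta> (munit A, b) = \<beta> b"
    using pair.monoidal_trans_extend[OF sm_functor_comp_Zpair[OF F'(2)] sm_functor_comp_Zpair[OF G'(2)], of \<alpha> \<beta>] by blast
  \<comment> \<open>The glued transformation with the monoidal structures forgotten, in the form
    required by \<open>Z_full\<close>.\<close>
  have "nat_trans X C (comp_fct (comp_fct id_fct F) Zpair) (comp_fct (comp_fct id_fct G) Zpair) \<theta>"
    by (rule nat_trans_cong[OF monoidal_nat_transD(1)[OF \<theta>(1)] pair.X.category_axioms]) simp_all
  from D.Z_full[OF lin_rex_underlying[OF F'(1)] lin_rex_underlying[OF G'(1)] this]
  obtain \<eta> where \<eta>: "nat_trans P C F G \<eta>" "\<And>x. x \<in> Ob X \<Longrightarrow> \<eta> (fo Zpair x) = \<theta> x"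
    using nat_trans_underlying by blast
  have "monoidal_nat_trans P C F G \<eta>"
    by (rule D.monoidal_of_restriction[OF F' G' \<eta>(1) monoidal_nat_trans_cong[OF \<theta>(1) X]]) (use \<eta>(2) in simp_all)
  then have "(F, G, restrict \<eta> (Ob P)) \<in> Hom (rex_sm_cat R P C) F G"
    using F G by (simp add: rex_sm_cat_Hom monoidal_nat_trans_restrict[OF SP.sm_category_axioms])
  moreover have "fa \<Phi> (F, G, restrict \<eta> (Ob P)) = k"
  proof -
    have ob: "fo Z (a, munit B) \<in> Ob P" "fo Z (munit A, b) \<in> Ob P" if "a \<in> Ob A" "b \<in> Ob B" for a b
      using functor_simps(1)[OF sm_functor_is_functor[OF sm_functor_Zpair], of "(a, munit B)"]
        functor_simps(1)[OF sm_functor_is_functor[OF sm_functor_Zpair], of "(munit A, b)"] that by simp_all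
    have "restrict (\<lambda>a. restrict \<eta> (Ob P) (fo left_incl a)) (Ob A) = \<alpha>"
      by (rule extensionalityI[OF restrict_extensional \<alpha>(2)]) (use ob[OF _ SB.munit_ob] \<eta>(2) \<theta>(2) in simp)
    moreover have "restrict (\<lambda>b. restrict \<eta> (Ob P) (fo right_incl b)) (Ob B) = \<beta>"
      by (rule extensionalityI[OF restrict_extensional \<beta>(2)]) (use ob[OF SA.munit_ob] \<eta>(2) \<theta>(3) in simp)
    ultimately show ?thesis by (simp only: pair_fct_sel precomp_fct_sel uv \<alpha>(1) \<beta>(1))
  qed
  ultimately show ?thesis by blast
qed

text \<open>The functor underlying \<open>copair\<close> descends from pairs of arrows to
  \<open>A \<otimes> B\<close> because the tensor product of \<open>C\<close> is bilinear; fixing a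
  variable leaves \<open>F\<close> or \<open>G\<close> followed by tensoring with an object, which
  is right exact.\<close>

lemma separately_rex_copair:
  assumes F: "lin_rex R A C F" and G: "lin_rex R B C G"
  obtains K :: "('ao \<times> 'bo, ('ao, 'aa, 'bo, 'ba, 'r) tensor_arrow, 'co, 'ca) fct"
  where "separately_rex R A B C K" "\<And>a b. fo K (a, b) = fo F a \<star>\<^bsub>C\<^esub> fo G b"
    "\<And>f g. f \<in> Ar A \<Longrightarrow> g \<in> Ar B \<Longrightarrow> fa K (tarr f g) = fa F f \<diamondop>\<^bsub>C\<^esub> fa G g"
proof -
  note [simp] = functor_simps[OF lin_rex_is_functor[OF F]] functor_simps[OF lin_rex_is_functor[OF G]]
  have lF: "linear_functor R A C F" and lG: "linear_functor R B C G"
    using F G by (simp_all add: lin_rex_def)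
  have bil: "bilinear_map R (HomM A (fst x) (fst y)) (HomM B (snd x) (snd y))
       (HomM C (fo F (fst x) \<star>\<^bsub>C\<^esub> fo G (snd x)) (fo F (fst y) \<star>\<^bsub>C\<^esub> fo G (snd y))) (\<lambda>f g. fa F f \<diamondop>\<^bsub>C\<^esub> fa G g)"
    if "x \<in> Ob A \<times> Ob B" "y \<in> Ob A \<times> Ob B" for x y
  proof -
    have ob: "fst x \<in> Ob A" "snd x \<in> Ob B" "fst y \<in> Ob A" "snd y \<in> Ob B" using that by auto
    note f = linear_functor_map[OF lF ob(1,3)] and g = linear_functor_map[OF lG ob(2,4)]
    have t: "bilinear_map R (HomM C (fo F (fst x)) (fo F (fst y))) (HomM C (fo G (snd x)) (fo G (snd y)))
       (HomM C (fo F (fst x) \<star>\<^bsub>C\<^esub> fo G (snd x)) (fo F (fst y) \<star>\<^bsub>C\<^esub> fo G (snd y))) (\<lambda>f g. f \<diamondop>\<^bsub>C\<^esub> g)"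
      by (rule LC.tar_bilinear) (use ob in simp_all)
    show ?thesis
    proof (rule bilinear_mapI)
      fix m assume "m \<in> carrier (HomM A (fst x) (fst y))"
      from bilinear_mapD(1)[OF t linear_mapD(1)[OF f this]]
      show "linear_map R (HomM B (snd x) (snd y)) (HomM C (fo F (fst x) \<star>\<^bsub>C\<^esub> fo G (snd x)) (fo F (fst y) \<star>\<^bsub>C\<^esub> fo G (snd y))) (\<lambda>g. fa F m \<diamondop>\<^bsub>C\<^esub> fa G g)"
        by (rule linear_map_comp[OF g])
    next
      fix n assume "n \<in> carrier (HomM B (snd x) (snd y))"
      from bilinear_mapD(2)[OF t linear_mapD(1)[OF g this]]
      show "linear_map R (HomM A (fst x) (fst y)) (HomM C (fo F (fst x) \<star>\<^bsub>C\<^esub> fo G (snd x)) (fo F (fst y) \<star>\<^bsub>C\<^esub> fo G (snd y))) (\<lambda>f. fa F f \<diamondop>\<^bsub>C\<^esub> fa G n)"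
        by (rule linear_map_comp[OF f])
    qed
  qed
  obtain K :: "('ao \<times> 'bo, ('ao, 'aa, 'bo, 'ba, 'r) tensor_arrow, 'co, 'ca) fct" where K: "linear_functor R T C K" "\<And>x. fo K x = fo F (fst x) \<star>\<^bsub>C\<^esub> fo G (snd x)"
    "\<And>f g. f \<in> Ar A \<Longrightarrow> g \<in> Ar B \<Longrightarrow> fa K (tarr f g) = fa F f \<diamondop>\<^bsub>C\<^esub> fa G g"
  proof (rule tensor_functor_exists[OF rex_sm_categoryD(3)[OF rexC] _ bil])
    show "fo F (fst x) \<star>\<^bsub>C\<^esub> fo G (snd x) \<in> Ob C" if "x \<in> Ob A \<times> Ob B" for x using that by auto
  qed (auto simp: C.tar_merge)
  have "right_exact B C (comp_fct K (fix_left R A B a))" if a: "a \<in> Ob A" for a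
  proof (rule right_exact_cong)
    show "right_exact B C (comp_fct (tensor_left C (fo F a)) G)"
      using lin_rex_comp[OF G lin_rex_tensor(1)[OF rexC, of "fo F a"]] a by (simp add: lin_rex_def)
  qed (use a in \<open>simp_all add: fix_left_def K B.category_axioms\<close>)
  moreover have "right_exact A C (comp_fct K (fix_right R A B b))" if b: "b \<in> Ob B" for b
  proof (rule right_exact_cong)
    show "right_exact A C (comp_fct (tensor_right C (fo G b)) F)"
      using lin_rex_comp[OF F lin_rex_tensor(2)[OF rexC, of "fo G b"]] b by (simp add: lin_rex_def)
  qed (use b in \<open>simp_all add: fix_right_def K A.category_axioms\<close>)
  ultimately have "separately_rex R A B C K" using K(1) by (simp add: separately_rex_def)
  then show ?thesis by (rule that) (simp_all add: K)
qed

text \<open>The preimage of \<open>(F, G)\<close> extends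
  \<open>(a, b) \<mapsto> F a \<star> G b\<close> along \<open>Z\<close>. The extension
  \<open>H0\<close> restricts to it only up to \<open>\<psi>\<close>, so the monoidal structure of
  \<open>copair\<close> is transported along \<open>\<psi>\<close> before being extended.\<close>

lemma restriction_es:
  assumes F: "F \<in> Ob (rex_sm_cat R A C)" and G: "G \<in> Ob (rex_sm_cat R B C)"
  shows "\<exists>H\<in>Ob (rex_sm_cat R P C). \<exists>k. is_iso (prod_cat (rex_sm_cat R A C) (rex_sm_cat R B C)) (fo \<Phi> H) (F, G) k"
proof -
  have F': "lin_rex R A C F" "sm_functor A C F" and G': "lin_rex R B C G" "sm_functor B C G"
    using F G by (simp_all add: rex_sm_cat_Ob)
  note fs = functor_simps[OF sm_functor_is_functor[OF F'(2)]] functor_simps[OF sm_functor_is_functor[OF G'(2)]]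
  let ?K = "pair.copair F G"
  note K = pair.sm_functor_copair[OF F'(2) G'(2)]
  obtain K0 :: "('ao \<times> 'bo, ('ao, 'aa, 'bo, 'ba, 'r) tensor_arrow, 'co, 'ca) fct" where K0: "separately_rex R A B C K0"
    "\<And>a b. fo K0 (a, b) = fo F a \<star>\<^bsub>C\<^esub> fo G b"
    "\<And>f g. f \<in> Ar A \<Longrightarrow> g \<in> Ar B \<Longrightarrow> fa K0 (tarr f g) = fa F f \<diamondop>\<^bsub>C\<^esub> fa G g"
    by (rule separately_rex_copair[OF F'(1) G'(1)], rule that)
  obtain H0 :: "('po, 'pa, 'co, 'ca) fct" and \<psi> where H0: "lin_rex R P C H0" and \<psi>: "nat_trans T C (comp_fct H0 Z) K0 \<psi>"
    and iso: "\<And>x. x \<in> Ob A \<times> Ob B \<Longrightarrow> iso_arr C (\<psi> x)"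
    by (rule extension_exists[OF rexC K0(1)], rule that)
  \<comment> \<open>The functor underlying \<open>E\<close> is \<open>H0\<close> after
    \<open>Zpair\<close>, and its constraints are those of \<open>copair\<close> conjugated by
    \<open>\<psi>\<close>, in the form demanded by \<open>transport_structure\<close>.\<close>
  define E :: "('ao \<times> 'bo, 'aa \<times> 'ba, 'co, 'ca) smfct" where
    "E = \<lparr>fo = \<lambda>x. fo H0 (fo Zpair x), fa = \<lambda>f. fa H0 (fa Zpair f),
      fmu = \<lambda>x y. inv_arr C (\<psi> (x \<star>\<^bsub>X\<^esub> y)) \<cdot>\<^bsub>C\<^esub> fmu ?K x y \<cdot>\<^bsub>C\<^esub> (\<psi> x \<diamondop>\<^bsub>C\<^esub> \<psi> y),
      feps = inv_arr C (\<psi> (munit X)) \<cdot>\<^bsub>C\<^esub> feps ?K\<rparr>"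
  have Esel: "fo E x = fo H0 (fo Zpair x)" "fa E f = fa H0 (fa Zpair f)" for x f
    by (simp_all add: E_def)
  have iE: "is_functor X C E"
    using functor_comp[OF sm_functor_is_functor[OF sm_functor_Zpair] lin_rex_is_functor[OF H0]]
    by (simp add: is_functor_def Esel)
  have \<psi>E: "nat_trans X C E ?K \<psi>"
  proof (rule nat_transI)
    fix x assume "x \<in> Ob X"
    then show "\<psi> x \<in> Ar C \<and> Dom C (\<psi> x) = fo E x \<and> Cod C (\<psi> x) = fo ?K x"
      using nat_trans_simps[OF \<psi>, of x] by (cases x) (simp add: Esel K0)
  next
    fix h assume "h \<in> Ar X"
    then obtain f g where "h = (f, g)" "f \<in> Ar A" "g \<in> Ar B" by auto
    then show "fa ?K h \<cdot>\<^bsub>C\<^esub> \<psi> (Dom X h) = \<psi> (Cod X h) \<cdot>\<^bsub>C\<^esub> fa E h"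
      using nat_trans_natural[OF \<psi>, of "tarr f g"] by (simp add: Esel K0)
  qed
  have E: "sm_functor X C E" "monoidal_nat_trans X C E ?K \<psi>"
    using transport_structure[OF X C.sm_category_axioms K iE \<psi>E] iso by (simp_all add: E_def)
  obtain H :: "('po, 'pa, 'co, 'ca) smfct" where H: "\<And>p. fo H p = fo H0 p" "\<And>f. fa H f = fa H0 f" "sm_functor P C H"
    "\<And>x y. x \<in> Ob X \<Longrightarrow> y \<in> Ob X \<Longrightarrow> fa H0 (fmu Zpair x y) \<cdot>\<^bsub>C\<^esub> fmu H (fo Zpair x) (fo Zpair y) = fmu E x y"
    "fa H0 (feps Zpair) \<cdot>\<^bsub>C\<^esub> feps H = feps E"
    using D.extend_structure[OF H0 E(1)] Esel by blast
  have HOb: "H \<in> Ob (rex_sm_cat R P C)"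
    using lin_rex_cong[OF H0 rex_sm_categoryD(3)[OF rexP], of H] H(1-3) by (simp add: rex_sm_cat_Ob)
  \<comment> \<open>By construction \<open>H\<close> restricts to \<open>E\<close> with equal
    constraints, so \<open>\<psi>\<close> is monoidal for this restriction as well.\<close>
  have \<psi>H: "monoidal_nat_trans X C (comp_smfct C H Zpair) ?K \<psi>"
    by (rule monoidal_nat_trans_cong[OF E(2) X]) (use H in \<open>simp_all add: Esel del: Zpair_sel\<close>)
  note sH = sm_functor_comp_Zpair[OF H(3)]
  note iA = SA.sm_category_axioms and iB = SB.sm_category_axioms and iC = C.sm_category_axioms
  obtain \<alpha> where \<alpha>: "monoidal_nat_trans A C (left_part ?K) F \<alpha>" "\<And>a. a \<in> Ob A \<Longrightarrow> iso_arr C (\<alpha> a)"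
    using pair.copair_left[OF F'(2) G'(2)] by blast
  obtain \<beta> where \<beta>: "monoidal_nat_trans B C (right_part ?K) G \<beta>" "\<And>b. b \<in> Ob B \<Longrightarrow> iso_arr C (\<beta> b)"
    using pair.copair_right[OF F'(2) G'(2)] by blast
  \<comment> \<open>The comparison with \<open>F\<close> and \<open>G\<close>: first
    \<open>\<psi>\<close> to reach \<open>copair\<close>, then the isomorphisms that collapse the
    factor \<open>G I\<close> or \<open>F I\<close>.\<close>
  let ?\<alpha> = "\<lambda>a. \<alpha> a \<cdot>\<^bsub>C\<^esub> \<psi> (fo (unit_incl_left A B) a)" and ?\<beta> = "\<lambda>b. \<beta> b \<cdot>\<^bsub>C\<^esub> \<psi> (fo (unit_incl_right A B) b)"
  have "monoidal_nat_trans A C (left_part (comp_smfct C H Zpair)) F ?\<alpha>"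
    by (rule monoidal_nat_trans_vcomp[OF iA iC pair.sm_functor_left_part[OF sH] pair.sm_functor_left_part[OF K] F'(2)
          monoidal_nat_trans_whisker[OF iA X iC sm_functor_unit_incl(1)[OF iA iB] sH K \<psi>H] \<alpha>(1)])
  then have 1: "monoidal_nat_trans A C (comp_smfct C H left_incl) F ?\<alpha>"
    by (rule monoidal_nat_trans_cong[OF _ iA]) (simp_all only: left_part_comp[OF H(3)], simp_all)
  have "monoidal_nat_trans B C (right_part (comp_smfct C H Zpair)) G ?\<beta>"
    by (rule monoidal_nat_trans_vcomp[OF iB iC pair.sm_functor_right_part[OF sH] pair.sm_functor_right_part[OF K] G'(2)
          monoidal_nat_trans_whisker[OF iB X iC sm_functor_unit_incl(2)[OF iA iB] sH K \<psi>H] \<beta>(1)])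
  then have 2: "monoidal_nat_trans B C (comp_smfct C H right_incl) G ?\<beta>"
    by (rule monoidal_nat_trans_cong[OF _ iB]) (simp_all only: right_part_comp[OF H(3)], simp_all)
  have i1: "iso_arr C (?\<alpha> a)" if "a \<in> Ob A" for a
    using \<alpha>(2)[OF that] iso[of "(a, munit B)"] nat_trans_simps[OF \<psi>E, of "(a, munit B)"]
      nat_trans_simps[OF monoidal_nat_transD(1)[OF \<alpha>(1)] that] that by simp
  have i2: "iso_arr C (?\<beta> b)" if "b \<in> Ob B" for b
    using \<beta>(2)[OF that] iso[of "(munit A, b)"] nat_trans_simps[OF \<psi>E, of "(munit A, b)"]
      nat_trans_simps[OF monoidal_nat_transD(1)[OF \<beta>(1)] that] that by simp
  have "is_iso (prod_cat (rex_sm_cat R A C) (rex_sm_cat R B C)) (comp_smfct C H left_incl, comp_smfct C H right_incl) (F, G)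
     ((comp_smfct C H left_incl, F, restrict ?\<alpha> (Ob A)), (comp_smfct C H right_incl, G, restrict ?\<beta> (Ob B)))"
    by (intro is_iso_prod_cat rex_sm_cat_isoI iA iB iC F G 1 2 i1 i2
        rex_sm_cat_comp[OF rexA rexP rexC left_incl_Ob HOb] rex_sm_cat_comp[OF rexB rexP rexC right_incl_Ob HOb])
  then show ?thesis using HOb by (intro bexI[of _ H] exI) simp_all
qed

lemma restriction_equivalence:
  "is_equivalence (rex_sm_cat R P C) (prod_cat (rex_sm_cat R A C) (rex_sm_cat R B C)) \<Phi>"
proof (rule equivalenceI)
  show "category (rex_sm_cat R P C)"
    by (rule category_rex_sm_cat[OF SP.sm_category_axioms C.sm_category_axioms])
  show "category (prod_cat (rex_sm_cat R A C) (rex_sm_cat R B C))"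
    by (intro category_prod_cat category_rex_sm_cat SA.sm_category_axioms SB.sm_category_axioms C.sm_category_axioms)
  show "is_functor (rex_sm_cat R P C) (prod_cat (rex_sm_cat R A C) (rex_sm_cat R B C)) \<Phi>"
    by (intro functor_pair_fct functor_precomp_fct rexA rexB rexP rexC left_incl_Ob right_incl_Ob)
  show "\<exists>H\<in>Ob (rex_sm_cat R P C). \<exists>k. is_iso (prod_cat (rex_sm_cat R A C) (rex_sm_cat R B C)) (fo \<Phi> H) z k"
    if "z \<in> Ob (prod_cat (rex_sm_cat R A C) (rex_sm_cat R B C))" for z
    using that restriction_es by (cases z) simp
qed (use restriction_faithful restriction_full in blast)+

end

text \<open>The test category enters only as a parameter of the preceding context, so
  \<open>restriction_equivalence\<close> covers all \<open>C\<close> of the given universe.\<close>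

lemma bicategorical_coproduct: "is_bicategorical_coproduct U R A B P left_incl right_incl"
  unfolding is_bicategorical_coproduct_def
  using rexP left_incl_Ob right_incl_Ob restriction_equivalence by blast

end

theorem theorem5p1:
  fixes R :: "('r, 'k) ring_scheme"
    and A :: "('ao, 'aa, 'r) smcat"
    and B :: "('bo, 'ba, 'r) smcat"
    and P :: "('po, 'pa, 'r) smcat"
    and Z :: "('ao \<times> 'bo, ('ao, 'aa, 'bo, 'ba, 'r) tensor_arrow, 'po, 'pa) smfct"
  assumes "cring R"
    and "rex_sm_category R A"
    and "rex_sm_category R B"
    and "is_rex_tensor TYPE('co \<times> 'ca) R A B P Z"
    and "rex_sm_category R P"
    and "strong_sm_functor R (tensor_smcat R A B) P Z"
  shows "is_bicategorical_coproduct TYPE('co \<times> 'ca) R A B P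
    (comp_smfct P Z (incl_left R A B)) (comp_smfct P Z (incl_right R A B))"
proof -
  interpret rex_tensor "TYPE('co \<times> 'ca)" R A B P Z
    by (intro rex_tensor.intro assms(2-6))
  \<comment> \<open>The inclusions in the claim pass through \<open>A \<otimes> B\<close>; composed
    with \<open>Z\<close>, they coincide with those through \<open>A \<times> B\<close>.\<close>
  show ?thesis unfolding comp_Z_incl by (rule bicategorical_coproduct)
qed

end
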